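(* Let $\Omega:=B(0,1)\times(0,l)$, where $B(0,1)$ is the unit ball in $\mathbb R^2$ and $l>0$. Let $1<p\le q<+\infty$, let $f:\{0,1\}\times\mathbb R^{3\times3}\to\mathbb R$ be a continuous function of the form $f(b,\xi)=bW_1(\xi)+(1-b)W_2(\xi)$, and assume that $$Qf(b,\cdot)=f^{**}(b,\cdot)\quad\text{for every } b\in\{0,1\},$$ and that there exist $c,c_0,C\in\mathbb R^+$ such that $$c|\xi|^p-c_0\le f(b,\xi)\le C(1+|\xi|^q)\quad\text{for every } b\in\{0,1\},\ \xi\in\mathbb R^{3\times3}.$$ Let $$\mathcal F^{DR}(\chi,u):=\inf\Big\{\liminf_{\varepsilon\to0^+}\Big[\int_\Omega f\big(\chi_\varepsilon(x),(\tfrac1\varepsilon\nabla_\alpha u_\varepsilon(x),\nabla_3u_\varepsilon(x))\big)\,dx+\big|(\tfrac1\varepsilon D_\alpha\chi_\varepsilon,D_3\chi_\varepsilon)\big|(\Omega)\Big]:\ u_\varepsilon\in W^{1,q}(\Omega;\mathbb R^3),\ \chi_\varepsilon\in BV(\Omega;\{0,1\}),\ u_\varepsilon\rightharpoonup u\text{ in }W^{1,p}(\Omega;\mathbb R^3),\ \chi_\varepsilon\overset{*}{\rightharpoonup}\chi\text{ in }BV(\Omega;\{0,1\})\Big\}.$$ Then $$\mathcal F^{DR}(\chi,u)=\pi\left(\int_0^l f_0^{**}(\chi(x_3),u'(x_3))\,dx_3+|D\chi|(0,l)\right)$$ for every $\chi\in BV((0,l);\{0,1\})$ and every $u\in W^{1,p}((0,l);\mathbb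 R^3)$ for which $\mathcal F^{DR}(\chi,u)$ is finite, where $$f_0(b,\xi_3):=\inf_{(\xi_1,\xi_2)\in\mathbb R^{2\times3}}f(b,\xi_1,\xi_2,\xi_3),\qquad b\in\{0,1\},\ (\xi_1,\xi_2,\xi_3)\equiv\xi\in\mathbb R^{3\times3},$$ and $f_0^{**}$ denotes the convex envelope of $f_0$ with respect to the second variable.
   Context: Points of $\Omega$ are written $x=(x_\alpha,x_3)$ with $x_\alpha=(x_1,x_2)$; $\nabla_\alpha u$, $D_\alpha\chi$ denote the partial derivatives with respect to $x_\alpha$ and $\nabla_3u$, $D_3\chi$ those with respect to $x_3$. Matrices $\xi\in\mathbb R^{3\times3}$ are written $(\xi_1,\xi_2,\xi_3)$ with $\xi_i\in\mathbb R^3$, where $\xi_i$ is the slot of the derivative in the direction $x_i$. $|(\tfrac1\varepsilon D_\alpha\chi_\varepsilon,D_3\chi_\varepsilon)|(\Omega)$ is the total variation in $\Omega$ of the $\mathbb R^3$-valued measure $(\tfrac1\varepsilon D_\alpha\chi_\varepsilon,D_3\chi_\varepsilon)$. Pairs $(\chi,u)\in BV((0,l);\{0,1\})\times W^{1,p}((0,l);\mathbb R^3)$ are identified with the functions on $\Omega$ depending only on $x_3$ (i.e. $(\chi,u)$ on $\Omega$ with $D_\alpha\chi=0$, $\nabla_\alpha u=0$). $BV(\cdot;\{0,1\})$ denotes functions of bounded variation with values in $\{0,1\}$; $\overset{*}{\rightharpoonup}$ in $BV$ means boundedness in $BV$ together with strong $L^1$ convergence. $Qf(b,\cdot)$ is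 the quasiconvex envelope of $f(b,\cdot)$, i.e. the greatest quasiconvex function that is less than or equal to $f(b,\cdot)$; a Borel measurable, locally bounded $g:\mathbb R^{3\times3}\to\mathbb R$ is quasiconvex if $g(\xi)\le\frac{1}{\mathcal L^3(D)}\int_Dg(\xi+\nabla\varphi(x))\,dx$ for every bounded open $D\subset\mathbb R^3$, $\xi\in\mathbb R^{3\times3}$, $\varphi\in W^{1,\infty}_0(D;\mathbb R^3)$. $f^{**}(b,\cdot)$ is the convex envelope of $f(b,\cdot)$. *)

theory Defs
  imports "HOL-Analysis.Analysis"
begin

text \<open>
  Elements of function spaces over an open set \<open>U\<close> are represented by total functions of which
  only the values almost everywhere in \<open>U\<close> matter.
\<close>

section \<open>Sobolev spaces\<close>

definition Lp :: "real \<Rightarrow> 'a::euclidean_space set \<Rightarrow> ('a \<Rightarrow> 'b::euclidean_space) set" where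
  "Lp p U = {f. f \<in> borel_measurable (lebesgue_on U) \<and>
                integrable (lebesgue_on U) (\<lambda>x. norm (f x) powr p)}"

definition Linf :: "'a::euclidean_space set \<Rightarrow> ('a \<Rightarrow> 'b::euclidean_space) set" where
  "Linf U = {f. f \<in> borel_measurable (lebesgue_on U) \<and>
                (\<exists>M. AE x in lebesgue_on U. norm (f x) \<le> M)}"

definition locally_integrable ::
    "'a::euclidean_space set \<Rightarrow> ('a \<Rightarrow> 'b::euclidean_space) \<Rightarrow> bool" where
  "locally_integrable U f \<longleftrightarrow>
     (\<forall>K. compact K \<and> K \<subseteq> U \<longrightarrow> integrable (lebesgue_on K) f)"

definition C1c :: "'a::euclidean_space set \<Rightarrow> ('a \<Rightarrow> 'b::real_normed_vector) set" where
  "C1c U = {\<phi>. \<phi> differentiable_on UNIV \<and>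
                (\<forall>v. continuous_on UNIV (\<lambda>x. frechet_derivative \<phi> (at x) v)) \<and>
                (\<exists>K. compact K \<and> K \<subseteq> U \<and> (\<forall>x. x \<notin> K \<longrightarrow> \<phi> x = 0))}"

definition has_weak_partial ::
    "'a::euclidean_space set \<Rightarrow> 'a \<Rightarrow> ('a \<Rightarrow> 'b::euclidean_space) \<Rightarrow> ('a \<Rightarrow> 'b) \<Rightarrow> bool" where
  "has_weak_partial U v f g \<longleftrightarrow>
     locally_integrable U f \<and> locally_integrable U g \<and>
     (\<forall>\<phi> \<in> C1c U. (LINT x|lebesgue_on U. frechet_derivative \<phi> (at x) v *\<^sub>R f x)
                 = - (LINT x|lebesgue_on U. (\<phi> x :: real) *\<^sub>R g x))"

text \<open>The weak derivative is unique up to null sets, and is only used modulo null sets.\<close>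

definition weak_partial ::
    "'a::euclidean_space set \<Rightarrow> 'a \<Rightarrow> ('a \<Rightarrow> 'b::euclidean_space) \<Rightarrow> 'a \<Rightarrow> 'b" where
  "weak_partial U v f = (SOME g. has_weak_partial U v f g)"

text \<open>
  The parameter \<open>L\<close> is the Lebesgue space of which the function and its weak derivatives are
  members: \<open>sobolev (Lp p) U\<close> and \<open>sobolev Linf U\<close> are the first-order Sobolev spaces with
  exponent \<open>p\<close> and \<open>\<infinity>\<close>.
\<close>

definition sobolev ::
    "('a::euclidean_space set \<Rightarrow> ('a \<Rightarrow> 'b::euclidean_space) set) \<Rightarrow> 'a set \<Rightarrow> ('a \<Rightarrow> 'b) set" where
  "sobolev L U = {f \<in> L U. \<forall>i\<in>Basis. \<exists>g \<in> L U. has_weak_partial U i f g}"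

text \<open>
  Zero boundary values: members of the Sobolev space with exponent \<open>\<infinity>\<close> that are limits of
  compactly supported functions in the norm of the Sobolev space with exponent 1.
\<close>

definition sobolev_inf_0 ::
    "'a::euclidean_space set \<Rightarrow> ('a \<Rightarrow> 'b::euclidean_space) set" where
  "sobolev_inf_0 U = {f \<in> sobolev Linf U. f \<in> sobolev (Lp 1) U \<and>
     (\<exists>\<phi>. (\<forall>n::nat. \<phi> n \<in> C1c U) \<and>
       (\<lambda>n. LINT x|lebesgue_on U. norm (\<phi> n x - f x)) \<longlonglongrightarrow> 0 \<and>
       (\<forall>i\<in>Basis. (\<lambda>n. LINT x|lebesgue_on U.
          norm (frechet_derivative (\<phi> n) (at x) i - weak_partial U i f x)) \<longlonglongrightarrow> 0))}"

definition weakly_in_Lp :: "real \<Rightarrow> 'a::euclidean_space set \<Rightarrow> 'i filter \<Rightarrow>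
    ('i \<Rightarrow> 'a \<Rightarrow> 'b::euclidean_space) \<Rightarrow> ('a \<Rightarrow> 'b) \<Rightarrow> bool" where
  "weakly_in_Lp p U F fs f \<longleftrightarrow>
     f \<in> Lp p U \<and> (\<forall>\<^sub>F \<epsilon> in F. fs \<epsilon> \<in> Lp p U) \<and>
     (\<forall>v \<in> Lp (p / (p - 1)) U.
        ((\<lambda>\<epsilon>. LINT x|lebesgue_on U. fs \<epsilon> x \<bullet> v x) \<longlongrightarrow> (LINT x|lebesgue_on U. f x \<bullet> v x)) F)"

definition weakly_in_W1p :: "real \<Rightarrow> 'a::euclidean_space set \<Rightarrow> 'i filter \<Rightarrow>
    ('i \<Rightarrow> 'a \<Rightarrow> 'b::euclidean_space) \<Rightarrow> ('a \<Rightarrow> 'b) \<Rightarrow> bool" where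
  "weakly_in_W1p p U F us u \<longleftrightarrow>
     u \<in> sobolev (Lp p) U \<and> (\<forall>\<^sub>F \<epsilon> in F. us \<epsilon> \<in> sobolev (Lp p) U) \<and>
     weakly_in_Lp p U F us u \<and>
     (\<forall>i\<in>Basis. weakly_in_Lp p U F (\<lambda>\<epsilon>. weak_partial U i (us \<epsilon>)) (weak_partial U i u))"

section \<open>Functions of bounded variation\<close>

definition vector_measure_on ::
    "'a::euclidean_space set \<Rightarrow> ('a set \<Rightarrow> 'b::euclidean_space) \<Rightarrow> bool" where
  "vector_measure_on U \<mu> \<longleftrightarrow>
     (\<forall>A::nat \<Rightarrow> 'a set. range A \<subseteq> sets (restrict_space borel U) \<and> disjoint_family A
        \<longrightarrow> (\<lambda>n. \<mu> (A n)) sums \<mu> (\<Union>n. A n))"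

definition total_variation ::
    "'a::euclidean_space set \<Rightarrow> ('a set \<Rightarrow> 'b::euclidean_space) \<Rightarrow> ennreal" where
  "total_variation U \<mu> =
     (SUP A \<in> {A :: nat \<Rightarrow> 'a set. range A \<subseteq> sets (restrict_space borel U) \<and>
                 disjoint_family A \<and> (\<Union>n. A n) = U}. \<Sum>n. ennreal (norm (\<mu> (A n))))"

text \<open>
  Integration against a real-valued (signed) measure \<open>\<nu>\<close>, by writing \<open>\<nu>\<close> as a difference of two
  finite positive measures; the value does not depend on the decomposition.
\<close>

definition has_signed_integral ::
    "'a::euclidean_space set \<Rightarrow> ('a set \<Rightarrow> real) \<Rightarrow> ('a \<Rightarrow> real) \<Rightarrow> real \<Rightarrow> bool" where
  "has_signed_integral U \<nu> \<phi> c \<longleftrightarrow>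
     (\<exists>P N. finite_measure P \<and> finite_measure N \<and>
        sets P = sets (restrict_space borel U) \<and> sets N = sets (restrict_space borel U) \<and>
        (\<forall>E \<in> sets (restrict_space borel U). \<nu> E = measure P E - measure N E) \<and>
        integrable P \<phi> \<and> integrable N \<phi> \<and>
        c = integral\<^sup>L P \<phi> - integral\<^sup>L N \<phi>)"

definition has_derivative_measure ::
    "'a::euclidean_space set \<Rightarrow> ('a \<Rightarrow> real) \<Rightarrow> ('a set \<Rightarrow> 'a) \<Rightarrow> bool" where
  "has_derivative_measure U w \<mu> \<longleftrightarrow>
     vector_measure_on U \<mu> \<and>
     (\<forall>\<phi> \<in> C1c U. \<forall>i\<in>Basis. has_signed_integral U (\<lambda>E. \<mu> E \<bullet> i) \<phi>
        (- (LINT x|lebesgue_on U. w x * frechet_derivative \<phi> (at x) i)))"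

definition BV :: "'a::euclidean_space set \<Rightarrow> ('a \<Rightarrow> real) set" where
  "BV U = {w. integrable (lebesgue_on U) w \<and> (\<exists>\<mu>. has_derivative_measure U w \<mu>)}"

definition BV01 :: "'a::euclidean_space set \<Rightarrow> ('a \<Rightarrow> real) set" where
  "BV01 U = {w \<in> BV U. AE x in lebesgue_on U. w x \<in> {0, 1}}"

text \<open>The derivative measure is unique on the Borel subsets of \<open>U\<close>.\<close>

definition derivative_measure ::
    "'a::euclidean_space set \<Rightarrow> ('a \<Rightarrow> real) \<Rightarrow> 'a set \<Rightarrow> 'a" where
  "derivative_measure U w = (SOME \<mu>. has_derivative_measure U w \<mu>)"

definition weakly_star_in_BV :: "'a::euclidean_space set \<Rightarrow> 'i filter \<Rightarrow>
    ('i \<Rightarrow> 'a \<Rightarrow> real) \<Rightarrow> ('a \<Rightarrow> real) \<Rightarrow> bool" where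
  "weakly_star_in_BV U F ws w \<longleftrightarrow>
     w \<in> BV U \<and> (\<forall>\<^sub>F \<epsilon> in F. ws \<epsilon> \<in> BV U) \<and>
     (\<exists>M. \<forall>\<^sub>F \<epsilon> in F. ennreal (LINT x|lebesgue_on U. \<bar>ws \<epsilon> x\<bar>)
             + total_variation U (derivative_measure U (ws \<epsilon>)) \<le> ennreal M) \<and>
     ((\<lambda>\<epsilon>. LINT x|lebesgue_on U. \<bar>ws \<epsilon> x - w x\<bar>) \<longlongrightarrow> 0) F"

section \<open>Envelopes\<close>

text \<open>
  A matrix is stored as \<open>\<xi> :: real^3^3\<close> with \<open>\<xi> $ i\<close> the slot of the derivative in the
  direction of the \<open>i\<close>-th coordinate, that is, \<open>$\<close> selects the columns of the Jacobian matrix.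
\<close>

definition weak_grad :: "(real^3) set \<Rightarrow> (real^3 \<Rightarrow> real^3) \<Rightarrow> real^3 \<Rightarrow> real^3^3" where
  "weak_grad U u x = (\<chi> i. weak_partial U (axis i 1) u x)"

definition quasiconvex :: "(real^3^3 \<Rightarrow> real) \<Rightarrow> bool" where
  "quasiconvex g \<longleftrightarrow>
     g \<in> borel_measurable borel \<and> (\<forall>S. bounded S \<longrightarrow> bounded (g ` S)) \<and>
     (\<forall>D \<xi>. open D \<and> bounded D \<and> D \<noteq> {} \<longrightarrow>
        (\<forall>\<phi> \<in> sobolev_inf_0 D.
           g \<xi> \<le> 1 / measure lebesgue D * (LINT x|lebesgue_on D. g (\<xi> + weak_grad D \<phi> x))))"

text \<open>
  The greatest function with property \<open>P\<close> below \<open>g\<close>, as the pointwise supremum of all of them;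
  meaningful if there is at least one.
\<close>

definition envelope :: "(('a \<Rightarrow> real) \<Rightarrow> bool) \<Rightarrow> ('a \<Rightarrow> real) \<Rightarrow> 'a \<Rightarrow> real" where
  "envelope P g x = (SUP h \<in> {h. P h \<and> (\<forall>y. h y \<le> g y)}. h x)"

lemma envelope_eq_greatest:
  assumes "P Q" "\<And>y. Q y \<le> g y" "\<And>h y. P h \<Longrightarrow> (\<And>z. h z \<le> g z) \<Longrightarrow> h y \<le> Q y"
  shows "envelope P g = Q"
proof
  fix x
  show "envelope P g x = Q x"
    unfolding envelope_def using assms by (intro cSup_eq_maximum) auto
qed

definition quasiconvex_envelope :: "(real^3^3 \<Rightarrow> real) \<Rightarrow> real^3^3 \<Rightarrow> real" where
  "quasiconvex_envelope = envelope quasiconvex"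

definition convex_envelope :: "('a::real_vector \<Rightarrow> real) \<Rightarrow> 'a \<Rightarrow> real" where
  "convex_envelope = envelope (convex_on UNIV)"

section \<open>The dimension reduction functional\<close>

text \<open>Integral with values in the extended reals, for integrands with integrable negative part.\<close>

definition ext_integral :: "'a measure \<Rightarrow> ('a \<Rightarrow> real) \<Rightarrow> ereal" where
  "ext_integral M g = enn2ereal (\<integral>\<^sup>+x. ennreal (g x) \<partial>M) - enn2ereal (\<integral>\<^sup>+x. ennreal (- g x) \<partial>M)"

definition cylinder :: "real \<Rightarrow> (real^3) set" where
  "cylinder l = {x. (x $ 1)\<^sup>2 + (x $ 2)\<^sup>2 < 1 \<and> 0 < x $ 3 \<and> x $ 3 < l}"

text \<open>The scaling \<open>(1/\<epsilon> v\<^sub>1, 1/\<epsilon> v\<^sub>2, v\<^sub>3)\<close>, used for gradients and for values of measures.\<close>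

definition rescale :: "real \<Rightarrow> 'b::real_vector^3 \<Rightarrow> 'b^3" where
  "rescale \<epsilon> v = (\<chi> i. if i = 3 then v $ i else (1 / \<epsilon>) *\<^sub>R v $ i)"

definition rescaled_energy :: "(real \<Rightarrow> real^3^3 \<Rightarrow> real) \<Rightarrow> real \<Rightarrow> real \<Rightarrow>
    (real^3 \<Rightarrow> real) \<Rightarrow> (real^3 \<Rightarrow> real^3) \<Rightarrow> ereal" where
  "rescaled_energy f l \<epsilon> w u =
     ext_integral (lebesgue_on (cylinder l))
       (\<lambda>x. f (w x) (rescale \<epsilon> (weak_grad (cylinder l) u x)))
     + enn2ereal (total_variation (cylinder l)
         (\<lambda>E. rescale \<epsilon> (derivative_measure (cylinder l) w E)))"

definition F_DR :: "(real \<Rightarrow> real^3^3 \<Rightarrow> real) \<Rightarrow> real \<Rightarrow> real \<Rightarrow> real \<Rightarrow>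
    (real^3 \<Rightarrow> real) \<Rightarrow> (real^3 \<Rightarrow> real^3) \<Rightarrow> ereal" where
  "F_DR f l p q w u =
     Inf {Liminf (at_right 0) (\<lambda>\<epsilon>. rescaled_energy f l \<epsilon> (ws \<epsilon>) (us \<epsilon>)) | ws us.
       (\<forall>\<epsilon>>0. us \<epsilon> \<in> sobolev (Lp q) (cylinder l) \<and> ws \<epsilon> \<in> BV01 (cylinder l)) \<and>
       weakly_in_W1p p (cylinder l) (at_right 0) us u \<and>
       weakly_star_in_BV (cylinder l) (at_right 0) ws w}"

definition f0 :: "(real \<Rightarrow> real^3^3 \<Rightarrow> real) \<Rightarrow> real \<Rightarrow> real^3 \<Rightarrow> real" where
  "f0 f b \<xi>3 = (INF (\<xi>1, \<xi>2) \<in> UNIV. f b (vector [\<xi>1, \<xi>2, \<xi>3]))"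

end

theory Submission
  imports Defs "HOL-Probability.Probability" "HOL-Real_Asymp.Real_Asymp"
begin

text \<open>
  Let \<open>g\<^sub>b\<close> be the convex envelope of \<open>f0 f b\<close>.

  Lower bound. Along an admissible sequence, affine minorants of \<open>g\<^sub>b\<close> composed with the third column
  of the gradient bound the energy density from below, up to a multiple of \<open>\<bar>\<chi>\<^sub>\<epsilon> - \<chi>\<bar>\<close> that is finite
  because \<open>p > 1\<close>. Affine functions with bounded measurable coefficients pass to the weak limit, and the
  supremum over countably many of them is \<open>g\<^sub>b\<close>, by monotone convergence. The surface term is lower
  semicontinuous by testing with a \<open>C\<^sup>1\<close> function concentrated near the discs over the jumps.

  Upper bound. The field \<open>\<chi>\<close> is kept fixed, since functions of \<open>x\<^sub>3\<close> have no radial derivative. The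
  derivative of \<open>u\<close> is replaced by a simple function and then by a rapidly oscillating one whose
  distribution realises \<open>g\<^sub>b\<close> as an average of \<open>f(b, \<xi>\<^sub>1, \<xi>\<^sub>2, \<xi>\<^sub>3)\<close>; after smoothing, a field
  \<open>Y = (Y\<^sub>1, Y\<^sub>2, Y\<^sub>3)\<close> in \<open>C\<^sup>1\<close> with compact support is the rescaled gradient, up to \<open>O(\<epsilon>)\<close>, of the primitive of \<open>Y\<^sub>3\<close>
  corrected by \<open>\<epsilon> (x\<^sub>1 Y\<^sub>1 + x\<^sub>2 Y\<^sub>2)\<close>, and a diagonal sequence concludes.
\<close>

section \<open>Test functions\<close>

text \<open>The two bounds are not independent. As u' is only in L^p while f may grow like |\<xi>|^q
  with q > p, the integral of the envelope along u' need not be finite a priori. Finiteness of the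
  relaxed functional makes it so through the lower bound, and the upper bound needs this
  integrability in order to truncate u'. All recovery fields are bounded, so continuity of f and
  dominated convergence handle their energies. Their sup bounds blow up along the approximation; the
  uniform L^p bound behind weak convergence is recovered from coercivity, because the energies stay
  bounded. The affine minorants may switch with x_3 and with the phase, which takes the place of
  localising around points. The factor pi is the area of the cross section: projection to the axis
  gives it to the bulk term, the disc over each jump gives it to the surface term. Weak derivatives
  and derivative measures are chosen objects and signed integrals are existential; testing with C1
  functions shows that nothing depends on the choices.\<close>

definition C1_deriv :: "('a::euclidean_space \<Rightarrow> 'b::real_normed_vector) \<Rightarrow> ('a \<Rightarrow> 'a \<Rightarrow> 'b) \<Rightarrow> bool"
  where "C1_deriv \<phi> D \<longleftrightarrow>
    (\<forall>x. (\<phi> has_derivative D x) (at x)) \<and> (\<forall>v. continuous_on UNIV (\<lambda>x. D x v))"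

lemma C1_deriv_continuous: "C1_deriv \<phi> D \<Longrightarrow> continuous_on A \<phi>"
  unfolding C1_deriv_def
  by (meson has_derivative_continuous continuous_at_imp_continuous_on)

lemma C1_deriv_continuous_deriv: "C1_deriv \<phi> D \<Longrightarrow> continuous_on A (\<lambda>x. D x v)"
  unfolding C1_deriv_def by (meson continuous_on_subset subset_UNIV)

lemma C1_deriv_const: "C1_deriv (\<lambda>_. c) (\<lambda>_ _. 0)"
  by (simp add: C1_deriv_def)

lemma C1_deriv_inner: "C1_deriv (\<lambda>x. x \<bullet> i) (\<lambda>_ v. v \<bullet> i)"
  by (auto simp: C1_deriv_def intro!: derivative_eq_intros)

lemma C1_deriv_add:
  "C1_deriv \<phi> D \<Longrightarrow> C1_deriv \<psi> E \<Longrightarrow> C1_deriv (\<lambda>x. \<phi> x + \<psi> x) (\<lambda>x v. D x v + E x v)"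
  by (auto simp: C1_deriv_def intro!: derivative_eq_intros continuous_intros)

lemma C1_deriv_diff:
  "C1_deriv \<phi> D \<Longrightarrow> C1_deriv \<psi> E \<Longrightarrow> C1_deriv (\<lambda>x. \<phi> x - \<psi> x) (\<lambda>x v. D x v - E x v)"
  by (auto simp: C1_deriv_def intro!: derivative_eq_intros continuous_intros)

lemma C1_deriv_scaleR:
  assumes "C1_deriv \<phi> D" "C1_deriv \<psi> E"
  shows "C1_deriv (\<lambda>x. \<phi> x *\<^sub>R \<psi> x) (\<lambda>x v. \<phi> x *\<^sub>R E x v + D x v *\<^sub>R \<psi> x)"
  using assms C1_deriv_continuous[OF assms(1)] C1_deriv_continuous[OF assms(2)]
  by (auto simp: C1_deriv_def intro!: derivative_eq_intros continuous_intros)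

lemma C1_deriv_sum:
  assumes "\<And>k. k \<in> I \<Longrightarrow> C1_deriv (\<phi> k) (D k)"
  shows "C1_deriv (\<lambda>x. \<Sum>k\<in>I. \<phi> k x) (\<lambda>x v. \<Sum>k\<in>I. D k x v)"
  using assms by (auto simp: C1_deriv_def intro!: derivative_eq_intros continuous_intros)

lemma C1_deriv_compose:
  assumes "C1_deriv \<phi> D" "\<And>t. (k has_vector_derivative k' t) (at t)" "continuous_on UNIV k'"
  shows "C1_deriv (\<lambda>x. k (\<phi> x)) (\<lambda>x v. D x v *\<^sub>R k' (\<phi> x))"
  unfolding C1_deriv_def
proof (intro conjI allI)
  fix x
  have "(\<phi> has_derivative D x) (at x)" using assms(1) by (simp add: C1_deriv_def)
  then have "((k \<circ> \<phi>) has_derivative (\<lambda>t. t *\<^sub>R k' (\<phi> x)) \<circ> D x) (at x)"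
    using assms(2) by (intro diff_chain_at) (auto simp: has_vector_derivative_def)
  then show "((\<lambda>x. k (\<phi> x)) has_derivative (\<lambda>v. D x v *\<^sub>R k' (\<phi> x))) (at x)"
    by (simp add: o_def)
next
  fix v
  show "continuous_on UNIV (\<lambda>x. D x v *\<^sub>R k' (\<phi> x))"
    by (intro continuous_intros C1_deriv_continuous_deriv[OF assms(1)]
        continuous_on_compose2[OF assms(3) C1_deriv_continuous[OF assms(1)]]) auto
qed

lemma C1_deriv_frechet: "C1_deriv \<phi> D \<Longrightarrow> frechet_derivative \<phi> (at x) = D x"
  unfolding C1_deriv_def by (metis frechet_derivative_at)

lemma C1cI:
  assumes "C1_deriv \<phi> D" "compact K" "K \<subseteq> U" "\<And>x. x \<notin> K \<Longrightarrow> \<phi> x = 0"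
  shows "\<phi> \<in> C1c U"
  unfolding C1c_def
proof (intro CollectI conjI allI)
  show "\<phi> differentiable_on UNIV"
    using assms(1) unfolding C1_deriv_def differentiable_on_def differentiable_def by auto
  show "continuous_on UNIV (\<lambda>x. frechet_derivative \<phi> (at x) v)" for v
    using assms(1) by (simp add: C1_deriv_frechet[OF assms(1)] C1_deriv_def)
qed (use assms in blast)

lemma C1c_C1_deriv:
  assumes "\<phi> \<in> C1c U" shows "C1_deriv \<phi> (\<lambda>x. frechet_derivative \<phi> (at x))"
  using assms unfolding C1c_def C1_deriv_def
  by (auto simp: differentiable_on_def frechet_derivative_works)

text \<open>The complement of the compact set is open and \<phi> is constantly 0 there, so the
  derivative vanishes on it too. One compact set then serves for \<phi> and all its partial
  derivatives.\<close>

lemma C1c_support: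
  assumes "\<phi> \<in> C1c U"
  obtains K where "compact K" "K \<subseteq> U" "\<And>x. x \<notin> K \<Longrightarrow> \<phi> x = 0"
    "\<And>x v. x \<notin> K \<Longrightarrow> frechet_derivative \<phi> (at x) v = 0"
proof -
  obtain K where K: "compact K" "K \<subseteq> U" "\<And>x. x \<notin> K \<Longrightarrow> \<phi> x = 0"
    using assms unfolding C1c_def by blast
  have "frechet_derivative \<phi> (at x) v = 0" if "x \<notin> K" for x v
  proof -
    have "(\<phi> has_derivative (\<lambda>_. 0)) (at x)"
    proof (rule has_derivative_transform_within_open[where s = "- K"])
      show "((\<lambda>_. 0) has_derivative (\<lambda>_. 0)) (at x)" by simp
      show "open (- K)" using K(1) by (simp add: compact_imp_closed open_Compl)
    qed (use that K(3) in auto)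
    then have "frechet_derivative \<phi> (at x) = (\<lambda>_. 0)" by (metis frechet_derivative_at)
    then show ?thesis by simp
  qed
  with K show ?thesis using that by blast
qed

lemma C1c_continuous: "\<phi> \<in> C1c U \<Longrightarrow> continuous_on A \<phi>"
  by (blast intro: C1_deriv_continuous C1c_C1_deriv)

lemma C1c_continuous_deriv: "\<phi> \<in> C1c U \<Longrightarrow> continuous_on A (\<lambda>x. frechet_derivative \<phi> (at x) v)"
  by (rule C1_deriv_continuous_deriv[OF C1c_C1_deriv])

lemma bounded_if_compact_support:
  fixes g :: "'a::euclidean_space \<Rightarrow> 'b::real_normed_vector"
  assumes "continuous_on UNIV g" "compact K" "\<And>x. x \<notin> K \<Longrightarrow> g x = 0"
  obtains M where "M > 0" "\<And>x. norm (g x) \<le> M"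
proof -
  have "compact (g ` K)" using assms by (meson compact_continuous_image continuous_on_subset subset_UNIV)
  then obtain M where "M > 0" "\<forall>y\<in>g ` K. norm y \<le> M" using bounded_pos compact_imp_bounded by blast
  then have "norm (g x) \<le> M" for x using assms(3)[of x] by (cases "x \<in> K") auto
  with \<open>M > 0\<close> show ?thesis using that by blast
qed

lemma C1c_bounded:
  assumes "\<phi> \<in> C1c U" obtains M where "M > 0" "\<And>x. norm (\<phi> x) \<le> M"
proof -
  obtain K where "compact K" "\<And>x. x \<notin> K \<Longrightarrow> \<phi> x = 0" using C1c_support[OF assms] by metis
  then show ?thesis
    using bounded_if_compact_support[of \<phi> K] C1c_continuous[OF assms] that by blast
qed

lemma C1c_bounded_deriv:
  assumes "\<phi> \<in> C1c U" obtains M where "M > 0" "\<And>x. norm (frechet_derivative \<phi> (at x) v) \<le> M"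
proof -
  obtain K where "compact K" "\<And>x v. x \<notin> K \<Longrightarrow> frechet_derivative \<phi> (at x) v = 0"
    using C1c_support[OF assms] by metis
  then show ?thesis
    using bounded_if_compact_support[of "\<lambda>x. frechet_derivative \<phi> (at x) v" K]
      C1c_continuous_deriv[OF assms] that by blast
qed

lemma C1c_mono: "U \<subseteq> V \<Longrightarrow> C1c U \<subseteq> C1c V"
  unfolding C1c_def by auto

lemma C1c_scaleR:
  assumes "\<phi> \<in> C1c U" "C1_deriv \<psi> E"
  shows "(\<lambda>x. \<phi> x *\<^sub>R \<psi> x) \<in> C1c U"
    and "frechet_derivative (\<lambda>x. \<phi> x *\<^sub>R \<psi> x) (at x) v =
      \<phi> x *\<^sub>R E x v + frechet_derivative \<phi> (at x) v *\<^sub>R \<psi> x"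
proof -
  note D = C1_deriv_scaleR[OF C1c_C1_deriv[OF assms(1)] assms(2)]
  obtain K where K: "compact K" "K \<subseteq> U" "\<And>x. x \<notin> K \<Longrightarrow> \<phi> x = 0"
    using C1c_support[OF assms(1)] by metis
  show "(\<lambda>x. \<phi> x *\<^sub>R \<psi> x) \<in> C1c U" by (rule C1cI[OF D K(1,2)]) (simp add: K)
  show "frechet_derivative (\<lambda>x. \<phi> x *\<^sub>R \<psi> x) (at x) v =
      \<phi> x *\<^sub>R E x v + frechet_derivative \<phi> (at x) v *\<^sub>R \<psi> x"
    by (simp add: C1_deriv_frechet[OF D])
qed

lemma C1c_sum:
  assumes "finite I" "\<And>k. k \<in> I \<Longrightarrow> \<phi> k \<in> C1c U"
  shows "(\<lambda>x. \<Sum>k\<in>I. \<phi> k x) \<in> C1c U"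
    and "frechet_derivative (\<lambda>x. \<Sum>k\<in>I. \<phi> k x) (at x) v = (\<Sum>k\<in>I. frechet_derivative (\<phi> k) (at x) v)"
proof -
  have D: "C1_deriv (\<lambda>x. \<Sum>k\<in>I. \<phi> k x) (\<lambda>x v. \<Sum>k\<in>I. frechet_derivative (\<phi> k) (at x) v)"
    by (intro C1_deriv_sum C1c_C1_deriv[of _ U] assms)
  have "\<forall>k. \<exists>K. k \<in> I \<longrightarrow> compact K \<and> K \<subseteq> U \<and> (\<forall>x. x \<notin> K \<longrightarrow> \<phi> k x = 0)"
    using C1c_support assms(2) by metis
  then obtain K where K: "\<And>k. k \<in> I \<Longrightarrow> compact (K k)" "\<And>k. k \<in> I \<Longrightarrow> K k \<subseteq> U"
    "\<And>k x. k \<in> I \<Longrightarrow> x \<notin> K k \<Longrightarrow> \<phi> k x = 0" by metis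
  show "(\<lambda>x. \<Sum>k\<in>I. \<phi> k x) \<in> C1c U"
  proof (rule C1cI[OF D, of "\<Union>k\<in>I. K k"])
    show "compact (\<Union>k\<in>I. K k)" using assms(1) K by (intro compact_UN) auto
  qed (use K in \<open>auto intro!: sum.neutral\<close>)
  show "frechet_derivative (\<lambda>x. \<Sum>k\<in>I. \<phi> k x) (at x) v = (\<Sum>k\<in>I. frechet_derivative (\<phi> k) (at x) v)"
    by (simp add: C1_deriv_frechet[OF D])
qed

text \<open>A cutoff that is 0 up to 0, positive afterwards, and tends to 1 at infinity. Squaring
  the positive part makes the derivative continuous at 0, and C1 is the regularity that
  \<open>C1c\<close> asks for; the quotient keeps the values below 1.\<close>

definition \<kappa> :: "real \<Rightarrow> real" where "\<kappa> t = (max 0 t)\<^sup>2 / (1 + (max 0 t)\<^sup>2)"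

definition \<kappa>' :: "real \<Rightarrow> real" where "\<kappa>' t = 2 * max 0 t / (1 + (max 0 t)\<^sup>2)\<^sup>2"

lemma DERIV_max_zero_square: "((\<lambda>t::real. (max 0 t)\<^sup>2) has_real_derivative 2 * max 0 t) (at t)"
proof -
  consider "t < 0" | "t = 0" | "t > 0" by linarith
  then show ?thesis
  proof cases
    case 1
    have "((\<lambda>t::real. 0) has_real_derivative 0) (at t)" by simp
    then have "((\<lambda>t::real. (max 0 t)\<^sup>2) has_real_derivative 0) (at t)"
      by (rule has_field_derivative_transform_within_open[where S = "{..<0}"]) (use 1 in auto)
    then show ?thesis using 1 by simp
  next
    case 2
    have "((\<lambda>h::real. (max 0 h)\<^sup>2 / h) \<longlongrightarrow> 0) (at 0)"
    proof (rule Lim_null_comparison)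
      show "\<forall>\<^sub>F h in at (0::real). norm ((max 0 h)\<^sup>2 / h) \<le> \<bar>h\<bar>"
        by (rule always_eventually) (auto simp: max_def power2_eq_square)
      show "((\<lambda>h::real. \<bar>h\<bar>) \<longlongrightarrow> 0) (at 0)"
        by (rule tendsto_eq_intros | simp)+
    qed
    then show ?thesis using 2 by (simp add: DERIV_def)
  next
    case 3
    have "((\<lambda>t::real. t\<^sup>2) has_real_derivative 2 * t) (at t)"
      by (auto intro!: derivative_eq_intros)
    then have "((\<lambda>t::real. (max 0 t)\<^sup>2) has_real_derivative 2 * t) (at t)"
      by (rule has_field_derivative_transform_within_open[where S = "{0<..}"]) (use 3 in auto)
    then show ?thesis using 3 by simp
  qed
qed

lemma one_plus_square_pos: "(0::real) < 1 + x\<^sup>2"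
  by (simp add: add_pos_nonneg)

lemma has_vector_derivative_\<kappa>: "(\<kappa> has_vector_derivative \<kappa>' t) (at t)"
proof -
  have "1 + (max 0 t)\<^sup>2 \<noteq> 0" using one_plus_square_pos[of "max 0 t"] by simp
  then have "((\<lambda>t. (max 0 t)\<^sup>2 / (1 + (max 0 t)\<^sup>2)) has_real_derivative \<kappa>' t) (at t)"
    unfolding \<kappa>'_def
    by (rule DERIV_cong[OF DERIV_divide[OF DERIV_max_zero_square
            DERIV_add[OF DERIV_const DERIV_max_zero_square]]])
      (simp_all add: power2_eq_square algebra_simps)
  then show ?thesis
    unfolding \<kappa>_def[abs_def] by (simp add: has_real_derivative_iff_has_vector_derivative)
qed

lemma continuous_on_\<kappa>': "continuous_on A \<kappa>'"
  unfolding \<kappa>'_def[abs_def]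
  using one_plus_square_pos by (intro continuous_intros) (metis less_irrefl power_not_zero)

lemma \<kappa>_nonneg: "0 \<le> \<kappa> t" and \<kappa>_le_1: "\<kappa> t \<le> 1" and \<kappa>_pos_iff: "0 < \<kappa> t \<longleftrightarrow> 0 < t"
  unfolding \<kappa>_def using one_plus_square_pos[of "max 0 t"]
  by (auto simp: field_simps max_def)

lemma \<kappa>_eq_0: "t \<le> 0 \<Longrightarrow> \<kappa> t = 0"
  by (simp add: \<kappa>_def)

lemma C1_deriv_\<kappa>: "C1_deriv \<phi> D \<Longrightarrow> C1_deriv (\<lambda>x. \<kappa> (\<phi> x)) (\<lambda>x v. D x v *\<^sub>R \<kappa>' (\<phi> x))"
  by (intro C1_deriv_compose has_vector_derivative_\<kappa> continuous_on_\<kappa>')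

lemma \<kappa>_tendsto_1: "filterlim g at_top F \<Longrightarrow> ((\<lambda>n. \<kappa> (g n)) \<longlongrightarrow> 1) F"
proof -
  have "(\<kappa> \<longlongrightarrow> 1) at_top"
  proof -
    have "((\<lambda>t::real. t\<^sup>2 / (1 + t\<^sup>2)) \<longlongrightarrow> 1) at_top" by real_asymp
    then show ?thesis
      by (rule Lim_transform_eventually)
        (auto simp: \<kappa>_def max_def intro!: eventually_mono[OF eventually_ge_at_top[of 0]])
  qed
  then show "filterlim g at_top F \<Longrightarrow> ((\<lambda>n. \<kappa> (g n)) \<longlongrightarrow> 1) F"
    by (rule filterlim_compose)
qed

text \<open>The shift by 1 keeps the support off the boundary of the positivity set: the cutoff is
  nonzero only where r * G exceeds 1, and the closed set where r * G is at least 1 lies in the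
  bounded set where G is positive. Large r brings the cutoff close to the indicator of that
  set.\<close>

lemma C1c_superlevel:
  fixes G :: "'a::euclidean_space \<Rightarrow> real"
  assumes "C1_deriv G D" "bounded {x. 0 < G x}" "{x. 0 < G x} \<subseteq> V" "0 \<le> r"
  shows "(\<lambda>x. \<kappa> (r * G x - 1)) \<in> C1c V"
proof -
  have "C1_deriv (\<lambda>x. r *\<^sub>R G x - 1) (\<lambda>x v. (r *\<^sub>R D x v + 0 *\<^sub>R G x) - 0)"
    using assms(1) by (intro C1_deriv_diff C1_deriv_scaleR C1_deriv_const)
  then have D: "C1_deriv (\<lambda>x. \<kappa> (r *\<^sub>R G x - 1))
      (\<lambda>x v. ((r *\<^sub>R D x v + 0 *\<^sub>R G x) - 0) *\<^sub>R \<kappa>' (r *\<^sub>R G x - 1))"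
    by (rule C1_deriv_\<kappa>)
  let ?K = "{x. 1 \<le> r * G x}"
  have sub: "?K \<subseteq> {x. 0 < G x}"
    using assms(4) by (smt (verit, best) mem_Collect_eq mult_nonneg_nonpos subsetI)
  have "closed ?K"
    by (intro closed_Collect_le continuous_intros C1_deriv_continuous[OF assms(1)])
  then have "compact ?K" using bounded_subset[OF assms(2) sub] by (simp add: compact_eq_bounded_closed)
  with sub show ?thesis
    by (intro C1cI[OF D[simplified], of ?K, simplified]) (use assms(3) in \<open>auto simp: \<kappa>_eq_0\<close>)
qed

lemma C1_deriv_prod:
  fixes g :: "'i \<Rightarrow> 'a::euclidean_space \<Rightarrow> real"
  assumes "finite I" "\<And>i. i \<in> I \<Longrightarrow> \<exists>D. C1_deriv (g i) D"
  shows "\<exists>D. C1_deriv (\<lambda>x. \<Prod>i\<in>I. g i x) D"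
  using assms
proof (induction I rule: finite_induct)
  case empty
  then show ?case using C1_deriv_const by auto
next
  case (insert i I)
  obtain D where D: "C1_deriv (g i) D" using insert.prems by blast
  obtain E where "C1_deriv (\<lambda>x. \<Prod>i\<in>I. g i x) E" using insert by blast
  from C1_deriv_scaleR[OF D this] insert.hyps show ?case by auto
qed

text \<open>Only the positivity set counts: a C1 function that is positive exactly on the open box,
  the building block for cutoffs of arbitrary open sets.\<close>

definition box_bump :: "'a::euclidean_space \<Rightarrow> 'a \<Rightarrow> 'a \<Rightarrow> real" where
  "box_bump a b x = (\<Prod>i\<in>Basis. \<kappa> (x \<bullet> i - a \<bullet> i) * \<kappa> (b \<bullet> i - x \<bullet> i))"

lemma C1_deriv_box_bump: "\<exists>D. C1_deriv (box_bump a b) D"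
proof -
  have "\<exists>D. C1_deriv (\<lambda>x. \<kappa> (x \<bullet> i - a \<bullet> i) * \<kappa> (b \<bullet> i - x \<bullet> i)) D" for i
    using C1_deriv_scaleR[OF
        C1_deriv_\<kappa>[OF C1_deriv_diff[OF C1_deriv_inner[of i] C1_deriv_const[of "a \<bullet> i"]]]
        C1_deriv_\<kappa>[OF C1_deriv_diff[OF C1_deriv_const[of "b \<bullet> i"] C1_deriv_inner[of i]]]]
    by auto
  then show ?thesis
    unfolding box_bump_def[abs_def] by (intro C1_deriv_prod) auto
qed

lemma box_bump_nonneg: "0 \<le> box_bump a b x"
  unfolding box_bump_def by (intro prod_nonneg) (auto simp: \<kappa>_nonneg)

lemma box_bump_pos_iff: "0 < box_bump a b x \<longleftrightarrow> x \<in> box a b"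
proof
  assume "x \<in> box a b"
  then show "0 < box_bump a b x"
    unfolding box_bump_def by (intro prod_pos) (auto simp: \<kappa>_pos_iff mem_box)
next
  assume *: "0 < box_bump a b x"
  have "0 < \<kappa> (x \<bullet> i - a \<bullet> i) * \<kappa> (b \<bullet> i - x \<bullet> i)" if "i \<in> Basis" for i
  proof -
    have "\<kappa> (x \<bullet> i - a \<bullet> i) * \<kappa> (b \<bullet> i - x \<bullet> i) \<noteq> 0"
    proof
      assume "\<kappa> (x \<bullet> i - a \<bullet> i) * \<kappa> (b \<bullet> i - x \<bullet> i) = 0"
      then have "box_bump a b x = 0"
        unfolding box_bump_def using that by (intro prod_zero) (auto intro!: bexI[of _ i])
      then show False using * by simp
    qed
    moreover have "0 \<le> \<kappa> (x \<bullet> i - a \<bullet> i) * \<kappa> (b \<bullet> i - x \<bullet> i)" by (simp add: \<kappa>_nonneg)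
    ultimately show ?thesis by linarith
  qed
  then have "0 < \<kappa> (x \<bullet> i - a \<bullet> i)" "0 < \<kappa> (b \<bullet> i - x \<bullet> i)" if "i \<in> Basis" for i
    using that \<kappa>_nonneg[of "x \<bullet> i - a \<bullet> i"] by (fastforce simp: zero_less_mult_iff)+
  then show "x \<in> box a b" by (auto simp: mem_box \<kappa>_pos_iff)
qed

text \<open>Where G n stays above some c > 0 the argument n * G n - 1 tends to infinity; where G
  vanishes identically it stays at -1. The functions G n may vary with n, as the partial sums in
  \<open>open_approx_C1c\<close> do.\<close>

lemma bump_tendsto_indicator:
  assumes "\<And>n::nat. 0 \<le> G n" "\<And>n. n > k \<Longrightarrow> G n \<ge> c" "c > 0 \<or> (\<forall>n. G n = 0)"
  shows "(\<lambda>n. \<kappa> (real n * G n - 1)) \<longlonglongrightarrow> (if c > 0 then 1 else 0)"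
proof (cases "c > 0")
  case True
  have "filterlim (\<lambda>n. real n * G n - 1) at_top sequentially"
  proof (rule filterlim_at_top_mono)
    show "filterlim (\<lambda>n. real n * c - 1) at_top sequentially" using True by real_asymp
    show "\<forall>\<^sub>F n in sequentially. real n * c - 1 \<le> real n * G n - 1"
      using eventually_gt_at_top[of k] by eventually_elim (simp add: assms mult_left_mono)
  qed
  then show ?thesis using True \<kappa>_tendsto_1 by auto
next
  case False
  then show ?thesis using assms(3) by (simp add: \<kappa>_eq_0)
qed

text \<open>An open set is a countable union of boxes. The sum of the first n bumps is positive
  exactly on the first n boxes, so its cutoff has compact support in V. At a point of V the sum
  dominates one fixed positive bump from some n on, which drives the cutoff to 1.\<close>

lemma open_approx_C1c:
  fixes V :: "'a::euclidean_space set"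
  assumes "open V"
  obtains \<phi> :: "nat \<Rightarrow> 'a \<Rightarrow> real" where "\<And>n. \<phi> n \<in> C1c V" "\<And>n x. 0 \<le> \<phi> n x" "\<And>n x. \<phi> n x \<le> 1"
    "\<And>x. (\<lambda>n. \<phi> n x) \<longlonglongrightarrow> indicator V x"
proof -
  obtain \<D> where \<D>: "countable \<D>" "\<D> \<subseteq> Pow V" "\<And>X. X \<in> \<D> \<Longrightarrow> \<exists>a b. X = box a b" "\<Union>\<D> = V"
    using open_countable_Union_open_box[OF assms] by metis
  \<comment> \<open>The empty box makes the family nonempty, so that it can be enumerated also when
    V is empty.\<close>
  let ?\<D> = "insert {} \<D>"
  have "\<exists>a b. X = box a b" if "X \<in> ?\<D>" for X
  proof (cases "X = {}")
    case True
    have "box (0::'a) 0 = {}" using nonempty_Basis by (auto simp: box_eq_empty)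
    then show ?thesis using True by metis
  qed (use that \<D>(3) in auto)
  then have "\<exists>a b. from_nat_into ?\<D> n = box a b" for n
    using from_nat_into[of ?\<D> n] by blast
  then obtain a b where ab: "\<And>n. from_nat_into ?\<D> n = box (a n) (b n)" by metis
  have un: "(\<Union>n. box (a n) (b n)) = V"
  proof -
    have "range (from_nat_into ?\<D>) = ?\<D>" using \<D>(1) by (intro range_from_nat_into) auto
    then have "(\<Union>n. from_nat_into ?\<D> n) = \<Union>?\<D>" by simp
    then show ?thesis using \<D>(4) ab by simp
  qed
  define G where "G n x = (\<Sum>k<n. box_bump (a k) (b k) x)" for n x
  have pos: "{x. 0 < G n x} = (\<Union>k<n. box (a k) (b k))" for n
  proof -
    have "0 < G n x \<longleftrightarrow> (\<exists>k<n. x \<in> box (a k) (b k))" for x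
    proof -
      have "0 < G n x \<longleftrightarrow> G n x \<noteq> 0" using sum_nonneg[of "{..<n}" "\<lambda>k. box_bump (a k) (b k) x"]
        by (auto simp: G_def box_bump_nonneg less_le)
      also have "\<dots> \<longleftrightarrow> (\<exists>k<n. box_bump (a k) (b k) x \<noteq> 0)"
        unfolding G_def by (subst sum_nonneg_eq_0_iff) (auto simp: box_bump_nonneg)
      also have "\<dots> \<longleftrightarrow> (\<exists>k<n. 0 < box_bump (a k) (b k) x)"
        using box_bump_nonneg by (metis less_le)
      finally show ?thesis by (simp add: box_bump_pos_iff)
    qed
    then show ?thesis by auto
  qed
  have G0: "0 \<le> G n x" for n x unfolding G_def by (intro sum_nonneg) (simp add: box_bump_nonneg)
  have "\<exists>D. C1_deriv (G n) D" for n
  proof -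
    have "\<forall>k. \<exists>E. C1_deriv (box_bump (a k) (b k)) E" by (simp add: C1_deriv_box_bump)
    then obtain E where "\<And>k. C1_deriv (box_bump (a k) (b k)) (E k)" by metis
    then show ?thesis using C1_deriv_sum[of "{..<n}" "\<lambda>k. box_bump (a k) (b k)" E]
      unfolding G_def[abs_def] by blast
  qed
  then obtain D where D: "\<And>n. C1_deriv (G n) (D n)" by metis
  show ?thesis
  proof (rule that[of "\<lambda>n x. \<kappa> (real n * G n x - 1)"])
    fix n
    show "(\<lambda>x. \<kappa> (real n * G n x - 1)) \<in> C1c V"
    proof (rule C1c_superlevel[OF D])
      show "bounded {x. 0 < G n x}" unfolding pos by (intro bounded_UN) (auto simp: bounded_box)
      show "{x. 0 < G n x} \<subseteq> V" unfolding pos using un by auto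
    qed simp
  next
    fix x
    show "(\<lambda>n. \<kappa> (real n * G n x - 1)) \<longlonglongrightarrow> indicator V x"
    proof (cases "x \<in> V")
      case True
      then obtain k where k: "x \<in> box (a k) (b k)" using un by auto
      have "box_bump (a k) (b k) x \<le> G n x" if "n > k" for n
        unfolding G_def using that by (intro member_le_sum) (auto simp: box_bump_nonneg)
      with bump_tendsto_indicator[of "\<lambda>n. G n x" k "box_bump (a k) (b k) x"] G0 k True
      show ?thesis by (simp add: box_bump_pos_iff)
    next
      case False
      then have "\<not> 0 < G n x" for n using pos[of n] un by auto
      then have "G n x = 0" for n using G0[of n x] by (simp add: less_le)
      then show ?thesis using False by (simp add: \<kappa>_eq_0)
    qed
  qed (auto simp: \<kappa>_nonneg \<kappa>_le_1)
qed

section \<open>Integrals of derivatives of test functions\<close>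

lemma integrable_C1c_like:
  fixes g :: "'a::euclidean_space \<Rightarrow> 'b::euclidean_space"
  assumes "continuous_on UNIV g" "compact K" "\<And>x. x \<notin> K \<Longrightarrow> g x = 0"
  shows "integrable lborel g"
proof -
  have "integrable lborel (\<lambda>x. indicator K x *\<^sub>R g x)"
    using borel_integrable_compact[OF assms(2) continuous_on_subset[OF assms(1)]] by auto
  moreover have "(\<lambda>x. indicator K x *\<^sub>R g x) = g" using assms(3) by (auto simp: indicator_def)
  ultimately show ?thesis by simp
qed

text \<open>Lebesgue measure is translation invariant, so every difference quotient of \<phi> in
  direction v has integral 0, and dominated convergence carries this over to the derivative.\<close>

lemma integral_C1c_deriv_zero:
  fixes \<phi> :: "'a::euclidean_space \<Rightarrow> 'b::euclidean_space"
  assumes "\<phi> \<in> C1c U"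
  shows "(LINT x|lborel. frechet_derivative \<phi> (at x) v) = 0"
proof -
  obtain K where K: "compact K" "\<And>x. x \<notin> K \<Longrightarrow> \<phi> x = 0"
    "\<And>x v. x \<notin> K \<Longrightarrow> frechet_derivative \<phi> (at x) v = 0"
    using C1c_support[OF assms] by metis
  obtain M where M: "M > 0" "\<And>x. norm (frechet_derivative \<phi> (at x) v) \<le> M"
    using C1c_bounded_deriv[OF assms] by metis
  obtain R where R: "\<And>x. x \<in> K \<Longrightarrow> norm x \<le> R"
    using K(1) by (meson bounded_iff compact_imp_bounded)
  define h where "h n = 1 / (real n + 1)" for n
  have h: "0 < h n" "h n \<le> 1" for n by (auto simp: h_def)
  have D: "(\<phi> has_derivative frechet_derivative \<phi> (at x)) (at x)" for x
    using C1c_C1_deriv[OF assms] by (simp add: C1_deriv_def)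
  have cont: "continuous_on UNIV \<phi>" by (rule C1c_continuous[OF assms])
  have vd: "((\<lambda>t. \<phi> (x + t *\<^sub>R v)) has_vector_derivative frechet_derivative \<phi> (at (x + t *\<^sub>R v)) v) (at t)" for x t
  proof -
    have "((\<lambda>t. x + t *\<^sub>R v) has_derivative (\<lambda>s. s *\<^sub>R v)) (at t)"
      by (auto intro!: derivative_eq_intros)
    from diff_chain_at[OF this D] have
      "((\<lambda>t. \<phi> (x + t *\<^sub>R v)) has_derivative (\<lambda>s. frechet_derivative \<phi> (at (x + t *\<^sub>R v)) (s *\<^sub>R v))) (at t)"
      by (simp add: o_def)
    moreover have "frechet_derivative \<phi> (at (x + t *\<^sub>R v)) (s *\<^sub>R v) = s *\<^sub>R frechet_derivative \<phi> (at (x + t *\<^sub>R v)) v" for s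
      using has_derivative_bounded_linear[OF D] by (simp add: linear_simps(5))
    ultimately show ?thesis by (simp add: has_vector_derivative_def)
  qed
  let ?q = "\<lambda>n x. (1 / h n) *\<^sub>R (\<phi> (x + h n *\<^sub>R v) - \<phi> x)"
  have int: "integrable lborel \<phi>" by (rule integrable_C1c_like[OF cont K(1,2)])
  have shift: "integrable lborel (\<lambda>x. \<phi> (x + c))" "(LINT x|lborel. \<phi> (x + c)) = (LINT x|lborel. \<phi> x)" for c
  proof -
    have e: "distr lborel borel ((+) c) = lborel" by (rule lborel_distr_plus)
    have *: "integrable (distr lborel borel ((+) c)) \<phi>" unfolding e by (rule int)
    show "integrable lborel (\<lambda>x. \<phi> (x + c))"
      using integrable_distr[OF _ *] by (simp add: add.commute)
    have "(LINT x|lborel. \<phi> x) = (LINT x|distr lborel borel ((+) c). \<phi> x)" unfolding e ..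
    also have "\<dots> = (LINT x|lborel. \<phi> (c + x))"
      using int by (intro integral_distr) auto
    finally show "(LINT x|lborel. \<phi> (x + c)) = (LINT x|lborel. \<phi> x)" by (simp add: add.commute)
  qed
  have "(\<lambda>n. LINT x|lborel. ?q n x) \<longlonglongrightarrow> (LINT x|lborel. frechet_derivative \<phi> (at x) v)"
  proof (rule integral_dominated_convergence[where w = "\<lambda>x. M * indicator (cball 0 (R + norm v)) x"])
    show "(\<lambda>x. frechet_derivative \<phi> (at x) v) \<in> borel_measurable lborel"
      using C1c_continuous_deriv[OF assms, of UNIV v] borel_measurable_continuous_onI by auto
    show "?q n \<in> borel_measurable lborel" for n
      unfolding measurable_lborel2
      by (intro borel_measurable_continuous_onI continuous_intros continuous_on_compose2[OF cont]) auto
    \<comment> \<open>The steps h n are at most 1, so all quotients vanish outside the ball of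
      radius R + norm v; inside it the mean value inequality bounds them by M.\<close>
    show "integrable lborel (\<lambda>x. M * indicator (cball 0 (R + norm v)) x :: real)"
      by (intro integrable_mult_right integrable_real_indicator) (auto simp: emeasure_lborel_cball_finite[unfolded infinity_ennreal_def])
    show "AE x in lborel. (\<lambda>n. ?q n x) \<longlonglongrightarrow> frechet_derivative \<phi> (at x) v"
    proof (rule AE_I2)
      fix x
      have "((\<lambda>t. (1 / t) *\<^sub>R (\<phi> (x + t *\<^sub>R v) - \<phi> x)) \<longlongrightarrow> frechet_derivative \<phi> (at x) v) (at 0)"
      proof (rule LIM_zero_cancel, rule tendsto_norm_zero_cancel)
        have "((\<lambda>t. norm (\<phi> (x + t *\<^sub>R v) - \<phi> x - t *\<^sub>R frechet_derivative \<phi> (at x) v) / norm t) \<longlongrightarrow> 0) (at 0)"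
          using vd[of x 0] unfolding has_vector_derivative_def has_derivative_at by simp
        then show "((\<lambda>t. norm ((1 / t) *\<^sub>R (\<phi> (x + t *\<^sub>R v) - \<phi> x) - frechet_derivative \<phi> (at x) v)) \<longlongrightarrow> 0) (at 0)"
        proof (rule Lim_transform_eventually)
          show "\<forall>\<^sub>F t in at 0. norm (\<phi> (x + t *\<^sub>R v) - \<phi> x - t *\<^sub>R frechet_derivative \<phi> (at x) v) / norm t
            = norm ((1 / t) *\<^sub>R (\<phi> (x + t *\<^sub>R v) - \<phi> x) - frechet_derivative \<phi> (at x) v)"
            unfolding eventually_at_topological
          proof (intro exI[of _ UNIV] conjI ballI impI)
            fix t :: real assume "t \<noteq> 0"
            then have "(1 / t) *\<^sub>R (\<phi> (x + t *\<^sub>R v) - \<phi> x) - frechet_derivative \<phi> (at x) v =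
              (1 / t) *\<^sub>R (\<phi> (x + t *\<^sub>R v) - \<phi> x - t *\<^sub>R frechet_derivative \<phi> (at x) v)"
              by (simp add: algebra_simps)
            then show "norm (\<phi> (x + t *\<^sub>R v) - \<phi> x - t *\<^sub>R frechet_derivative \<phi> (at x) v) / norm t
              = norm ((1 / t) *\<^sub>R (\<phi> (x + t *\<^sub>R v) - \<phi> x) - frechet_derivative \<phi> (at x) v)"
              by simp
          qed auto
        qed
      qed
      moreover have "filterlim h (at 0) sequentially"
        unfolding h_def[abs_def] by real_asymp
      ultimately show "(\<lambda>n. ?q n x) \<longlonglongrightarrow> frechet_derivative \<phi> (at x) v"
        by (rule filterlim_compose)
    qed
    show "AE x in lborel. norm (?q n x) \<le> M * indicator (cball 0 (R + norm v)) x" for n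
    proof (rule AE_I2)
      fix x
      show "norm (?q n x) \<le> M * indicator (cball 0 (R + norm v)) x"
      proof (cases "x \<in> cball 0 (R + norm v)")
        case True
        have "norm (\<phi> (x + h n *\<^sub>R v) - \<phi> (x + 0 *\<^sub>R v)) \<le> M * norm (h n - 0)"
        proof (rule differentiable_bound[of "{0..h n}"])
          show "((\<lambda>t. \<phi> (x + t *\<^sub>R v)) has_derivative (\<lambda>s. s *\<^sub>R frechet_derivative \<phi> (at (x + t *\<^sub>R v)) v)) (at t within {0..h n})" for t
            using vd[of x t] by (simp add: has_vector_derivative_def has_derivative_at_withinI)
          show "onorm (\<lambda>s::real. s *\<^sub>R frechet_derivative \<phi> (at (x + t *\<^sub>R v)) v) \<le> M" for t
            by (rule onorm_le) (auto simp: mult.commute[of M] intro!: mult_left_mono M(2))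
        qed (use h[of n] in auto)
        then show ?thesis using True h[of n] by (simp add: pos_divide_le_eq)
      next
        case False
        then have n1: "norm x > R + norm v" by simp
        have "norm x \<le> norm (x + h n *\<^sub>R v) + norm (h n *\<^sub>R v)"
          by (metis add_diff_cancel norm_triangle_ineq4)
        moreover have "norm (h n *\<^sub>R v) \<le> norm v" using h[of n] by (simp add: mult_left_le_one_le)
        ultimately have "x \<notin> K" "x + h n *\<^sub>R v \<notin> K" using n1 R[of x] R[of "x + h n *\<^sub>R v"]
          by (smt (verit) norm_ge_zero)+
        then show ?thesis using K(2) False by simp
      qed
    qed
  qed
  moreover have "(LINT x|lborel. ?q n x) = 0" for n
    using shift int by simp
  ultimately have "(\<lambda>n::nat. 0) \<longlonglongrightarrow> (LINT x|lborel. frechet_derivative \<phi> (at x) v)" by (simp only:)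
  then show ?thesis by (simp add: LIMSEQ_const_iff)
qed

section \<open>Uniqueness of weak derivatives and derivative measures\<close>

lemma sets_restrict_borel_open:
  assumes "open U"
  shows "sets (restrict_space borel U) = sigma_sets U {V. open V \<and> V \<subseteq> U}"
proof -
  have "(\<inter>) U ` sigma_sets UNIV {V. open V} = sigma_sets U ((\<inter>) U ` {V. open V})"
    using assms by (intro sigma_sets_Int) auto
  moreover have "(\<inter>) U ` {V. open V} = {V. open V \<and> V \<subseteq> U}" using assms by auto
  ultimately show ?thesis by (simp add: sets_restrict_space borel_def)
qed

lemma borel_measurable_restrict_cong:
  assumes "sets L = sets (restrict_space borel U)" "continuous_on UNIV g"
  shows "g \<in> borel_measurable L"
proof -
  have "g \<in> borel_measurable borel" using assms(2) by (rule borel_measurable_continuous_onI)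
  then show ?thesis
    unfolding measurable_cong_sets[OF assms(1) refl] by (rule measurable_restrict_space1)
qed

lemma space_restrict_borel: "sets L = sets (restrict_space borel U) \<Longrightarrow> space L = U"
  using sets_eq_imp_space_eq[of L "restrict_space borel U"] by (simp add: space_restrict_space)

lemma integral_tendsto_measure:
  assumes "finite_measure L" "sets L = sets (restrict_space borel U)" "V \<in> sets L"
    "\<And>n. continuous_on UNIV (\<phi> n)" "\<And>n x. 0 \<le> \<phi> n x" "\<And>n x. \<phi> n x \<le> (1::real)"
    "\<And>x. (\<lambda>n. \<phi> n x) \<longlonglongrightarrow> indicator V x"
  shows "(\<lambda>n. integral\<^sup>L L (\<phi> n)) \<longlonglongrightarrow> measure L V"
proof -
  interpret L: finite_measure L by fact
  have "(\<lambda>n. integral\<^sup>L L (\<phi> n)) \<longlonglongrightarrow> (LINT x|L. indicator V x)"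
  proof (rule integral_dominated_convergence[where w = "\<lambda>_. 1"])
    show "(\<lambda>x. indicator V x :: real) \<in> borel_measurable L" using assms(3) by simp
    show "\<phi> n \<in> borel_measurable L" for n
      by (rule borel_measurable_restrict_cong[OF assms(2,4)])
  qed (use assms in \<open>auto simp: abs_le_iff\<close>)
  then show ?thesis using assms(3) by simp
qed

text \<open>Cutoffs tend to indicators of open sets, so the two differences agree on open subsets of
  U. These are stable under intersection and generate the Borel sets, and agreement is inherited by
  complements and disjoint unions because all four measures are finite. Four measures appear so that
  signed measures given by unrelated decompositions can be compared.\<close>

lemma signed_measure_eqI_C1c:
  fixes U :: "'a::euclidean_space set"
  assumes "open U"
    and fin: "finite_measure P" "finite_measure N" "finite_measure P'" "finite_measure N'"
    and sets: "sets P = sets (restrict_space borel U)" "sets N = sets (restrict_space borel U)"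
      "sets P' = sets (restrict_space borel U)" "sets N' = sets (restrict_space borel U)"
    and eq: "\<And>\<phi> :: 'a \<Rightarrow> real. \<phi> \<in> C1c U \<Longrightarrow>
      integral\<^sup>L P \<phi> - integral\<^sup>L N \<phi> = integral\<^sup>L P' \<phi> - integral\<^sup>L N' \<phi>"
    and E: "E \<in> sets (restrict_space borel U)"
  shows "measure P E - measure N E = measure P' E - measure N' E"
proof -
  interpret P: finite_measure P by fact
  interpret N: finite_measure N by fact
  interpret P': finite_measure P' by fact
  interpret N': finite_measure N' by fact
  note sp = sets[THEN space_restrict_borel]
  have op: "measure P V - measure N V = measure P' V - measure N' V" if V: "open V" "V \<subseteq> U" for V
  proof -
    obtain \<phi> :: "nat \<Rightarrow> 'a \<Rightarrow> real" where \<phi>: "\<And>n. \<phi> n \<in> C1c V" "\<And>n x. 0 \<le> \<phi> n x" "\<And>n x. \<phi> n x \<le> 1"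
      "\<And>x. (\<lambda>n. \<phi> n x) \<longlonglongrightarrow> indicator V x" by (rule open_approx_C1c[OF V(1)]) (rule that)
    have VB: "V \<in> sets (restrict_space borel U)"
      using V sets_restrict_borel_open[OF assms(1)] by auto
    have c: "continuous_on UNIV (\<phi> n)" for n using C1c_continuous[OF \<phi>(1)] .
    have lim: "(\<lambda>n. integral\<^sup>L L (\<phi> n)) \<longlonglongrightarrow> measure L V"
      if "finite_measure L" "sets L = sets (restrict_space borel U)" for L
      by (rule integral_tendsto_measure[OF that _ c \<phi>(2-4)]) (simp add: that VB)
    have "integral\<^sup>L P (\<phi> n) - integral\<^sup>L N (\<phi> n) = integral\<^sup>L P' (\<phi> n) - integral\<^sup>L N' (\<phi> n)" for n
      by (rule eq) (use \<phi>(1) C1c_mono[OF V(2)] in blast)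
    with tendsto_diff[OF lim[OF fin(1) sets(1)] lim[OF fin(2) sets(2)]]
      tendsto_diff[OF lim[OF fin(3) sets(3)] lim[OF fin(4) sets(4)]]
    show ?thesis by (auto intro: LIMSEQ_unique)
  qed
  have "Int_stable {V. open V \<and> V \<subseteq> U}" "{V. open V \<and> V \<subseteq> U} \<subseteq> Pow U"
    by (auto simp: Int_stable_def)
  moreover have "E \<in> sigma_sets U {V. open V \<and> V \<subseteq> U}"
    using E sets_restrict_borel_open[OF assms(1)] by simp
  ultimately show ?thesis
  proof (induction E rule: sigma_sets_induct_disjoint)
    case (basic A) then show ?case using op by simp
  next
    case empty then show ?case by simp
  next
    case (compl A)
    then have A: "A \<in> sets P" "A \<in> sets N" "A \<in> sets P'" "A \<in> sets N'"
      using sets sets_restrict_borel_open[OF assms(1)] by auto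
    have "measure P U - measure N U = measure P' U - measure N' U" using op assms(1) by simp
    then show ?case
      using compl A P.finite_measure_compl[OF A(1)] N.finite_measure_compl[OF A(2)]
        P'.finite_measure_compl[OF A(3)] N'.finite_measure_compl[OF A(4)] by (simp add: sp)
  next
    case (union A)
    then have A: "range A \<subseteq> sets P" "range A \<subseteq> sets N" "range A \<subseteq> sets P'" "range A \<subseteq> sets N'"
      using sets sets_restrict_borel_open[OF assms(1)] by auto
    have "(\<lambda>n. measure P (A n) - measure N (A n)) sums (measure P (\<Union>n. A n) - measure N (\<Union>n. A n))"
      using A union by (intro sums_diff P.finite_measure_UNION N.finite_measure_UNION)
    moreover have "(\<lambda>n. measure P' (A n) - measure N' (A n)) sums (measure P' (\<Union>n. A n) - measure N' (\<Union>n. A n))"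
      using A union by (intro sums_diff P'.finite_measure_UNION N'.finite_measure_UNION)
    ultimately show ?case using union.IH sums_unique2 by auto
  qed
qed

text \<open>U is cut into level sets of \<phi> of height \<delta>; on the k-th one \<phi> is within
  \<delta> of k * \<delta>. The bound m is large enough to catch every level that is attained. The
  sum sees only the values of \<nu> and not the decomposition into P and N, which makes it useful
  both for the uniqueness of the integral and for the comparison with a total variation.\<close>

lemma signed_integral_step_approx:
  fixes \<phi> :: "'a::euclidean_space \<Rightarrow> real"
  assumes "finite_measure P" "finite_measure N"
    and sets: "sets P = sets (restrict_space borel U)" "sets N = sets (restrict_space borel U)"
    and \<nu>: "\<And>E. E \<in> sets (restrict_space borel U) \<Longrightarrow> \<nu> E = measure P E - measure N E"
    and "continuous_on UNIV \<phi>" "\<And>x. \<bar>\<phi> x\<bar> \<le> B" "0 < \<delta>"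
  defines "m \<equiv> \<lceil>B / \<delta>\<rceil> + 1" and "E \<equiv> \<lambda>k. {x \<in> U. \<lfloor>\<phi> x / \<delta>\<rfloor> = k}"
  shows "\<bar>(integral\<^sup>L P \<phi> - integral\<^sup>L N \<phi>) - (\<Sum>k\<in>{-m..m}. (of_int k * \<delta>) * \<nu> (E k))\<bar>
    \<le> \<delta> * (measure P U + measure N U)"
    and "\<And>k. E k \<in> sets (restrict_space borel U)"
proof -
  show Es: "E k \<in> sets (restrict_space borel U)" for k
  proof -
    have [measurable]: "\<phi> \<in> borel_measurable borel" using assms(6) by (rule borel_measurable_continuous_onI)
    have "{x \<in> space borel. \<lfloor>\<phi> x / \<delta>\<rfloor> = k} \<in> sets borel" by measurable
    then have "U \<inter> {x. \<lfloor>\<phi> x / \<delta>\<rfloor> = k} \<in> (\<inter>) U ` sets borel" by auto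
    moreover have "E k = U \<inter> {x. \<lfloor>\<phi> x / \<delta>\<rfloor> = k}" by (auto simp: E_def)
    ultimately show ?thesis by (simp add: sets_restrict_space)
  qed
  have B: "0 \<le> B" using assms(7)[of undefined] by linarith
  have *: "\<bar>integral\<^sup>L L \<phi> - (\<Sum>k\<in>{-m..m}. (of_int k * \<delta>) * measure L (E k))\<bar> \<le> \<delta> * measure L U"
    if L: "finite_measure L" "sets L = sets (restrict_space borel U)" for L
  proof -
    interpret L: finite_measure L by fact
    have EL: "E k \<in> sets L" for k using L Es by simp
    let ?s = "\<lambda>x. \<Sum>k\<in>{-m..m}. (of_int k * \<delta>) * indicator (E k) x"
    have int: "integrable L \<phi>"
      by (rule L.integrable_const_bound[of _ B])
        (use assms(7) borel_measurable_restrict_cong[OF L(2) assms(6)] in auto)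
    have EI: "integrable L (indicator (E k) :: _ \<Rightarrow> real)" for k
      using EL by (intro integrable_real_indicator) (auto simp: less_top[symmetric] L.emeasure_finite)
    have ints: "integrable L ?s"
      by (intro Bochner_Integration.integrable_sum integrable_mult_right EI)
    have s: "integral\<^sup>L L ?s = (\<Sum>k\<in>{-m..m}. (of_int k * \<delta>) * measure L (E k))"
      using EL by (subst Bochner_Integration.integral_sum) (auto intro!: integrable_mult_right EI)
    have near: "\<bar>\<phi> x - ?s x\<bar> \<le> \<delta>" if "x \<in> space L" for x
    proof -
      have "x \<in> U" using that space_restrict_borel[OF L(2)] by simp
      let ?k = "\<lfloor>\<phi> x / \<delta>\<rfloor>"
      have "\<bar>\<phi> x / \<delta>\<bar> \<le> B / \<delta>" using assms(7)[of x] assms(8) by (simp add: divide_right_mono)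
      then have k: "?k \<in> {-m..m}" unfolding m_def by (simp; linarith)
      have "?s x = (\<Sum>k\<in>{-m..m}. if k = ?k then of_int k * \<delta> else 0)"
        using \<open>x \<in> U\<close> by (intro sum.cong) (auto simp: E_def)
      also have "\<dots> = of_int ?k * \<delta>" using k by simp
      finally have sx: "?s x = of_int ?k * \<delta>" .
      have "of_int ?k \<le> \<phi> x / \<delta>" "\<phi> x / \<delta> \<le> of_int ?k + 1" by linarith+
      then have "of_int ?k * \<delta> \<le> \<phi> x" "\<phi> x \<le> (of_int ?k + 1) * \<delta>"
        using assms(8) by (simp_all only: pos_le_divide_eq pos_divide_le_eq)
      then have "of_int ?k * \<delta> \<le> \<phi> x" "\<phi> x \<le> of_int ?k * \<delta> + \<delta>" by (simp_all add: distrib_right)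
      then show ?thesis unfolding sx by linarith
    qed
    have "\<bar>integral\<^sup>L L \<phi> - integral\<^sup>L L ?s\<bar> = \<bar>LINT x|L. \<phi> x - ?s x\<bar>"
      using int ints by simp
    also have "\<dots> \<le> (LINT x|L. \<bar>\<phi> x - ?s x\<bar>)" by (rule integral_abs_bound)
    also have "\<dots> \<le> (LINT x|L. \<delta>)"
      using int ints near by (intro integral_mono integrable_abs Bochner_Integration.integrable_diff) auto
    also have "\<dots> = \<delta> * measure L U" using space_restrict_borel[OF L(2)] by simp
    finally show ?thesis unfolding s .
  qed
  have "(\<Sum>k\<in>{-m..m}. (of_int k * \<delta>) * \<nu> (E k)) =
    (\<Sum>k\<in>{-m..m}. (of_int k * \<delta>) * measure P (E k)) - (\<Sum>k\<in>{-m..m}. (of_int k * \<delta>) * measure N (E k))"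
    unfolding sum_subtractf[symmetric] by (intro sum.cong) (simp_all add: \<nu>[OF Es] right_diff_distrib)
  with *[OF assms(1) sets(1)] *[OF assms(2) sets(2)]
  show "\<bar>(integral\<^sup>L P \<phi> - integral\<^sup>L N \<phi>) - (\<Sum>k\<in>{-m..m}. (of_int k * \<delta>) * \<nu> (E k))\<bar>
    \<le> \<delta> * (measure P U + measure N U)" by (simp add: algebra_simps)
qed

text \<open>Any two decompositions are compared with the same step sum, and the error is a fixed
  multiple of the arbitrary \<delta>.\<close>

lemma signed_integral_unique:
  fixes \<phi> :: "'a::euclidean_space \<Rightarrow> real"
  assumes fin: "finite_measure P" "finite_measure N"
    and sets: "sets P = sets (restrict_space borel U)" "sets N = sets (restrict_space borel U)"
    and \<nu>: "\<And>E. E \<in> sets (restrict_space borel U) \<Longrightarrow> \<nu> E = measure P E - measure N E"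
    and \<phi>: "continuous_on UNIV \<phi>" "\<And>x. \<bar>\<phi> x\<bar> \<le> B"
    and c: "has_signed_integral U \<nu> \<phi> c"
  shows "c = integral\<^sup>L P \<phi> - integral\<^sup>L N \<phi>"
proof -
  obtain P' N' where PN': "finite_measure P'" "finite_measure N'"
    "sets P' = sets (restrict_space borel U)" "sets N' = sets (restrict_space borel U)"
    "\<And>E. E \<in> sets (restrict_space borel U) \<Longrightarrow> \<nu> E = measure P' E - measure N' E"
    "c = integral\<^sup>L P' \<phi> - integral\<^sup>L N' \<phi>"
    using c unfolding has_signed_integral_def by blast
  define C where "C = measure P U + measure N U + measure P' U + measure N' U"
  have "\<bar>c - (integral\<^sup>L P \<phi> - integral\<^sup>L N \<phi>)\<bar> \<le> \<delta> * C" if "\<delta> > 0" for \<delta>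
    using signed_integral_step_approx(1)[OF PN'(1-5) \<phi> that]
      signed_integral_step_approx(1)[OF fin sets \<nu> \<phi> that]
    unfolding C_def PN'(6) by (simp add: algebra_simps)
  moreover have "((\<lambda>\<delta>. \<delta> * C) \<longlongrightarrow> 0) (at_right 0)"
    by (rule tendsto_eq_intros | simp)+
  ultimately have "\<bar>c - (integral\<^sup>L P \<phi> - integral\<^sup>L N \<phi>)\<bar> \<le> 0"
    by (intro tendsto_lowerbound[of _ _ "at_right 0"])
      (auto simp: eventually_at_right_less intro!: eventually_mono[OF eventually_at_right_less])
  then show ?thesis by simp
qed

text \<open>\<open>has_derivative_measure\<close> supplies a decomposition separately for each test
  function. Here one pair P, N per direction is fixed that represents the derivative against all
  test functions.\<close>

lemma has_derivative_measure_decomposition: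
  fixes w :: "'a::euclidean_space \<Rightarrow> real"
  assumes "has_derivative_measure U w \<mu>" "i \<in> Basis"
  obtains P N where "finite_measure P" "finite_measure N"
    "sets P = sets (restrict_space borel U)" "sets N = sets (restrict_space borel U)"
    "\<And>E. E \<in> sets (restrict_space borel U) \<Longrightarrow> \<mu> E \<bullet> i = measure P E - measure N E"
    "\<And>\<phi> :: _ \<Rightarrow> real. \<phi> \<in> C1c U \<Longrightarrow> integral\<^sup>L P \<phi> - integral\<^sup>L N \<phi>
      = - (LINT x|lebesgue_on U. w x * frechet_derivative \<phi> (at x) i)"
proof -
  have h: "has_signed_integral U (\<lambda>E. \<mu> E \<bullet> i) \<phi>
        (- (LINT x|lebesgue_on U. w x * frechet_derivative \<phi> (at x) i))" if "\<phi> \<in> C1c U" for \<phi> :: "_ \<Rightarrow> real"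
    using assms that unfolding has_derivative_measure_def by blast
  \<comment> \<open>The zero function is a test function, and its signed integral already contains a
    decomposition of the component.\<close>
  have "(\<lambda>_. 0) \<in> C1c U" by (rule C1cI[OF C1_deriv_const, of "{}"]) auto
  from h[OF this] obtain P N where PN: "finite_measure P" "finite_measure N"
    "sets P = sets (restrict_space borel U)" "sets N = sets (restrict_space borel U)"
    "\<And>E. E \<in> sets (restrict_space borel U) \<Longrightarrow> \<mu> E \<bullet> i = measure P E - measure N E"
    unfolding has_signed_integral_def by blast
  show ?thesis
  proof (rule that[OF PN])
    fix \<phi> :: "'a \<Rightarrow> real" assume \<phi>: "\<phi> \<in> C1c U"
    obtain M where M: "\<And>x. norm (\<phi> x) \<le> M" using C1c_bounded[OF \<phi>] by metis
    show "integral\<^sup>L P \<phi> - integral\<^sup>L N \<phi>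
      = - (LINT x|lebesgue_on U. w x * frechet_derivative \<phi> (at x) i)"
      using signed_integral_unique[OF PN C1c_continuous[OF \<phi>] M[unfolded real_norm_def] h[OF \<phi>]] by simp
  qed
qed

lemma has_derivative_measure_unique:
  fixes w :: "'a::euclidean_space \<Rightarrow> real"
  assumes "open U" "has_derivative_measure U w \<mu>" "has_derivative_measure U w \<mu>'"
    "E \<in> sets (restrict_space borel U)"
  shows "\<mu> E = \<mu>' E"
proof (rule euclidean_eqI)
  fix i :: 'a assume i: "i \<in> Basis"
  obtain P N where PN: "finite_measure P" "finite_measure N"
    "sets P = sets (restrict_space borel U)" "sets N = sets (restrict_space borel U)"
    "\<And>E. E \<in> sets (restrict_space borel U) \<Longrightarrow> \<mu> E \<bullet> i = measure P E - measure N E"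
    "\<And>\<phi> :: _ \<Rightarrow> real. \<phi> \<in> C1c U \<Longrightarrow> integral\<^sup>L P \<phi> - integral\<^sup>L N \<phi>
      = - (LINT x|lebesgue_on U. w x * frechet_derivative \<phi> (at x) i)"
    by (rule has_derivative_measure_decomposition[OF assms(2) i]) (rule that)
  obtain P' N' where PN': "finite_measure P'" "finite_measure N'"
    "sets P' = sets (restrict_space borel U)" "sets N' = sets (restrict_space borel U)"
    "\<And>E. E \<in> sets (restrict_space borel U) \<Longrightarrow> \<mu>' E \<bullet> i = measure P' E - measure N' E"
    "\<And>\<phi>. \<phi> \<in> C1c U \<Longrightarrow> integral\<^sup>L P' \<phi> - integral\<^sup>L N' \<phi>
      = - (LINT x|lebesgue_on U. w x * frechet_derivative \<phi> (at x) i)"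
    by (rule has_derivative_measure_decomposition[OF assms(3) i]) (rule that)
  show "\<mu> E \<bullet> i = \<mu>' E \<bullet> i"
    using signed_measure_eqI_C1c[OF assms(1) PN(1,2) PN'(1,2) PN(3,4) PN'(3,4) _ assms(4)]
      PN(5,6) PN'(5,6) assms(4) by simp
qed

lemma has_derivative_measure_derivative_measure:
  assumes "w \<in> BV U"
  shows "has_derivative_measure U w (derivative_measure U w)"
proof -
  have "\<exists>\<mu>. has_derivative_measure U w \<mu>" using assms unfolding BV_def by simp
  then show ?thesis unfolding derivative_measure_def by (rule someI_ex)
qed

text \<open>The level sets of \<phi> partition U, so the step sum for the integral of \<phi> is
  bounded by the corresponding sum for the total variation of \<rho>, up to a factor 1 + 2 *
  \<delta>. The measure \<rho> is kept apart from \<mu> because it will be the rescaled derivative,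
  whose norm dominates the axial component of \<mu>.\<close>

lemma total_variation_ge_test:
  fixes w :: "'a::euclidean_space \<Rightarrow> real"
  assumes "has_derivative_measure U w \<mu>" "i \<in> Basis" "\<phi> \<in> C1c U" "\<And>x. \<bar>\<phi> x\<bar> \<le> 1"
    and K: "\<And>E. E \<in> sets (restrict_space borel U) \<Longrightarrow> \<bar>\<mu> E \<bullet> i\<bar> \<le> norm (\<rho> E)"
  shows "ennreal \<bar>LINT x|lebesgue_on U. w x * frechet_derivative \<phi> (at x) i\<bar> \<le> total_variation U \<rho>"
proof (cases "total_variation U \<rho>" rule: ennreal_cases)
  case (real T)
  obtain P N where PN: "finite_measure P" "finite_measure N"
    "sets P = sets (restrict_space borel U)" "sets N = sets (restrict_space borel U)"
    "\<And>E. E \<in> sets (restrict_space borel U) \<Longrightarrow> \<mu> E \<bullet> i = measure P E - measure N E"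
    "\<And>\<phi> :: _ \<Rightarrow> real. \<phi> \<in> C1c U \<Longrightarrow> integral\<^sup>L P \<phi> - integral\<^sup>L N \<phi>
      = - (LINT x|lebesgue_on U. w x * frechet_derivative \<phi> (at x) i)"
    by (rule has_derivative_measure_decomposition[OF assms(1,2)]) (rule that)
  let ?c = "integral\<^sup>L P \<phi> - integral\<^sup>L N \<phi>"
  define C where "C = measure P U + measure N U"
  have "\<bar>?c\<bar> \<le> (1 + 2 * \<delta>) * T + \<delta> * C" if \<delta>: "\<delta> > 0" for \<delta>
  proof -
    define m where "m = \<lceil>1 / \<delta>\<rceil> + 1"
    define E where "E k = {x \<in> U. \<lfloor>\<phi> x / \<delta>\<rfloor> = k}" for k
    note ap = signed_integral_step_approx[OF PN(1-5) C1c_continuous[OF assms(3)] assms(4) \<delta>, folded m_def E_def C_def]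
    \<comment> \<open>The total variation runs over sequences of sets, so the integer levels are
      enumerated by natural numbers; levels that are not attained give empty sets.\<close>
    define A where "A n = E (int_decode n)" for n
    have TV: "(\<Sum>n. ennreal (norm (\<rho> (A n)))) \<le> total_variation U \<rho>"
      unfolding total_variation_def
    proof (rule SUP_upper, intro CollectI conjI)
      show "range A \<subseteq> sets (restrict_space borel U)" using ap(2) by (auto simp: A_def)
      show "disjoint_family A"
        by (auto simp: disjoint_family_on_def A_def E_def inj_eq[OF inj_int_decode])
      show "\<Union> (range A) = U"
      proof -
        have "x \<in> A (int_encode \<lfloor>\<phi> x / \<delta>\<rfloor>)" if "x \<in> U" for x
          using that by (simp add: A_def E_def)
        moreover have "A n \<subseteq> U" for n by (auto simp: A_def E_def)
        ultimately show ?thesis by blast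
      qed
    qed
    have le: "(\<Sum>n\<in>F. ennreal (norm (\<rho> (A n)))) \<le> ennreal T" if "finite F" for F
      using order_trans[OF sum_le_suminf[OF summableI that] TV] real(2) by simp
    have "(\<Sum>k\<in>{-m..m}. norm (\<rho> (E k))) = (\<Sum>n\<in>int_encode ` {-m..m}. norm (\<rho> (A n)))"
      by (subst sum.reindex) (auto simp: A_def intro: inj_int_encode)
    also have "\<dots> \<le> T"
      using le[of "int_encode ` {-m..m}"] real by (simp add: sum_ennreal)
    finally have sumT: "(\<Sum>k\<in>{-m..m}. norm (\<rho> (E k))) \<le> T" .
    have "\<bar>of_int k * \<delta>\<bar> \<le> 1 + 2 * \<delta>" if "k \<in> {-m..m}" for k
    proof -
      have "\<bar>of_int k\<bar> \<le> real_of_int m" using that by auto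
      also have "\<dots> \<le> 1 / \<delta> + 2" unfolding m_def by simp linarith
      finally have "\<bar>of_int k\<bar> * \<delta> \<le> (1 / \<delta> + 2) * \<delta>" using \<delta> by (intro mult_right_mono) auto
      then show ?thesis using \<delta> by (simp add: abs_mult algebra_simps)
    qed
    then have "\<bar>\<Sum>k\<in>{-m..m}. (of_int k * \<delta>) * (\<mu> (E k) \<bullet> i)\<bar> \<le> (\<Sum>k\<in>{-m..m}. (1 + 2 * \<delta>) * norm (\<rho> (E k)))"
      using K[OF ap(2)] \<delta>
      by (intro order_trans[OF sum_abs] sum_mono) (auto simp: abs_mult intro!: mult_mono)
    also have "\<dots> \<le> (1 + 2 * \<delta>) * T"
      unfolding sum_distrib_left[symmetric] using sumT \<delta> by (intro mult_left_mono) auto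
    finally show ?thesis using ap(1) by linarith
  qed
  moreover have "((\<lambda>\<delta>. (1 + 2 * \<delta>) * T + \<delta> * C) \<longlongrightarrow> T) (at_right 0)"
    by (rule tendsto_eq_intros | simp)+
  ultimately have "\<bar>?c\<bar> \<le> T"
    by (intro tendsto_lowerbound[of _ _ "at_right 0"])
      (auto intro!: eventually_mono[OF eventually_at_right_less])
  then show ?thesis using real PN(6)[OF assms(3)] by (simp add: ennreal_leI)
qed simp

section \<open>Lebesgue measure on a subset and the fundamental lemma of the calculus of
  variations\<close>

lemma integral_lebesgue_on:
  fixes f :: "'a::euclidean_space \<Rightarrow> 'b::euclidean_space"
  assumes "S \<in> sets lebesgue"
  shows "(LINT x|lebesgue_on S. f x) = (LINT x|lebesgue. indicator S x *\<^sub>R f x)"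
  using assms by (intro integral_restrict_space) simp

lemma integrable_lebesgue_on:
  fixes f :: "'a::euclidean_space \<Rightarrow> 'b::euclidean_space"
  assumes "S \<in> sets lebesgue"
  shows "integrable (lebesgue_on S) f \<longleftrightarrow> integrable lebesgue (\<lambda>x. indicator S x *\<^sub>R f x)"
  using assms by (intro integrable_restrict_space) simp

lemma AE_lebesgue_on:
  assumes "S \<in> sets lebesgue"
  shows "(AE x in lebesgue_on S. P x) \<longleftrightarrow> (AE x in lborel. x \<in> S \<longrightarrow> P x)"
  using assms by (subst AE_restrict_space_iff) (auto simp: AE_completion_iff)

text \<open>Lebesgue measure is complete. This gives measurability of the chosen weak derivatives,
  which are known only up to null sets.\<close>

lemma borel_measurable_lebesgue_on_AE_cong:
  fixes f g :: "'a::euclidean_space \<Rightarrow> 'b::euclidean_space"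
  assumes S: "S \<in> sets lebesgue" and "f \<in> borel_measurable (lebesgue_on S)"
    and "AE x in lebesgue_on S. f x = g x"
  shows "g \<in> borel_measurable (lebesgue_on S)"
proof -
  have "(\<lambda>x. indicator S x *\<^sub>R f x) \<in> borel_measurable lebesgue"
    using assms(2) S by (subst borel_measurable_restrict_space_iff[symmetric]) auto
  moreover have "AE x in lebesgue. indicator S x *\<^sub>R f x = indicator S x *\<^sub>R g x"
    using assms(3) S by (auto simp: AE_lebesgue_on AE_completion_iff elim!: eventually_mono)
  ultimately have "(\<lambda>x. indicator S x *\<^sub>R g x) \<in> borel_measurable lebesgue"
    by (rule borel_measurable_AE)
  then show ?thesis using S by (subst borel_measurable_restrict_space_iff) auto
qed

lemma continuous_measurable_lebesgue_on:
  fixes f :: "'a::euclidean_space \<Rightarrow> 'b::euclidean_space"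
  assumes "continuous_on UNIV f"
  shows "f \<in> borel_measurable (lebesgue_on S)"
proof -
  have "f \<in> borel_measurable lborel" using borel_measurable_continuous_onI[OF assms] by simp
  then have "f \<in> borel_measurable lebesgue" by (rule measurable_completion)
  then show ?thesis by (rule measurable_restrict_space1)
qed

text \<open>The positive and the negative part of h, taken as densities, integrate every test
  function alike, so they define the same finite measure. Uniqueness of densities makes h and -h
  have the same positive part, which leaves only 0.\<close>

lemma AE_zero_if_integral_C1c_zero_real:
  fixes h :: "'a::euclidean_space \<Rightarrow> real"
  assumes "open V" and h: "integrable lborel h"
    and 0: "\<And>\<phi>. \<phi> \<in> C1c V \<Longrightarrow> (LINT x|lborel. \<phi> x * h x) = 0"
  shows "AE x in lborel. x \<in> V \<longrightarrow> h x = 0"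
proof -
  define L :: "'a measure" where "L = restrict_space lborel V"
  have VB: "V \<in> sets borel" using assms(1) by simp
  have sL: "sets L = sets (restrict_space borel V)" unfolding L_def
    by (rule sets_restrict_space_cong) simp
  have hL: "integrable L h"
    unfolding L_def using VB integrable_mult_indicator[OF _ h, of V] by (subst integrable_restrict_space) auto
  have hm: "h \<in> borel_measurable L" using hL by auto
  define P N where "P = density L (\<lambda>x. ennreal (h x))" and "N = density L (\<lambda>x. ennreal (- h x))"
  have fin: "finite_measure (density L (\<lambda>x. ennreal (g x)))" if "integrable L g" for g
  proof (rule finite_measureI)
    have "(\<integral>\<^sup>+ x. ennreal (g x) \<partial>L) \<le> (\<integral>\<^sup>+ x. ennreal (norm (g x)) \<partial>L)"
      by (intro nn_integral_mono) (auto intro!: ennreal_leI)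
    also have "\<dots> < \<infinity>" using that by (simp add: integrable_iff_bounded)
    finally show "emeasure (density L (\<lambda>x. ennreal (g x))) (space (density L (\<lambda>x. ennreal (g x)))) \<noteq> \<infinity>"
      using that by (subst emeasure_density) auto
  qed
  have PN: "finite_measure P" "finite_measure N"
    using fin[OF hL] fin[of "\<lambda>x. - h x"] hL by (auto simp: P_def N_def)
  have sPN: "sets P = sets (restrict_space borel V)" "sets N = sets (restrict_space borel V)"
    by (auto simp: P_def N_def sL)
  \<comment> \<open>With the zero measure twice on the other side, the comparison of P with N
    becomes an instance of \<open>signed_measure_eqI_C1c\<close>.\<close>
  let ?O = "null_measure (restrict_space borel V)"
  interpret P: finite_measure P by fact
  interpret N: finite_measure N by fact
  have O: "finite_measure ?O" by (rule finite_measureI) simp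
  have eq: "integral\<^sup>L P \<phi> - integral\<^sup>L N \<phi> = integral\<^sup>L ?O \<phi> - integral\<^sup>L ?O \<phi>"
    if \<phi>: "\<phi> \<in> C1c V" for \<phi> :: "'a \<Rightarrow> real"
  proof -
    obtain M where M: "M > 0" "\<And>x. norm (\<phi> x) \<le> M" by (rule C1c_bounded[OF \<phi>]) (rule that)
    have \<phi>m: "\<phi> \<in> borel_measurable L"
      by (rule borel_measurable_restrict_cong[OF sL C1c_continuous[OF \<phi>]])
    have d: "density L (\<lambda>x. ennreal (g x)) = density L (\<lambda>x. ennreal (max 0 (g x)))" for g :: "'a \<Rightarrow> real"
    proof -
      have "(\<lambda>x. ennreal (g x)) = (\<lambda>x. ennreal (max 0 (g x)))"
        by (auto simp: max_def ennreal_neg)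
      then show ?thesis by simp
    qed
    have P: "integral\<^sup>L P \<phi> = (LINT x|L. max 0 (h x) * \<phi> x)"
      unfolding P_def using hm by (subst d, intro integral_real_density \<phi>m) auto
    have N: "integral\<^sup>L N \<phi> = (LINT x|L. max 0 (- h x) * \<phi> x)"
      unfolding N_def using hm by (subst d, intro integral_real_density \<phi>m) auto
    have Mh: "integrable L (\<lambda>x. M * norm (h x))" using hL by (intro integrable_mult_right integrable_norm)
    have int: "integrable L (\<lambda>x. max 0 (h x) * \<phi> x)" "integrable L (\<lambda>x. max 0 (- h x) * \<phi> x)"
    proof -
      have "norm (max 0 (s * h x) * \<phi> x) \<le> norm (M * norm (h x))" if "s \<in> {1, -1}" for s x
      proof -
        have "norm (max 0 (s * h x) * \<phi> x) \<le> norm (h x) * M"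
          unfolding norm_mult using that M by (intro mult_mono) auto
        then show ?thesis using M(1) by (simp add: abs_mult mult.commute)
      qed
      from this[of 1] this[of "-1"]
      show "integrable L (\<lambda>x. max 0 (h x) * \<phi> x)" "integrable L (\<lambda>x. max 0 (- h x) * \<phi> x)"
        using hm \<phi>m by (auto intro!: Bochner_Integration.integrable_bound[OF Mh] AE_I2)
    qed
    have "integral\<^sup>L P \<phi> - integral\<^sup>L N \<phi> = (LINT x|L. max 0 (h x) * \<phi> x - max 0 (- h x) * \<phi> x)"
      unfolding P N using Bochner_Integration.integral_diff[OF int] by simp
    also have "\<dots> = (LINT x|L. \<phi> x * h x)" by (intro Bochner_Integration.integral_cong) (auto simp: max_def)
    also have "\<dots> = (LINT x|lborel. indicator V x *\<^sub>R (\<phi> x * h x))"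
      unfolding L_def using VB by (subst integral_restrict_space) auto
    also have "\<dots> = (LINT x|lborel. \<phi> x * h x)"
    proof (rule Bochner_Integration.integral_cong[OF refl])
      have "\<phi> x = 0" if "x \<notin> V" for x using \<phi> that unfolding C1c_def by blast
      then show "indicator V x *\<^sub>R (\<phi> x * h x) = \<phi> x * h x" for x by (auto simp: indicator_def)
    qed
    also have "\<dots> = 0" by (rule 0[OF \<phi>])
    finally show ?thesis by simp
  qed
  have "P = N"
  proof (rule measure_eqI)
    fix E assume "E \<in> sets P"
    then have "measure P E - measure N E = measure ?O E - measure ?O E"
    proof (intro signed_measure_eqI_C1c[OF assms(1) PN O O sPN])
      fix \<phi> :: "'a \<Rightarrow> real" assume "\<phi> \<in> C1c V"
      then show "integral\<^sup>L P \<phi> - integral\<^sup>L N \<phi> = integral\<^sup>L ?O \<phi> - integral\<^sup>L ?O \<phi>" by (rule eq)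
    qed (use sPN in auto)
    then show "emeasure P E = emeasure N E"
      by (simp add: P.emeasure_eq_measure N.emeasure_eq_measure)
  qed (simp add: sPN)
  then have "AE x in L. ennreal (h x) = ennreal (- h x)"
    using sigma_finite_density_unique[of "\<lambda>x. ennreal (h x)" L "\<lambda>x. ennreal (- h x)"] hm
      P.sigma_finite_measure_axioms unfolding P_def N_def by simp
  then have "AE x in L. h x = 0"
    proof (rule eventually_mono)
    fix x assume *: "ennreal (h x) = ennreal (- h x)"
    show "h x = 0"
    proof (cases "0 \<le> h x")
      case True
      then have "ennreal (h x) = 0" using * by (simp add: ennreal_neg)
      then show ?thesis using True by simp
    next
      case False
      then have "ennreal (- h x) = 0" using * by (simp add: ennreal_neg)
      then show ?thesis using False by simp
    qed
  qed
  then show ?thesis unfolding L_def using VB by (subst (asm) AE_restrict_space_iff) auto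
qed

text \<open>Since f is integrable only on compact subsets, the scalar lemma is applied on boxes
  whose closure lies in U, to a Borel version of each component. Countably many such boxes cover U,
  so the exceptional null sets add up to a null set.\<close>

lemma AE_zero_if_integral_C1c_zero:
  fixes f :: "'a::euclidean_space \<Rightarrow> 'b::euclidean_space"
  assumes "open U" and f: "locally_integrable U f"
    and 0: "\<And>\<phi>. \<phi> \<in> C1c U \<Longrightarrow> (LINT x|lebesgue_on U. (\<phi> x :: real) *\<^sub>R f x) = 0"
  shows "AE x in lebesgue_on U. f x = 0"
proof -
  have U: "U \<in> sets lebesgue" using assms(1) by simp
  have box: "AE x in lborel. x \<in> box a b \<longrightarrow> f x \<bullet> i = 0" if ab: "cbox a b \<subseteq> U" and "i \<in> Basis" for a b i
  proof -
    let ?V = "box a b"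
    have V: "?V \<in> sets lebesgue" "?V \<subseteq> cbox a b" "?V \<subseteq> U" using ab box_subset_cbox by auto
    have "integrable (lebesgue_on (cbox a b)) f"
      using f ab unfolding locally_integrable_def by (simp add: compact_cbox)
    then have "integrable lebesgue (\<lambda>x. indicator (cbox a b) x *\<^sub>R f x)"
      by (subst (asm) integrable_lebesgue_on) auto
    from integrable_mult_indicator[OF V(1) this]
    have "integrable lebesgue (\<lambda>x. indicator ?V x *\<^sub>R indicator (cbox a b) x *\<^sub>R f x)" .
    moreover have "(\<lambda>x. indicator ?V x *\<^sub>R indicator (cbox a b) x *\<^sub>R f x) = (\<lambda>x. indicator ?V x *\<^sub>R f x)"
      using V(2) by (intro ext) (auto split: split_indicator)
    ultimately have fV: "integrable lebesgue (\<lambda>x. indicator ?V x *\<^sub>R f x)" by simp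
    then have "integrable lebesgue (\<lambda>x. (indicator ?V x *\<^sub>R f x) \<bullet> i)" by (rule integrable_inner_left)
    then have g: "integrable lebesgue (\<lambda>x. indicator ?V x * (f x \<bullet> i))" by simp
    then have "(\<lambda>x. indicator ?V x * (f x \<bullet> i)) \<in> borel_measurable lebesgue" by auto
    from completion_ex_borel_measurable_real[OF this] obtain h where
      h: "h \<in> borel_measurable lborel" "AE x in lborel. indicator ?V x * (f x \<bullet> i) = h x" by blast
    have hleb: "AE x in lebesgue. indicator ?V x * (f x \<bullet> i) = h x" using h(2) by (rule AE_completion)
    have hl: "integrable lebesgue h"
      using g hleb measurable_completion[OF h(1)]
      by (subst integrable_cong_AE[symmetric, of "\<lambda>x. indicator ?V x * (f x \<bullet> i)"]) auto
    have "integrable lborel h"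
      using hl h(1) integrable_completion by blast
    moreover have "(LINT x|lborel. \<phi> x * h x) = 0" if \<phi>: "\<phi> \<in> C1c ?V" for \<phi> :: "'a \<Rightarrow> real"
    proof -
      have z: "\<phi> x = 0" if "x \<notin> ?V" for x using \<phi> that unfolding C1c_def by blast
      have pm: "\<phi> \<in> borel_measurable borel"
        by (intro borel_measurable_continuous_onI C1c_continuous[OF \<phi>])
      have pf: "integrable (lebesgue_on U) (\<lambda>x. \<phi> x *\<^sub>R f x)"
      proof -
        obtain M where M: "M > 0" "\<And>x. norm (\<phi> x) \<le> M" by (rule C1c_bounded[OF \<phi>]) (rule that)
        have "integrable lebesgue (\<lambda>x. M * norm (indicator ?V x *\<^sub>R f x))"
          using fV by (intro integrable_mult_right integrable_norm)
        then have "integrable lebesgue (\<lambda>x. \<phi> x *\<^sub>R (indicator ?V x *\<^sub>R f x))"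
        proof (rule Bochner_Integration.integrable_bound)
          show "(\<lambda>x. \<phi> x *\<^sub>R (indicator ?V x *\<^sub>R f x)) \<in> borel_measurable lebesgue"
          proof (rule borel_measurable_scaleR)
            have "\<phi> \<in> borel_measurable lborel" using pm by simp
            then show "\<phi> \<in> borel_measurable lebesgue" by (rule measurable_completion)
            show "(\<lambda>x. indicator ?V x *\<^sub>R f x) \<in> borel_measurable lebesgue" using fV by (rule borel_measurable_integrable)
          qed
          show "AE x in lebesgue. norm (\<phi> x *\<^sub>R (indicator ?V x *\<^sub>R f x)) \<le> norm (M * norm (indicator ?V x *\<^sub>R f x))"
          proof (rule AE_I2)
            fix x
            have "norm (\<phi> x *\<^sub>R z) \<le> norm (M * norm z)" for z :: 'b
              using M(1) M(2)[of x] by (simp add: abs_mult mult_right_mono)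
            then show "norm (\<phi> x *\<^sub>R (indicator ?V x *\<^sub>R f x)) \<le> norm (M * norm (indicator ?V x *\<^sub>R f x))" .
          qed
        qed
        moreover have "(\<lambda>x. indicator U x *\<^sub>R \<phi> x *\<^sub>R f x) = (\<lambda>x. \<phi> x *\<^sub>R (indicator ?V x *\<^sub>R f x))"
        proof
          show "indicator U x *\<^sub>R \<phi> x *\<^sub>R f x = \<phi> x *\<^sub>R (indicator ?V x *\<^sub>R f x)" for x
            using z[of x] V(3) by (auto split: split_indicator)
        qed
        ultimately show ?thesis using U by (simp only: integrable_lebesgue_on)
      qed
      have "(LINT x|lborel. \<phi> x * h x) = (LINT x|lebesgue. \<phi> x * h x)"
        using h(1) pm by (subst integral_completion) auto
      also have "\<dots> = (LINT x|lebesgue. (indicator U x *\<^sub>R \<phi> x *\<^sub>R f x) \<bullet> i)"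
      proof (rule integral_cong_AE)
        show "AE x in lebesgue. \<phi> x * h x = (indicator U x *\<^sub>R \<phi> x *\<^sub>R f x) \<bullet> i"
          using hleb
        proof (rule eventually_mono)
          fix x assume "indicator ?V x * (f x \<bullet> i) = h x"
          then show "\<phi> x * h x = (indicator U x *\<^sub>R \<phi> x *\<^sub>R f x) \<bullet> i"
            using z[of x] V(3) by (cases "x \<in> ?V") auto
        qed
        have "integrable lebesgue (\<lambda>x. indicator U x *\<^sub>R \<phi> x *\<^sub>R f x)"
          using pf U by (simp only: integrable_lebesgue_on)
        then show "(\<lambda>x. (indicator U x *\<^sub>R \<phi> x *\<^sub>R f x) \<bullet> i) \<in> borel_measurable lebesgue"
          by (intro borel_measurable_integrable integrable_inner_left)
        show "(\<lambda>x. \<phi> x * h x) \<in> borel_measurable lebesgue"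
          using h(1) pm by (intro measurable_completion borel_measurable_times) auto
      qed
      also have "\<dots> = (LINT x|lebesgue. indicator U x *\<^sub>R \<phi> x *\<^sub>R f x) \<bullet> i"
        using pf[unfolded integrable_lebesgue_on[OF U]] by (rule integral_inner_left)
      also have "\<dots> = 0"
        using 0[unfolded integral_lebesgue_on[OF U], OF subsetD[OF C1c_mono[OF V(3)] \<phi>]] by simp
      finally show ?thesis .
    qed
    ultimately have "AE x in lborel. x \<in> ?V \<longrightarrow> h x = 0"
      by (intro AE_zero_if_integral_C1c_zero_real) auto
    with h(2) show ?thesis by eventually_elim (auto simp: indicator_def)
  qed
  let ?F = "{box a b | a b. cbox a b \<subseteq> U}"
  obtain F' where F': "F' \<subseteq> ?F" "countable F'" "\<Union>F' = \<Union>?F"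
    by (rule Lindelof[of ?F]) auto
  have "AE x in lborel. \<forall>V\<in>F'. \<forall>i\<in>Basis. x \<in> V \<longrightarrow> f x \<bullet> i = 0"
  proof (intro AE_ball_countable' F'(2) countable_finite finite_Basis)
    fix V :: "'a set" and i :: 'b assume "V \<in> F'" "i \<in> Basis"
    with F'(1) obtain a b where "V = box a b" "cbox a b \<subseteq> U" by auto
    with box[OF _ \<open>i \<in> Basis\<close>] show "AE x in lborel. x \<in> V \<longrightarrow> f x \<bullet> i = 0" by blast
  qed
  moreover have "\<exists>V\<in>F'. x \<in> V" if "x \<in> U" for x
  proof -
    obtain a b where "x \<in> box a b" "cbox a b \<subseteq> U"
    proof -
      obtain e where e: "e > 0" "cball x e \<subseteq> U" using assms(1) \<open>x \<in> U\<close> by (auto simp: open_contains_cball)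
      obtain a b where ab: "x \<in> box a b" "box a b \<subseteq> ball x e" using rational_boxes[OF e(1), of x] by blast
      have "cbox a b = closure (box a b)" using ab(1) by (intro closure_box[symmetric]) auto
      also have "\<dots> \<subseteq> closure (ball x e)" by (rule closure_mono[OF ab(2)])
      also have "\<dots> \<subseteq> U" using e by simp
      finally show ?thesis using ab(1) that by blast
    qed
    then have "x \<in> \<Union>?F" by blast
    then show ?thesis using F'(3) by blast
  qed
  ultimately have "AE x in lborel. x \<in> U \<longrightarrow> f x = 0"
    by (elim eventually_mono) (metis euclidean_all_zero_iff)
  then show ?thesis using U by (simp add: AE_lebesgue_on)
qed

lemma integrable_bounded_support_scaleR:
  fixes f :: "'a::euclidean_space \<Rightarrow> 'b::euclidean_space" and g :: "'a \<Rightarrow> real"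
  assumes "open U" "locally_integrable U f" "continuous_on UNIV g" "compact K" "K \<subseteq> U"
    "\<And>x. x \<notin> K \<Longrightarrow> g x = 0"
  shows "integrable (lebesgue_on U) (\<lambda>x. g x *\<^sub>R f x)"
proof -
  obtain M where M: "M > 0" "\<And>x. norm (g x) \<le> M"
    by (rule bounded_if_compact_support[OF assms(3,4,6)]) (auto intro: that)
  have K: "K \<in> sets lebesgue" using assms(4) by (simp add: borel_compact)
  have "integrable lebesgue (\<lambda>x. indicator K x *\<^sub>R f x)"
    using assms(2,4,5) K unfolding locally_integrable_def by (subst integrable_lebesgue_on[symmetric]) auto
  note Kf = this
  have "integrable lebesgue (\<lambda>x. M * norm (indicator K x *\<^sub>R f x))"
    using Kf by (intro integrable_mult_right integrable_norm)
  then have "integrable lebesgue (\<lambda>x. g x *\<^sub>R indicator K x *\<^sub>R f x)"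
  proof (rule Bochner_Integration.integrable_bound)
    show "(\<lambda>x. g x *\<^sub>R indicator K x *\<^sub>R f x) \<in> borel_measurable lebesgue"
    proof (rule borel_measurable_scaleR)
      have "g \<in> borel_measurable lborel" using borel_measurable_continuous_onI[OF assms(3)] by simp
      then show "g \<in> borel_measurable lebesgue" by (rule measurable_completion)
      show "(\<lambda>x. indicator K x *\<^sub>R f x) \<in> borel_measurable lebesgue" using Kf by (rule borel_measurable_integrable)
    qed
    show "AE x in lebesgue. norm (g x *\<^sub>R indicator K x *\<^sub>R f x) \<le> norm (M * norm (indicator K x *\<^sub>R f x))"
    proof (rule AE_I2)
      fix x
      have "norm (g x *\<^sub>R z) \<le> norm (M * norm z)" for z :: 'b
        using M(1) M(2)[of x] by (simp add: abs_mult mult_right_mono)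
      then show "norm (g x *\<^sub>R indicator K x *\<^sub>R f x) \<le> norm (M * norm (indicator K x *\<^sub>R f x))" .
    qed
  qed
  moreover have "(\<lambda>x. g x *\<^sub>R indicator K x *\<^sub>R f x) = (\<lambda>x. indicator U x *\<^sub>R g x *\<^sub>R f x)"
  proof
    show "g x *\<^sub>R indicator K x *\<^sub>R f x = indicator U x *\<^sub>R g x *\<^sub>R f x" for x
      using assms(6)[of x] assms(5) by (auto split: split_indicator)
  qed
  moreover have "U \<in> sets lebesgue" using assms(1) by simp
  ultimately show ?thesis by (simp only: integrable_lebesgue_on)
qed

lemma integrable_C1c_scaleR:
  fixes f :: "'a::euclidean_space \<Rightarrow> 'b::euclidean_space" and \<phi> :: "'a \<Rightarrow> real"
  assumes "open U" "locally_integrable U f" "\<phi> \<in> C1c U"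
  shows "integrable (lebesgue_on U) (\<lambda>x. \<phi> x *\<^sub>R f x)"
    and "integrable (lebesgue_on U) (\<lambda>x. frechet_derivative \<phi> (at x) v *\<^sub>R f x)"
proof -
  obtain K where K: "compact K" "K \<subseteq> U" "\<And>x. x \<notin> K \<Longrightarrow> \<phi> x = 0"
    "\<And>x v. x \<notin> K \<Longrightarrow> frechet_derivative \<phi> (at x) v = 0"
    by (rule C1c_support[OF assms(3)]) (rule that)
  show "integrable (lebesgue_on U) (\<lambda>x. \<phi> x *\<^sub>R f x)"
    "integrable (lebesgue_on U) (\<lambda>x. frechet_derivative \<phi> (at x) v *\<^sub>R f x)"
    using integrable_bounded_support_scaleR[OF assms(1,2) C1c_continuous[OF assms(3)] K(1,2,3)]
      integrable_bounded_support_scaleR[OF assms(1,2) C1c_continuous_deriv[OF assms(3)] K(1,2,4)]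
    by auto
qed

lemma locally_integrable_diff:
  "locally_integrable U f \<Longrightarrow> locally_integrable U g \<Longrightarrow> locally_integrable U (\<lambda>x. f x - g x)"
  unfolding locally_integrable_def by auto

lemma locally_integrable_if_integrable:
  fixes f :: "'a::euclidean_space \<Rightarrow> 'b::euclidean_space"
  assumes "open U" "integrable (lebesgue_on U) f"
  shows "locally_integrable U f"
  unfolding locally_integrable_def
proof (intro allI impI)
  fix K assume K: "compact K \<and> K \<subseteq> U"
  then have "K \<in> sets lebesgue" by (simp add: borel_compact)
  moreover have "integrable lebesgue (\<lambda>x. indicator U x *\<^sub>R f x)"
    using assms by (subst integrable_lebesgue_on[symmetric]) auto
  ultimately have "integrable lebesgue (\<lambda>x. indicator K x *\<^sub>R indicator U x *\<^sub>R f x)"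
    by (rule integrable_mult_indicator)
  moreover have "(\<lambda>x. indicator K x *\<^sub>R indicator U x *\<^sub>R f x) = (\<lambda>x. indicator K x *\<^sub>R f x)"
    using K by (intro ext) (auto split: split_indicator)
  ultimately show "integrable (lebesgue_on K) f"
    using \<open>K \<in> sets lebesgue\<close> by (simp only: integrable_lebesgue_on)
qed

section \<open>Weak partial derivatives: uniqueness and the classical case\<close>

lemma has_weak_partial_unique:
  fixes f :: "'a::euclidean_space \<Rightarrow> 'b::euclidean_space"
  assumes "open U" "has_weak_partial U v f g" "has_weak_partial U v f g'"
  shows "AE x in lebesgue_on U. g x = g' x"
proof -
  have l: "locally_integrable U g" "locally_integrable U g'" using assms(2,3) by (auto simp: has_weak_partial_def)
  have "AE x in lebesgue_on U. g x - g' x = 0"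
  proof (rule AE_zero_if_integral_C1c_zero[OF assms(1) locally_integrable_diff[OF l]])
    fix \<phi> :: "'a \<Rightarrow> real" assume \<phi>: "\<phi> \<in> C1c U"
    then have "(LINT x|lebesgue_on U. \<phi> x *\<^sub>R g x) = (LINT x|lebesgue_on U. \<phi> x *\<^sub>R g' x)"
      using assms(2,3) unfolding has_weak_partial_def by (metis neg_equal_iff_equal)
    then show "(LINT x|lebesgue_on U. \<phi> x *\<^sub>R (g x - g' x)) = 0"
      using integrable_C1c_scaleR(1)[OF assms(1) l(1) \<phi>] integrable_C1c_scaleR(1)[OF assms(1) l(2) \<phi>]
      by (simp add: scaleR_diff_right)
  qed
  then show ?thesis by simp
qed

lemma has_weak_partial_weak_partial:
  "has_weak_partial U v f g \<Longrightarrow> has_weak_partial U v f (weak_partial U v f)"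
  unfolding weak_partial_def by (rule someI[of "has_weak_partial U v f"])

lemma weak_partial_AE:
  fixes f :: "'a::euclidean_space \<Rightarrow> 'b::euclidean_space"
  assumes "open U" "has_weak_partial U v f g"
  shows "AE x in lebesgue_on U. weak_partial U v f x = g x"
  by (rule has_weak_partial_unique[OF assms(1) has_weak_partial_weak_partial[OF assms(2)] assms(2)])

lemma integral_C1c_lebesgue_on:
  fixes g :: "'a::euclidean_space \<Rightarrow> 'b::euclidean_space"
  assumes "open U" "continuous_on UNIV g" "\<And>x. x \<notin> U \<Longrightarrow> g x = 0"
  shows "(LINT x|lebesgue_on U. g x) = (LINT x|lborel. g x)"
proof -
  have "(\<lambda>x. indicator U x *\<^sub>R g x) = g" using assms(3) by (intro ext) (auto split: split_indicator)
  then show ?thesis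
    using assms(1) borel_measurable_continuous_onI[OF assms(2)]
    by (subst integral_lebesgue_on) (auto intro!: integral_completion)
qed

lemma locally_integrable_continuous:
  fixes g :: "'a::euclidean_space \<Rightarrow> 'b::euclidean_space"
  assumes "continuous_on UNIV g"
  shows "locally_integrable U g"
  unfolding locally_integrable_def
proof (intro allI impI)
  fix K assume K: "compact K \<and> K \<subseteq> U"
  then have b: "K \<in> sets borel" by (simp add: borel_compact)
  have "integrable lborel (\<lambda>x. indicator K x *\<^sub>R g x)"
    using K borel_integrable_compact[OF _ continuous_on_subset[OF assms]] by auto
  moreover have "(\<lambda>x. indicator K x *\<^sub>R g x) \<in> borel_measurable lborel"
    using b borel_measurable_continuous_onI[OF assms] by (auto)
  ultimately have "integrable lebesgue (\<lambda>x. indicator K x *\<^sub>R g x)"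
    using integrable_completion by blast
  then show "integrable (lebesgue_on K) g" using b by (subst integrable_lebesgue_on) auto
qed

text \<open>The product of a test function with a C1 function is again a test function. Its
  derivative has integral 0, and the Leibniz rule turns this into integration by parts.\<close>

lemma has_weak_partial_C1:
  fixes u :: "'a::euclidean_space \<Rightarrow> 'b::euclidean_space"
  assumes "open U" "C1_deriv u D"
  shows "has_weak_partial U v u (\<lambda>x. D x v)"
  unfolding has_weak_partial_def
proof (intro conjI ballI)
  show l: "locally_integrable U u" "locally_integrable U (\<lambda>x. D x v)"
    by (intro locally_integrable_continuous C1_deriv_continuous[OF assms(2)] C1_deriv_continuous_deriv[OF assms(2)])+
  fix \<phi> :: "'a \<Rightarrow> real" assume \<phi>: "\<phi> \<in> C1c U"
  note c = C1c_scaleR[OF \<phi> assms(2)]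
  obtain K where K: "compact K" "K \<subseteq> U" "\<And>x. x \<notin> K \<Longrightarrow> \<phi> x *\<^sub>R u x = 0"
    "\<And>x v. x \<notin> K \<Longrightarrow> frechet_derivative (\<lambda>x. \<phi> x *\<^sub>R u x) (at x) v = 0"
    by (rule C1c_support[OF c(1)]) (rule that)
  have "0 = (LINT x|lborel. frechet_derivative (\<lambda>x. \<phi> x *\<^sub>R u x) (at x) v)"
    using integral_C1c_deriv_zero[OF c(1)] by simp
  also have "\<dots> = (LINT x|lebesgue_on U. frechet_derivative (\<lambda>x. \<phi> x *\<^sub>R u x) (at x) v)"
    by (rule integral_C1c_lebesgue_on[symmetric, OF assms(1) C1c_continuous_deriv[OF c(1)]]) (use K in auto)
  also have "\<dots> = (LINT x|lebesgue_on U. \<phi> x *\<^sub>R D x v) + (LINT x|lebesgue_on U. frechet_derivative \<phi> (at x) v *\<^sub>R u x)"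
    unfolding c(2) by (intro Bochner_Integration.integral_add integrable_C1c_scaleR[OF assms(1) _ \<phi>] l)
  finally show "(LINT x|lebesgue_on U. frechet_derivative \<phi> (at x) v *\<^sub>R u x) = - (LINT x|lebesgue_on U. \<phi> x *\<^sub>R D x v)"
    by (metis add_eq_0_iff2 add.commute)
qed

section \<open>Density of test functions\<close>

lemma abs_diff_indicator_le: "0 \<le> a \<Longrightarrow> a \<le> 1 \<Longrightarrow> \<bar>a - indicator B x\<bar> \<le> (1::real)"
  by (auto split: split_indicator)

text \<open>By outer regularity A differs little from an open T containing it, and cutoffs
  approximate the indicator of T \<inter> U. The two errors give L1 convergence, hence convergence
  almost everywhere along a subsequence.\<close>

lemma indicator_approx_C1c:
  fixes U :: "'a::euclidean_space set"
  assumes U: "open U" "U \<in> lmeasurable" and A: "A \<in> sets lebesgue"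
  obtains \<phi> :: "nat \<Rightarrow> 'a \<Rightarrow> real" where "\<And>n. \<phi> n \<in> C1c U" "\<And>n x. 0 \<le> \<phi> n x" "\<And>n x. \<phi> n x \<le> 1"
    "AE x in lebesgue_on U. (\<lambda>n. \<phi> n x) \<longlonglongrightarrow> indicator A x"
proof -
  let ?L = "lebesgue_on U"
  interpret L: finite_measure ?L by (rule finite_measure_lebesgue_on[OF U(2)])
  have Us: "U \<in> sets lebesgue" using U by simp
  have indm: "(\<lambda>x. indicator B x :: real) \<in> borel_measurable ?L" if "B \<in> sets lebesgue" for B
    using that by (intro measurable_restrict_space1) simp
  have intd: "integrable ?L (\<lambda>x. g x - indicator B x)"
    if "g \<in> borel_measurable ?L" "\<And>x. 0 \<le> g x" "\<And>x. g x \<le> 1" "B \<in> sets lebesgue"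
    for g :: "'a \<Rightarrow> real" and B
    by (rule L.integrable_const_bound[of _ 1])
      (use that in \<open>simp_all add: abs_diff_indicator_le borel_measurable_diff[OF _ indm]\<close>)
  have "\<exists>\<phi>::'a \<Rightarrow> real. \<phi> \<in> C1c U \<and> (\<forall>x. 0 \<le> \<phi> x \<and> \<phi> x \<le> 1) \<and>
      (LINT x|?L. \<bar>\<phi> x - indicator A x\<bar>) \<le> 2 / (real n + 1)" for n
  proof -
    let ?e = "1 / (real n + 1)"
    obtain T where T: "open T" "A \<subseteq> T" "T - A \<in> lmeasurable" "emeasure lebesgue (T - A) < ennreal ?e"
      by (rule sets_lebesgue_outer_open[OF A, of ?e]) auto
    let ?V = "T \<inter> U"
    have V: "open ?V" "?V \<in> sets lebesgue" using T U by auto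
    obtain \<psi> :: "nat \<Rightarrow> 'a \<Rightarrow> real" where \<psi>: "\<And>n. \<psi> n \<in> C1c ?V" "\<And>n x. 0 \<le> \<psi> n x" "\<And>n x. \<psi> n x \<le> 1"
      "\<And>x. (\<lambda>n. \<psi> n x) \<longlonglongrightarrow> indicator ?V x" by (rule open_approx_C1c[OF V(1)]) (rule that)
    have \<psi>m: "\<psi> k \<in> borel_measurable ?L" for k
      by (rule continuous_measurable_lebesgue_on[OF C1c_continuous[OF \<psi>(1)]])
    have "(\<lambda>k. LINT x|?L. \<bar>\<psi> k x - indicator ?V x\<bar>) \<longlonglongrightarrow> (LINT x|?L. 0)"
    proof (rule integral_dominated_convergence[where w = "\<lambda>_. 1"])
      show "(\<lambda>x. \<bar>\<psi> k x - indicator ?V x\<bar>) \<in> borel_measurable ?L" for k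
        using \<psi>m indm[OF V(2)] by (intro borel_measurable_abs borel_measurable_diff)
      show "AE x in ?L. (\<lambda>k. \<bar>\<psi> k x - indicator ?V x\<bar>) \<longlonglongrightarrow> 0"
        using \<psi>(4) by (intro AE_I2 tendsto_rabs_zero) (simp add: LIM_zero_iff)
      show "AE x in ?L. norm \<bar>\<psi> k x - indicator ?V x\<bar> \<le> 1" for k
        using \<psi>(2,3)[of k] by (intro AE_I2) (simp add: abs_diff_indicator_le)
    qed auto
    then have "\<forall>\<^sub>F k in sequentially. (LINT x|?L. \<bar>\<psi> k x - indicator ?V x\<bar>) < ?e"
      by (rule order_tendstoD) (simp add: add_pos_nonneg)
    then obtain k where k: "(LINT x|?L. \<bar>\<psi> k x - indicator ?V x\<bar>) < ?e"
      using eventually_happens trivial_limit_sequentially by blast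
    have d: "AE x in ?L. \<bar>\<psi> k x - indicator A x\<bar> \<le> \<bar>\<psi> k x - indicator ?V x\<bar> + indicator (T - A) x"
      using T(2) by (intro AE_I2) (auto simp: indicator_def)
    have i1: "integrable ?L (\<lambda>x. \<bar>\<psi> k x - indicator ?V x\<bar>)"
      by (intro integrable_abs intd \<psi>m \<psi>(2,3) V(2))
    have i2: "integrable ?L (\<lambda>x. indicator (T - A) x :: real)"
      by (rule L.integrable_const_bound[of _ 1]) (use indm[of "T - A"] T(3) in \<open>auto intro!: AE_I2\<close>)
    have j1: "integrable lebesgue (\<lambda>x. indicator (T - A) x :: real)"
      using T(3) by (intro integrable_real_indicator fmeasurableD) (auto simp: fmeasurable_def)
    have j2: "integrable lebesgue (\<lambda>x. indicator U x *\<^sub>R (indicator (T - A) x :: real))"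
      by (rule integrable_mult_indicator[OF Us j1])
    have "(LINT x|?L. indicator (T - A) x :: real) \<le> (LINT x|lebesgue. indicator (T - A) x :: real)"
      unfolding integral_lebesgue_on[OF Us] by (rule integral_mono[OF j2 j1]) (auto split: split_indicator)
    also have "\<dots> = measure lebesgue (T - A)" using T(3) by (simp add: fmeasurable_def)
    also have "\<dots> \<le> ?e" using T(4) by (simp add: measure_def enn2real_leI less_imp_le)
    finally have e2: "(LINT x|?L. indicator (T - A) x :: real) \<le> ?e" .
    have "(LINT x|?L. \<bar>\<psi> k x - indicator A x\<bar>) \<le> (LINT x|?L. \<bar>\<psi> k x - indicator ?V x\<bar> + indicator (T - A) x)"
    proof (rule integral_mono_AE[OF _ _ d])
      show "integrable ?L (\<lambda>x. \<bar>\<psi> k x - indicator ?V x\<bar> + indicator (T - A) x)"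
        using i1 i2 by (rule Bochner_Integration.integrable_add)
      show "integrable ?L (\<lambda>x. \<bar>\<psi> k x - indicator A x\<bar>)"
        by (intro integrable_abs intd \<psi>m \<psi>(2,3) A)
    qed
    also have "\<dots> \<le> ?e + ?e" using i1 i2 e2 k by simp
    finally show ?thesis
      using \<psi>(1)[of k] \<psi>(2,3) C1c_mono[of ?V U] by (intro exI[of _ "\<psi> k"]) auto
  qed
  then have "\<forall>n::nat. \<exists>\<phi>::'a \<Rightarrow> real. \<phi> \<in> C1c U \<and> (\<forall>x. 0 \<le> \<phi> x \<and> \<phi> x \<le> 1) \<and>
      (LINT x|?L. \<bar>\<phi> x - indicator A x\<bar>) \<le> 2 / (real n + 1)" by (rule allI)
  from choice[OF this] obtain \<phi> :: "nat \<Rightarrow> 'a \<Rightarrow> real" where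
    \<phi>0: "\<forall>n. \<phi> n \<in> C1c U \<and> (\<forall>x. 0 \<le> \<phi> n x \<and> \<phi> n x \<le> 1) \<and>
      (LINT x|?L. \<bar>\<phi> n x - indicator A x\<bar>) \<le> 2 / (real n + 1)" by (rule exE)
  then have \<phi>: "\<And>n. \<phi> n \<in> C1c U" "\<And>n x. 0 \<le> \<phi> n x" "\<And>n x. \<phi> n x \<le> 1"
      "\<And>n. (LINT x|?L. \<bar>\<phi> n x - indicator A x\<bar>) \<le> 2 / (real n + 1)" by simp_all
  have \<phi>m: "\<phi> k \<in> borel_measurable ?L" for k
    by (rule continuous_measurable_lebesgue_on[OF C1c_continuous[OF \<phi>(1)]])
  have "\<exists>r. strict_mono r \<and> (AE x in ?L. (\<lambda>n. \<phi> (r n) x - indicator A x) \<longlonglongrightarrow> 0)"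
  proof (rule tendsto_L1_AE_subseq)
    show "integrable ?L (\<lambda>x. \<phi> n x - indicator A x)" for n
      by (intro intd \<phi>m \<phi>(2,3) A)
    show "(\<lambda>n. LINT x|?L. norm (\<phi> n x - indicator A x)) \<longlonglongrightarrow> 0"
    proof (rule tendsto_sandwich[of "\<lambda>_. 0" _ _ "\<lambda>n. 2 / (real n + 1)"])
      show "(\<lambda>n. 2 / (real n + 1)) \<longlonglongrightarrow> 0" by real_asymp
    qed (use \<phi>(4) in \<open>auto intro!: always_eventually integral_nonneg_AE\<close>)
  qed
  then obtain r where r: "AE x in ?L. (\<lambda>n. \<phi> (r n) x - indicator A x) \<longlonglongrightarrow> 0" by blast
  show ?thesis
  proof (rule that[of "\<lambda>n. \<phi> (r n)"])
    show "AE x in ?L. (\<lambda>n. \<phi> (r n) x) \<longlonglongrightarrow> indicator A x"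
      using r by eventually_elim (simp add: LIM_zero_iff)
  qed (use \<phi> in auto)
qed

text \<open>A linear combination of cutoffs for the finitely many level sets of X. The bound B does
  not depend on n: bounded convergence almost everywhere is what passes through integrands that are
  merely continuous.\<close>

lemma simple_approx_C1c:
  fixes X :: "'a::euclidean_space \<Rightarrow> 'b::euclidean_space"
  assumes U: "open U" "U \<in> lmeasurable" and X: "X \<in> borel_measurable (lebesgue_on U)" "finite (X ` U)"
  obtains Y B where "\<And>n::nat. Y n \<in> C1c U" "\<And>n x. norm (Y n x) \<le> B"
    "AE x in lebesgue_on U. (\<lambda>n. Y n x) \<longlonglongrightarrow> X x"
proof -
  let ?L = "lebesgue_on U"
  have Us: "U \<in> sets lebesgue" using U by simp
  define A where "A y = U \<inter> X -` {y}" for y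
  have A: "A y \<in> sets lebesgue" for y
  proof -
    have "X -` {y} \<inter> space ?L \<in> sets ?L" using X(1) by (rule measurable_sets) simp
    then show ?thesis using Us by (auto simp: A_def sets_restrict_space_iff Int_commute)
  qed
  have "\<forall>y. \<exists>\<phi>::nat \<Rightarrow> 'a \<Rightarrow> real. (\<forall>n. \<phi> n \<in> C1c U) \<and> (\<forall>n x. 0 \<le> \<phi> n x \<and> \<phi> n x \<le> 1) \<and>
    (AE x in ?L. (\<lambda>n. \<phi> n x) \<longlonglongrightarrow> indicator (A y) x)"
    by (rule allI, rule indicator_approx_C1c[OF U A]) blast
  from choice[OF this] obtain \<phi> :: "'b \<Rightarrow> nat \<Rightarrow> 'a \<Rightarrow> real" where
    "\<forall>y. (\<forall>n. \<phi> y n \<in> C1c U) \<and> (\<forall>n x. 0 \<le> \<phi> y n x \<and> \<phi> y n x \<le> 1) \<and>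
    (AE x in ?L. (\<lambda>n. \<phi> y n x) \<longlonglongrightarrow> indicator (A y) x)" by (rule exE)
  then have \<phi>: "\<And>y n. \<phi> y n \<in> C1c U"
    "\<And>y n x. 0 \<le> \<phi> y n x" "\<And>y n x. \<phi> y n x \<le> 1"
    "\<And>y. AE x in ?L. (\<lambda>n. \<phi> y n x) \<longlonglongrightarrow> indicator (A y) x" by simp_all
  show ?thesis
  proof (rule that[of "\<lambda>n x. \<Sum>y\<in>X ` U. \<phi> y n x *\<^sub>R y" "\<Sum>y\<in>X ` U. norm y"])
    show "(\<lambda>x. \<Sum>y\<in>X ` U. \<phi> y n x *\<^sub>R y) \<in> C1c U" for n
      by (rule C1c_sum(1)[OF X(2)]) (rule C1c_scaleR(1)[OF \<phi>(1) C1_deriv_const])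
    show "norm (\<Sum>y\<in>X ` U. \<phi> y n x *\<^sub>R y) \<le> (\<Sum>y\<in>X ` U. norm y)" for n x
      using \<phi>(2,3) by (intro order_trans[OF norm_sum] sum_mono) (auto intro!: mult_left_le_one_le)
    have "AE x in ?L. \<forall>y\<in>X ` U. (\<lambda>n. \<phi> y n x) \<longlonglongrightarrow> indicator (A y) x"
      by (intro AE_ball_countable' \<phi>(4) countable_finite X(2))
    moreover have "AE x in ?L. x \<in> U" using AE_space[of ?L] by simp
    ultimately show "AE x in ?L. (\<lambda>n. \<Sum>y\<in>X ` U. \<phi> y n x *\<^sub>R y) \<longlonglongrightarrow> X x"
    proof eventually_elim
      fix x assume *: "\<forall>y\<in>X ` U. (\<lambda>n. \<phi> y n x) \<longlonglongrightarrow> indicator (A y) x" "x \<in> U"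
      then have "(\<lambda>n. \<Sum>y\<in>X ` U. \<phi> y n x *\<^sub>R y) \<longlonglongrightarrow> (\<Sum>y\<in>X ` U. indicator (A y) x *\<^sub>R y)"
        by (intro tendsto_sum tendsto_scaleR tendsto_const) auto
      moreover have "(\<Sum>y\<in>X ` U. indicator (A y) x *\<^sub>R y) = (\<Sum>y\<in>X ` U. if y = X x then y else 0)"
        using *(2) by (intro sum.cong) (auto simp: A_def indicator_def)
      ultimately show "(\<lambda>n. \<Sum>y\<in>X ` U. \<phi> y n x *\<^sub>R y) \<longlonglongrightarrow> X x"
        using *(2) X(2) by simp
    qed
  qed
qed

section \<open>Density in Lebesgue spaces and duality\<close>

lemma add_powr_le:
  fixes a b r :: real
  assumes "0 \<le> a" "0 \<le> b" "0 \<le> r"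
  shows "(a + b) powr r \<le> 2 powr r * (a powr r + b powr r)"
proof -
  have "(a + b) powr r \<le> (2 * max a b) powr r" using assms by (intro powr_mono2) auto
  also have "\<dots> = 2 powr r * max a b powr r" using assms by (intro powr_mult)
  also have "\<dots> \<le> 2 powr r * (a powr r + b powr r)"
    by (intro mult_left_mono) (auto simp: max_def)
  finally show ?thesis .
qed

text \<open>The approximation goes through simple functions dominated by a multiple of f and then
  through bounded test functions. Working with the integral of the power instead of a norm turns
  both passages into dominated convergence.\<close>

lemma Lp_density:
  fixes f :: "'a::euclidean_space \<Rightarrow> 'b::euclidean_space"
  assumes U: "open U" "U \<in> lmeasurable" and f: "f \<in> Lp r U" and r: "0 < r" and e: "0 < e"
  obtains g where "g \<in> C1c U" "integrable (lebesgue_on U) (\<lambda>x. norm (f x - g x) powr r)"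
    "(LINT x|lebesgue_on U. norm (f x - g x) powr r) < e"
proof -
  let ?L = "lebesgue_on U"
  interpret L: finite_measure ?L by (rule finite_measure_lebesgue_on[OF U(2)])
  have fm: "f \<in> borel_measurable ?L" and fi: "integrable ?L (\<lambda>x. norm (f x) powr r)"
    using f by (auto simp: Lp_def)
  obtain s where s0: "(\<forall>i. simple_function ?L (s i)) \<and> (\<forall>x\<in>space ?L. (\<lambda>i. s i x) \<longlonglongrightarrow> f x) \<and>
      (\<forall>i. \<forall>x\<in>space ?L. dist (s i x) 0 \<le> 2 * dist (f x) 0)"
    using borel_measurable_implies_sequence_metric[OF fm, of 0] by (rule exE)
  have s: "\<And>i. simple_function ?L (s i)" "\<And>x. x \<in> space ?L \<Longrightarrow> (\<lambda>i. s i x) \<longlonglongrightarrow> f x"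
    "\<And>i x. x \<in> space ?L \<Longrightarrow> norm (s i x) \<le> 2 * norm (f x)"
    using s0 by auto
  have sm: "s i \<in> borel_measurable ?L" for i using s(1) by (rule borel_measurable_simple_function)
  \<comment> \<open>The factor 3 in the dominating function: |s i| is at most 2 * |f|, so |f - s i|
    is at most 3 * |f|.\<close>
  have "(\<lambda>i. LINT x|?L. norm (f x - s i x) powr r) \<longlonglongrightarrow> (LINT x|?L. 0)"
  proof (rule integral_dominated_convergence[where w = "\<lambda>x. 3 powr r * norm (f x) powr r"])
    show "(\<lambda>x. norm (f x - s i x) powr r) \<in> borel_measurable ?L" for i
      using fm sm by measurable
    show "integrable ?L (\<lambda>x. 3 powr r * norm (f x) powr r)" using fi by simp
    show "AE x in ?L. (\<lambda>i. norm (f x - s i x) powr r) \<longlonglongrightarrow> 0"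
    proof (rule AE_I2)
      fix x assume "x \<in> space ?L"
      then have "(\<lambda>i. norm (f x - s i x)) \<longlonglongrightarrow> norm (f x - f x)" by (intro tendsto_intros s(2))
      then have "(\<lambda>i. norm (f x - s i x) powr r) \<longlonglongrightarrow> 0 powr r"
        using r by (intro tendsto_powr') auto
      then show "(\<lambda>i. norm (f x - s i x) powr r) \<longlonglongrightarrow> 0" using r by simp
    qed
    show "AE x in ?L. norm (norm (f x - s i x) powr r) \<le> 3 powr r * norm (f x) powr r" for i
    proof (rule AE_I2)
      fix x assume x: "x \<in> space ?L"
      have "norm (f x - s i x) \<le> 3 * norm (f x)" using s(3)[OF x, of i] norm_triangle_ineq4[of "f x" "s i x"] by linarith
      then have "norm (f x - s i x) powr r \<le> (3 * norm (f x)) powr r" using r by (intro powr_mono2) auto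
      then show "norm (norm (f x - s i x) powr r) \<le> 3 powr r * norm (f x) powr r" by (simp add: powr_mult)
    qed
  qed auto
  then have "\<forall>\<^sub>F i in sequentially. (LINT x|?L. norm (f x - s i x) powr r) < e"
    using e by (intro order_tendstoD) auto
  then obtain i where i: "(LINT x|?L. norm (f x - s i x) powr r) < e"
    using eventually_happens trivial_limit_sequentially by blast
  have "finite (s i ` U)" using simple_functionD(1)[OF s(1)[of i]] by simp
  from simple_approx_C1c[OF U sm this]
  obtain Y B where Y: "\<And>n::nat. Y n \<in> C1c U" "\<And>n x. norm (Y n x) \<le> B"
    "AE x in ?L. (\<lambda>n. Y n x) \<longlonglongrightarrow> s i x" by blast
  have B: "0 \<le> B" using Y(2)[of undefined undefined] norm_ge_zero order_trans by blast
  have Ym: "Y n \<in> borel_measurable ?L" for n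
    by (rule continuous_measurable_lebesgue_on[OF C1c_continuous[OF Y(1)]])
  have dom: "norm (norm (f x - Y n x) powr r) \<le> 2 powr r * (norm (f x) powr r + B powr r)" for x n
  proof -
    have "norm (f x - Y n x) \<le> norm (f x) + B" using Y(2)[of n x] norm_triangle_ineq4[of "f x" "Y n x"] by linarith
    then have "norm (f x - Y n x) powr r \<le> (norm (f x) + B) powr r" using r by (intro powr_mono2) auto
    also have "\<dots> \<le> 2 powr r * (norm (f x) powr r + B powr r)" using B r by (intro add_powr_le) auto
    finally show ?thesis by simp
  qed
  have domi: "integrable ?L (\<lambda>x. 2 powr r * (norm (f x) powr r + B powr r))" using fi by simp
  have Yfm: "(\<lambda>x. norm (f x - Y n x) powr r) \<in> borel_measurable ?L" for n using fm Ym by measurable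
  have "(\<lambda>n. LINT x|?L. norm (f x - Y n x) powr r) \<longlonglongrightarrow> (LINT x|?L. norm (f x - s i x) powr r)"
  proof (rule integral_dominated_convergence[OF _ Yfm domi])
    show "(\<lambda>x. norm (f x - s i x) powr r) \<in> borel_measurable ?L" using fm sm by measurable
    show "AE x in ?L. (\<lambda>n. norm (f x - Y n x) powr r) \<longlonglongrightarrow> norm (f x - s i x) powr r"
      using Y(3)
    proof eventually_elim
      fix x assume "(\<lambda>n. Y n x) \<longlonglongrightarrow> s i x"
      then show "(\<lambda>n. norm (f x - Y n x) powr r) \<longlonglongrightarrow> norm (f x - s i x) powr r"
        using r by (intro tendsto_powr' tendsto_intros) auto
    qed
  qed (use dom in auto)
  then have "\<forall>\<^sub>F n in sequentially. (LINT x|?L. norm (f x - Y n x) powr r) < e"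
    using i by (intro order_tendstoD) auto
  then obtain n where n: "(LINT x|?L. norm (f x - Y n x) powr r) < e"
    using eventually_happens trivial_limit_sequentially by blast
  show ?thesis
  proof (rule that[of "Y n"])
    show "integrable ?L (\<lambda>x. norm (f x - Y n x) powr r)"
      using Bochner_Integration.integrable_bound[OF domi Yfm] dom by (auto intro!: AE_I2 intro: order_trans abs_ge_self)
  qed (use Y n in auto)
qed

lemma Young_simple:
  fixes a b p :: real
  assumes "0 \<le> a" "0 \<le> b" "1 < p"
  shows "a * b \<le> a powr p + b powr (p / (p - 1))"
proof -
  let ?q = "p / (p - 1)"
  have q: "1 < ?q" "1 / p + 1 / ?q = 1" using assms(3) by (auto simp: field_simps)
  have *: "x / r \<le> x" if "0 \<le> x" "1 < r" for x r :: real
    using that by (simp add: pos_divide_le_eq mult_le_cancel_left1)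
  have "a * b \<le> a powr p / p + b powr ?q / ?q"
    by (rule Youngs_inequality[OF assms(3) q assms(1,2)])
  also have "\<dots> \<le> a powr p + b powr ?q"
    by (intro add_mono *) (use assms(3) q(1) in auto)
  finally show ?thesis .
qed

text \<open>Young's inequality with a free weight \<tau> takes the place of Hoelder's. The weight
  makes the pairing small when one factor is bounded and the other is small: first \<tau> is adapted
  to the bounded factor, then the other factor is taken small relative to \<tau>.\<close>

lemma Lp_inner_integrable:
  fixes f g :: "'a::euclidean_space \<Rightarrow> 'b::euclidean_space"
  assumes f: "f \<in> Lp p U" and g: "g \<in> Lp (p / (p - 1)) U" and "1 < p" "0 < \<tau>"
  shows "integrable (lebesgue_on U) (\<lambda>x. f x \<bullet> g x)"
    and "\<bar>LINT x|lebesgue_on U. f x \<bullet> g x\<bar> \<le> \<tau> powr p * (LINT x|lebesgue_on U. norm (f x) powr p)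
      + (1 / \<tau>) powr (p / (p - 1)) * (LINT x|lebesgue_on U. norm (g x) powr (p / (p - 1)))"
proof -
  let ?L = "lebesgue_on U" and ?q = "p / (p - 1)"
  have m: "f \<in> borel_measurable ?L" "g \<in> borel_measurable ?L"
    and i: "integrable ?L (\<lambda>x. norm (f x) powr p)" "integrable ?L (\<lambda>x. norm (g x) powr ?q)"
    using f g by (auto simp: Lp_def)
  have le: "norm (f x \<bullet> g x) \<le> \<tau> powr p * norm (f x) powr p + (1 / \<tau>) powr ?q * norm (g x) powr ?q" for x
  proof -
    have "norm (f x \<bullet> g x) \<le> norm (f x) * norm (g x)" using Cauchy_Schwarz_ineq2 by simp
    also have "\<dots> = (\<tau> * norm (f x)) * ((1 / \<tau>) * norm (g x))" using assms(4) by simp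
    also have "\<dots> \<le> (\<tau> * norm (f x)) powr p + ((1 / \<tau>) * norm (g x)) powr ?q"
      using assms(3,4) by (intro Young_simple) auto
    finally show ?thesis using assms(4) by (simp only: powr_mult)
  qed
  have I: "integrable ?L (\<lambda>x. \<tau> powr p * norm (f x) powr p + (1 / \<tau>) powr ?q * norm (g x) powr ?q)"
    using i by (intro Bochner_Integration.integrable_add integrable_mult_right)
  show J: "integrable ?L (\<lambda>x. f x \<bullet> g x)"
    using m le by (intro Bochner_Integration.integrable_bound[OF I]) (auto intro!: AE_I2 intro: order_trans abs_ge_self)
  have "\<bar>LINT x|?L. f x \<bullet> g x\<bar> \<le> (LINT x|?L. norm (f x \<bullet> g x))"
    using integral_norm_bound[of ?L "\<lambda>x. f x \<bullet> g x"] by simp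
  also have "\<dots> \<le> (LINT x|?L. \<tau> powr p * norm (f x) powr p + (1 / \<tau>) powr ?q * norm (g x) powr ?q)"
    using le by (intro integral_mono I integrable_norm J) auto
  also have "\<dots> = \<tau> powr p * (LINT x|?L. norm (f x) powr p) + (1 / \<tau>) powr ?q * (LINT x|?L. norm (g x) powr ?q)"
    using i by (subst Bochner_Integration.integral_add) auto
  finally show "\<bar>LINT x|?L. f x \<bullet> g x\<bar> \<le> \<tau> powr p * (LINT x|?L. norm (f x) powr p)
      + (1 / \<tau>) powr ?q * (LINT x|?L. norm (g x) powr ?q)" .
qed

lemma Lp_integrable:
  fixes f :: "'a::euclidean_space \<Rightarrow> 'b::euclidean_space"
  assumes "U \<in> lmeasurable" "f \<in> Lp p U" "1 \<le> p"
  shows "integrable (lebesgue_on U) f"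
proof -
  interpret L: finite_measure "lebesgue_on U" by (rule finite_measure_lebesgue_on[OF assms(1)])
  have "integrable (lebesgue_on U) (\<lambda>x. 1 + norm (f x) powr p)" using assms(2) by (simp add: Lp_def)
  then show ?thesis
  proof (rule Bochner_Integration.integrable_bound)
    show "f \<in> borel_measurable (lebesgue_on U)" using assms(2) by (simp add: Lp_def)
    have "norm y \<le> 1 + norm y powr p" for y :: 'b
    proof (cases "norm y \<le> 1")
      case False
      then have "norm y powr 1 \<le> norm y powr p" using assms(3) by (intro powr_mono) auto
      then show ?thesis using False by simp
    qed (simp add: add_increasing2)
    then show "AE x in lebesgue_on U. norm (f x) \<le> norm (1 + norm (f x) powr p)"
      by (intro AE_I2) (simp add: add_nonneg_nonneg abs_of_nonneg)
  qed
qed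

lemma bounded_in_Lp:
  fixes f :: "'a::euclidean_space \<Rightarrow> 'b::euclidean_space"
  assumes "U \<in> lmeasurable" "f \<in> borel_measurable (lebesgue_on U)" "\<And>x. norm (f x) \<le> M" "0 \<le> p"
  shows "f \<in> Lp p U"
proof -
  interpret L: finite_measure "lebesgue_on U" by (rule finite_measure_lebesgue_on[OF assms(1)])
  have "integrable (lebesgue_on U) (\<lambda>x. norm (f x) powr p)"
  proof (rule L.integrable_const_bound[of _ "M powr p"])
    show "AE x in lebesgue_on U. norm (norm (f x) powr p) \<le> M powr p"
      using assms(3,4) by (intro AE_I2) (simp add: powr_mono2)
  qed (use assms(2) in measurable)
  then show ?thesis using assms(2) by (simp add: Lp_def)
qed

lemma C1c_inner:
  assumes "g \<in> C1c U"
  shows "(\<lambda>x. g x \<bullet> i) \<in> C1c U"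
proof -
  obtain K where K: "compact K" "K \<subseteq> U" "\<And>x. x \<notin> K \<Longrightarrow> g x = 0"
    "\<And>x v. x \<notin> K \<Longrightarrow> frechet_derivative g (at x) v = 0"
    by (rule C1c_support[OF assms]) (rule that)
  have "C1_deriv (\<lambda>x. g x \<bullet> i) (\<lambda>x v. frechet_derivative g (at x) v \<bullet> i)"
    using C1c_C1_deriv[OF assms] unfolding C1_deriv_def
    by (auto intro!: derivative_eq_intros continuous_intros)
  then show ?thesis by (rule C1cI[OF _ K(1,2)]) (simp add: K(3))
qed

text \<open>Test functions are dense in the dual space and the family is eventually bounded in L^p,
  so convergence against test functions is enough. Scalar test functions suffice, because the
  pairing with a vector-valued one splits into components.\<close>

lemma weakly_in_Lp_if_C1c:
  fixes f :: "'a::euclidean_space \<Rightarrow> 'b::euclidean_space"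
  assumes U: "open U" "U \<in> lmeasurable" and p: "1 < p" and f: "f \<in> Lp p U"
    and fs: "\<forall>\<^sub>F \<epsilon> in F. fs \<epsilon> \<in> Lp p U \<and> (LINT x|lebesgue_on U. norm (fs \<epsilon> x) powr p) \<le> M"
    and test: "\<And>\<phi> :: 'a \<Rightarrow> real. \<phi> \<in> C1c U \<Longrightarrow>
      ((\<lambda>\<epsilon>. LINT x|lebesgue_on U. \<phi> x *\<^sub>R fs \<epsilon> x) \<longlongrightarrow> (LINT x|lebesgue_on U. \<phi> x *\<^sub>R f x)) F"
  shows "weakly_in_Lp p U F fs f"
  unfolding weakly_in_Lp_def
proof (intro conjI ballI f)
  let ?L = "lebesgue_on U" and ?q = "p / (p - 1)"
  show "\<forall>\<^sub>F \<epsilon> in F. fs \<epsilon> \<in> Lp p U" using fs by eventually_elim simp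
  fix v :: "'a \<Rightarrow> 'b" assume v: "v \<in> Lp ?q U"
  have q: "1 < ?q" using p by simp
  define M' where "M' = max 1 (max M (LINT x|?L. norm (f x) powr p))"
  have M': "0 < M'" "M \<le> M'" "(LINT x|?L. norm (f x) powr p) \<le> M'" by (auto simp: M'_def)
  show "((\<lambda>\<epsilon>. LINT x|?L. fs \<epsilon> x \<bullet> v x) \<longlongrightarrow> (LINT x|?L. f x \<bullet> v x)) F"
  proof (rule tendstoI)
    fix e :: real assume e: "e > 0"
    \<comment> \<open>The weight for Young's inequality: its p-th power times the common bound M' is
      e / 8. The test function g is then chosen so close to v that the dual term is at most e / 8 as
      well.\<close>
    define \<tau> where "\<tau> = (e / (8 * M')) powr (1 / p)"
    have \<tau>: "0 < \<tau>" "\<tau> powr p * M' = e / 8"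
      using e M'(1) p by (auto simp: \<tau>_def powr_powr)
    let ?e = "e / 8 * \<tau> powr ?q"
    have "0 < ?e" using e \<tau>(1) by simp
    obtain g where g: "g \<in> C1c U" "integrable ?L (\<lambda>x. norm (v x - g x) powr ?q)"
      "(LINT x|?L. norm (v x - g x) powr ?q) < ?e"
      by (rule Lp_density[OF U v _ \<open>0 < ?e\<close>]) (use q that in auto)
    obtain B where B: "\<And>x. norm (g x) \<le> B" by (rule C1c_bounded[OF g(1)]) (rule that)
    have gm: "g \<in> borel_measurable ?L"
      by (rule continuous_measurable_lebesgue_on[OF C1c_continuous[OF g(1)]])
    have vg: "(\<lambda>x. v x - g x) \<in> Lp ?q U"
      using g(2) v gm by (auto simp: Lp_def intro: borel_measurable_diff)
    have gL: "g \<in> Lp ?q U" by (rule bounded_in_Lp[OF U(2) gm B]) (use q in simp)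
    have small: "\<bar>LINT x|?L. h x \<bullet> (v x - g x)\<bar> \<le> e / 4"
      and split: "(LINT x|?L. h x \<bullet> v x) = (LINT x|?L. h x \<bullet> (v x - g x)) + (LINT x|?L. h x \<bullet> g x)"
      if h: "h \<in> Lp p U" "(LINT x|?L. norm (h x) powr p) \<le> M'" for h
    proof -
      have "(1 / \<tau>) powr ?q * (LINT x|?L. norm (v x - g x) powr ?q) \<le> (1 / \<tau>) powr ?q * ?e"
        using g(3) by (intro mult_left_mono) auto
      also have "\<dots> = e / 8" using \<tau>(1) by (simp add: powr_divide)
      finally have "(1 / \<tau>) powr ?q * (LINT x|?L. norm (v x - g x) powr ?q) \<le> e / 8" .
      moreover have "\<tau> powr p * (LINT x|?L. norm (h x) powr p) \<le> \<tau> powr p * M'"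
        using h(2) by (intro mult_left_mono) auto
      ultimately show "\<bar>LINT x|?L. h x \<bullet> (v x - g x)\<bar> \<le> e / 4"
        using Lp_inner_integrable(2)[OF h(1) vg p \<tau>(1)] \<tau>(2) by linarith
      show "(LINT x|?L. h x \<bullet> v x) = (LINT x|?L. h x \<bullet> (v x - g x)) + (LINT x|?L. h x \<bullet> g x)"
        using Lp_inner_integrable(1)[OF h(1) vg p \<tau>(1)] Lp_inner_integrable(1)[OF h(1) gL p \<tau>(1)]
        by (subst Bochner_Integration.integral_add[symmetric]) (auto simp: inner_diff_right)
    qed
    have comp: "(LINT x|?L. h x \<bullet> g x) = (\<Sum>i\<in>Basis. (LINT x|?L. (g x \<bullet> i) *\<^sub>R h x) \<bullet> i)" if h: "h \<in> Lp p U" for h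
    proof -
      have int: "integrable ?L (\<lambda>x. (g x \<bullet> i) *\<^sub>R h x)" for i
        by (rule integrable_C1c_scaleR(1)[OF U(1) locally_integrable_if_integrable[OF U(1) Lp_integrable[OF U(2) h]] C1c_inner[OF g(1)]])
          (use p in simp)
      have "(LINT x|?L. h x \<bullet> g x) = (LINT x|?L. (\<Sum>i\<in>Basis. ((g x \<bullet> i) *\<^sub>R h x) \<bullet> i))"
        by (intro Bochner_Integration.integral_cong refl, subst euclidean_inner) (simp add: mult.commute)
      also have "\<dots> = (\<Sum>i\<in>Basis. (LINT x|?L. ((g x \<bullet> i) *\<^sub>R h x) \<bullet> i))"
        by (rule Bochner_Integration.integral_sum) (rule integrable_inner_left[OF int])
      also have "\<dots> = (\<Sum>i\<in>Basis. (LINT x|?L. (g x \<bullet> i) *\<^sub>R h x) \<bullet> i)"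
        by (intro sum.cong refl integral_inner_left int)
      finally show ?thesis .
    qed
    have "((\<lambda>\<epsilon>. \<Sum>i\<in>Basis. (LINT x|?L. (g x \<bullet> i) *\<^sub>R fs \<epsilon> x) \<bullet> i) \<longlongrightarrow>
        (\<Sum>i\<in>Basis. (LINT x|?L. (g x \<bullet> i) *\<^sub>R f x) \<bullet> i)) F"
      by (intro tendsto_sum tendsto_inner tendsto_const test C1c_inner g(1))
    then have "\<forall>\<^sub>F \<epsilon> in F. dist (\<Sum>i\<in>Basis. (LINT x|?L. (g x \<bullet> i) *\<^sub>R fs \<epsilon> x) \<bullet> i)
        (\<Sum>i\<in>Basis. (LINT x|?L. (g x \<bullet> i) *\<^sub>R f x) \<bullet> i) < e / 4"
      using e by (intro tendstoD) auto
    with fs show "\<forall>\<^sub>F \<epsilon> in F. dist (LINT x|?L. fs \<epsilon> x \<bullet> v x) (LINT x|?L. f x \<bullet> v x) < e"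
    proof eventually_elim
      fix \<epsilon>
      assume 1: "fs \<epsilon> \<in> Lp p U \<and> (LINT x|?L. norm (fs \<epsilon> x) powr p) \<le> M"
        and 2: "dist (\<Sum>i\<in>Basis. (LINT x|?L. (g x \<bullet> i) *\<^sub>R fs \<epsilon> x) \<bullet> i)
        (\<Sum>i\<in>Basis. (LINT x|?L. (g x \<bullet> i) *\<^sub>R f x) \<bullet> i) < e / 4"
      then have 3: "fs \<epsilon> \<in> Lp p U" "(LINT x|?L. norm (fs \<epsilon> x) powr p) \<le> M'" using M'(2) by auto
      show "dist (LINT x|?L. fs \<epsilon> x \<bullet> v x) (LINT x|?L. f x \<bullet> v x) < e"
        using 2 small[OF 3] small[OF f M'(3)] e
        unfolding split[OF 3] split[OF f M'(3)] comp[OF 3(1)] comp[OF f] dist_real_def by linarith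
    qed
  qed
qed

section \<open>One-dimensional Sobolev functions\<close>

lemma antiderivative:
  fixes V :: "real \<Rightarrow> 'b::euclidean_space"
  assumes "continuous_on UNIV V"
  obtains G where "\<And>t. (G has_vector_derivative V t) (at t)" "G 0 = 0"
proof -
  have "\<exists>F. \<forall>x::real. -\<infinity> < ereal x \<longrightarrow> ereal x < \<infinity> \<longrightarrow> (F has_vector_derivative V x) (at x)"
    by (rule einterval_antiderivative)
      (use assms in \<open>auto simp: continuous_on_eq_continuous_at\<close>)
  then obtain F where F: "\<And>x. (F has_vector_derivative V x) (at x)" by auto
  show ?thesis
  proof (rule that[of "\<lambda>t. F t - F 0"])
    show "((\<lambda>t. F t - F 0) has_vector_derivative V t) (at t)" for t
      using has_vector_derivative_diff[OF F has_vector_derivative_const] by simp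
  qed simp
qed

lemma C1_deriv_real:
  fixes V :: "real \<Rightarrow> 'b::euclidean_space"
  assumes "\<And>t. (G has_vector_derivative V t) (at t)" "continuous_on UNIV V"
  shows "C1_deriv G (\<lambda>t v. v *\<^sub>R V t)"
  using assms unfolding C1_deriv_def has_vector_derivative_def
  by (auto intro!: continuous_intros)

lemma antiderivative_diff:
  fixes V :: "real \<Rightarrow> 'b::euclidean_space"
  assumes "continuous_on UNIV V" "\<And>t. (G has_vector_derivative V t) (at t)" "a \<le> b"
  shows "(LINT s|lborel. indicator {a..b} s *\<^sub>R V s) = G b - G a"
  by (rule integral_FTC_Icc[OF assms(3)])
    (use assms(1,2) in \<open>auto intro: has_vector_derivative_at_within continuous_on_subset\<close>)

lemma antiderivative_eq_integral:
  fixes V :: "real \<Rightarrow> 'b::euclidean_space"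
  assumes "continuous_on UNIV V" "\<And>t. (G has_vector_derivative V t) (at t)"
    "\<And>t. t \<le> a \<Longrightarrow> V t = 0" "G a = 0"
  shows "G t = (LINT s|lborel. indicator {..t} s *\<^sub>R V s)"
proof (cases "a \<le> t")
  case True
  have "(\<lambda>s. indicator {..t} s *\<^sub>R V s) = (\<lambda>s. indicator {a..t} s *\<^sub>R V s)"
    using assms(3) by (intro ext) (auto split: split_indicator)
  then show ?thesis using antiderivative_diff[OF assms(1,2) True] assms(4) by simp
next
  case False
  have "(\<lambda>s. indicator {t..a} s *\<^sub>R V s) = (\<lambda>s. 0)" "(\<lambda>s. indicator {..t} s *\<^sub>R V s) = (\<lambda>s. 0)"
    using assms(3) False by (auto split: split_indicator intro!: ext)
  then show ?thesis using antiderivative_diff[OF assms(1,2), of t a] assms(4) False by simp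
qed

text \<open>The primitive that vanishes at 0. Only the values of V in (0, l) enter and the result is
  constant on either side of that interval, so it is a total function on the line although V is
  given only inside.\<close>

definition prim :: "real \<Rightarrow> (real \<Rightarrow> 'b::euclidean_space) \<Rightarrow> real \<Rightarrow> 'b" where
  "prim l V t = (LINT s|lebesgue_on {0<..<l}. indicator {..t} s *\<^sub>R V s)"

lemma prim_integrable:
  fixes V :: "real \<Rightarrow> 'b::euclidean_space"
  assumes "integrable (lebesgue_on {0<..<l}) V"
  shows "integrable (lebesgue_on {0<..<l}) (\<lambda>s. indicator {..t} s *\<^sub>R V s)"
proof -
  have "{0<..<l} \<inter> {..t} \<in> sets (lebesgue_on {0<..<l})" by (simp add: sets_restrict_space_iff)
  from integrable_mult_indicator[OF this assms]
  have "integrable (lebesgue_on {0<..<l}) (\<lambda>s. indicator ({0<..<l} \<inter> {..t}) s *\<^sub>R V s)" .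
  then show ?thesis
    by (rule Bochner_Integration.integrable_cong[OF refl, THEN iffD1, rotated])
      (auto split: split_indicator)
qed

lemma prim_dist_le:
  fixes V W :: "real \<Rightarrow> 'b::euclidean_space"
  assumes "integrable (lebesgue_on {0<..<l}) V" "integrable (lebesgue_on {0<..<l}) W"
  shows "norm (prim l V t - prim l W t) \<le> (LINT s|lebesgue_on {0<..<l}. norm (V s - W s))"
proof -
  have "prim l V t - prim l W t = (LINT s|lebesgue_on {0<..<l}. indicator {..t} s *\<^sub>R V s - indicator {..t} s *\<^sub>R W s)"
    unfolding prim_def by (rule Bochner_Integration.integral_diff[symmetric]) (rule prim_integrable[OF assms(1)] prim_integrable[OF assms(2)])+
  also have "norm \<dots> \<le> (LINT s|lebesgue_on {0<..<l}. norm (indicator {..t} s *\<^sub>R V s - indicator {..t} s *\<^sub>R W s))"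
    by (rule integral_norm_bound)
  also have "\<dots> \<le> (LINT s|lebesgue_on {0<..<l}. norm (V s - W s))"
    using prim_integrable assms
    by (intro integral_mono integrable_norm Bochner_Integration.integrable_diff) (auto split: split_indicator)
  finally show ?thesis .
qed

lemma prim_has_vector_derivative:
  fixes V :: "real \<Rightarrow> 'b::euclidean_space"
  assumes "V \<in> C1c {0<..<l}"
  shows "(prim l V has_vector_derivative V t) (at t)"
proof -
  have c: "continuous_on UNIV V" by (rule C1c_continuous[OF assms])
  have z: "V t = 0" if "t \<notin> {0<..<l}" for t using assms that unfolding C1c_def by blast
  obtain G where G: "\<And>t. (G has_vector_derivative V t) (at t)" "G 0 = 0"
    by (rule antiderivative[OF c]) (rule that)
  have "G t = prim l V t" for t
  proof -
    have "G t = (LINT s|lborel. indicator {..t} s *\<^sub>R V s)"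
      by (rule antiderivative_eq_integral[OF c G(1) _ G(2)]) (use z in auto)
    also have "\<dots> = (LINT s|lebesgue. indicator {..t} s *\<^sub>R V s)"
      using borel_measurable_continuous_onI[OF c] by (subst integral_completion) auto
    also have "\<dots> = prim l V t"
      unfolding prim_def using z
      by (subst integral_lebesgue_on) (auto intro!: Bochner_Integration.integral_cong split: split_indicator)
    finally show ?thesis .
  qed
  then have "G = prim l V" by (rule ext)
  then show ?thesis using G(1) by simp
qed

lemma interval_lmeasurable: "{0<..<l::real} \<in> lmeasurable"
  by (simp add: bounded_set_imp_lmeasurable)

lemma L1_density:
  fixes f :: "'a::euclidean_space \<Rightarrow> 'b::euclidean_space"
  assumes "open U" "U \<in> lmeasurable" "integrable (lebesgue_on U) f" "0 < e"
  obtains g where "g \<in> C1c U" "integrable (lebesgue_on U) g" "(LINT x|lebesgue_on U. norm (f x - g x)) < e"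
proof -
  have f: "f \<in> Lp 1 U" using assms(3) by (auto simp: Lp_def)
  obtain g where g: "g \<in> C1c U" "integrable (lebesgue_on U) (\<lambda>x. norm (f x - g x) powr 1)"
    "(LINT x|lebesgue_on U. norm (f x - g x) powr 1) < e"
    by (rule Lp_density[OF assms(1,2) f zero_less_one assms(4)]) (rule that)
  obtain B where B: "\<And>x. norm (g x) \<le> B" by (rule C1c_bounded[OF g(1)]) (rule that)
  have "g \<in> Lp 1 U"
    by (rule bounded_in_Lp[OF assms(2) continuous_measurable_lebesgue_on[OF C1c_continuous[OF g(1)]] B]) simp
  then have "integrable (lebesgue_on U) g" by (rule Lp_integrable[OF assms(2)]) simp
  with g that show ?thesis by simp
qed

text \<open>V is approximated in L1 by test functions, whose primitives are classical. Primitives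
  differ uniformly by at most the L1 distance of the integrands, so continuity and integration by
  parts both survive the limit.\<close>

lemma prim_has_weak_partial:
  fixes V :: "real \<Rightarrow> 'b::euclidean_space"
  assumes V: "integrable (lebesgue_on {0<..<l}) V"
  shows "has_weak_partial {0<..<l} 1 (prim l V) V"
    and "integrable (lebesgue_on {0<..<l}) (prim l V)"
    and "\<And>t. norm (prim l V t) \<le> (LINT s|lebesgue_on {0<..<l}. norm (V s))"
    and "continuous_on UNIV (prim l V)"
proof -
  let ?I = "{0<..<l}" and ?L = "lebesgue_on {0<..<l}"
  interpret L: finite_measure ?L by (rule finite_measure_lebesgue_on[OF interval_lmeasurable])
  show b: "norm (prim l V t) \<le> (LINT s|?L. norm (V s))" for t
    using prim_dist_le[OF V, of "\<lambda>_. 0" t] by (simp add: prim_def)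
  have "\<forall>n. \<exists>g. g \<in> C1c ?I \<and> integrable ?L g \<and> (LINT x|?L. norm (V x - g x)) < 1 / (real n + 1)"
    by (rule allI, rule L1_density[OF _ interval_lmeasurable V]) auto
  from choice[OF this] obtain g where
    g0: "\<forall>n. g n \<in> C1c ?I \<and> integrable ?L (g n) \<and> (LINT x|?L. norm (V x - g n x)) < 1 / (real n + 1)" by (rule exE)
  then have g: "\<And>n. g n \<in> C1c ?I" "\<And>n. integrable ?L (g n)"
    "\<And>n. (LINT x|?L. norm (V x - g n x)) < 1 / (real n + 1)" by simp_all
  have lim0: "(\<lambda>n. 1 / (real n + 1)) \<longlonglongrightarrow> 0" by real_asymp
  have close: "norm (prim l V t - prim l (g n) t) \<le> 1 / (real n + 1)" for n t
    using prim_dist_le[OF V g(2), of t n] g(3)[of n] by linarith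
  have pg: "C1_deriv (prim l (g n)) (\<lambda>t v. v *\<^sub>R g n t)" for n
    by (rule C1_deriv_real[OF prim_has_vector_derivative[OF g(1)] C1c_continuous[OF g(1)]])
  have "uniform_limit UNIV (\<lambda>n. prim l (g n)) (prim l V) sequentially"
  proof (rule uniform_limitI)
    fix e :: real assume "e > 0"
    then have "\<forall>\<^sub>F n in sequentially. 1 / (real n + 1) < e" using order_tendstoD(2)[OF lim0] by auto
    then show "\<forall>\<^sub>F n in sequentially. \<forall>t\<in>UNIV. dist (prim l (g n) t) (prim l V t) < e"
    proof eventually_elim
      fix n assume "1 / (real n + 1) < e"
      then show "\<forall>t\<in>UNIV. dist (prim l (g n) t) (prim l V t) < e"
        using close[of _ n] by (auto simp: dist_norm norm_minus_commute intro: le_less_trans)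
    qed
  qed
  then show cont: "continuous_on UNIV (prim l V)"
    by (rule uniform_limit_theorem[rotated]) (auto intro!: always_eventually C1_deriv_continuous[OF pg])
  show int: "integrable ?L (prim l V)"
    by (rule L.integrable_const_bound[OF AE_I2[OF b] continuous_measurable_lebesgue_on[OF cont]])
  have lV: "locally_integrable ?I V" "locally_integrable ?I (prim l V)"
    by (rule locally_integrable_if_integrable[OF _ V] locally_integrable_if_integrable[OF _ int]; simp)+
  show "has_weak_partial ?I 1 (prim l V) V"
    unfolding has_weak_partial_def
  proof (intro conjI lV ballI)
    fix \<phi> :: "real \<Rightarrow> real" assume \<phi>: "\<phi> \<in> C1c ?I"
    let ?d = "\<lambda>x. frechet_derivative \<phi> (at x) 1"
    obtain M where M: "M > 0" "\<And>x. norm (\<phi> x) \<le> M" by (rule C1c_bounded[OF \<phi>]) (rule that)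
    obtain M' where M': "M' > 0" "\<And>x. norm (?d x) \<le> M'" by (rule C1c_bounded_deriv[OF \<phi>, of 1]) (rule that)
    have lg: "locally_integrable ?I (g n)" "locally_integrable ?I (prim l (g n))" for n
      by (rule locally_integrable_continuous, rule C1c_continuous[OF g(1)] C1_deriv_continuous[OF pg])+
    have "has_weak_partial ?I 1 (prim l (g n)) (\<lambda>x. 1 *\<^sub>R g n x)" for n
      by (rule has_weak_partial_C1[OF _ pg]) simp
    then have eq: "(LINT x|?L. ?d x *\<^sub>R prim l (g n) x) = - (LINT x|?L. \<phi> x *\<^sub>R g n x)" for n
      using \<phi> unfolding has_weak_partial_def by simp
    have "(\<lambda>n. LINT x|?L. ?d x *\<^sub>R prim l (g n) x) \<longlonglongrightarrow> (LINT x|?L. ?d x *\<^sub>R prim l V x)"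
    proof (rule LIM_zero_cancel, rule Lim_null_comparison)
      show "(\<lambda>n. (M' * measure ?L (space ?L)) * (1 / (real n + 1))) \<longlonglongrightarrow> 0"
        using tendsto_mult_right_zero[OF lim0] by blast
      show "\<forall>\<^sub>F n in sequentially. norm ((LINT x|?L. ?d x *\<^sub>R prim l (g n) x) - (LINT x|?L. ?d x *\<^sub>R prim l V x))
        \<le> (M' * measure ?L (space ?L)) * (1 / (real n + 1))"
      proof (rule always_eventually, rule allI)
        fix n
        have i: "integrable ?L (\<lambda>x. ?d x *\<^sub>R prim l (g n) x)" "integrable ?L (\<lambda>x. ?d x *\<^sub>R prim l V x)"
          by (rule integrable_C1c_scaleR(2)[OF _ lg(2) \<phi>] integrable_C1c_scaleR(2)[OF _ lV(2) \<phi>]; simp)+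
        have "norm ((LINT x|?L. ?d x *\<^sub>R prim l (g n) x) - (LINT x|?L. ?d x *\<^sub>R prim l V x))
          = norm (LINT x|?L. ?d x *\<^sub>R prim l (g n) x - ?d x *\<^sub>R prim l V x)"
          by (simp only: Bochner_Integration.integral_diff[OF i])
        also have "\<dots> \<le> (LINT x|?L. norm (?d x *\<^sub>R prim l (g n) x - ?d x *\<^sub>R prim l V x))"
          by (rule integral_norm_bound)
        also have "\<dots> \<le> (LINT x|?L. M' * (1 / (real n + 1)))"
        proof (rule integral_mono)
          show "norm (?d x *\<^sub>R prim l (g n) x - ?d x *\<^sub>R prim l V x) \<le> M' * (1 / (real n + 1))" for x
            unfolding scaleR_diff_right[symmetric] norm_scaleR
            using M'(1) M'(2)[of x] close[of x n] by (intro mult_mono) (auto simp: norm_minus_commute)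
        qed (use i in auto)
        also have "\<dots> = (M' * measure ?L (space ?L)) * (1 / (real n + 1))" by simp
        finally show "norm ((LINT x|?L. ?d x *\<^sub>R prim l (g n) x) - (LINT x|?L. ?d x *\<^sub>R prim l V x))
          \<le> (M' * measure ?L (space ?L)) * (1 / (real n + 1))" .
      qed
    qed
    moreover have "(\<lambda>n. LINT x|?L. \<phi> x *\<^sub>R g n x) \<longlonglongrightarrow> (LINT x|?L. \<phi> x *\<^sub>R V x)"
    proof (rule LIM_zero_cancel, rule Lim_null_comparison)
      show "(\<lambda>n. M * (1 / (real n + 1))) \<longlonglongrightarrow> 0"
        using tendsto_mult_right_zero[OF lim0] by blast
      show "\<forall>\<^sub>F n in sequentially. norm ((LINT x|?L. \<phi> x *\<^sub>R g n x) - (LINT x|?L. \<phi> x *\<^sub>R V x)) \<le> M * (1 / (real n + 1))"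
      proof (rule always_eventually, rule allI)
        fix n
        have i: "integrable ?L (\<lambda>x. \<phi> x *\<^sub>R g n x)" "integrable ?L (\<lambda>x. \<phi> x *\<^sub>R V x)"
          by (rule integrable_C1c_scaleR(1)[OF _ lg(1) \<phi>] integrable_C1c_scaleR(1)[OF _ lV(1) \<phi>]; simp)+
        have "norm ((LINT x|?L. \<phi> x *\<^sub>R g n x) - (LINT x|?L. \<phi> x *\<^sub>R V x))
          = norm (LINT x|?L. \<phi> x *\<^sub>R g n x - \<phi> x *\<^sub>R V x)"
          by (simp only: Bochner_Integration.integral_diff[OF i])
        also have "\<dots> \<le> (LINT x|?L. norm (\<phi> x *\<^sub>R g n x - \<phi> x *\<^sub>R V x))"
          by (rule integral_norm_bound)
        also have "\<dots> \<le> (LINT x|?L. M * norm (V x - g n x))"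
        proof (rule integral_mono)
          show "norm (\<phi> x *\<^sub>R g n x - \<phi> x *\<^sub>R V x) \<le> M * norm (V x - g n x)" for x
            unfolding scaleR_diff_right[symmetric] norm_scaleR
            using M(1) M(2)[of x] by (intro mult_mono) (auto simp: norm_minus_commute)
        qed (use i g(2) V in auto)
        also have "\<dots> \<le> M * (1 / (real n + 1))"
          using mult_left_mono[OF less_imp_le[OF g(3)[of n]], of M] M(1) by simp
        finally show "norm ((LINT x|?L. \<phi> x *\<^sub>R g n x) - (LINT x|?L. \<phi> x *\<^sub>R V x)) \<le> M * (1 / (real n + 1))" .
      qed
    qed
    ultimately show "(LINT x|?L. ?d x *\<^sub>R prim l V x) = - (LINT x|?L. \<phi> x *\<^sub>R V x)"
      unfolding eq using tendsto_minus LIMSEQ_unique by blast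
  qed
qed

section \<open>Functions with vanishing weak derivative on an interval\<close>

lemma compact_subset_interval:
  assumes "compact K" "K \<subseteq> {0<..<l::real}" "0 < l"
  obtains a b where "0 < a" "a \<le> b" "b < l" "K \<subseteq> {a..b}"
proof (cases "K = {}")
  case True
  show ?thesis using that[of "l/2" "l/2"] True assms(3) by simp
next
  case False
  obtain a where a: "a \<in> K" "\<forall>t\<in>K. a \<le> t" using compact_attains_inf[OF assms(1) False] by blast
  obtain b where b: "b \<in> K" "\<forall>t\<in>K. t \<le> b" using compact_attains_sup[OF assms(1) False] by blast
  show ?thesis by (rule that[of a b]) (use a b assms(2) in \<open>auto\<close>)
qed

text \<open>To the left of the support of V the primitive is 0; to the right it equals the full
  integral, which vanishes by assumption.\<close>

lemma prim_in_C1c: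
  assumes "V \<in> C1c {0<..<l}" "0 < l" and 0: "(LINT s|lebesgue_on {0<..<l}. V s) = (0::real)"
  shows "prim l V \<in> C1c {0<..<l}"
proof -
  obtain K where K: "compact K" "K \<subseteq> {0<..<l}" "\<And>x. x \<notin> K \<Longrightarrow> V x = 0"
    "\<And>x v. x \<notin> K \<Longrightarrow> frechet_derivative V (at x) v = 0"
    by (rule C1c_support[OF assms(1)]) (rule that)
  obtain a b where ab: "0 < a" "a \<le> b" "b < l" "K \<subseteq> {a..b}"
    by (rule compact_subset_interval[OF K(1,2) assms(2)]) (rule that)
  show ?thesis
  proof (rule C1cI[of _ _ "{a..b}"])
    show "C1_deriv (prim l V) (\<lambda>t v. v *\<^sub>R V t)"
      by (rule C1_deriv_real[OF prim_has_vector_derivative[OF assms(1)] C1c_continuous[OF assms(1)]])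
    fix t assume t: "t \<notin> {a..b}"
    show "prim l V t = 0"
    proof (cases "t < a")
      case True
      then have "indicator {..t} s *\<^sub>R V s = 0" for s
        using K(3)[of s] subsetD[OF ab(4), of s] by (cases "s \<in> K") (auto split: split_indicator)
      then show ?thesis unfolding prim_def by (simp only: Bochner_Integration.integral_zero)
    next
      case False
      then have "indicator {..t} s *\<^sub>R V s = V s" for s
        using K(3)[of s] subsetD[OF ab(4), of s] t by (cases "s \<in> K") (auto split: split_indicator)
      then show ?thesis unfolding prim_def by (simp only: 0)
    qed
  qed (use ab in auto)
qed

text \<open>A test function of mean 0 is the derivative of a test function. Subtracting from \<psi>
  its integral times a fixed \<rho> of integral 1 produces such a function, and testing with its
  primitive shows that \<psi> integrates h - c to 0, where c is the average of h with weight
  \<rho>.\<close>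

lemma du_Bois_Reymond:
  fixes h :: "real \<Rightarrow> 'b::euclidean_space"
  assumes l: "0 < l" and h: "integrable (lebesgue_on {0<..<l}) h"
    and 0: "\<And>\<phi> :: real \<Rightarrow> real. \<phi> \<in> C1c {0<..<l} \<Longrightarrow>
      (LINT t|lebesgue_on {0<..<l}. frechet_derivative \<phi> (at t) 1 *\<^sub>R h t) = 0"
  obtains c where "AE t in lebesgue_on {0<..<l}. h t = c"
proof -
  let ?I = "{0<..<l}" and ?L = "lebesgue_on {0<..<l}"
  interpret L: finite_measure ?L by (rule finite_measure_lebesgue_on[OF interval_lmeasurable])
  have lh: "locally_integrable ?I h" by (rule locally_integrable_if_integrable[OF _ h]) simp
  have intC: "integrable ?L \<psi>" if \<psi>: "\<psi> \<in> C1c ?I" for \<psi> :: "real \<Rightarrow> real"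
  proof -
    obtain B where "\<And>x. norm (\<psi> x) \<le> B" by (rule C1c_bounded[OF \<psi>]) (rule that)
    then show ?thesis
      using continuous_measurable_lebesgue_on[OF C1c_continuous[OF \<psi>]]
      by (intro L.integrable_const_bound[of _ B]) auto
  qed
  have one: "integrable ?L (\<lambda>_. 1 :: real)" by simp
  \<comment> \<open>A test function at L1 distance less than l from the constant 1 cannot have
    integral 0, so it can be normalised to \<rho>.\<close>
  obtain g :: "real \<Rightarrow> real" where g: "g \<in> C1c ?I" "integrable ?L g" "(LINT x|?L. norm (1 - g x)) < l"
    by (rule L1_density[OF open_greaterThanLessThan interval_lmeasurable one l]) (rule that)
  have "(LINT x|?L. g x) \<noteq> 0"
  proof
    assume "(LINT x|?L. g x) = 0"
    then have "l = (LINT x|?L. 1 - g x)"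
      using g(2) l by (simp add: measure_restrict_space)
    also have "\<dots> \<le> \<bar>LINT x|?L. 1 - g x\<bar>" by (rule abs_ge_self)
    also have "\<dots> \<le> (LINT x|?L. norm (1 - g x))" unfolding real_norm_def by (rule integral_abs_bound)
    finally show False using g(3) by simp
  qed
  define \<rho> where "\<rho> x = (1 / (LINT x|?L. g x)) * g x" for x
  have \<rho>: "\<rho> \<in> C1c ?I"
    using C1c_scaleR(1)[OF g(1) C1_deriv_const[of "1 / (LINT x|?L. g x)"]] by (simp add: \<rho>_def[abs_def] mult.commute)
  have \<rho>1: "(LINT x|?L. \<rho> x) = 1" unfolding \<rho>_def using \<open>(LINT x|?L. g x) \<noteq> 0\<close> by simp
  define c where "c = (LINT x|?L. \<rho> x *\<^sub>R h x)"
  show ?thesis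
  proof (rule that[of c])
    have "AE x in ?L. h x - c = 0"
    proof (rule AE_zero_if_integral_C1c_zero)
      show "locally_integrable ?I (\<lambda>x. h x - c)"
        by (rule locally_integrable_diff[OF lh locally_integrable_continuous]) simp
      fix \<psi> :: "real \<Rightarrow> real" assume \<psi>: "\<psi> \<in> C1c ?I"
      define m where "m = (LINT x|?L. \<psi> x)"
      define \<zeta> where "\<zeta> x = \<psi> x + \<rho> x * (- m)" for x
      have "(\<lambda>x. \<Sum>k\<in>{0::nat,1}. (if k = 0 then \<psi> x else \<rho> x *\<^sub>R (- m))) \<in> C1c ?I"
        using \<psi> C1c_scaleR(1)[OF \<rho> C1_deriv_const[of "- m"]]
        by (intro C1c_sum(1)) auto
      then have \<zeta>: "\<zeta> \<in> C1c ?I" by (simp add: \<zeta>_def[abs_def])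
      have "(LINT x|?L. \<zeta> x) = 0"
        unfolding \<zeta>_def using intC[OF \<psi>] intC[OF \<rho>] \<rho>1 by (simp add: m_def)
      then have P: "prim l \<zeta> \<in> C1c ?I" by (rule prim_in_C1c[OF \<zeta> l])
      have "frechet_derivative (prim l \<zeta>) (at t) 1 = \<zeta> t" for t
        using C1_deriv_frechet[OF C1_deriv_real[OF prim_has_vector_derivative[OF \<zeta>] C1c_continuous[OF \<zeta>]], of t] by simp
      with 0[OF P] have "0 = (LINT t|?L. \<zeta> t *\<^sub>R h t)" by simp
      also have "\<dots> = (LINT t|?L. \<psi> t *\<^sub>R h t - m *\<^sub>R \<rho> t *\<^sub>R h t)"
        by (intro Bochner_Integration.integral_cong) (auto simp: \<zeta>_def scaleR_left_diff_distrib mult.commute)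
      also have "\<dots> = (LINT t|?L. \<psi> t *\<^sub>R h t) - m *\<^sub>R c"
        unfolding c_def using integrable_C1c_scaleR(1)[OF _ lh \<psi>] integrable_C1c_scaleR(1)[OF _ lh \<rho>]
        by (simp del: scaleR_scaleR)
      also have "\<dots> = (LINT t|?L. \<psi> t *\<^sub>R (h t - c))"
        unfolding scaleR_diff_right m_def using integrable_C1c_scaleR(1)[OF _ lh \<psi>] intC[OF \<psi>]
        by simp
      finally show "(LINT t|?L. \<psi> t *\<^sub>R (h t - c)) = 0" by simp
    qed simp
    then show "AE x in ?L. h x = c" by simp
  qed
qed

text \<open>\<open>weak_partial\<close> is a choice; uniqueness up to null sets transfers membership
  in L^p to it from the witness in \<open>sobolev\<close>.\<close>

lemma sobolev_weak_partial:
  assumes "open U" "u \<in> sobolev (Lp p) U" "i \<in> Basis"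
  shows "has_weak_partial U i u (weak_partial U i u)" "weak_partial U i u \<in> Lp p U"
proof -
  have U: "U \<in> sets lebesgue" using assms(1) by simp
  obtain g where g: "g \<in> Lp p U" "has_weak_partial U i u g" using assms(2,3) unfolding sobolev_def by blast
  show "has_weak_partial U i u (weak_partial U i u)" by (rule has_weak_partial_weak_partial[OF g(2)])
  have AE: "AE x in lebesgue_on U. g x = weak_partial U i u x"
    using weak_partial_AE[OF assms(1) g(2)] by eventually_elim simp
  have m: "weak_partial U i u \<in> borel_measurable (lebesgue_on U)"
    by (rule borel_measurable_lebesgue_on_AE_cong[OF U _ AE]) (use g(1) in \<open>simp add: Lp_def\<close>)
  have "integrable (lebesgue_on U) (\<lambda>x. norm (g x) powr p)" using g(1) by (simp add: Lp_def)
  then have "integrable (lebesgue_on U) (\<lambda>x. norm (weak_partial U i u x) powr p)"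
  proof (rule integrable_cong_AE_imp)
    show "(\<lambda>x. norm (weak_partial U i u x) powr p) \<in> borel_measurable (lebesgue_on U)" using m by measurable
    show "AE x in lebesgue_on U. norm (g x) powr p = norm (weak_partial U i u x) powr p"
      using AE by eventually_elim simp
  qed
  then show "weak_partial U i u \<in> Lp p U" using m by (simp add: Lp_def)
qed

text \<open>The difference between u and the primitive of its weak derivative has weak derivative 0,
  so \<open>du_Bois_Reymond\<close> applies to it.\<close>

lemma sobolev_1D_eq_prim:
  fixes u :: "real \<Rightarrow> 'b::euclidean_space"
  assumes "0 < l" "1 \<le> p" "u \<in> sobolev (Lp p) {0<..<l}"
  obtains c where "AE t in lebesgue_on {0<..<l}. u t = c + prim l (weak_partial {0<..<l} 1 u) t"
proof -
  let ?I = "{0<..<l}" and ?L = "lebesgue_on {0<..<l}"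
  let ?V = "weak_partial ?I 1 u"
  note V = sobolev_weak_partial[OF _ assms(3), of 1, simplified]
  have Vi: "integrable ?L ?V" by (rule Lp_integrable[OF interval_lmeasurable V(2) assms(2)])
  have ui: "integrable ?L u"
    by (rule Lp_integrable[OF interval_lmeasurable _ assms(2)]) (use assms(3) in \<open>simp add: sobolev_def\<close>)
  note P = prim_has_weak_partial[OF Vi]
  have lu: "locally_integrable ?I u" "locally_integrable ?I (prim l ?V)"
    by (rule locally_integrable_if_integrable[OF _ ui] locally_integrable_if_integrable[OF _ P(2)]; simp)+
  obtain c where "AE t in ?L. u t - prim l ?V t = c"
  proof (rule du_Bois_Reymond[OF assms(1), of "\<lambda>t. u t - prim l ?V t"])
    show "integrable ?L (\<lambda>t. u t - prim l ?V t)" using ui P(2) by simp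
    fix \<phi> :: "real \<Rightarrow> real" assume \<phi>: "\<phi> \<in> C1c ?I"
    have "(LINT t|?L. frechet_derivative \<phi> (at t) 1 *\<^sub>R u t) = (LINT t|?L. frechet_derivative \<phi> (at t) 1 *\<^sub>R prim l ?V t)"
      using V(1) P(1) \<phi> unfolding has_weak_partial_def by simp
    then show "(LINT t|?L. frechet_derivative \<phi> (at t) 1 *\<^sub>R (u t - prim l ?V t)) = 0"
      unfolding scaleR_diff_right
      using integrable_C1c_scaleR(2)[OF _ lu(1) \<phi>] integrable_C1c_scaleR(2)[OF _ lu(2) \<phi>] by simp
  qed (rule that)
  then have "AE t in ?L. u t = c + prim l ?V t" by eventually_elim (simp add: algebra_simps)
  then show ?thesis by (rule that)
qed

section \<open>Binary functions of bounded variation on an interval\<close>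

text \<open>This identifies the weak derivative of a Heaviside step as the unit point mass at
  s.\<close>

lemma integral_deriv_above:
  fixes \<phi> :: "real \<Rightarrow> real"
  assumes "\<phi> \<in> C1c U"
  shows "(LINT t|lborel. indicator {s..} t * frechet_derivative \<phi> (at t) 1) = - \<phi> s"
proof -
  obtain K where K: "compact K" "K \<subseteq> U" "\<And>x. x \<notin> K \<Longrightarrow> \<phi> x = 0"
    "\<And>x v. x \<notin> K \<Longrightarrow> frechet_derivative \<phi> (at x) v = 0"
    by (rule C1c_support[OF assms]) (rule that)
  obtain B where B: "\<And>x. x \<in> K \<Longrightarrow> norm x \<le> B" using K(1) by (meson bounded_iff compact_imp_bounded)
  define b where "b = max s (B + 1)"
  have b: "s \<le> b" "b \<notin> K" "\<And>t. b < t \<Longrightarrow> t \<notin> K" using B unfolding b_def by (fastforce simp: max_def split: if_splits)+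
  have D: "(\<phi> has_vector_derivative frechet_derivative \<phi> (at t) 1) (at t)" for t
  proof -
    have d: "(\<phi> has_derivative frechet_derivative \<phi> (at t)) (at t)"
      using C1c_C1_deriv[OF assms] by (simp add: C1_deriv_def)
    have "frechet_derivative \<phi> (at t) = (\<lambda>v. v *\<^sub>R frechet_derivative \<phi> (at t) 1)"
    proof (rule ext)
      show "frechet_derivative \<phi> (at t) v = v *\<^sub>R frechet_derivative \<phi> (at t) 1" for v
        using linear_simps(5)[OF has_derivative_bounded_linear[OF d], of v 1] by simp
    qed
    with d show ?thesis unfolding has_vector_derivative_def by simp
  qed
  have "(\<lambda>t. indicator {s..} t * frechet_derivative \<phi> (at t) 1) = (\<lambda>t. indicator {s..b} t *\<^sub>R frechet_derivative \<phi> (at t) 1)"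
  proof
    show "indicator {s..} t * frechet_derivative \<phi> (at t) 1 = indicator {s..b} t *\<^sub>R frechet_derivative \<phi> (at t) 1" for t
      using b(3)[of t] K(4)[of t 1] by (auto split: split_indicator)
  qed
  then show ?thesis
    using antiderivative_diff[OF C1c_continuous_deriv[OF assms] D b(1)] K(3)[OF b(2)] by simp
qed

text \<open>The measures in a decomposition live on the interval; pushed forward to the whole line
  they acquire a distribution function.\<close>

lemma finite_measure_distr_borel:
  assumes "finite_measure P" "sets P = sets (restrict_space borel U)"
  shows "finite_borel_measure (distr P borel (\<lambda>x::real. x))"
    and "\<And>A. A \<in> sets borel \<Longrightarrow> measure (distr P borel (\<lambda>x. x)) A = measure P (A \<inter> U)"
    and "\<And>\<phi>. continuous_on UNIV \<phi> \<Longrightarrow> integral\<^sup>L (distr P borel (\<lambda>x. x)) \<phi> = (integral\<^sup>L P \<phi> :: real)"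
proof -
  have m: "(\<lambda>x. x) \<in> measurable P borel"
    unfolding measurable_cong_sets[OF assms(2) refl] by (rule measurable_restrict_space1) simp
  interpret P: finite_measure P by fact
  have "finite_measure (distr P borel (\<lambda>x. x))" by (rule P.finite_measure_distr[OF m])
  then show "finite_borel_measure (distr P borel (\<lambda>x. x))"
    by (simp add: finite_borel_measure_def finite_borel_measure_axioms_def)
  show "measure (distr P borel (\<lambda>x. x)) A = measure P (A \<inter> U)" if "A \<in> sets borel" for A
    using that by (subst measure_distr[OF m]) (auto simp: space_restrict_borel[OF assms(2)])
  show "integral\<^sup>L (distr P borel (\<lambda>x. x)) \<phi> = integral\<^sup>L P \<phi>" if "continuous_on UNIV \<phi>" for \<phi> :: "real \<Rightarrow> real"
    by (rule integral_distr[OF m borel_measurable_continuous_onI[OF that]])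
qed

text \<open>A distribution function is a superposition of Heaviside steps: its value at t is the
  P-integral over s of \<open>indicator {s..} t\<close>. Exchanging the integrals reduces the claim
  to a single step, so the weak derivative of \<open>cdf P\<close> is P.\<close>

lemma integral_deriv_cdf:
  assumes "finite_borel_measure P" and \<phi>: "\<phi> \<in> C1c U"
  shows "(LINT t|lborel. frechet_derivative \<phi> (at t) 1 * cdf P t) = - integral\<^sup>L P \<phi>"
    and "integrable lborel (\<lambda>t. frechet_derivative \<phi> (at t) 1 * cdf P t)"
proof -
  interpret P: finite_borel_measure P by fact
  interpret pair_sigma_finite P lborel ..
  let ?d = "\<lambda>t. frechet_derivative \<phi> (at t) 1"
  have sP [measurable_cong]: "sets P = sets borel" by (rule P.M_is_borel)
  obtain K where K: "compact K" "K \<subseteq> U" "\<And>x. x \<notin> K \<Longrightarrow> \<phi> x = 0"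
    "\<And>x v. x \<notin> K \<Longrightarrow> frechet_derivative \<phi> (at x) v = 0"
    by (rule C1c_support[OF \<phi>]) (rule that)
  have dm [measurable]: "?d \<in> borel_measurable borel"
    by (rule borel_measurable_continuous_onI[OF C1c_continuous_deriv[OF \<phi>]])
  have di: "integrable lborel ?d" by (rule integrable_C1c_like[OF C1c_continuous_deriv[OF \<phi>] K(1,4)])
  let ?f = "\<lambda>(s, t). indicator {s..} t * ?d t"
  have ind [measurable]: "(\<lambda>(s :: real, t). indicator {s..} t :: real) \<in> borel_measurable (borel \<Otimes>\<^sub>M borel)"
  proof -
    have "(\<lambda>p. indicator {p. fst p \<le> snd p} p :: real) \<in> borel_measurable (borel \<Otimes>\<^sub>M borel :: (real \<times> real) measure)"
    proof (rule borel_measurable_indicator)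
      have "closed {p :: real \<times> real. fst p \<le> snd p}" by (intro closed_Collect_le continuous_intros)
      then show "{p. fst p \<le> snd p} \<in> sets (borel \<Otimes>\<^sub>M borel :: (real \<times> real) measure)"
        unfolding borel_prod by (rule borel_closed)
    qed
    then show ?thesis
      by (rule measurable_cong[THEN iffD1, rotated]) (auto split: split_indicator)
  qed
  have fm: "?f \<in> borel_measurable (P \<Otimes>\<^sub>M lborel)"
  proof -
    have "?f = (\<lambda>p. (case p of (s, t) \<Rightarrow> indicator {s..} t) * ?d (snd p))" by (auto simp: fun_eq_iff)
    moreover have "(\<lambda>p. (case p of (s, t) \<Rightarrow> indicator {s..} t) * ?d (snd p)) \<in> borel_measurable (borel \<Otimes>\<^sub>M borel)"
      by (intro borel_measurable_times ind measurable_compose[OF measurable_snd dm])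
    moreover have "sets (P \<Otimes>\<^sub>M lborel) = sets (borel \<Otimes>\<^sub>M borel :: (real \<times> real) measure)"
      by (intro sets_pair_measure_cong sP sets_lborel)
    ultimately show ?thesis by (simp cong: measurable_cong_sets)
  qed
  have fi: "integrable (P \<Otimes>\<^sub>M lborel) ?f"
  proof (rule Fubini_integrable[OF fm])
    have "AE s in P. integrable lborel (\<lambda>t. indicator {s..} t * ?d t)"
      using integrable_mult_indicator[OF _ di] by (intro AE_I2) simp
    then show "AE s in P. integrable lborel (\<lambda>t. case (s, t) of (s, t) \<Rightarrow> indicator {s..} t * ?d t)" by simp
    have le: "(LINT t|lborel. norm (indicator {s..} t * ?d t)) \<le> (LINT t|lborel. norm (?d t))" for s
      using di integrable_mult_indicator[OF _ di, of "{s..}"]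
      by (intro integral_mono integrable_norm) (auto split: split_indicator)
    show "integrable P (\<lambda>s. LINT t|lborel. norm (case (s, t) of (s, t) \<Rightarrow> indicator {s..} t * ?d t))"
    proof (rule P.integrable_const_bound)
      show "AE s in P. norm (LINT t|lborel. norm (case (s, t) of (s, t) \<Rightarrow> indicator {s..} t * ?d t)) \<le> (LINT t|lborel. norm (?d t))"
        using le by (intro AE_I2) (simp add: integral_nonneg_AE)
      have "(\<lambda>p. norm (?f p)) \<in> borel_measurable (P \<Otimes>\<^sub>M lborel)" using fm by measurable
      then show "(\<lambda>s. LINT t|lborel. norm (case (s, t) of (s, t) \<Rightarrow> indicator {s..} t * ?d t)) \<in> borel_measurable P"
        by (intro lborel.borel_measurable_lebesgue_integral) (simp add: split_beta')
    qed
  qed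
  have inner: "(LINT s|P. indicator {s..} t * ?d t) = ?d t * cdf P t" for t
  proof -
    have "(LINT s|P. indicator {s..} t * ?d t) = (LINT s|P. ?d t * indicator {..t} s)"
      by (intro Bochner_Integration.integral_cong) (auto split: split_indicator)
    also have "\<dots> = ?d t * cdf P t" by (simp add: cdf_def)
    finally show ?thesis .
  qed
  have "(LINT t|lborel. LINT s|P. indicator {s..} t * ?d t) = (LINT s|P. LINT t|lborel. indicator {s..} t * ?d t)"
    by (rule Fubini_integral) (use fi in simp)
  then show "(LINT t|lborel. ?d t * cdf P t) = - integral\<^sup>L P \<phi>"
    unfolding inner integral_deriv_above[OF \<phi>] by simp
  have "integrable lborel (\<lambda>t. LINT s|P. ?f (s, t))" by (rule integrable_snd) (use fi in simp)
  then show "integrable lborel (\<lambda>t. ?d t * cdf P t)" by (simp only: prod.case inner)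
qed

lemma tendsto_cdf_at_left: "finite_borel_measure M \<Longrightarrow> (cdf M \<longlongrightarrow> cdf M a - measure M {a}) (at_left a)"
proof -
  assume "finite_borel_measure M"
  then interpret finite_borel_measure M .
  have "measure M {..a} = measure M {..<a} + measure M {a}"
    by (subst finite_measure_Union[symmetric]) (auto simp: ivl_disj_un_singleton(2)[symmetric] M_is_borel)
  then show ?thesis using cdf_at_left[of a] by (simp add: cdf_def)
qed

text \<open>A one-sided limit outside the closed set C would keep G outside C on an interval of
  positive length, against the hypothesis almost everywhere.\<close>

lemma closed_AE_right_limit:
  fixes G :: "real \<Rightarrow> real"
  assumes "AE t in lebesgue_on {0<..<l}. G t \<in> C" "closed C" "0 < l" "(G \<longlongrightarrow> y) F"
    "F = at_right t \<and> 0 \<le> t \<and> t < l \<or> F = at_left t \<and> 0 < t \<and> t \<le> l"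
  shows "y \<in> C"
proof (rule ccontr)
  assume "y \<notin> C"
  then have "\<forall>\<^sub>F s in F. G s \<in> - C"
    using topological_tendstoD[OF assms(4), of "- C"] assms(2) by auto
  then obtain a b where ab: "0 \<le> a" "a < b" "b \<le> l" "\<And>s. a < s \<Longrightarrow> s < b \<Longrightarrow> G s \<notin> C"
  proof -
    assume ev: "\<forall>\<^sub>F s in F. G s \<in> - C" and *: "\<And>a b. 0 \<le> a \<Longrightarrow> a < b \<Longrightarrow> b \<le> l \<Longrightarrow> (\<And>s. a < s \<Longrightarrow> s < b \<Longrightarrow> G s \<notin> C) \<Longrightarrow> thesis"
    from assms(5) show thesis
    proof
      assume F: "F = at_right t \<and> 0 \<le> t \<and> t < l"
      then obtain b where "b > t" "\<And>s. t < s \<Longrightarrow> s < b \<Longrightarrow> G s \<in> - C"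
        using ev by (auto simp: eventually_at_right_field)
      then show thesis using F by (intro *[of t "min b l"]) auto
    next
      assume F: "F = at_left t \<and> 0 < t \<and> t \<le> l"
      then obtain b where "b < t" "\<And>s. b < s \<Longrightarrow> s < t \<Longrightarrow> G s \<in> - C"
        using ev by (auto simp: eventually_at_left_field)
      then show thesis using F by (intro *[of "max b 0" t]) auto
    qed
  qed
  have "AE s in lborel. s \<in> {0<..<l} \<longrightarrow> G s \<in> C" using assms(1) by (subst (asm) AE_lebesgue_on) auto
  then have "AE s in lborel. s \<notin> {a<..<b}"
    by eventually_elim (use ab in auto)
  then have "emeasure lborel {a<..<b} = 0"
    by (subst (asm) AE_iff_measurable[of "{a<..<b}"]) auto
  then show False using ab(2) by simp
qed

text \<open>Integrating the derivative measure gives a representative with one-sided limits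
  everywhere. Both limits are 0 or 1, so each atom has size 1 and the finite total mass admits only
  finitely many. With the jumps removed, a continuous function with finitely many values on an
  interval remains, which is constant; hence the derivative has no diffuse part.\<close>

lemma BV01_interval_jumps:
  fixes w :: "real \<Rightarrow> real"
  assumes l: "0 < l" and w: "w \<in> BV01 {0<..<l}"
  obtains J :: "real set" and s :: "real \<Rightarrow> real" and c where "finite J" "J \<subseteq> {0<..<l}"
    "\<And>t. t \<in> J \<Longrightarrow> \<bar>s t\<bar> = 1"
    "AE t in lebesgue_on {0<..<l}. w t = c + (\<Sum>r\<in>J. s r * indicator {r..} t)"
proof -
  let ?I = "{0<..<l}" and ?L = "lebesgue_on {0<..<l}"
  interpret L: finite_measure ?L by (rule finite_measure_lebesgue_on[OF interval_lmeasurable])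
  have wBV: "w \<in> BV ?I" and w01: "AE t in ?L. w t \<in> {0, 1}" using w by (auto simp: BV01_def)
  have wi: "integrable ?L w" using wBV by (simp add: BV_def)
  note h = has_derivative_measure_derivative_measure[OF wBV]
  obtain P0 N0 where PN: "finite_measure P0" "finite_measure N0"
    "sets P0 = sets (restrict_space borel ?I)" "sets N0 = sets (restrict_space borel ?I)"
    "\<And>E. E \<in> sets (restrict_space borel ?I) \<Longrightarrow> derivative_measure ?I w E \<bullet> 1 = measure P0 E - measure N0 E"
    "\<And>\<phi> :: real \<Rightarrow> real. \<phi> \<in> C1c ?I \<Longrightarrow> integral\<^sup>L P0 \<phi> - integral\<^sup>L N0 \<phi>
      = - (LINT x|?L. w x * frechet_derivative \<phi> (at x) 1)"
    by (rule has_derivative_measure_decomposition[OF h, of 1]) (simp, rule that)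
  define P N where "P = distr P0 borel (\<lambda>x. x)" and "N = distr N0 borel (\<lambda>x. x)"
  note dP = finite_measure_distr_borel[OF PN(1,3), folded P_def] and dN = finite_measure_distr_borel[OF PN(2,4), folded N_def]
  interpret P: finite_borel_measure P by (rule dP(1))
  interpret N: finite_borel_measure N by (rule dN(1))
  define g where "g t = cdf P t - cdf N t" for t
  have cm: "cdf M \<in> borel_measurable borel" if "finite_borel_measure M" for M
    by (rule borel_measurable_mono) (auto simp: mono_def intro: finite_borel_measure.cdf_nondecreasing[OF that])
  have gm: "g \<in> borel_measurable ?L"
    unfolding g_def[abs_def]
    by (intro measurable_restrict_space1 measurable_completion borel_measurable_diff)
      (use cm[OF dP(1)] cm[OF dN(1)] in simp_all)
  have gi: "integrable ?L g"
  proof (rule L.integrable_const_bound[OF AE_I2 gm])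
    fix t
    show "norm (g t) \<le> measure P (space P) + measure N (space N)"
      using P.cdf_bounded[of t] N.cdf_bounded[of t] P.cdf_nonneg[of t] N.cdf_nonneg[of t] by (simp add: g_def)
  qed
  \<comment> \<open>The function w and the difference g of the distribution functions have the same
    weak derivative.\<close>
  obtain c where c: "AE t in ?L. w t - g t = c"
  proof (rule du_Bois_Reymond[OF l, of "\<lambda>t. w t - g t"])
    show "integrable ?L (\<lambda>t. w t - g t)" using wi gi by simp
    fix \<phi> :: "real \<Rightarrow> real" assume \<phi>: "\<phi> \<in> C1c ?I"
    let ?d = "\<lambda>t. frechet_derivative \<phi> (at t) 1"
    obtain K where K: "compact K" "K \<subseteq> ?I" "\<And>x. x \<notin> K \<Longrightarrow> \<phi> x = 0"
      "\<And>x v. x \<notin> K \<Longrightarrow> frechet_derivative \<phi> (at x) v = 0"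
      by (rule C1c_support[OF \<phi>]) (rule that)
    have z: "?d t = 0" if "t \<notin> ?I" for t using K(2,4) that by blast
    have "(LINT t|?L. ?d t * g t) = (LINT t|lborel. ?d t * g t)"
    proof -
      have "(LINT t|?L. ?d t * g t) = (LINT t|lebesgue. ?d t * g t)"
        using z by (subst integral_lebesgue_on) (auto intro!: Bochner_Integration.integral_cong split: split_indicator)
      also have "\<dots> = (LINT t|lborel. ?d t * g t)"
      proof (intro integral_completion)
        have "(\<lambda>t. ?d t * g t) \<in> borel_measurable borel"
          unfolding g_def
          by (intro borel_measurable_times borel_measurable_diff cm dP(1) dN(1)
              borel_measurable_continuous_onI C1c_continuous_deriv[OF \<phi>])
        then show "(\<lambda>t. ?d t * g t) \<in> borel_measurable lborel" by simp
      qed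
      finally show ?thesis .
    qed
    also have "\<dots> = (LINT t|lborel. ?d t * cdf P t - ?d t * cdf N t)" by (simp add: g_def algebra_simps)
    also have "\<dots> = - (integral\<^sup>L P \<phi> - integral\<^sup>L N \<phi>)"
      using integral_deriv_cdf[OF dP(1) \<phi>] integral_deriv_cdf[OF dN(1) \<phi>] by simp
    also have "\<dots> = (LINT t|?L. w t * ?d t)"
      using PN(6)[OF \<phi>] dP(3)[OF C1c_continuous[OF \<phi>]] dN(3)[OF C1c_continuous[OF \<phi>]] by simp
    finally have e: "(LINT t|?L. ?d t * g t) = (LINT t|?L. w t * ?d t)" .
    have "integrable ?L (\<lambda>t. ?d t *\<^sub>R w t)" "integrable ?L (\<lambda>t. ?d t *\<^sub>R g t)"
      by (rule integrable_C1c_scaleR(2)[OF _ locally_integrable_if_integrable[OF _ wi] \<phi>]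
          integrable_C1c_scaleR(2)[OF _ locally_integrable_if_integrable[OF _ gi] \<phi>]; simp)+
    then show "(LINT t|?L. ?d t *\<^sub>R (w t - g t)) = 0"
      using e by (simp add: left_diff_distrib mult.commute)
  qed (rule that)
  define G where "G t = c + g t" for t
  have wG: "AE t in ?L. w t = G t" using c by eventually_elim (simp add: G_def)
  have G01: "AE t in ?L. G t \<in> {0, 1}" using wG w01 by eventually_elim simp
  define \<mu> where "\<mu> t = measure P {t} - measure N {t}" for t
  have Gr: "(G \<longlongrightarrow> G t) (at_right t)" for t
    unfolding G_def g_def using P.cdf_is_right_cont[of t] N.cdf_is_right_cont[of t]
    by (intro tendsto_intros) (auto simp: continuous_within)
  have Gl: "(G \<longlongrightarrow> G t - \<mu> t) (at_left t)" for t
  proof -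
    have "((\<lambda>t. c + (cdf P t - cdf N t)) \<longlongrightarrow> c + ((cdf P t - measure P {t}) - (cdf N t - measure N {t}))) (at_left t)"
      by (intro tendsto_intros tendsto_cdf_at_left dP(1) dN(1))
    then show ?thesis unfolding G_def[abs_def] g_def \<mu>_def by (simp add: algebra_simps)
  qed
  \<comment> \<open>The right limit is G t itself, the left limit is smaller by the atom \<mu> t;
    both inherit the closed value set {0, 1}.\<close>
  have v01: "G t \<in> {0, 1}" "G t - \<mu> t \<in> {0, 1}" if "t \<in> ?I" for t
    using that closed_AE_right_limit[OF G01 _ l Gr[of t], of t] closed_AE_right_limit[OF G01 _ l Gl[of t], of t]
    by auto
  define J where "J = {t \<in> ?I. \<mu> t \<noteq> 0}"
  have s1: "\<bar>\<mu> t\<bar> = 1" if "t \<in> J" for t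
    using that v01[of t] by (auto simp: J_def)
  have J: "J \<subseteq> ?I" by (auto simp: J_def)
  have finJ: "finite J"
  proof (rule ccontr)
    assume inf: "infinite J"
    \<comment> \<open>An integer above the total mass: that many atoms of size 1 cannot
      exist.\<close>
    define n where "n = nat \<lceil>measure P (space P) + measure N (space N)\<rceil> + 1"
    obtain F where F: "F \<subseteq> J" "finite F" "card F = n" using infinite_arbitrarily_large[OF inf] by metis
    have sum: "(\<Sum>t\<in>F. measure M {t}) = measure M F" if "finite_borel_measure M" for M
    proof -
      interpret M: finite_borel_measure M by fact
      show ?thesis using F(2) by (intro M.finite_measure_eq_sum_singleton[symmetric]) auto
    qed
    have "real n = (\<Sum>t\<in>F. 1)" using F(3) by simp
    also have "\<dots> \<le> (\<Sum>t\<in>F. measure P {t} + measure N {t})"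
    proof (rule sum_mono)
      fix t assume "t \<in> F"
      then have "\<bar>\<mu> t\<bar> = 1" using F(1) s1 by auto
      then show "1 \<le> measure P {t} + measure N {t}"
        unfolding \<mu>_def using measure_nonneg[of P "{t}"] measure_nonneg[of N "{t}"] by linarith
    qed
    also have "\<dots> = measure P F + measure N F" using sum[OF dP(1)] sum[OF dN(1)] by (simp add: sum.distrib)
    also have "\<dots> \<le> measure P (space P) + measure N (space N)"
      by (intro add_mono P.bounded_measure N.bounded_measure)
    also have "\<dots> < real n" unfolding n_def by linarith
    finally show False by simp
  qed
  define S where "S t = (\<Sum>r\<in>J. \<mu> r * indicator {r..} t)" for t
  have ind_r: "((\<lambda>x. indicator {r..} x :: real) \<longlongrightarrow> indicator {r..} t) (at_right t)" for r t :: real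
  proof (rule tendsto_eventually)
    show "\<forall>\<^sub>F x in at_right t. indicator {r..} x = (indicator {r..} t :: real)"
    proof (cases "r \<le> t")
      case True
      show ?thesis using eventually_at_right_less[of t] by eventually_elim (use True in \<open>auto split: split_indicator\<close>)
    next
      case False
      then have "\<forall>\<^sub>F x in at_right t. x < r" by (intro eventually_at_right_field[THEN iffD2] exI[of _ r]) auto
      then show ?thesis by eventually_elim (use False in \<open>auto split: split_indicator\<close>)
    qed
  qed
  have ind_l: "((\<lambda>x. indicator {r..} x :: real) \<longlongrightarrow> indicator {r..} t - (if r = t then 1 else 0)) (at_left t)" for r t :: real
  proof (rule tendsto_eventually)
    show "\<forall>\<^sub>F x in at_left t. indicator {r..} x = (indicator {r..} t - (if r = t then 1 else 0) :: real)"
    proof (cases "r < t")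
      case True
      then have "\<forall>\<^sub>F x in at_left t. r < x" by (intro eventually_at_left_field[THEN iffD2] exI[of _ r]) auto
      then show ?thesis by eventually_elim (use True in \<open>auto split: split_indicator\<close>)
    next
      case False
      have "\<forall>\<^sub>F x in at_left t. x < t" by (intro eventually_at_left_field[THEN iffD2] exI[of _ "t - 1"]) auto
      then show ?thesis by eventually_elim (use False in \<open>auto split: split_indicator\<close>)
    qed
  qed
  have "continuous_on ?I (\<lambda>t. G t - S t)"
  proof (rule continuous_at_imp_continuous_on, rule ballI)
    fix t assume t: "t \<in> ?I"
    have r: "((\<lambda>t. G t - S t) \<longlongrightarrow> G t - S t) (at_right t)"
      unfolding S_def by (intro tendsto_intros Gr ind_r)
    have "((\<lambda>t. G t - S t) \<longlongrightarrow> (G t - \<mu> t) - (\<Sum>r\<in>J. \<mu> r * (indicator {r..} t - (if r = t then 1 else 0)))) (at_left t)"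
      unfolding S_def by (intro tendsto_intros Gl ind_l)
    moreover have "(\<Sum>r\<in>J. \<mu> r * (indicator {r..} t - (if r = t then 1 else 0))) = S t - \<mu> t"
    proof -
      have "(\<Sum>r\<in>J. \<mu> r * (if r = t then 1 else 0)) = (\<Sum>r\<in>J. if r = t then \<mu> r else 0)"
        by (intro sum.cong) auto
      also have "\<dots> = \<mu> t" using finJ t by (simp add: J_def)
      finally show ?thesis by (simp add: S_def right_diff_distrib sum_subtractf)
    qed
    ultimately have l: "((\<lambda>t. G t - S t) \<longlongrightarrow> G t - S t) (at_left t)" by simp
    show "isCont (\<lambda>t. G t - S t) t"
      unfolding isCont_def filterlim_at_split using r l by simp
  qed
  \<comment> \<open>G takes only the values 0 and 1, and S only the sums of \<mu> over subsets of
    the finite set J.\<close>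
  moreover have "finite ((\<lambda>t. G t - S t) ` ?I)"
  proof (rule finite_subset)
    let ?A = "(\<lambda>(x, A). x - (\<Sum>r\<in>A. \<mu> r)) ` ({0, 1} \<times> Pow J)"
    show "finite ?A" using finJ by auto
    have "G t - S t \<in> ?A" if "t \<in> ?I" for t
    proof -
      have "S t = (\<Sum>r\<in>J \<inter> {..t}. \<mu> r)"
      proof -
        have "S t = (\<Sum>r\<in>J. if r \<in> {..t} then \<mu> r else 0)"
          unfolding S_def by (intro sum.cong) (auto split: split_indicator)
        then show ?thesis using sum.inter_restrict[OF finJ, of \<mu> "{..t}"] by simp
      qed
      then have "G t - S t = (\<lambda>(x, A). x - (\<Sum>r\<in>A. \<mu> r)) (G t, J \<inter> {..t})" by simp
      then show ?thesis using v01(1)[OF that] by (intro image_eqI[of _ _ "(G t, J \<inter> {..t})"]) auto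
    qed
    then show "(\<lambda>t. G t - S t) ` ?I \<subseteq> ?A" by auto
  qed
  ultimately have "(\<lambda>t. G t - S t) constant_on ?I"
    by (intro continuous_finite_range_constant) auto
  then obtain d where d: "\<And>t. t \<in> ?I \<Longrightarrow> G t - S t = d" by (auto simp: constant_on_def)
  show ?thesis
  proof (rule that[of J \<mu> d, OF finJ J s1])
    have "AE t in ?L. t \<in> ?I" using AE_space[of ?L] by simp
    with wG show "AE t in ?L. w t = d + (\<Sum>r\<in>J. \<mu> r * indicator {r..} t)"
    proof eventually_elim
      fix t assume "w t = G t" "t \<in> ?I"
      then show "w t = d + (\<Sum>r\<in>J. \<mu> r * indicator {r..} t)" using d[of t] by (simp add: S_def)
    qed
  qed
qed

section \<open>Functions of the axial variable on the cylinder\<close>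

text \<open>Cylindrical bookkeeping of coordinates: the cross section is the first factor and the
  height the second, so that in Fubini's theorem the axial variable is integrated on the
  inside.\<close>

definition cyl_point :: "(real \<times> real) \<times> real \<Rightarrow> real^3" where
  "cyl_point p = (\<chi> i. if i = 1 then fst (fst p) else if i = 2 then snd (fst p) else snd p)"

lemma cyl_point_nth [simp]:
  "cyl_point ((a, b), c) $ 1 = a" "cyl_point ((a, b), c) $ 2 = b" "cyl_point ((a, b), c) $ 3 = c"
  by (simp_all add: cyl_point_def)

lemma continuous_cyl_point: "continuous_on A cyl_point"
  unfolding cyl_point_def[abs_def]
proof (rule continuous_on_vec_lambda)
  fix i :: 3
  show "continuous_on A (\<lambda>p :: (real \<times> real) \<times> real. if i = 1 then fst (fst p) else if i = 2 then snd (fst p) else snd p)"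
    by (cases "i = 1"; cases "i = 2") (auto intro!: continuous_intros)
qed

lemma Basis_real3: "(Basis :: (real^3) set) = {axis 1 1, axis 2 1, axis 3 1}"
proof -
  have "(Basis :: (real^3) set) = (\<lambda>i. axis i 1) ` UNIV" by (auto simp: Basis_vec_def)
  then show ?thesis by (simp add: UNIV_3)
qed

lemma axis_in_Basis3 [simp]: "axis i 1 \<in> (Basis :: (real^3) set)"
  by (auto simp: Basis_vec_def)

lemma lborel_eq_distr_cyl_point: "distr lborel borel cyl_point = lborel"
proof (rule lborel_eqI[symmetric])
  have m: "cyl_point \<in> measurable lborel borel"
    using borel_measurable_continuous_onI[OF continuous_cyl_point] by simp
  fix l u :: "real^3" assume le: "\<And>b. b \<in> Basis \<Longrightarrow> l \<bullet> b \<le> u \<bullet> b"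
  have l: "l $ i \<le> u $ i" for i using le[of "axis i 1"] by (simp add: inner_axis)
  have "cyl_point -` box l u = ({l $ 1<..<u $ 1} \<times> {l $ 2<..<u $ 2}) \<times> {l $ 3<..<u $ 3}"
    by (auto simp: mem_box_cart forall_3)
  then have "emeasure (distr lborel borel cyl_point) (box l u) =
      emeasure (lborel \<Otimes>\<^sub>M lborel) (({l $ 1<..<u $ 1} \<times> {l $ 2<..<u $ 2}) \<times> {l $ 3<..<u $ 3})"
    by (subst emeasure_distr[OF m]) (auto simp: lborel_prod)
  also have "\<dots> = emeasure (lborel \<Otimes>\<^sub>M lborel) ({l $ 1<..<u $ 1} \<times> {l $ 2<..<u $ 2}) * ennreal (u $ 3 - l $ 3)"
    using l by (subst lborel.emeasure_pair_measure_Times) (auto simp: lborel_prod intro!: borel_open open_Times)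
  also have "\<dots> = ennreal (u $ 1 - l $ 1) * ennreal (u $ 2 - l $ 2) * ennreal (u $ 3 - l $ 3)"
    using l by (subst lborel.emeasure_pair_measure_Times) auto
  also have "\<dots> = ennreal (\<Prod>b\<in>Basis. (u - l) \<bullet> b)"
    using l by (simp add: Basis_real3 axis_eq_axis inner_axis ennreal_mult[symmetric] mult.assoc)
  finally show "emeasure (distr lborel borel cyl_point) (box l u) = ennreal (\<Prod>b\<in>Basis. (u - l) \<bullet> b)" .
qed simp

definition disc :: "(real \<times> real) set" where "disc = ball 0 1"

lemma mem_disc: "(a, b) \<in> disc \<longleftrightarrow> a\<^sup>2 + b\<^sup>2 < 1"
  by (simp add: disc_def dist_norm norm_Pair real_sqrt_less_iff real_sqrt_lt_1_iff)

lemma emeasure_disc: "emeasure lborel disc = ennreal pi"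
  unfolding disc_def by (subst emeasure_ball) (auto simp: unit_ball_vol_2)

lemma disc_sets [simp, measurable]: "disc \<in> sets borel"
  by (simp add: disc_def)

lemma cyl_point_in_cylinder: "cyl_point (y, t) \<in> cylinder l \<longleftrightarrow> y \<in> disc \<and> t \<in> {0<..<l}"
  by (cases y) (simp add: cylinder_def mem_disc)

lemma continuous_on_nth [continuous_intros]: "continuous_on A (\<lambda>x::real^3. x $ i)"
  by (intro continuous_on_component continuous_on_id)

lemma cylinder_open: "open (cylinder l)"
  unfolding cylinder_def by (intro open_Collect_conj open_Collect_less continuous_intros)

lemma cylinder_bounded: "bounded (cylinder l)"
proof -
  have "norm x \<le> 2 + l" if "x \<in> cylinder l" for x
  proof -
    have a: "\<bar>x $ 1\<bar> \<le> 1" "\<bar>x $ 2\<bar> \<le> 1"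
      using that by (auto simp: cylinder_def abs_square_le_1[symmetric])
        (smt (verit) zero_le_power2)+
    have "norm x \<le> (\<Sum>i\<in>UNIV. \<bar>x $ i\<bar>)" by (rule norm_le_l1_cart)
    also have "\<dots> \<le> 2 + l" using a that by (simp add: sum_3 cylinder_def)
    finally show ?thesis .
  qed
  then show ?thesis by (auto simp: bounded_iff)
qed

lemma cylinder_lmeasurable: "cylinder l \<in> lmeasurable"
  by (rule bounded_set_imp_lmeasurable[OF cylinder_bounded]) (simp add: cylinder_open)

lemma cylinder_sets [simp]: "cylinder l \<in> sets borel" "cylinder l \<in> sets lebesgue"
  using cylinder_open[of l] by simp_all

text \<open>The cylinder is the product of disc and interval, so each Borel set of heights is
  weighted with the area pi of the disc. The factor pi of the bulk integrals originates
  here.\<close>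

lemma distr_axial:
  "distr (restrict_space lborel (cylinder l)) borel (\<lambda>x. x $ 3) =
    density lborel (\<lambda>t. ennreal (pi * indicator {0<..<l} t))"
proof (rule measure_eqI)
  have m3: "(\<lambda>x::real^3. x $ 3) \<in> borel_measurable borel"
    by (rule borel_measurable_continuous_onI[OF continuous_on_nth])
  have m: "(\<lambda>x::real^3. x $ 3) \<in> measurable (restrict_space lborel (cylinder l)) borel"
    by (rule measurable_restrict_space1) (use m3 in simp)
  fix A :: "real set" assume "A \<in> sets (distr (restrict_space lborel (cylinder l)) borel (\<lambda>x. x $ 3))"
  then have A: "A \<in> sets borel" by simp
  have dm: "disc \<in> sets (borel \<Otimes>\<^sub>M borel)" unfolding borel_prod by simp
  have vA: "(\<lambda>x::real^3. x $ 3) -` A \<in> sets borel" using measurable_sets[OF m3 A] by simp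
  have "emeasure (distr (restrict_space lborel (cylinder l)) borel (\<lambda>x. x $ 3)) A
    = emeasure lborel ((\<lambda>x. x $ 3) -` A \<inter> cylinder l)"
    using A by (subst emeasure_distr[OF m])
      (auto simp: space_restrict_space emeasure_restrict_space)
  also have "\<dots> = emeasure (distr lborel borel cyl_point) ((\<lambda>x. x $ 3) -` A \<inter> cylinder l)"
    by (simp add: lborel_eq_distr_cyl_point)
  also have "\<dots> = emeasure lborel (cyl_point -` ((\<lambda>x. x $ 3) -` A \<inter> cylinder l))"
    using vA borel_measurable_continuous_onI[OF continuous_cyl_point] by (subst emeasure_distr) auto
  also have "cyl_point -` ((\<lambda>x. x $ 3) -` A \<inter> cylinder l) = disc \<times> (A \<inter> {0<..<l})"
    by (auto simp: cyl_point_in_cylinder)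
  also have "emeasure lborel (disc \<times> (A \<inter> {0<..<l})) = ennreal pi * emeasure lborel (A \<inter> {0<..<l})"
    using A dm unfolding lborel_prod[symmetric]
    by (subst lborel.emeasure_pair_measure_Times) (auto simp: lborel_prod emeasure_disc)
  also have "\<dots> = (\<integral>\<^sup>+t. ennreal pi * indicator (A \<inter> {0<..<l}) t \<partial>lborel)"
    using A by (subst nn_integral_cmult_indicator) auto
  also have "\<dots> = emeasure (density lborel (\<lambda>t. ennreal (pi * indicator {0<..<l} t))) A"
    using A by (subst emeasure_density) (auto intro!: nn_integral_cong split: split_indicator)
  finally show "emeasure (distr (restrict_space lborel (cylinder l)) borel (\<lambda>x. x $ 3)) A =
    emeasure (density lborel (\<lambda>t. ennreal (pi * indicator {0<..<l} t))) A" .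
qed simp

text \<open>A Lebesgue measurable function of the height need not compose measurably with a Borel
  map such as the projection to the axis. After a change on a null set it does, and
  \<open>AE_axial\<close> shows that this null set lifts to a null set of the cylinder.\<close>

lemma lebesgue_borel_version:
  fixes h :: "'a::euclidean_space \<Rightarrow> 'b::euclidean_space"
  assumes "h \<in> borel_measurable (lebesgue_on S)" and S: "S \<in> sets lebesgue"
  obtains h' where "h' \<in> borel_measurable borel" "AE x in lebesgue_on S. h x = h' x"
proof -
  have "(\<lambda>x. indicator S x *\<^sub>R h x) \<in> borel_measurable lebesgue"
    using assms by (subst borel_measurable_restrict_space_iff[symmetric]) auto
  then have "\<forall>i. \<exists>g. g \<in> borel_measurable lborel \<and> (AE x in lborel. (indicator S x *\<^sub>R h x) \<bullet> i = g x)"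
  proof (intro allI)
    fix i :: 'b
    have "(\<lambda>x. (indicator S x *\<^sub>R h x) \<bullet> i) \<in> borel_measurable lebesgue"
      using \<open>(\<lambda>x. indicator S x *\<^sub>R h x) \<in> borel_measurable lebesgue\<close> by (intro borel_measurable_inner) auto
    from completion_ex_borel_measurable_real[OF this]
    show "\<exists>g. g \<in> borel_measurable lborel \<and> (AE x in lborel. (indicator S x *\<^sub>R h x) \<bullet> i = g x)" by blast
  qed
  from choice[OF this] obtain g where
    g: "\<forall>i. g i \<in> borel_measurable lborel \<and> (AE x in lborel. (indicator S x *\<^sub>R h x) \<bullet> i = g i x)" by (rule exE)
  show ?thesis
  proof (rule that[of "\<lambda>x. \<Sum>i\<in>Basis. g i x *\<^sub>R i"])
    show "(\<lambda>x. \<Sum>i\<in>Basis. g i x *\<^sub>R i) \<in> borel_measurable borel"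
      using g by (intro borel_measurable_sum borel_measurable_scaleR) auto
    have "AE x in lborel. \<forall>i\<in>Basis. (indicator S x *\<^sub>R h x) \<bullet> i = g i x"
      using g by (intro AE_finite_allI) auto
    then have "AE x in lborel. x \<in> S \<longrightarrow> h x = (\<Sum>i\<in>Basis. g i x *\<^sub>R i)"
    proof eventually_elim
      fix x assume *: "\<forall>i\<in>Basis. (indicator S x *\<^sub>R h x) \<bullet> i = g i x"
      show "x \<in> S \<longrightarrow> h x = (\<Sum>i\<in>Basis. g i x *\<^sub>R i)"
      proof
        assume "x \<in> S"
        then have "(\<Sum>i\<in>Basis. g i x *\<^sub>R i) = (\<Sum>i\<in>Basis. (h x \<bullet> i) *\<^sub>R i)"
          using * by (intro sum.cong) auto
        then show "h x = (\<Sum>i\<in>Basis. g i x *\<^sub>R i)" by (simp add: euclidean_representation)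
      qed
    qed
    then show "AE x in lebesgue_on S. h x = (\<Sum>i\<in>Basis. g i x *\<^sub>R i)" using S by (simp add: AE_lebesgue_on)
  qed
qed

lemma AE_axial:
  assumes "AE t in lebesgue_on {0<..<l}. P t"
  shows "AE x in lebesgue_on (cylinder l). P (x $ 3)"
proof -
  have m: "(\<lambda>x::real^3. x $ 3) \<in> measurable (restrict_space lborel (cylinder l)) borel"
    by (rule measurable_restrict_space1)
      (use borel_measurable_continuous_onI[OF continuous_on_nth] in simp)
  have "AE t in lborel. t \<in> {0<..<l} \<longrightarrow> P t" using assms by (subst (asm) AE_lebesgue_on) auto
  then have "AE t in density lborel (\<lambda>t. ennreal (pi * indicator {0<..<l} t)). P t"
    by (subst AE_density) (auto split: split_indicator elim!: eventually_mono)
  then have "AE x in restrict_space lborel (cylinder l). P (x $ 3)"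
    unfolding distr_axial[symmetric] by (rule AE_distrD[OF m])
  then show ?thesis
    by (simp add: AE_lebesgue_on) (simp add: AE_restrict_space_iff)
qed

lemma measurable_axial:
  fixes h :: "real \<Rightarrow> 'b::euclidean_space"
  assumes "h \<in> borel_measurable (lebesgue_on {0<..<l})"
  shows "(\<lambda>x. h (x $ 3)) \<in> borel_measurable (lebesgue_on (cylinder l))"
proof -
  obtain h' where h': "h' \<in> borel_measurable borel" "AE t in lebesgue_on {0<..<l}. h t = h' t"
    by (rule lebesgue_borel_version[OF assms]) (simp, rule that)
  have "(\<lambda>x::real^3. h' (x $ 3)) \<in> borel_measurable borel"
    by (rule measurable_compose[OF borel_measurable_continuous_onI[OF continuous_on_nth] h'(1)])
  then have "(\<lambda>x::real^3. h' (x $ 3)) \<in> borel_measurable lborel" by simp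
  then have "(\<lambda>x::real^3. h' (x $ 3)) \<in> borel_measurable (lebesgue_on (cylinder l))"
    by (intro measurable_restrict_space1) (rule measurable_completion)
  then show ?thesis
  proof (rule borel_measurable_lebesgue_on_AE_cong[rotated])
    show "AE x in lebesgue_on (cylinder l). h' (x $ 3) = h (x $ 3)"
      by (rule AE_axial) (use h'(2) in \<open>auto elim!: eventually_mono\<close>)
  qed simp
qed

lemma integral_axial:
  fixes h :: "real \<Rightarrow> 'b::euclidean_space"
  assumes "integrable (lebesgue_on {0<..<l}) h"
  shows "integrable (lebesgue_on (cylinder l)) (\<lambda>x. h (x $ 3))"
    and "(LINT x|lebesgue_on (cylinder l). h (x $ 3)) = pi *\<^sub>R (LINT t|lebesgue_on {0<..<l}. h t)"
proof -
  let ?O = "lebesgue_on (cylinder l)" and ?L = "lebesgue_on {0<..<l}"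
  have hm: "h \<in> borel_measurable ?L" using assms by simp
  obtain h' where h': "h' \<in> borel_measurable borel" "AE t in ?L. h t = h' t"
    by (rule lebesgue_borel_version[OF hm]) (simp, rule that)
  have m: "(\<lambda>x::real^3. x $ 3) \<in> measurable (restrict_space lborel (cylinder l)) borel"
    by (rule measurable_restrict_space1)
      (use borel_measurable_continuous_onI[OF continuous_on_nth] in simp)
  have h'L: "h' \<in> borel_measurable ?L"
    by (intro measurable_restrict_space1) (rule measurable_completion, use h'(1) in simp)
  have "integrable ?L h'" by (rule integrable_cong_AE_imp[OF assms h'L]) (use h'(2) in \<open>auto elim!: eventually_mono\<close>)
  then have "integrable lebesgue (\<lambda>t. indicator {0<..<l} t *\<^sub>R h' t)" by (subst (asm) integrable_lebesgue_on) auto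
  then have hi: "integrable lborel (\<lambda>t. indicator {0<..<l} t *\<^sub>R h' t)"
    using h'(1) by (subst (asm) integrable_completion) auto
  have ind: "(\<lambda>t. pi * indicator {0<..<l} t) \<in> borel_measurable lborel" by simp
  have pi_ind: "(pi * indicator {0<..<l} t) *\<^sub>R h' t = pi *\<^sub>R (indicator {0<..<l} t *\<^sub>R h' t)" for t by simp
  have den: "integrable (density lborel (\<lambda>t. ennreal (pi * indicator {0<..<l} t))) h'"
    by (rule integrable_density[THEN iffD2])
      (use h'(1) hi ind in \<open>simp_all only: pi_ind integrable_scaleR_right measurable_lborel2, auto split: split_indicator\<close>)
  have eq1: "integrable (restrict_space lborel (cylinder l)) (\<lambda>x. h' (x $ 3))"
    using den unfolding distr_axial[symmetric] by (rule integrable_distr[OF m])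
  have "(LINT x|restrict_space lborel (cylinder l). h' (x $ 3)) = (LINT t|lborel. (pi * indicator {0<..<l} t) *\<^sub>R h' t)"
    using h'(1) by (subst integral_distr[OF m, symmetric]) (auto simp: distr_axial integral_density)
  also have "\<dots> = pi *\<^sub>R (LINT t|lborel. indicator {0<..<l} t *\<^sub>R h' t)" by (simp only: pi_ind integral_scaleR_right)
  finally have eq2: "(LINT x|restrict_space lborel (cylinder l). h' (x $ 3)) = pi *\<^sub>R (LINT t|lborel. indicator {0<..<l} t *\<^sub>R h' t)" .
  have bm: "(\<lambda>x. indicator (cylinder l) x *\<^sub>R h' (x $ 3)) \<in> borel_measurable lborel"
    using measurable_compose[OF borel_measurable_continuous_onI[OF continuous_on_nth] h'(1), of 3]
    by (intro borel_measurable_scaleR borel_measurable_indicator) auto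
  have i3: "integrable ?O (\<lambda>x. h' (x $ 3))"
  proof -
    have "integrable lborel (\<lambda>x. indicator (cylinder l) x *\<^sub>R h' (x $ 3))"
      using eq1 by (subst (asm) integrable_restrict_space) auto
    then show ?thesis using bm by (simp add: integrable_lebesgue_on integrable_completion)
  qed
  have AEx: "AE x in ?O. h' (x $ 3) = h (x $ 3)"
    by (rule AE_axial) (use h'(2) in \<open>auto elim!: eventually_mono\<close>)
  show int: "integrable ?O (\<lambda>x. h (x $ 3))"
    by (rule integrable_cong_AE_imp[OF i3 measurable_axial[OF hm]]) (use AEx in \<open>auto elim!: eventually_mono\<close>)
  have "(LINT x|?O. h (x $ 3)) = (LINT x|?O. h' (x $ 3))"
    using int i3 AEx by (intro integral_cong_AE) (auto elim!: eventually_mono)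
  also have "\<dots> = (LINT x|restrict_space lborel (cylinder l). h' (x $ 3))"
    using bm by (subst integral_restrict_space) (auto simp: integral_lebesgue_on integral_completion)
  also have "\<dots> = pi *\<^sub>R (LINT t|?L. h' t)"
    unfolding eq2 using h'(1) by (simp add: integral_lebesgue_on integral_completion)
  also have "(LINT t|?L. h' t) = (LINT t|?L. h t)"
    using h'(2) hm h'L by (intro integral_cong_AE) (auto elim!: eventually_mono)
  finally show "(LINT x|?O. h (x $ 3)) = pi *\<^sub>R (LINT t|?L. h t)" .
qed

section \<open>Stability of weak derivatives under L1 convergence\<close>

lemma integral_bounded_tendsto:
  fixes f :: "'a::euclidean_space \<Rightarrow> 'b::euclidean_space" and d :: "'a \<Rightarrow> real"
  assumes d: "d \<in> borel_measurable (lebesgue_on U)" "\<And>x. \<bar>d x\<bar> \<le> M"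
    and f: "\<forall>\<^sub>F k in F. integrable (lebesgue_on U) (fk k)" "integrable (lebesgue_on U) f"
    and lim: "((\<lambda>k. LINT x|lebesgue_on U. norm (fk k x - f x)) \<longlongrightarrow> 0) F"
  shows "((\<lambda>k. LINT x|lebesgue_on U. d x *\<^sub>R fk k x) \<longlongrightarrow> (LINT x|lebesgue_on U. d x *\<^sub>R f x)) F"
proof (rule LIM_zero_cancel, rule Lim_null_comparison)
  let ?L = "lebesgue_on U"
  have M: "0 \<le> M" using d(2)[of undefined] by linarith
  have i: "integrable ?L (\<lambda>x. d x *\<^sub>R g x)" if "integrable ?L g" for g :: "'a \<Rightarrow> 'b"
  proof (rule Bochner_Integration.integrable_bound)
    show "integrable ?L (\<lambda>x. M * norm (g x))" using that by (intro integrable_mult_right integrable_norm)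
    show "(\<lambda>x. d x *\<^sub>R g x) \<in> borel_measurable ?L"
      using d(1) borel_measurable_integrable[OF that] by (rule borel_measurable_scaleR)
    show "AE x in ?L. norm (d x *\<^sub>R g x) \<le> norm (M * norm (g x))"
      using d(2) M by (intro AE_I2) (simp add: abs_mult mult_right_mono)
  qed
  show "((\<lambda>k. M * (LINT x|?L. norm (fk k x - f x))) \<longlongrightarrow> 0) F"
    using tendsto_mult_right_zero[OF lim] by blast
  show "\<forall>\<^sub>F k in F. norm ((LINT x|?L. d x *\<^sub>R fk k x) - (LINT x|?L. d x *\<^sub>R f x)) \<le> M * (LINT x|?L. norm (fk k x - f x))"
    using f(1)
  proof eventually_elim
    fix k assume k: "integrable ?L (fk k)"
    have "norm ((LINT x|?L. d x *\<^sub>R fk k x) - (LINT x|?L. d x *\<^sub>R f x)) = norm (LINT x|?L. d x *\<^sub>R (fk k x - f x))"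
      unfolding scaleR_diff_right by (simp only: Bochner_Integration.integral_diff[OF i[OF k] i[OF f(2)]])
    also have "\<dots> \<le> (LINT x|?L. norm (d x *\<^sub>R (fk k x - f x)))" by (rule integral_norm_bound)
    also have "\<dots> \<le> (LINT x|?L. M * norm (fk k x - f x))"
    proof (rule integral_mono)
      show "integrable ?L (\<lambda>x. norm (d x *\<^sub>R (fk k x - f x)))"
        using i[OF Bochner_Integration.integrable_diff[OF k f(2)]] by (rule integrable_norm)
      show "integrable ?L (\<lambda>x. M * norm (fk k x - f x))"
        using Bochner_Integration.integrable_diff[OF k f(2)] by (intro integrable_mult_right integrable_norm)
      show "norm (d x *\<^sub>R (fk k x - f x)) \<le> M * norm (fk k x - f x)" for x
        using d(2)[of x] by (simp add: mult_right_mono)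
    qed
    finally show "norm ((LINT x|?L. d x *\<^sub>R fk k x) - (LINT x|?L. d x *\<^sub>R f x)) \<le> M * (LINT x|?L. norm (fk k x - f x))"
      by simp
  qed
qed

lemma C1c_bounded_measurable:
  fixes \<phi> :: "'a::euclidean_space \<Rightarrow> real"
  assumes "\<phi> \<in> C1c U"
  obtains M where "\<And>x. \<bar>\<phi> x\<bar> \<le> M" "\<And>x. \<bar>frechet_derivative \<phi> (at x) v\<bar> \<le> M"
    "\<phi> \<in> borel_measurable (lebesgue_on V)" "(\<lambda>x. frechet_derivative \<phi> (at x) v) \<in> borel_measurable (lebesgue_on V)"
proof -
  obtain M where M: "M > 0" "\<And>x. norm (\<phi> x) \<le> M" by (rule C1c_bounded[OF assms]) (rule that)
  obtain M' where M': "M' > 0" "\<And>x. norm (frechet_derivative \<phi> (at x) v) \<le> M'"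
    by (rule C1c_bounded_deriv[OF assms, of v]) (rule that)
  show ?thesis
    by (rule that[of "max M M'"])
      (use M M' in \<open>auto simp: le_max_iff_disj intro: continuous_measurable_lebesgue_on C1c_continuous[OF assms] C1c_continuous_deriv[OF assms]\<close>)
qed

text \<open>Test functions and their derivatives are bounded, so both sides of the integration by
  parts formula are continuous with respect to L1 convergence.\<close>

lemma has_weak_partial_limit:
  fixes u :: "'a::euclidean_space \<Rightarrow> 'b::euclidean_space"
  assumes "open U" and h: "\<And>k::nat. has_weak_partial U v (uk k) (gk k)"
    and int: "\<And>k. integrable (lebesgue_on U) (uk k)" "\<And>k. integrable (lebesgue_on U) (gk k)"
      "integrable (lebesgue_on U) u" "integrable (lebesgue_on U) g"
    and lim: "(\<lambda>k. LINT x|lebesgue_on U. norm (uk k x - u x)) \<longlonglongrightarrow> 0"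
      "(\<lambda>k. LINT x|lebesgue_on U. norm (gk k x - g x)) \<longlonglongrightarrow> 0"
  shows "has_weak_partial U v u g"
  unfolding has_weak_partial_def
proof (intro conjI ballI locally_integrable_if_integrable assms(1) int(3,4))
  fix \<phi> :: "'a \<Rightarrow> real" assume \<phi>: "\<phi> \<in> C1c U"
  obtain M where M: "\<And>x. \<bar>\<phi> x\<bar> \<le> M" "\<And>x. \<bar>frechet_derivative \<phi> (at x) v\<bar> \<le> M"
    "\<phi> \<in> borel_measurable (lebesgue_on U)" "(\<lambda>x. frechet_derivative \<phi> (at x) v) \<in> borel_measurable (lebesgue_on U)"
    by (rule C1c_bounded_measurable[OF \<phi>, of v U]) (rule that)
  have 1: "(\<lambda>k. LINT x|lebesgue_on U. frechet_derivative \<phi> (at x) v *\<^sub>R uk k x) \<longlonglongrightarrow>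
      (LINT x|lebesgue_on U. frechet_derivative \<phi> (at x) v *\<^sub>R u x)"
    by (rule integral_bounded_tendsto[OF M(4,2) _ int(3) lim(1)]) (simp add: int)
  have 2: "(\<lambda>k. LINT x|lebesgue_on U. \<phi> x *\<^sub>R gk k x) \<longlonglongrightarrow> (LINT x|lebesgue_on U. \<phi> x *\<^sub>R g x)"
    by (rule integral_bounded_tendsto[OF M(3,1) _ int(4) lim(2)]) (simp add: int)
  have 3: "(LINT x|lebesgue_on U. frechet_derivative \<phi> (at x) v *\<^sub>R uk k x) = - (LINT x|lebesgue_on U. \<phi> x *\<^sub>R gk k x)" for k
    using h[of k] \<phi> unfolding has_weak_partial_def by blast
  show "(LINT x|lebesgue_on U. frechet_derivative \<phi> (at x) v *\<^sub>R u x) = - (LINT x|lebesgue_on U. \<phi> x *\<^sub>R g x)"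
    by (rule LIMSEQ_unique[OF 1[unfolded 3] tendsto_minus[OF 2]])
qed

lemma C1_deriv_axial:
  fixes g :: "real \<Rightarrow> 'b::real_normed_vector"
  assumes "\<And>t. (g has_vector_derivative g' t) (at t)" "continuous_on UNIV g'"
  shows "C1_deriv (\<lambda>x::real^3. g (x $ 3)) (\<lambda>x v. (v $ 3) *\<^sub>R g' (x $ 3))"
proof -
  have "C1_deriv (\<lambda>x::real^3. g (x \<bullet> axis 3 1)) (\<lambda>x v. (v \<bullet> axis 3 1) *\<^sub>R g' (x \<bullet> axis 3 1))"
    by (rule C1_deriv_compose[OF C1_deriv_inner assms])
  then show ?thesis by (simp add: inner_axis)
qed

lemma L1_approx_sequence:
  fixes V :: "'a::euclidean_space \<Rightarrow> 'b::euclidean_space"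
  assumes "open U" "U \<in> lmeasurable" "integrable (lebesgue_on U) V"
  obtains g where "\<And>n::nat. g n \<in> C1c U" "\<And>n. integrable (lebesgue_on U) (g n)"
    "(\<lambda>n. LINT x|lebesgue_on U. norm (g n x - V x)) \<longlonglongrightarrow> 0"
proof -
  have "\<forall>n. \<exists>g. g \<in> C1c U \<and> integrable (lebesgue_on U) g \<and> (LINT x|lebesgue_on U. norm (V x - g x)) < 1 / (real n + 1)"
    by (rule allI, rule L1_density[OF assms]) auto
  from choice[OF this] obtain g where
    g: "\<forall>n. g n \<in> C1c U \<and> integrable (lebesgue_on U) (g n) \<and> (LINT x|lebesgue_on U. norm (V x - g n x)) < 1 / (real n + 1)" by (rule exE)
  show ?thesis
  proof (rule that[of g])
    show "(\<lambda>n. LINT x|lebesgue_on U. norm (g n x - V x)) \<longlonglongrightarrow> 0"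
    proof (rule Lim_null_comparison)
      show "(\<lambda>n. 1 / (real n + 1)) \<longlonglongrightarrow> 0" by real_asymp
      show "\<forall>\<^sub>F n in sequentially. norm (LINT x|lebesgue_on U. norm (g n x - V x)) \<le> 1 / (real n + 1)"
        using g by (intro always_eventually allI) (simp add: norm_minus_commute less_imp_le)
    qed
  qed (use g in auto)
qed

lemma C1c_has_vector_derivative:
  fixes g :: "real \<Rightarrow> 'b::real_normed_vector"
  assumes "g \<in> C1c U"
  shows "(g has_vector_derivative frechet_derivative g (at t) 1) (at t)"
proof -
  have d: "(g has_derivative frechet_derivative g (at t)) (at t)"
    using C1c_C1_deriv[OF assms] by (simp add: C1_deriv_def)
  have "frechet_derivative g (at t) = (\<lambda>v. v *\<^sub>R frechet_derivative g (at t) 1)"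
  proof (rule ext)
    show "frechet_derivative g (at t) v = v *\<^sub>R frechet_derivative g (at t) 1" for v
      using linear_simps(5)[OF has_derivative_bounded_linear[OF d], of v 1] by simp
  qed
  with d show ?thesis unfolding has_vector_derivative_def by simp
qed

text \<open>For C1 functions of the height the radial derivatives vanish classically, and L1 limits
  preserve this. No differentiability of h enters, so the lemma covers the jumping field \<chi> as
  well.\<close>

lemma axial_radial_partial_zero:
  fixes h :: "real \<Rightarrow> 'b::euclidean_space"
  assumes h: "integrable (lebesgue_on {0<..<l}) h" and i: "i \<noteq> 3"
  shows "has_weak_partial (cylinder l) (axis i 1) (\<lambda>x. h (x $ 3)) (\<lambda>_. 0)"
proof -
  obtain g where g: "\<And>n::nat. g n \<in> C1c {0<..<l}" "\<And>n. integrable (lebesgue_on {0<..<l}) (g n)"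
    "(\<lambda>n. LINT x|lebesgue_on {0<..<l}. norm (g n x - h x)) \<longlonglongrightarrow> 0"
    by (rule L1_approx_sequence[OF _ interval_lmeasurable h]) (simp, rule that)
  show ?thesis
  proof (rule has_weak_partial_limit[OF cylinder_open, where uk = "\<lambda>n x. g n (x $ 3)" and gk = "\<lambda>_ _. 0"])
    fix n
    have "(g n has_vector_derivative frechet_derivative (g n) (at t) 1) (at t)" for t
      by (rule C1c_has_vector_derivative[OF g(1)])
    from has_weak_partial_C1[OF cylinder_open C1_deriv_axial[OF this C1c_continuous_deriv[OF g(1)]], of l "axis i 1"]
    show "has_weak_partial (cylinder l) (axis i 1) (\<lambda>x. g n (x $ 3)) (\<lambda>_. 0)"
      using i by (simp add: axis_def)
    show "integrable (lebesgue_on (cylinder l)) (\<lambda>x. g n (x $ 3))" by (rule integral_axial(1)[OF g(2)])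
  next
    show "(\<lambda>k. LINT x|lebesgue_on (cylinder l). norm (g k (x $ 3) - h (x $ 3))) \<longlonglongrightarrow> 0"
      using tendsto_mult_right_zero[OF g(3), of pi]
        integral_axial(2)[OF integrable_norm[OF Bochner_Integration.integrable_diff[OF g(2) h]]] by simp
  qed (use integral_axial(1)[OF h] in auto)
qed

text \<open>The approximation acts on V and not on u: primitives of test functions are C1, they
  converge to u, and their axial derivatives converge to V.\<close>

lemma axial_weak_partial:
  fixes u :: "real \<Rightarrow> 'b::euclidean_space"
  assumes V: "integrable (lebesgue_on {0<..<l}) V" and u: "AE t in lebesgue_on {0<..<l}. u t = c + prim l V t"
    and ui: "integrable (lebesgue_on {0<..<l}) u"
  shows "has_weak_partial (cylinder l) (axis 3 1) (\<lambda>x. u (x $ 3)) (\<lambda>x. V (x $ 3))"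
proof -
  let ?L = "lebesgue_on {0<..<l}"
  interpret L: finite_measure ?L by (rule finite_measure_lebesgue_on[OF interval_lmeasurable])
  obtain g where g: "\<And>n::nat. g n \<in> C1c {0<..<l}" "\<And>n. integrable ?L (g n)"
    "(\<lambda>n. LINT x|?L. norm (g n x - V x)) \<longlonglongrightarrow> 0"
    by (rule L1_approx_sequence[OF _ interval_lmeasurable V]) (simp, rule that)
  have pi: "integrable ?L (\<lambda>t. c + prim l (g n) t)" for n
    using prim_has_weak_partial(2)[OF g(2)] by simp
  have vd: "((\<lambda>t. c + prim l (g n) t) has_vector_derivative g n t) (at t)" for n t
    using has_vector_derivative_add[OF has_vector_derivative_const prim_has_vector_derivative[OF g(1)]] by simp
  show ?thesis
  proof (rule has_weak_partial_limit[OF cylinder_open,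
        where uk = "\<lambda>n x. c + prim l (g n) (x $ 3)" and gk = "\<lambda>n x. g n (x $ 3)"])
    show "has_weak_partial (cylinder l) (axis 3 1) (\<lambda>x. c + prim l (g n) (x $ 3)) (\<lambda>x. g n (x $ 3))" for n
      using has_weak_partial_C1[OF cylinder_open C1_deriv_axial[OF vd C1c_continuous[OF g(1)]], of l "axis 3 1"] by simp
    show "integrable (lebesgue_on (cylinder l)) (\<lambda>x. c + prim l (g n) (x $ 3))" for n by (rule integral_axial(1)[OF pi])
    show "integrable (lebesgue_on (cylinder l)) (\<lambda>x. g n (x $ 3))" for n by (rule integral_axial(1)[OF g(2)])
    show "integrable (lebesgue_on (cylinder l)) (\<lambda>x. u (x $ 3))" by (rule integral_axial(1)[OF ui])
    show "integrable (lebesgue_on (cylinder l)) (\<lambda>x. V (x $ 3))" by (rule integral_axial(1)[OF V])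
    show "(\<lambda>k. LINT x|lebesgue_on (cylinder l). norm (g k (x $ 3) - V (x $ 3))) \<longlonglongrightarrow> 0"
      using tendsto_mult_right_zero[OF g(3), of pi]
        integral_axial(2)[OF integrable_norm[OF Bochner_Integration.integrable_diff[OF g(2) V]]] by simp
    show "(\<lambda>k. LINT x|lebesgue_on (cylinder l). norm (c + prim l (g k) (x $ 3) - u (x $ 3))) \<longlonglongrightarrow> 0"
    proof -
      have le: "(LINT t|?L. norm (c + prim l (g k) t - u t)) \<le> measure ?L (space ?L) * (LINT x|?L. norm (g k x - V x))" for k
      proof -
        have "(LINT t|?L. norm (c + prim l (g k) t - u t)) \<le> (LINT t|?L. (LINT x|?L. norm (g k x - V x)))"
        proof (rule integral_mono_AE)
          show "AE t in ?L. norm (c + prim l (g k) t - u t) \<le> (LINT x|?L. norm (g k x - V x))"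
            using u
          proof eventually_elim
            fix t assume "u t = c + prim l V t"
            then show "norm (c + prim l (g k) t - u t) \<le> (LINT x|?L. norm (g k x - V x))"
              using prim_dist_le[OF g(2) V, of k t] by simp
          qed
        qed (use pi ui in auto)
        then show ?thesis by simp
      qed
      have "(\<lambda>k. LINT t|?L. norm (c + prim l (g k) t - u t)) \<longlonglongrightarrow> 0"
        by (rule Lim_null_comparison[OF _ tendsto_mult_right_zero[OF g(3)]])
          (use le in \<open>auto intro!: always_eventually simp: integral_nonneg_AE\<close>)
      then show ?thesis
        using tendsto_mult_right_zero[of "\<lambda>k. LINT t|?L. norm (c + prim l (g k) t - u t)" sequentially pi]
          integral_axial(2)[OF integrable_norm[OF Bochner_Integration.integrable_diff[OF pi ui]]] by simp
    qed
  qed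
qed

lemma axial_in_Lp:
  assumes "h \<in> Lp p {0<..<l}"
  shows "(\<lambda>x. h (x $ 3)) \<in> Lp p (cylinder l)"
  using assms integral_axial(1)[of l "\<lambda>t. norm (h t) powr p"] measurable_axial
  by (auto simp: Lp_def)

section \<open>Explicit derivative measures\<close>

text \<open>Made for functions of one variable, whose derivative measure has a single nonzero
  component. The other components are represented by the trivial decomposition of 0 into P minus
  P.\<close>

lemma has_derivative_measureI:
  fixes w :: "'a::euclidean_space \<Rightarrow> real"
  assumes fin: "finite_measure P" "finite_measure N"
    and sets: "sets P = sets (restrict_space borel U)" "sets N = sets (restrict_space borel U)"
    and i0: "i0 \<in> Basis"
    and eq: "\<And>\<phi> :: 'a \<Rightarrow> real. \<phi> \<in> C1c U \<Longrightarrow> integral\<^sup>L P \<phi> - integral\<^sup>L N \<phi> =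
      - (LINT x|lebesgue_on U. w x * frechet_derivative \<phi> (at x) i0)"
    and zero: "\<And>\<phi> i. \<phi> \<in> C1c U \<Longrightarrow> i \<in> Basis \<Longrightarrow> i \<noteq> i0 \<Longrightarrow>
      (LINT x|lebesgue_on U. w x * frechet_derivative \<phi> (at x) i) = 0"
  shows "has_derivative_measure U w (\<lambda>E. (measure P E - measure N E) *\<^sub>R i0)"
  unfolding has_derivative_measure_def
proof (intro conjI ballI)
  interpret P: finite_measure P by fact
  interpret N: finite_measure N by fact
  show "vector_measure_on U (\<lambda>E. (measure P E - measure N E) *\<^sub>R i0)"
    unfolding vector_measure_on_def
  proof (intro allI impI, elim conjE)
    fix A :: "nat \<Rightarrow> 'a set" assume A: "range A \<subseteq> sets (restrict_space borel U)" "disjoint_family A"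
    show "(\<lambda>n. (measure P (A n) - measure N (A n)) *\<^sub>R i0) sums ((measure P (\<Union>n. A n) - measure N (\<Union>n. A n)) *\<^sub>R i0)"
      using A sets by (intro sums_scaleR_left sums_diff P.finite_measure_UNION N.finite_measure_UNION) auto
  qed
next
  fix \<phi> :: "'a \<Rightarrow> real" and i :: 'a assume \<phi>: "\<phi> \<in> C1c U" and i: "i \<in> Basis"
  have int: "integrable M \<phi>" if "finite_measure M" "sets M = sets (restrict_space borel U)" for M
  proof -
    interpret M: finite_measure M by fact
    obtain B where "\<And>x. norm (\<phi> x) \<le> B" by (rule C1c_bounded[OF \<phi>]) (rule that)
    then show ?thesis
      by (intro M.integrable_const_bound[of _ B] AE_I2 borel_measurable_restrict_cong[OF that(2) C1c_continuous[OF \<phi>]])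
  qed
  show "has_signed_integral U (\<lambda>E. (measure P E - measure N E) *\<^sub>R i0 \<bullet> i) \<phi>
      (- (LINT x|lebesgue_on U. w x * frechet_derivative \<phi> (at x) i))"
  proof (cases "i = i0")
    case True
    then show ?thesis
      unfolding has_signed_integral_def
      by (intro exI[of _ P] exI[of _ N]) (use fin sets int[OF fin(1) sets(1)] int[OF fin(2) sets(2)] eq[OF \<phi>] i0 in auto)
  next
    case False
    then show ?thesis
      unfolding has_signed_integral_def
      by (intro exI[of _ P] exI[of _ P])
        (use fin sets int[OF fin(1) sets(1)] zero[OF \<phi> i] i i0 in \<open>auto simp: inner_not_same_Basis\<close>)
  qed
qed

lemma total_variation_le_measures:
  fixes \<kappa> :: "'a::euclidean_space set \<Rightarrow> 'b::euclidean_space"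
  assumes fin: "finite_measure P" "finite_measure N"
    and sets: "sets P = sets (restrict_space borel U)" "sets N = sets (restrict_space borel U)"
    and le: "\<And>E. E \<in> sets (restrict_space borel U) \<Longrightarrow> norm (\<kappa> E) \<le> measure P E + measure N E"
  shows "total_variation U \<kappa> \<le> ennreal (measure P U + measure N U)"
  unfolding total_variation_def
proof (rule SUP_least)
  interpret P: finite_measure P by fact
  interpret N: finite_measure N by fact
  fix A :: "nat \<Rightarrow> 'a set"
  assume "A \<in> {A. range A \<subseteq> sets (restrict_space borel U) \<and> disjoint_family A \<and> (\<Union>n. A n) = U}"
  then have A: "range A \<subseteq> sets (restrict_space borel U)" "disjoint_family A" "(\<Union>n. A n) = U" by auto
  have s: "(\<lambda>n. measure P (A n) + measure N (A n)) sums (measure P U + measure N U)"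
    using A sets unfolding A(3)[symmetric]
    by (intro sums_add P.finite_measure_UNION N.finite_measure_UNION) auto
  have "(\<Sum>n. ennreal (norm (\<kappa> (A n)))) \<le> (\<Sum>n. ennreal (measure P (A n) + measure N (A n)))"
    using A(1) le by (intro suminf_le ennreal_leI) auto
  also have "\<dots> = ennreal (measure P U + measure N U)"
    using s by (intro suminf_ennreal_eq) auto
  finally show "(\<Sum>n. ennreal (norm (\<kappa> (A n)))) \<le> ennreal (measure P U + measure N U)" .
qed

section \<open>Slicing the cylinder along its axis\<close>

lemma slice_curve_derivative:
  fixes \<phi> :: "real^3 \<Rightarrow> real"
  assumes "\<phi> \<in> C1c U"
  shows "(\<lambda>t. \<phi> (cyl_point (y, t))) \<in> C1c UNIV"
    and "frechet_derivative (\<lambda>t. \<phi> (cyl_point (y, t))) (at t) 1 = frechet_derivative \<phi> (at (cyl_point (y, t))) (axis 3 1)"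
proof -
  have e: "cyl_point (y, t) = cyl_point (y, 0) + t *\<^sub>R axis 3 1" for t
    by (cases y) (simp add: vec_eq_iff forall_3 axis_def)
  have D: "(\<phi> has_derivative frechet_derivative \<phi> (at x)) (at x)" for x
    using C1c_C1_deriv[OF assms] by (simp add: C1_deriv_def)
  have vd: "((\<lambda>t. \<phi> (cyl_point (y, t))) has_vector_derivative frechet_derivative \<phi> (at (cyl_point (y, t))) (axis 3 1)) (at t)" for t
  proof -
    have "((\<lambda>t. cyl_point (y, 0) + t *\<^sub>R axis 3 1) has_derivative (\<lambda>s. s *\<^sub>R axis 3 1)) (at t)"
      by (auto intro!: derivative_eq_intros)
    from diff_chain_at[OF this D] have
      "((\<lambda>t. \<phi> (cyl_point (y, t))) has_derivative (\<lambda>s. frechet_derivative \<phi> (at (cyl_point (y, t))) (s *\<^sub>R axis 3 1))) (at t)"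
      by (simp add: o_def e[symmetric])
    moreover have "frechet_derivative \<phi> (at (cyl_point (y, t))) (s *\<^sub>R axis 3 1) = s *\<^sub>R frechet_derivative \<phi> (at (cyl_point (y, t))) (axis 3 1)" for s
      using has_derivative_bounded_linear[OF D] by (simp add: linear_simps(5))
    ultimately show ?thesis by (simp add: has_vector_derivative_def)
  qed
  have cc: "continuous_on A (\<lambda>t. cyl_point (y, t))" for A
  proof -
    have "continuous_on A (\<lambda>t. cyl_point (y, 0) + t *\<^sub>R axis 3 1)" by (intro continuous_intros)
    then show ?thesis by (rule continuous_on_cong[OF refl e, THEN iffD2])
  qed
  have c: "continuous_on UNIV (\<lambda>t. frechet_derivative \<phi> (at (cyl_point (y, t))) (axis 3 1))"
    by (rule continuous_on_compose2[OF C1c_continuous_deriv[OF assms, of UNIV] cc]) auto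
  note D1 = C1_deriv_real[OF vd c]
  obtain K where K: "compact K" "K \<subseteq> U" "\<And>x. x \<notin> K \<Longrightarrow> \<phi> x = 0"
    "\<And>x v. x \<notin> K \<Longrightarrow> frechet_derivative \<phi> (at x) v = 0"
    by (rule C1c_support[OF assms]) (rule that)
  have "compact ((\<lambda>x::real^3. x $ 3) ` K)"
    by (rule compact_continuous_image[OF continuous_on_nth K(1)])
  then show "(\<lambda>t. \<phi> (cyl_point (y, t))) \<in> C1c UNIV"
  proof (rule C1cI[OF D1])
    fix t assume "t \<notin> (\<lambda>x::real^3. x $ 3) ` K"
    moreover have "cyl_point (y, t) $ 3 = t" by (cases y) simp
    ultimately have "cyl_point (y, t) \<notin> K" by (metis imageI)
    then show "\<phi> (cyl_point (y, t)) = 0" by (rule K(3))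
  qed simp
  show "frechet_derivative (\<lambda>t. \<phi> (cyl_point (y, t))) (at t) 1 = frechet_derivative \<phi> (at (cyl_point (y, t))) (axis 3 1)"
    by (simp add: C1_deriv_frechet[OF D1])
qed

text \<open>On every line parallel to the axis the inner integral is that of a derivative over a
  half line, which leaves minus the value at height r. A jump at r thus becomes the area measure on
  the disc at that height.\<close>

lemma integral_axial_deriv_above:
  fixes \<phi> :: "real^3 \<Rightarrow> real"
  assumes "\<phi> \<in> C1c (cylinder l)"
  shows "(LINT x|lebesgue_on (cylinder l). indicator {r..} (x $ 3) * frechet_derivative \<phi> (at x) (axis 3 1))
      = - (LINT y|lborel. \<phi> (cyl_point (y, r)))"
    and "integrable (lebesgue_on (cylinder l)) (\<lambda>x. indicator {r..} (x $ 3) * frechet_derivative \<phi> (at x) (axis 3 1))"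
proof -
  let ?d = "\<lambda>x. frechet_derivative \<phi> (at x) (axis 3 1)"
  let ?F = "\<lambda>x. indicator {r..} (x $ 3) * ?d x"
  obtain K where K: "compact K" "K \<subseteq> cylinder l" "\<And>x. x \<notin> K \<Longrightarrow> \<phi> x = 0"
    "\<And>x v. x \<notin> K \<Longrightarrow> frechet_derivative \<phi> (at x) v = 0"
    by (rule C1c_support[OF assms]) (rule that)
  have di: "integrable lborel ?d" by (rule integrable_C1c_like[OF C1c_continuous_deriv[OF assms] K(1,4)])
  have S: "{x::real^3. r \<le> x $ 3} \<in> sets lborel"
    unfolding sets_lborel by (intro borel_closed closed_Collect_le continuous_intros)
  have Fi: "integrable lborel ?F"
  proof -
    have "?F = (\<lambda>x. indicator {x. r \<le> x $ 3} x *\<^sub>R ?d x)" by (auto split: split_indicator)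
    then show ?thesis using integrable_mult_indicator[OF S di] by simp
  qed
  have z: "(\<lambda>x. indicator (cylinder l) x *\<^sub>R ?F x) = ?F"
  proof
    show "indicator (cylinder l) x *\<^sub>R ?F x = ?F x" for x
      using K(2) K(4)[of x "axis 3 1"] by (auto split: split_indicator)
  qed
  have Fm: "?F \<in> borel_measurable lborel" using Fi by simp
  show "integrable (lebesgue_on (cylinder l)) ?F"
    using Fi Fm by (subst integrable_lebesgue_on) (simp_all only: cylinder_sets z integrable_completion)
  have cm: "cyl_point \<in> measurable lborel borel"
    using borel_measurable_continuous_onI[OF continuous_cyl_point] by simp
  have FTi: "integrable ((lborel :: (real \<times> real) measure) \<Otimes>\<^sub>M (lborel :: real measure)) (\<lambda>p. ?F (cyl_point p))"
  proof -
    have "integrable (distr lborel borel cyl_point) ?F" unfolding lborel_eq_distr_cyl_point by (rule Fi)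
    from integrable_distr[OF cm this] show ?thesis by (simp add: lborel_prod)
  qed
  have "(LINT x|lebesgue_on (cylinder l). ?F x) = (LINT x|lborel. ?F x)"
    using Fm by (subst integral_lebesgue_on) (simp_all only: cylinder_sets z integral_completion)
  also have "\<dots> = (LINT x|distr lborel borel cyl_point. ?F x)" by (simp only: lborel_eq_distr_cyl_point)
  also have "\<dots> = (LINT p|lborel. ?F (cyl_point p))"
    using Fm by (intro integral_distr[OF cm]) simp
  also have "\<dots> = (LINT p|((lborel :: (real \<times> real) measure) \<Otimes>\<^sub>M (lborel :: real measure)). ?F (cyl_point p))"
    by (simp only: lborel_prod)
  also have "\<dots> = (LINT y|lborel. LINT t|lborel. ?F (cyl_point (y, t)))"
    by (rule lborel_pair.integral_fst'[OF FTi, symmetric])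
  also have "\<dots> = (LINT y|lborel. - \<phi> (cyl_point (y, r)))"
  proof (intro Bochner_Integration.integral_cong refl)
    fix y :: "real \<times> real"
    have "cyl_point (y, t) $ 3 = t" for t by (cases y) simp
    then have "(LINT t|lborel. ?F (cyl_point (y, t))) =
        (LINT t|lborel. indicator {r..} t * frechet_derivative (\<lambda>t. \<phi> (cyl_point (y, t))) (at t) 1)"
      by (simp only: slice_curve_derivative(2)[OF assms])
    also have "\<dots> = - \<phi> (cyl_point (y, r))"
      by (rule integral_deriv_above[OF slice_curve_derivative(1)[OF assms]])
    finally show "(LINT t|lborel. ?F (cyl_point (y, t))) = - \<phi> (cyl_point (y, r))" .
  qed
  finally show "(LINT x|lebesgue_on (cylinder l). ?F x) = - (LINT y|lborel. \<phi> (cyl_point (y, r)))" by simp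
qed

text \<open>Unit point masses at the elements of A, carried by the \<sigma>-algebra that
  \<open>has_signed_integral\<close> prescribes. In \<open>disc_meas\<close> each point is replaced
  by the area measure of the cross section at that height.\<close>

definition jump_meas :: "real \<Rightarrow> real set \<Rightarrow> real measure" where
  "jump_meas l A = distr (count_space A) (restrict_space borel {0<..<l}) (\<lambda>x. x)"

definition disc_meas :: "real \<Rightarrow> real set \<Rightarrow> (real^3) measure" where
  "disc_meas l A = distr (count_space A \<Otimes>\<^sub>M restrict_space lborel disc)
     (restrict_space borel (cylinder l)) (\<lambda>(t, y). cyl_point (y, t))"

lemma jump_meas:
  assumes "finite A" "A \<subseteq> {0<..<l}"
  shows "finite_measure (jump_meas l A)" "sets (jump_meas l A) = sets (restrict_space borel {0<..<l})"
    "\<And>E. E \<in> sets (restrict_space borel {0<..<l}) \<Longrightarrow> measure (jump_meas l A) E = card (E \<inter> A)"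
    "\<And>\<phi> :: real \<Rightarrow> real. continuous_on UNIV \<phi> \<Longrightarrow> integral\<^sup>L (jump_meas l A) \<phi> = (\<Sum>t\<in>A. \<phi> t)"
proof -
  have m: "(\<lambda>x. x) \<in> measurable (count_space A) (restrict_space borel {0<..<l})"
    using assms(2) by (auto simp: measurable_count_space_eq1 space_restrict_space)
  interpret C: finite_measure "count_space A" by (rule finite_measure_count_space[OF assms(1)])
  show "finite_measure (jump_meas l A)" unfolding jump_meas_def by (rule C.finite_measure_distr[OF m])
  show "sets (jump_meas l A) = sets (restrict_space borel {0<..<l})" by (simp add: jump_meas_def)
  show "measure (jump_meas l A) E = card (E \<inter> A)" if "E \<in> sets (restrict_space borel {0<..<l})" for E
    unfolding jump_meas_def using that assms(1) by (subst measure_distr[OF m]) (auto simp: measure_count_space)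
  show "integral\<^sup>L (jump_meas l A) \<phi> = (\<Sum>t\<in>A. \<phi> t)" if "continuous_on UNIV \<phi>" for \<phi> :: "real \<Rightarrow> real"
    unfolding jump_meas_def using assms(1) borel_measurable_continuous_onI[OF that]
    by (subst integral_distr[OF m]) (auto simp: lebesgue_integral_count_space_finite intro: measurable_restrict_space1)
qed

lemma disc_meas:
  assumes "finite A" "A \<subseteq> {0<..<l}"
  shows "finite_measure (disc_meas l A)" "sets (disc_meas l A) = sets (restrict_space borel (cylinder l))"
    "measure (disc_meas l A) (cylinder l) = card A * pi"
    "\<And>\<phi> :: real^3 \<Rightarrow> real. \<phi> \<in> C1c (cylinder l) \<Longrightarrow>
      integral\<^sup>L (disc_meas l A) \<phi> = (\<Sum>t\<in>A. LINT y|lborel. \<phi> (cyl_point (y, t)))"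
proof -
  let ?D = "restrict_space lborel disc" and ?C = "count_space A"
  let ?h = "\<lambda>(t, y). cyl_point (y, t)"
  have dm: "disc \<in> sets lborel" by simp
  have spD: "space ?D = disc" by (simp add: space_restrict_space)
  have eD: "emeasure ?D disc = ennreal pi" using dm by (subst emeasure_restrict_space) (auto simp: emeasure_disc)
  interpret D: finite_measure ?D by (rule finite_measureI) (simp add: spD eD)
  interpret C: finite_measure ?C by (rule finite_measure_count_space[OF assms(1)])
  interpret CD: pair_sigma_finite ?C ?D ..
  interpret P: finite_measure "?C \<Otimes>\<^sub>M ?D" by (rule finite_measure_pair_measure) (rule C.finite_measure_axioms D.finite_measure_axioms)+
  have m: "?h \<in> measurable (?C \<Otimes>\<^sub>M ?D) (restrict_space borel (cylinder l))"
  proof (rule measurable_pair_measure_countable1)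
    show "countable A" using assms(1) by (rule countable_finite)
    fix t assume t: "t \<in> A"
    have "continuous_on UNIV (\<lambda>y. cyl_point (y, t))"
      by (rule continuous_on_compose2[OF continuous_cyl_point[of UNIV]]) (auto intro!: continuous_intros)
    then have "(\<lambda>y. cyl_point (y, t)) \<in> measurable ?D borel"
      by (intro measurable_restrict_space1) (simp add: borel_measurable_continuous_onI)
    then have "(\<lambda>y. cyl_point (y, t)) \<in> measurable ?D (restrict_space borel (cylinder l))"
      by (rule measurable_restrict_space2[rotated]) (use t assms(2) spD in \<open>auto simp: cyl_point_in_cylinder\<close>)
    then show "(\<lambda>y. ?h (t, y)) \<in> measurable ?D (restrict_space borel (cylinder l))" by simp
  qed
  show f: "finite_measure (disc_meas l A)" unfolding disc_meas_def by (rule P.finite_measure_distr[OF m])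
  show s: "sets (disc_meas l A) = sets (restrict_space borel (cylinder l))" by (simp add: disc_meas_def)
  have sp: "space (?C \<Otimes>\<^sub>M ?D) = A \<times> disc" by (simp add: space_pair_measure spD)
  have cs: "cylinder l \<in> sets (restrict_space borel (cylinder l))" by (simp add: sets_restrict_space_iff)
  have pre: "?h -` cylinder l \<inter> space (?C \<Otimes>\<^sub>M ?D) = A \<times> disc"
    using assms(2) unfolding sp by (auto simp: cyl_point_in_cylinder)
  have "emeasure (disc_meas l A) (cylinder l) = emeasure (?C \<Otimes>\<^sub>M ?D) (A \<times> disc)"
    unfolding disc_meas_def emeasure_distr[OF m cs] pre ..
  also have "\<dots> = emeasure ?C A * emeasure ?D disc"
    by (rule D.emeasure_pair_measure_Times) (auto simp: sets_restrict_space_iff)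
  also have "\<dots> = ennreal (card A * pi)"
    using assms(1) by (simp add: eD ennreal_mult ennreal_of_nat_eq_real_of_nat)
  finally show "measure (disc_meas l A) (cylinder l) = card A * pi" by (simp add: measure_def)
  show "integral\<^sup>L (disc_meas l A) \<phi> = (\<Sum>t\<in>A. LINT y|lborel. \<phi> (cyl_point (y, t)))"
    if \<phi>: "\<phi> \<in> C1c (cylinder l)" for \<phi> :: "real^3 \<Rightarrow> real"
  proof -
    obtain B where B: "\<And>x. norm (\<phi> x) \<le> B" by (rule C1c_bounded[OF \<phi>]) (rule that)
    have \<phi>m: "\<phi> \<in> borel_measurable (restrict_space borel (cylinder l))"
      by (rule borel_measurable_restrict_cong[OF refl C1c_continuous[OF \<phi>]])
    have int: "integrable (?C \<Otimes>\<^sub>M ?D) (\<lambda>p. \<phi> (?h p))"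
      using measurable_compose[OF m \<phi>m] B by (intro P.integrable_const_bound[of _ B]) auto
    have "integral\<^sup>L (disc_meas l A) \<phi> = (LINT p|(?C \<Otimes>\<^sub>M ?D). \<phi> (?h p))"
      unfolding disc_meas_def by (rule integral_distr[OF m \<phi>m])
    also have "\<dots> = (LINT t|?C. LINT y|?D. \<phi> (?h (t, y)))"
      by (rule CD.integral_fst'[OF int, symmetric])
    also have "\<dots> = (\<Sum>t\<in>A. LINT y|?D. \<phi> (cyl_point (y, t)))"
      using assms(1) by (simp add: lebesgue_integral_count_space_finite)
    also have "\<dots> = (\<Sum>t\<in>A. LINT y|lborel. \<phi> (cyl_point (y, t)))"
    proof (rule sum.cong[OF refl])
      fix t assume "t \<in> A"
      have z: "\<phi> x = 0" if "x \<notin> cylinder l" for x using \<phi> that unfolding C1c_def by blast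
      have "(LINT y|?D. \<phi> (cyl_point (y, t))) = (LINT y|lborel. indicator disc y *\<^sub>R \<phi> (cyl_point (y, t)))"
        by (rule integral_restrict_space) simp
      also have "(\<lambda>y. indicator disc y *\<^sub>R \<phi> (cyl_point (y, t))) = (\<lambda>y. \<phi> (cyl_point (y, t)))"
        using z by (auto simp: cyl_point_in_cylinder split: split_indicator)
      finally show "(LINT y|?D. \<phi> (cyl_point (y, t))) = (LINT y|lborel. \<phi> (cyl_point (y, t)))" .
    qed
    finally show ?thesis .
  qed
qed

text \<open>\<open>s\<close> gives the signs of the jumps of a binary function with jump set \<open>J\<close>.\<close>

locale jumps =
  fixes l :: real and w :: "real \<Rightarrow> real" and J :: "real set" and s :: "real \<Rightarrow> real" and c :: real
  assumes l: "0 < l" and finJ: "finite J" and J: "J \<subseteq> {0<..<l}" and s: "\<And>t. t \<in> J \<Longrightarrow> \<bar>s t\<bar> = 1"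
    and w: "AE t in lebesgue_on {0<..<l}. w t = c + (\<Sum>r\<in>J. s r * indicator {r..} t)"
    and wi: "integrable (lebesgue_on {0<..<l}) w"
begin

definition "Jp = {t \<in> J. s t = 1}"
definition "Jm = {t \<in> J. s t = -1}"

lemma Jpm: "finite Jp" "finite Jm" "Jp \<subseteq> {0<..<l}" "Jm \<subseteq> {0<..<l}" "Jp \<union> Jm = J" "Jp \<inter> Jm = {}"
  using finJ J s by (auto simp: Jp_def Jm_def abs_if split: if_splits) (metis minus_minus)

lemma card_J: "card Jp + card Jm = card J"
  using card_Un_disjoint[OF Jpm(1,2,6)] Jpm(5) by simp

lemma sum_s: "(\<Sum>r\<in>J. s r * g r) = (\<Sum>r\<in>Jp. g r) - (\<Sum>r\<in>Jm. g r)"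
proof -
  have "(\<Sum>r\<in>J. s r * g r) = (\<Sum>r\<in>Jp. s r * g r) + (\<Sum>r\<in>Jm. s r * g r)"
    using sum.union_disjoint[OF Jpm(1,2,6)] Jpm(5) by metis
  then show ?thesis by (simp add: Jp_def Jm_def sum_negf)
qed

lemma integral_1D:
  fixes \<phi> :: "real \<Rightarrow> real"
  assumes \<phi>: "\<phi> \<in> C1c {0<..<l}"
  shows "- (LINT t|lebesgue_on {0<..<l}. w t * frechet_derivative \<phi> (at t) 1) = (\<Sum>r\<in>J. s r * \<phi> r)"
proof -
  let ?L = "lebesgue_on {0<..<l}"
  let ?d = "\<lambda>t. frechet_derivative \<phi> (at t) 1"
  obtain K where K: "compact K" "K \<subseteq> {0<..<l}" "\<And>x. x \<notin> K \<Longrightarrow> \<phi> x = 0"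
    "\<And>x v. x \<notin> K \<Longrightarrow> frechet_derivative \<phi> (at x) v = 0"
    by (rule C1c_support[OF \<phi>]) (rule that)
  have di: "integrable lborel ?d" by (rule integrable_C1c_like[OF C1c_continuous_deriv[OF \<phi>] K(1,4)])
  have gen: "integrable ?L g" "(LINT t|?L. g t) = (LINT t|lborel. g t)"
    if "integrable lborel g" "\<And>t. t \<notin> K \<Longrightarrow> g t = 0" for g :: "real \<Rightarrow> real"
  proof -
    have z: "(\<lambda>t. indicator {0<..<l} t *\<^sub>R g t) = g"
    proof (rule ext)
      show "indicator {0<..<l} t *\<^sub>R g t = g t" for t
        using that(2)[of t] K(2) by (cases "t \<in> K") (auto split: split_indicator)
    qed
    have gm: "g \<in> borel_measurable lborel" using that(1) by simp
    show "integrable ?L g"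
      using that(1) gm by (subst integrable_lebesgue_on) (simp_all only: z integrable_completion, simp)
    show "(LINT t|?L. g t) = (LINT t|lborel. g t)"
      using gm by (subst integral_lebesgue_on) (simp_all only: z integral_completion, simp)
  qed
  have ri: "integrable lborel (\<lambda>t. indicator {r..} t * ?d t)" for r
    using integrable_mult_indicator[OF _ di, of "{r..}"] by simp
  have r: "integrable ?L (\<lambda>t. indicator {r..} t * ?d t)" "(LINT t|?L. indicator {r..} t * ?d t) = - \<phi> r" for r
    using gen[OF ri, of r] K(4) integral_deriv_above[OF \<phi>, of r] by simp_all
  have d0: "integrable ?L ?d" "(LINT t|?L. ?d t) = 0"
    using gen[OF di] K(4) integral_C1c_deriv_zero[OF \<phi>] by simp_all
  have "(LINT t|?L. w t * ?d t) = (LINT t|?L. c * ?d t + (\<Sum>r\<in>J. s r * (indicator {r..} t * ?d t)))"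
  proof (rule integral_cong_AE)
    show "AE t in ?L. w t * ?d t = c * ?d t + (\<Sum>r\<in>J. s r * (indicator {r..} t * ?d t))"
      using w by eventually_elim (simp add: distrib_right sum_distrib_right mult.assoc)
    show "(\<lambda>t. w t * ?d t) \<in> borel_measurable ?L"
      using wi continuous_measurable_lebesgue_on[OF C1c_continuous_deriv[OF \<phi>]] by (intro borel_measurable_times) auto
    show "(\<lambda>t. c * ?d t + (\<Sum>r\<in>J. s r * (indicator {r..} t * ?d t))) \<in> borel_measurable ?L"
      using d0 r by (intro borel_measurable_integrable Bochner_Integration.integrable_add Bochner_Integration.integrable_sum integrable_mult_right)
  qed
  also have "\<dots> = c * (LINT t|?L. ?d t) + (\<Sum>r\<in>J. s r * (LINT t|?L. indicator {r..} t * ?d t))"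
    using d0 r by (subst Bochner_Integration.integral_add) (auto simp: Bochner_Integration.integral_sum)
  finally show ?thesis by (simp add: d0 r sum_negf)
qed

lemma integral_3D:
  fixes \<phi> :: "real^3 \<Rightarrow> real"
  assumes \<phi>: "\<phi> \<in> C1c (cylinder l)"
  shows "- (LINT x|lebesgue_on (cylinder l). w (x $ 3) * frechet_derivative \<phi> (at x) (axis 3 1))
    = (\<Sum>r\<in>J. s r * (LINT y|lborel. \<phi> (cyl_point (y, r))))"
proof -
  let ?L = "lebesgue_on (cylinder l)"
  let ?d = "\<lambda>t. frechet_derivative \<phi> (at t) (axis 3 1)"
  obtain K where K: "compact K" "K \<subseteq> cylinder l" "\<And>x. x \<notin> K \<Longrightarrow> \<phi> x = 0"
    "\<And>x v. x \<notin> K \<Longrightarrow> frechet_derivative \<phi> (at x) v = 0"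
    by (rule C1c_support[OF \<phi>]) (rule that)
  note r = integral_axial_deriv_above(2)[OF \<phi>] integral_axial_deriv_above(1)[OF \<phi>]
  have d0: "integrable ?L ?d" "(LINT t|?L. ?d t) = 0"
  proof -
    have "integrable ?L (\<lambda>x. ?d x *\<^sub>R (1::real))"
      by (rule integrable_C1c_scaleR(2)[OF cylinder_open locally_integrable_continuous \<phi>]) simp
    then show "integrable ?L ?d" by simp
    have "(LINT t|?L. ?d t) = (LINT t|lborel. ?d t)"
      by (rule integral_C1c_lebesgue_on[OF cylinder_open C1c_continuous_deriv[OF \<phi>]]) (use K(2,4) in blast)
    then show "(LINT t|?L. ?d t) = 0" by (simp add: integral_C1c_deriv_zero[OF \<phi>])
  qed
  have wm: "(\<lambda>x. w (x $ 3)) \<in> borel_measurable ?L" using wi by (intro measurable_axial) auto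
  have "(LINT t|?L. w (t $ 3) * ?d t) = (LINT t|?L. c * ?d t + (\<Sum>r\<in>J. s r * (indicator {r..} (t $ 3) * ?d t)))"
  proof (rule integral_cong_AE)
    show "AE t in ?L. w (t $ 3) * ?d t = c * ?d t + (\<Sum>r\<in>J. s r * (indicator {r..} (t $ 3) * ?d t))"
      using AE_axial[OF w] by eventually_elim (simp add: distrib_right sum_distrib_right mult.assoc)
    show "(\<lambda>t. w (t $ 3) * ?d t) \<in> borel_measurable ?L"
      using wm continuous_measurable_lebesgue_on[OF C1c_continuous_deriv[OF \<phi>]] by (intro borel_measurable_times) auto
    show "(\<lambda>t. c * ?d t + (\<Sum>r\<in>J. s r * (indicator {r..} (t $ 3) * ?d t))) \<in> borel_measurable ?L"
      using d0 r by (intro borel_measurable_integrable Bochner_Integration.integrable_add Bochner_Integration.integrable_sum integrable_mult_right)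
  qed
  also have "\<dots> = c * (LINT t|?L. ?d t) + (\<Sum>r\<in>J. s r * (LINT t|?L. indicator {r..} (t $ 3) * ?d t))"
    using d0 r by (subst Bochner_Integration.integral_add) (auto simp: Bochner_Integration.integral_sum)
  finally show ?thesis by (simp add: d0 r sum_negf)
qed

lemma derivative_1D: "has_derivative_measure {0<..<l} w
    (\<lambda>E. (measure (jump_meas l Jp) E - measure (jump_meas l Jm) E) *\<^sub>R 1)"
proof (rule has_derivative_measureI)
  note p = jump_meas[OF Jpm(1,3)] and m = jump_meas[OF Jpm(2,4)]
  show "finite_measure (jump_meas l Jp)" "finite_measure (jump_meas l Jm)" by (rule p(1) m(1))+
  show "sets (jump_meas l Jp) = sets (restrict_space borel {0<..<l})"
    "sets (jump_meas l Jm) = sets (restrict_space borel {0<..<l})" by (rule p(2) m(2))+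
  show "integral\<^sup>L (jump_meas l Jp) \<phi> - integral\<^sup>L (jump_meas l Jm) \<phi> =
      - (LINT x|lebesgue_on {0<..<l}. w x * frechet_derivative \<phi> (at x) 1)"
    if "\<phi> \<in> C1c {0<..<l}" for \<phi> :: "real \<Rightarrow> real"
    by (simp only: p(4)[OF C1c_continuous[OF that]] m(4)[OF C1c_continuous[OF that]] integral_1D[OF that] sum_s)
qed auto

text \<open>From above, the total mass of the point masses; from below, the partition into single
  jumps and the rest, in which each jump contributes 1.\<close>

lemma total_variation_1D: "total_variation {0<..<l} (derivative_measure {0<..<l} w) = ennreal (card J)"
proof -
  let ?I = "{0<..<l}" and ?P = "jump_meas l Jp" and ?N = "jump_meas l Jm"
  note p = jump_meas[OF Jpm(1,3)] and m = jump_meas[OF Jpm(2,4)]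
  have "w \<in> BV ?I" using derivative_1D wi unfolding BV_def by blast
  note h = has_derivative_measure_derivative_measure[OF this]
  have eq: "derivative_measure ?I w E = measure ?P E - measure ?N E" if "E \<in> sets (restrict_space borel ?I)" for E
    using has_derivative_measure_unique[OF _ h derivative_1D that] by simp
  have "total_variation ?I (derivative_measure ?I w) \<le> ennreal (measure ?P ?I + measure ?N ?I)"
    by (rule total_variation_le_measures[OF p(1) m(1) p(2) m(2)]) (auto simp: eq abs_le_iff add_increasing add_increasing2)
  also have "measure ?P ?I + measure ?N ?I = card J"
  proof -
    have "?I \<in> sets (restrict_space borel ?I)" by (simp add: sets_restrict_space_iff)
    then show ?thesis using p(3) m(3) Jpm card_J by (simp add: Int_absorb1)
  qed
  finally have le: "total_variation ?I (derivative_measure ?I w) \<le> ennreal (card J)" .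
  define f where "f = from_nat_into J"
  have f: "bij_betw (from_nat_into J) {..<card J} J" using bij_betw_from_nat_into_finite[OF finJ] .
  \<comment> \<open>Index 0 takes the complement of J, the indices from 1 to card J take one jump
    each, and all later sets are empty.\<close>
  define A where "A n = (if n = 0 then ?I - J else if n \<le> card J then {f (n - 1)} else {})" for n
  have single: "norm (derivative_measure ?I w {r}) = 1" if "r \<in> J" for r
  proof -
    have "{r} \<in> sets (restrict_space borel ?I)" using that J by (auto simp: sets_restrict_space_iff)
    then have "derivative_measure ?I w {r} = card ({r} \<inter> Jp) - real (card ({r} \<inter> Jm))"
      using eq p(3) m(3) by simp
    moreover have "r \<in> Jp \<and> r \<notin> Jm \<or> r \<notin> Jp \<and> r \<in> Jm" using that Jpm(5,6) by auto
    ultimately show ?thesis by auto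
  qed
  have fJ: "f n \<in> J" if "n < card J" for n using f that unfolding f_def bij_betw_def by blast
  have "(\<Sum>n. ennreal (norm (derivative_measure ?I w (A n)))) \<le> total_variation ?I (derivative_measure ?I w)"
    unfolding total_variation_def
  proof (rule SUP_upper, intro CollectI conjI)
    have Jb: "J \<in> sets borel" using finJ by (simp add: finite_imp_closed borel_closed)
    have fI: "f (n - 1) \<in> ?I" if "n \<noteq> 0" "n \<le> card J" for n
    proof -
      have "n - 1 < card J" using that by linarith
      from fJ[OF this] J show ?thesis by blast
    qed
    from this show "range A \<subseteq> sets (restrict_space borel ?I)"
      using Jb by (auto simp: A_def sets_restrict_space_iff)
    show "disjoint_family A"
    proof -
      have "f (m - 1) \<noteq> f (n - 1)" if "m \<noteq> n" "m \<noteq> 0" "n \<noteq> 0" "m \<le> card J" "n \<le> card J" for m n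
        using f that unfolding f_def bij_betw_def inj_on_def by fastforce
      then show ?thesis using fJ by (auto simp: disjoint_family_on_def A_def)
    qed
    show "\<Union> (range A) = ?I"
    proof -
      have "x \<in> \<Union> (range A)" if "x \<in> ?I" for x
      proof (cases "x \<in> J")
        case True
        then have "x \<in> f ` {..<card J}" using f unfolding f_def bij_betw_def by simp
        then obtain n where "n < card J" "f n = x" by blast
        then have "x \<in> A (Suc n)" by (simp add: A_def)
        then show ?thesis by blast
      next
        case False
        then have "x \<in> A 0" using that by (simp add: A_def)
        then show ?thesis by blast
      qed
      moreover have "A n \<subseteq> ?I" for n using fI[of n] by (auto simp: A_def)
      ultimately show ?thesis by blast
    qed
  qed
  moreover have "ennreal (card J) \<le> (\<Sum>n. ennreal (norm (derivative_measure ?I w (A n))))"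
  proof -
    have "(\<Sum>n\<in>Suc ` {..<card J}. ennreal (norm (derivative_measure ?I w (A n)))) = (\<Sum>n\<in>Suc ` {..<card J}. 1)"
      by (rule sum.cong) (auto simp: A_def single[OF fJ] simp del: real_norm_def)
    also have "\<dots> = ennreal (card J)" by (simp add: card_image ennreal_of_nat_eq_real_of_nat)
    finally have "ennreal (card J) = (\<Sum>n\<in>Suc ` {..<card J}. ennreal (norm (derivative_measure ?I w (A n))))" by (rule sym)
    also have "\<dots> \<le> (\<Sum>n. ennreal (norm (derivative_measure ?I w (A n))))"
      by (rule sum_le_suminf[OF summableI]) auto
    finally show ?thesis .
  qed
  ultimately show ?thesis using le by (meson order_antisym order_trans)
qed

lemma wi3: "integrable (lebesgue_on (cylinder l)) (\<lambda>x. w (x $ 3))"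
  by (rule integral_axial(1)[OF wi])

lemma derivative_3D: "has_derivative_measure (cylinder l) (\<lambda>x. w (x $ 3))
    (\<lambda>E. (measure (disc_meas l Jp) E - measure (disc_meas l Jm) E) *\<^sub>R axis 3 1)"
proof (rule has_derivative_measureI)
  note p = disc_meas[OF Jpm(1,3)] and m = disc_meas[OF Jpm(2,4)]
  show "finite_measure (disc_meas l Jp)" "finite_measure (disc_meas l Jm)" by (rule p(1) m(1))+
  show "sets (disc_meas l Jp) = sets (restrict_space borel (cylinder l))"
    "sets (disc_meas l Jm) = sets (restrict_space borel (cylinder l))" by (rule p(2) m(2))+
  show "integral\<^sup>L (disc_meas l Jp) \<phi> - integral\<^sup>L (disc_meas l Jm) \<phi> =
      - (LINT x|lebesgue_on (cylinder l). w (x $ 3) * frechet_derivative \<phi> (at x) (axis 3 1))"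
    if "\<phi> \<in> C1c (cylinder l)" for \<phi> :: "real^3 \<Rightarrow> real"
    by (simp only: p(4)[OF that] m(4)[OF that] integral_3D[OF that] sum_s)
  show "(LINT x|lebesgue_on (cylinder l). w (x $ 3) * frechet_derivative \<phi> (at x) i) = 0"
    if \<phi>: "\<phi> \<in> C1c (cylinder l)" and i: "i \<in> Basis" "i \<noteq> axis 3 1" for \<phi> :: "real^3 \<Rightarrow> real" and i
  proof -
    obtain k where k: "i = axis k 1" "k \<noteq> 3" using i by (auto simp: Basis_vec_def)
    show ?thesis
      using axial_radial_partial_zero[OF wi k(2)] \<phi> unfolding has_weak_partial_def k(1)
      by (simp add: mult.commute)
  qed
qed simp

lemma w_BV: "(\<lambda>x. w (x $ 3)) \<in> BV (cylinder l)"
  using derivative_3D wi3 unfolding BV_def by blast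

text \<open>The derivative measure of a function of the height has only a third component, which the
  scaling leaves alone. Hence the surface energy of the constant sequence does not depend on
  \<epsilon>.\<close>

lemma rescale_axis: "rescale \<epsilon> (a *\<^sub>R axis 3 1 :: real^3) = a *\<^sub>R axis 3 1"
  by (simp add: rescale_def vec_eq_iff axis_def)

lemma total_variation_3D:
  "total_variation (cylinder l) (\<lambda>E. rescale \<epsilon> (derivative_measure (cylinder l) (\<lambda>x. w (x $ 3)) E)) \<le> ennreal (card J * pi)"
  "total_variation (cylinder l) (derivative_measure (cylinder l) (\<lambda>x. w (x $ 3))) \<le> ennreal (card J * pi)"
proof -
  let ?P = "disc_meas l Jp" and ?N = "disc_meas l Jm"
  note p = disc_meas[OF Jpm(1,3)] and m = disc_meas[OF Jpm(2,4)]
  have eq: "derivative_measure (cylinder l) (\<lambda>x. w (x $ 3)) E = (measure ?P E - measure ?N E) *\<^sub>R axis 3 1"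
    if "E \<in> sets (restrict_space borel (cylinder l))" for E
    using has_derivative_measure_unique[OF cylinder_open has_derivative_measure_derivative_measure[OF w_BV] derivative_3D that] .
  have b: "norm ((measure ?P E - measure ?N E) *\<^sub>R axis 3 1 :: real^3) \<le> measure ?P E + measure ?N E" for E
    by (simp add: norm_axis_1 abs_le_iff add_increasing add_increasing2)
  have c: "measure ?P (cylinder l) + measure ?N (cylinder l) = card J * pi"
    by (simp add: p(3) m(3) card_J[symmetric] distrib_right)
  show "total_variation (cylinder l) (\<lambda>E. rescale \<epsilon> (derivative_measure (cylinder l) (\<lambda>x. w (x $ 3)) E)) \<le> ennreal (card J * pi)"
    unfolding c[symmetric]
    by (rule total_variation_le_measures[OF p(1) m(1) p(2) m(2)]) (simp only: eq rescale_axis b)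
  show "total_variation (cylinder l) (derivative_measure (cylinder l) (\<lambda>x. w (x $ 3))) \<le> ennreal (card J * pi)"
    unfolding c[symmetric]
    by (rule total_variation_le_measures[OF p(1) m(1) p(2) m(2)]) (simp only: eq b)
qed

end

section \<open>Lower semicontinuity of the surface term\<close>

lemma finite_set_separation:
  fixes J :: "real set"
  assumes "finite J" "J \<subseteq> {0<..<l}"
  obtains \<rho> where "0 < \<rho>" "\<And>r. r \<in> J \<Longrightarrow> \<rho> \<le> r" "\<And>r. r \<in> J \<Longrightarrow> r + \<rho> \<le> l"
    "\<And>r r'. r \<in> J \<Longrightarrow> r' \<in> J \<Longrightarrow> r \<noteq> r' \<Longrightarrow> 2 * \<rho> \<le> \<bar>r - r'\<bar>"
proof -
  \<comment> \<open>The minimum is at most the distance of each jump to both ends and half of every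
    gap; the element 1 keeps the set nonempty when there are no jumps.\<close>
  let ?S = "insert 1 (J \<union> (\<lambda>r. l - r) ` J \<union> (\<lambda>(r, r'). \<bar>r - r'\<bar> / 2) ` {(r, r') \<in> J \<times> J. r \<noteq> r'})"
  have fin: "finite ?S"
    using assms(1) finite_subset[of "{(r, r') \<in> J \<times> J. r \<noteq> r'}" "J \<times> J"] by auto
  have le: "Min ?S \<le> x" if "x \<in> ?S" for x using Min_le[OF fin that] .
  show ?thesis
  proof (rule that[of "Min ?S"])
    have "Min ?S \<in> ?S" by (rule Min_in[OF fin]) simp
    then show "0 < Min ?S" using assms(2) by auto
    show "Min ?S \<le> r" if "r \<in> J" for r by (rule le) (use that in auto)
    show "r + Min ?S \<le> l" if "r \<in> J" for r
    proof -
      have "Min ?S \<le> l - r" by (rule le) (use that in auto)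
      then show ?thesis by simp
    qed
    show "2 * Min ?S \<le> \<bar>r - r'\<bar>" if "r \<in> J" "r' \<in> J" "r \<noteq> r'" for r r'
    proof -
      have "Min ?S \<le> \<bar>r - r'\<bar> / 2" by (rule le) (use that in \<open>auto intro!: image_eqI[of _ _ "(r, r')"]\<close>)
      then show ?thesis by simp
    qed
  qed
qed

context jumps
begin

text \<open>One bump per jump, supported in a slab of half-width \<rho> around its disc and
  multiplied by the sign of the jump. The slabs are disjoint, so the sum stays between -1 and 1. On
  the discs themselves the bumps tend to 1, so every jump contributes nearly the full area pi, with
  a positive sign since the two signs cancel.\<close>

lemma jump_test_function:
  assumes "0 < \<delta>"
  obtains \<phi> where "\<phi> \<in> C1c (cylinder l)" "\<And>x. \<bar>\<phi> x\<bar> \<le> 1"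
    "card J * pi - \<delta> < \<bar>LINT x|lebesgue_on (cylinder l). w (x $ 3) * frechet_derivative \<phi> (at x) (axis 3 1)\<bar>"
proof -
  obtain \<rho> where \<rho>: "0 < \<rho>" "\<And>r. r \<in> J \<Longrightarrow> \<rho> \<le> r" "\<And>r. r \<in> J \<Longrightarrow> r + \<rho> \<le> l"
    "\<And>r r'. r \<in> J \<Longrightarrow> r' \<in> J \<Longrightarrow> r \<noteq> r' \<Longrightarrow> 2 * \<rho> \<le> \<bar>r - r'\<bar>"
    by (rule finite_set_separation[OF finJ J]) (rule that)
  define G where "G r x = \<kappa> (1 - ((x $ 1) * (x $ 1) + (x $ 2) * (x $ 2))) * (\<kappa> (x $ 3 - (r - \<rho>)) * \<kappa> ((r + \<rho>) - x $ 3))"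
    for r and x :: "real^3"
  have nth: "C1_deriv (\<lambda>x::real^3. x $ i) (\<lambda>_ v. v $ i)" for i
    using C1_deriv_inner[of "axis i 1 :: real^3"] by (simp add: inner_axis)
  have "\<exists>D. C1_deriv (G r) D" for r
    using C1_deriv_scaleR[OF C1_deriv_\<kappa>[OF C1_deriv_diff[OF C1_deriv_const[of 1]
            C1_deriv_add[OF C1_deriv_scaleR[OF nth[of 1] nth[of 1]] C1_deriv_scaleR[OF nth[of 2] nth[of 2]]]]]
        C1_deriv_scaleR[OF C1_deriv_\<kappa>[OF C1_deriv_diff[OF nth[of 3] C1_deriv_const[of "r - \<rho>"]]]
          C1_deriv_\<kappa>[OF C1_deriv_diff[OF C1_deriv_const[of "r + \<rho>"] nth[of 3]]]]]
    unfolding G_def[abs_def] real_scaleR_def by blast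
  then obtain D where D: "\<And>r. C1_deriv (G r) (D r)" by metis
  have G0: "0 \<le> G r x" for r x unfolding G_def by (intro mult_nonneg_nonneg \<kappa>_nonneg)
  have Gpos: "0 < G r x \<longleftrightarrow> (x $ 1)\<^sup>2 + (x $ 2)\<^sup>2 < 1 \<and> \<bar>x $ 3 - r\<bar> < \<rho>" for r x
  proof -
    have *: "0 < a * (b * c) \<longleftrightarrow> 0 < a \<and> 0 < b \<and> 0 < c" if "0 \<le> a" "0 \<le> b" "0 \<le> c" for a b c :: real
      using that by (auto simp: zero_less_mult_iff)
    show ?thesis unfolding G_def *[OF \<kappa>_nonneg \<kappa>_nonneg \<kappa>_nonneg] \<kappa>_pos_iff
      by (auto simp: power2_eq_square)
  qed
  have Gcyl: "{x. 0 < G r x} \<subseteq> cylinder l" if "r \<in> J" for r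
    using \<rho>(2,3)[OF that] by (auto simp: Gpos cylinder_def)
  define \<phi> where "\<phi> n x = (\<Sum>r\<in>J. \<kappa> (real n * G r x - 1) *\<^sub>R s r)" for n :: nat and x
  have \<phi>: "\<phi> n \<in> C1c (cylinder l)" for n
    unfolding \<phi>_def[abs_def]
  proof (rule C1c_sum(1)[OF finJ], rule C1c_scaleR(1)[OF _ C1_deriv_const])
    fix r assume "r \<in> J"
    then show "(\<lambda>x. \<kappa> (real n * G r x - 1)) \<in> C1c (cylinder l)"
      using Gcyl bounded_subset[OF cylinder_bounded Gcyl] by (intro C1c_superlevel[OF D]) simp_all
  qed
  have z: "\<kappa> (real n * G r x - 1) = 0" if "\<not> 0 < G r x" for n r x
    using that G0[of r x] by (simp add: \<kappa>_eq_0)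
  have single: "\<phi> n x = \<kappa> (real n * G r0 x - 1) * s r0" if "r0 \<in> J" "\<bar>x $ 3 - r0\<bar> < \<rho>" for n x r0
  proof -
    have "\<kappa> (real n * G r x - 1) = 0" if "r \<in> J" "r \<noteq> r0" for r
    proof (rule z)
      have "\<not> \<bar>x $ 3 - r\<bar> < \<rho>" using \<rho>(4)[OF \<open>r \<in> J\<close> \<open>r0 \<in> J\<close> \<open>r \<noteq> r0\<close>] \<open>\<bar>x $ 3 - r0\<bar> < \<rho>\<close> by linarith
      then show "\<not> 0 < G r x" by (simp add: Gpos)
    qed
    then have "\<phi> n x = (\<Sum>r\<in>J. if r = r0 then \<kappa> (real n * G r0 x - 1) * s r0 else 0)"
      unfolding \<phi>_def by (intro sum.cong) auto
    then show ?thesis using finJ that(1) by simp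
  qed
  have bound: "\<bar>\<phi> n x\<bar> \<le> 1" for n x
  proof (cases "\<exists>r0\<in>J. \<bar>x $ 3 - r0\<bar> < \<rho>")
    case True
    then obtain r0 where r0: "r0 \<in> J" "\<bar>x $ 3 - r0\<bar> < \<rho>" by blast
    show ?thesis unfolding single[OF r0] using s[OF r0(1)] \<kappa>_nonneg \<kappa>_le_1 by (simp add: abs_mult)
  next
    case False
    then have "\<phi> n x = 0" unfolding \<phi>_def using z by (intro sum.neutral) (auto simp: Gpos)
    then show ?thesis by simp
  qed
  \<comment> \<open>The common profile of all bumps on their central discs: at height r both axial
    factors of \<open>G r\<close> equal \<kappa> \<rho>.\<close>
  define H where "H y = \<kappa> (1 - (fst y * fst y + snd y * snd y)) * (\<kappa> \<rho> * \<kappa> \<rho>)" for y :: "real \<times> real"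
  have slice: "s r * \<phi> n (cyl_point (y, r)) = \<kappa> (real n * H y - 1)" if "r \<in> J" for r n y
  proof -
    have c3: "cyl_point (y, r) $ 3 = r" "cyl_point (y, r) $ 1 = fst y" "cyl_point (y, r) $ 2 = snd y"
      by (cases y; simp)+
    have "s r * s r = 1" using s[OF that] by (metis abs_mult_self_eq mult_1)
    moreover have "G r (cyl_point (y, r)) = H y" by (simp add: G_def H_def c3)
    ultimately show ?thesis
      using single[OF that, of "cyl_point (y, r)" n] \<rho>(1) by (simp add: c3 mult.left_commute)
  qed
  have \<kappa>c: "continuous_on UNIV \<kappa>"
    using has_vector_derivative_\<kappa> by (auto intro!: continuous_at_imp_continuous_on has_vector_derivative_continuous)
  have Hc: "continuous_on UNIV H"
  proof -
    have "continuous_on UNIV (\<lambda>y :: real \<times> real. \<kappa> (1 - (fst y * fst y + snd y * snd y)))"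
      by (rule continuous_on_compose2[OF \<kappa>c]) (auto intro!: continuous_intros)
    then show ?thesis unfolding H_def[abs_def] by (rule continuous_on_mult_right)
  qed
  have Hpos: "0 < H y \<longleftrightarrow> y \<in> disc" for y
  proof -
    have *: "0 < a * (b * b) \<longleftrightarrow> 0 < a" if "0 \<le> a" "0 < b" for a b :: real
      using that by (auto simp: zero_less_mult_iff)
    have "0 < \<kappa> \<rho>" using \<rho>(1) by (simp add: \<kappa>_pos_iff)
    moreover have "y \<in> disc \<longleftrightarrow> fst y * fst y + snd y * snd y < 1"
      by (cases y) (simp add: mem_disc power2_eq_square)
    ultimately show ?thesis unfolding H_def by (simp add: *[OF \<kappa>_nonneg] \<kappa>_pos_iff)
  qed
  have H0: "0 \<le> H y" for y unfolding H_def by (intro mult_nonneg_nonneg \<kappa>_nonneg)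
  have lim: "(\<lambda>n. LINT y|lborel. \<kappa> (real n * H y - 1)) \<longlonglongrightarrow> (LINT y|lborel. indicator disc y)"
  proof (rule integral_dominated_convergence[where w = "indicator disc"])
    have "continuous_on UNIV (\<lambda>y. \<kappa> (real n * H y - 1))" for n
      by (rule continuous_on_compose2[OF \<kappa>c]) (auto intro!: continuous_intros Hc)
    then show "(\<lambda>y. \<kappa> (real n * H y - 1)) \<in> borel_measurable lborel" for n
      by (simp add: borel_measurable_continuous_onI)
    show "integrable lborel (indicator disc :: real \<times> real \<Rightarrow> real)"
      by (rule integrable_real_indicator) (auto simp: emeasure_disc)
    show "AE y in lborel. (\<lambda>n. \<kappa> (real n * H y - 1)) \<longlonglongrightarrow> indicator disc y"
    proof (rule AE_I2)
      fix y
      have "(\<lambda>n. \<kappa> (real n * H y - 1)) \<longlonglongrightarrow> (if 0 < H y then 1 else 0)"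
        by (rule bump_tendsto_indicator[of "\<lambda>_. H y" 0]) (use H0[of y] in auto)
      then show "(\<lambda>n. \<kappa> (real n * H y - 1)) \<longlonglongrightarrow> indicator disc y"
        by (cases "y \<in> disc") (simp_all add: Hpos)
    qed
    show "AE y in lborel. norm (\<kappa> (real n * H y - 1)) \<le> indicator disc y" for n
    proof (rule AE_I2)
      fix y
      have "\<kappa> (real n * H y - 1) = 0" if "y \<notin> disc"
        using that Hpos[of y] H0[of y] by (simp add: \<kappa>_eq_0)
      then show "norm (\<kappa> (real n * H y - 1)) \<le> indicator disc y"
        using \<kappa>_nonneg \<kappa>_le_1 by (auto split: split_indicator)
    qed
  qed simp
  have "(LINT y|lborel. indicator disc y :: real) = pi" by (simp add: measure_def emeasure_disc)
  with tendsto_mult[OF tendsto_const[of "real (card J)"] lim]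
  have "(\<lambda>n. real (card J) * (LINT y|lborel. \<kappa> (real n * H y - 1))) \<longlonglongrightarrow> card J * pi" by simp
  then have "\<forall>\<^sub>F n in sequentially. card J * pi - \<delta> < real (card J) * (LINT y|lborel. \<kappa> (real n * H y - 1))"
    by (rule order_tendstoD) (use assms in simp)
  then obtain n where n: "card J * pi - \<delta> < real (card J) * (LINT y|lborel. \<kappa> (real n * H y - 1))"
    using eventually_happens trivial_limit_sequentially by blast
  show ?thesis
  proof (rule that[of "\<phi> n", OF \<phi> bound])
    have "- (LINT x|lebesgue_on (cylinder l). w (x $ 3) * frechet_derivative (\<phi> n) (at x) (axis 3 1))
      = (\<Sum>r\<in>J. s r * (LINT y|lborel. \<phi> n (cyl_point (y, r))))" by (rule integral_3D[OF \<phi>])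
    also have "\<dots> = (\<Sum>r\<in>J. (LINT y|lborel. \<kappa> (real n * H y - 1)))"
    proof (rule sum.cong[OF refl])
      fix r assume "r \<in> J"
      have "s r * (LINT y|lborel. \<phi> n (cyl_point (y, r))) = (LINT y|lborel. s r * \<phi> n (cyl_point (y, r)))" by simp
      then show "s r * (LINT y|lborel. \<phi> n (cyl_point (y, r))) = (LINT y|lborel. \<kappa> (real n * H y - 1))"
        by (simp only: slice[OF \<open>r \<in> J\<close>])
    qed
    finally show "card J * pi - \<delta> < \<bar>LINT x|lebesgue_on (cylinder l). w (x $ 3) * frechet_derivative (\<phi> n) (at x) (axis 3 1)\<bar>"
      using n by simp
  qed
qed

lemma rescale_3: "rescale \<epsilon> v $ 3 = v $ 3"
  by (simp add: rescale_def)

text \<open>The test function is fixed, and its integral against \<open>ws \<epsilon>\<close>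
  converges by L1 convergence. It tests only the axial component, which no scaling changes and which
  the norm of the rescaled measure dominates; so the scaling e may be any function of
  \<epsilon>.\<close>

lemma total_variation_lower_semicontinuous:
  assumes conv: "weakly_star_in_BV (cylinder l) F ws (\<lambda>x. w (x $ 3))" and \<delta>: "0 < \<delta>"
  shows "\<forall>\<^sub>F \<epsilon> in F. ennreal (card J * pi - \<delta>) \<le>
    total_variation (cylinder l) (\<lambda>E. rescale (e \<epsilon>) (derivative_measure (cylinder l) (ws \<epsilon>) E))"
proof -
  let ?L = "lebesgue_on (cylinder l)"
  obtain \<phi> where \<phi>: "\<phi> \<in> C1c (cylinder l)" "\<And>x. \<bar>\<phi> x\<bar> \<le> 1"
    "card J * pi - \<delta> < \<bar>LINT x|?L. w (x $ 3) * frechet_derivative \<phi> (at x) (axis 3 1)\<bar>"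
    by (rule jump_test_function[OF \<delta>]) (rule that)
  let ?d = "\<lambda>x. frechet_derivative \<phi> (at x) (axis 3 1)"
  obtain M where M: "\<And>x. \<bar>\<phi> x\<bar> \<le> M" "\<And>x. \<bar>?d x\<bar> \<le> M"
    "\<phi> \<in> borel_measurable ?L" "?d \<in> borel_measurable ?L"
    by (rule C1c_bounded_measurable[OF \<phi>(1), of "axis 3 1" "cylinder l"]) (rule that)
  have ev: "\<forall>\<^sub>F \<epsilon> in F. ws \<epsilon> \<in> BV (cylinder l)"
    and lim: "((\<lambda>\<epsilon>. LINT x|?L. \<bar>ws \<epsilon> x - w (x $ 3)\<bar>) \<longlongrightarrow> 0) F"
    using conv by (auto simp: weakly_star_in_BV_def)
  have "((\<lambda>\<epsilon>. LINT x|?L. ?d x *\<^sub>R ws \<epsilon> x) \<longlongrightarrow> (LINT x|?L. ?d x *\<^sub>R w (x $ 3))) F"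
    by (rule integral_bounded_tendsto[OF M(4,2) _ wi3])
      (use ev lim in \<open>auto elim!: eventually_mono simp: BV_def\<close>)
  from tendsto_rabs[OF this] have "\<forall>\<^sub>F \<epsilon> in F. card J * pi - \<delta> < \<bar>LINT x|?L. ?d x *\<^sub>R ws \<epsilon> x\<bar>"
    by (rule order_tendstoD) (use \<phi>(3) in \<open>simp add: mult.commute\<close>)
  with ev show ?thesis
  proof eventually_elim
    fix \<epsilon> assume 1: "ws \<epsilon> \<in> BV (cylinder l)" and 2: "card J * pi - \<delta> < \<bar>LINT x|?L. ?d x *\<^sub>R ws \<epsilon> x\<bar>"
    have "ennreal \<bar>LINT x|?L. ws \<epsilon> x * ?d x\<bar>
      \<le> total_variation (cylinder l) (\<lambda>E. rescale (e \<epsilon>) (derivative_measure (cylinder l) (ws \<epsilon>) E))"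
    proof (rule total_variation_ge_test[OF has_derivative_measure_derivative_measure[OF 1] axis_in_Basis3 \<phi>(1,2)])
      fix E
      let ?v = "derivative_measure (cylinder l) (ws \<epsilon>) E"
      have "\<bar>?v \<bullet> axis 3 1\<bar> = \<bar>rescale (e \<epsilon>) ?v $ 3\<bar>" by (simp add: inner_axis rescale_3)
      also have "\<dots> \<le> norm (rescale (e \<epsilon>) ?v)" by (rule component_le_norm_cart)
      finally show "\<bar>?v \<bullet> axis 3 1\<bar> \<le> norm (rescale (e \<epsilon>) ?v)" .
    qed
    moreover have "ennreal (card J * pi - \<delta>) \<le> ennreal \<bar>LINT x|?L. ws \<epsilon> x * ?d x\<bar>"
      using 2 by (intro ennreal_leI) (simp add: mult.commute)
    ultimately show "ennreal (card J * pi - \<delta>) \<le>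
        total_variation (cylinder l) (\<lambda>E. rescale (e \<epsilon>) (derivative_measure (cylinder l) (ws \<epsilon>) E))"
      by (rule order_trans[rotated])
  qed
qed

end

section \<open>Convex envelopes\<close>

text \<open>The point (x, r) is separated from the closed convex epigraph. The vertical component of
  the separating functional is positive because (x, g x) lies straight above (x, r), so the
  hyperplane is the graph of an affine function.\<close>

lemma convex_affine_minorant:
  fixes g :: "'a::euclidean_space \<Rightarrow> real"
  assumes g: "convex_on UNIV g" and r: "r < g x"
  obtains a \<beta> where "\<And>y. a + \<beta> \<bullet> y \<le> g y" "r < a + \<beta> \<bullet> x"
proof -
  have c: "continuous_on UNIV g" by (rule convex_on_continuous[OF open_UNIV g])
  let ?E = "{p. g (fst p) \<le> snd p}"
  have "closed ?E"
    by (intro closed_Collect_le continuous_intros continuous_on_compose2[OF c]) auto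
  moreover have "convex ?E"
    using g convex_epigraph[of UNIV g] by (simp add: epigraph_def)
  moreover have "(x, r) \<notin> ?E" using r by simp
  ultimately obtain a b where ab: "a \<bullet> (x, r) < b" "\<And>p. p \<in> ?E \<Longrightarrow> b < a \<bullet> p"
    using separating_hyperplane_closed_point[of ?E "(x, r)"] by blast
  have 1: "fst a \<bullet> x + snd a * r < b" using ab(1) by (simp add: inner_prod_def)
  have 2: "b < fst a \<bullet> y + snd a * g y" for y using ab(2)[of "(y, g y)"] by (simp add: inner_prod_def)
  have "0 < snd a * (g x - r)" using 1 2[of x] by (simp add: right_diff_distrib)
  then have p: "0 < snd a" using r by (simp add: zero_less_mult_iff)
  show ?thesis
  proof (rule that[of "b / snd a" "- ((1 / snd a) *\<^sub>R fst a)"])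
    show "b / snd a + - ((1 / snd a) *\<^sub>R fst a) \<bullet> y \<le> g y" for y
    proof -
      have "b / snd a - (fst a \<bullet> y) / snd a = (b - fst a \<bullet> y) / snd a" by (simp add: diff_divide_distrib)
      also have "\<dots> \<le> g y" using 2[of y] p by (simp add: pos_divide_le_eq mult.commute)
      finally show ?thesis by simp
    qed
    have "r < (b - fst a \<bullet> x) / snd a" using 1 p by (simp add: pos_less_divide_eq mult.commute)
    then show "r < b / snd a + - ((1 / snd a) *\<^sub>R fst a) \<bullet> x" by (simp add: diff_divide_distrib)
  qed
qed

text \<open>The region strictly below the graph of g is the union of the open regions below its
  affine minorants, and by Lindeloef countably many of them have the same union.\<close>

lemma convex_countable_affine_minorants:
  fixes g :: "'a::euclidean_space \<Rightarrow> real"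
  assumes g: "convex_on UNIV g"
  obtains a \<beta> where "\<And>(n::nat) y. a n + \<beta> n \<bullet> y \<le> g y" "\<And>x r. r < g x \<Longrightarrow> \<exists>n. r < a n + \<beta> n \<bullet> x"
proof -
  let ?S = "\<lambda>(a, \<beta>). {p. snd p < a + \<beta> \<bullet> fst p}"
  let ?M = "{(a, \<beta>). \<forall>y. a + \<beta> \<bullet> y \<le> g y}"
  let ?F = "?S ` ?M"
  have op: "open S" if "S \<in> ?F" for S
    using that by (auto intro!: open_Collect_less continuous_intros)
  obtain F' where F': "F' \<subseteq> ?F" "countable F'" "\<Union>F' = \<Union>?F"
    by (rule Lindelof[OF op])
  have cov: "\<exists>S\<in>F'. (x, r) \<in> S" if rg: "r < g x" for x r
  proof -
    obtain a \<beta> where "\<And>y. a + \<beta> \<bullet> y \<le> g y" "r < a + \<beta> \<bullet> x"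
      by (rule convex_affine_minorant[OF g rg]) (rule that)
    then have "(x, r) \<in> ?S (a, \<beta>)" "(a, \<beta>) \<in> ?M" by auto
    then have "(x, r) \<in> \<Union>?F" by blast
    then show ?thesis using F'(3) by blast
  qed
  have "F' \<noteq> {}" using cov[of "g 0 - 1" 0] by auto
  then have fn: "from_nat_into F' n \<in> F'" for n by (rule from_nat_into)
  have "\<forall>n. \<exists>p. p \<in> ?M \<and> from_nat_into F' n = ?S p"
  proof
    fix n
    have "from_nat_into F' n \<in> ?F" using fn F'(1) by (rule subsetD[rotated])
    then obtain p where "from_nat_into F' n = ?S p" "p \<in> ?M" by (rule imageE)
    then show "\<exists>p. p \<in> ?M \<and> from_nat_into F' n = ?S p" by (intro exI[of _ p] conjI)
  qed
  from choice[OF this] obtain p where p: "\<forall>n. p n \<in> ?M \<and> from_nat_into F' n = ?S (p n)" by (rule exE)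
  show ?thesis
  proof (rule that[of "\<lambda>n. fst (p n)" "\<lambda>n. snd (p n)"])
    show "fst (p n) + snd (p n) \<bullet> y \<le> g y" for n y
      using p by (metis (mono_tags, lifting) case_prodE fst_conv mem_Collect_eq snd_conv)
    fix x r assume "r < g x"
    then obtain S where S: "S \<in> F'" "(x, r) \<in> S" using cov by blast
    then obtain n where "S = from_nat_into F' n" using from_nat_into_surj[OF F'(2)] by metis
    then have "(x, r) \<in> ?S (p n)" using S p by simp
    then show "\<exists>n. r < fst (p n) + snd (p n) \<bullet> x" by (auto simp: split_beta)
  qed
qed

lemma convex_envelope_bdd:
  "bdd_above ((\<lambda>h. h x) ` {h. convex_on UNIV h \<and> (\<forall>y. h y \<le> g y)})"
  by (rule bdd_aboveI2[of _ _ "g x"]) auto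

lemma convex_envelope_ge:
  assumes "convex_on UNIV h" "\<And>y. h y \<le> g y"
  shows "h x \<le> convex_envelope g x"
  unfolding convex_envelope_def envelope_def
  by (rule cSUP_upper[OF _ convex_envelope_bdd]) (use assms in auto)

lemma convex_envelope_le:
  assumes "convex_on UNIV h" "\<And>y. h y \<le> g y"
  shows "convex_envelope g x \<le> g x"
  unfolding convex_envelope_def envelope_def
  by (rule cSUP_least) (use assms in auto)

lemma convex_on_convex_envelope:
  assumes "convex_on UNIV h" "\<And>y. h y \<le> g y"
  shows "convex_on UNIV (convex_envelope g)"
proof (rule convex_onI)
  fix t x y assume t: "0 < (t::real)" "t < 1"
  show "convex_envelope g ((1 - t) *\<^sub>R x + t *\<^sub>R y) \<le> (1 - t) * convex_envelope g x + t * convex_envelope g y"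
    unfolding convex_envelope_def[of ] envelope_def[of _ _ "(1 - t) *\<^sub>R x + t *\<^sub>R y"]
  proof (rule cSUP_least)
    show "{h. convex_on UNIV h \<and> (\<forall>y. h y \<le> g y)} \<noteq> {}" using assms by auto
    fix k assume k: "k \<in> {h. convex_on UNIV h \<and> (\<forall>y. h y \<le> g y)}"
    then have "k ((1 - t) *\<^sub>R x + t *\<^sub>R y) \<le> (1 - t) * k x + t * k y"
      using t by (intro convex_onD[of UNIV k]) auto
    also have "\<dots> \<le> (1 - t) * convex_envelope g x + t * convex_envelope g y"
      using t k by (intro add_mono mult_left_mono convex_envelope_ge) auto
    finally show "k ((1 - t) *\<^sub>R x + t *\<^sub>R y) \<le> (1 - t) * envelope (convex_on UNIV) g x + t * envelope (convex_on UNIV) g y"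
      by (simp add: convex_envelope_def)
  qed
qed simp

section \<open>Minimising out the first two columns, and the convex envelope of the result\<close>

lemma vector_3_nth: "(vector [a, b, c] :: real^3^3) $ 1 = a" "(vector [a, b, c] :: real^3^3) $ 2 = b"
  "(vector [a, b, c] :: real^3^3) $ 3 = c"
  by (simp_all add: vector_3)

lemma matrix3_eq: "(\<xi> :: real^3^3) = vector [\<xi> $ 1, \<xi> $ 2, \<xi> $ 3]"
  by (simp add: vec_eq_iff forall_3 vector_3)

lemma f0_le:
  assumes "\<And>\<xi>. m \<le> f b \<xi>"
  shows "f0 f b (\<xi> $ 3) \<le> f b \<xi>"
proof -
  have "f0 f b (\<xi> $ 3) \<le> (case (\<xi> $ 1, \<xi> $ 2) of (\<xi>1, \<xi>2) \<Rightarrow> f b (vector [\<xi>1, \<xi>2, \<xi> $ 3]))"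
    unfolding f0_def by (rule cINF_lower) (use assms in \<open>auto intro!: bdd_belowI2[of _ m]\<close>)
  then show ?thesis by (simp add: matrix3_eq[of \<xi>, symmetric])
qed

lemma f0_ge:
  assumes "\<And>\<xi>. \<xi> $ 3 = \<eta> \<Longrightarrow> m \<le> f b \<xi>"
  shows "m \<le> f0 f b \<eta>"
  unfolding f0_def by (rule cINF_greatest) (use assms in \<open>auto simp: vector_3_nth\<close>)

text \<open>
  A value of the convex envelope of \<open>f0\<close> is almost attained by a probability vector on matrices;
  it is realised as the distribution of a step function on the unit interval.
\<close>

definition step_fun :: "(nat \<Rightarrow> real) \<Rightarrow> (nat \<Rightarrow> 'b::real_vector) \<Rightarrow> nat \<Rightarrow> real \<Rightarrow> 'b" where
  "step_fun lam X k t = (\<Sum>i<k. indicator {sum lam {..<i}..<sum lam {..<Suc i}} t *\<^sub>R X i)"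

lemma step_fun_value:
  assumes "\<And>i. i < k \<Longrightarrow> 0 \<le> lam i" "t \<in> {sum lam {..<j}..<sum lam {..<Suc j}}" "j < k"
  shows "step_fun lam X k t = X j"
proof -
  have mono: "sum lam {..<i} \<le> sum lam {..<i'}" if "i \<le> i'" "i' \<le> k" for i i'
    using that assms(1) by (intro sum_mono2) auto
  have "indicator {sum lam {..<i}..<sum lam {..<Suc i}} t *\<^sub>R X i = (if i = j then X j else 0)" if "i < k" for i
  proof (cases "i = j")
    case False
    then have "Suc i \<le> j \<or> Suc j \<le> i" by linarith
    then have "t \<notin> {sum lam {..<i}..<sum lam {..<Suc i}}"
      using assms(2,3) mono[of "Suc i" j] mono[of "Suc j" i] that by fastforce
    then show ?thesis using False by simp
  qed (use assms(2) in simp)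
  then have "step_fun lam X k t = (\<Sum>i<k. if i = j then X j else 0)"
    unfolding step_fun_def by (intro sum.cong) auto
  then show ?thesis using assms(3) by simp
qed

lemma step_fun_range: "(\<And>i. i < k \<Longrightarrow> 0 \<le> lam i) \<Longrightarrow> step_fun lam X k t \<in> insert 0 (X ` {..<k})"
proof -
  assume nn: "\<And>i. i < k \<Longrightarrow> 0 \<le> lam i"
  show ?thesis
  proof (cases "\<exists>j<k. t \<in> {sum lam {..<j}..<sum lam {..<Suc j}}")
    case True
    then obtain j where j: "j < k" "t \<in> {sum lam {..<j}..<sum lam {..<Suc j}}" by blast
    have "step_fun lam X k t = X j" by (rule step_fun_value[OF nn j(2,1)])
    then show ?thesis using j(1) by blast
  next
    case False
    then have "step_fun lam X k t = 0" unfolding step_fun_def by (intro sum.neutral) auto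
    then show ?thesis by simp
  qed
qed

lemma step_fun_covers:
  fixes lam :: "nat \<Rightarrow> real"
  assumes "\<And>i. i < k \<Longrightarrow> 0 \<le> lam i" "0 \<le> t" "t < sum lam {..<k}"
  shows "\<exists>j<k. t \<in> {sum lam {..<j}..<sum lam {..<Suc j}}"
  using assms
proof (induction k)
  case (Suc k)
  show ?case
  proof (cases "t < sum lam {..<k}")
    case True
    then show ?thesis using Suc.IH Suc.prems(1,2) by (meson less_SucI)
  next
    case False
    then show ?thesis using Suc.prems(3) by (intro exI[of _ k]) auto
  qed
qed auto

lemma step_fun_integral:
  fixes X :: "nat \<Rightarrow> 'b::euclidean_space" and F :: "'b \<Rightarrow> 'c::euclidean_space"
  assumes nn: "\<And>i. i < k \<Longrightarrow> 0 \<le> lam i" and 1: "sum lam {..<k} = 1"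
  shows "(LINT t|lborel. indicator {0..<1} t *\<^sub>R F (step_fun lam X k t)) = (\<Sum>i<k. lam i *\<^sub>R F (X i))"
proof -
  let ?I = "\<lambda>i. {sum lam {..<i}..<sum lam {..<Suc i}}"
  have mono: "sum lam {..<i} \<le> sum lam {..<i'}" if "i \<le> i'" "i' \<le> k" for i i'
    using that nn by (intro sum_mono2) auto
  have eq: "indicator {0..<1} t *\<^sub>R F (step_fun lam X k t) = (\<Sum>i<k. indicator (?I i) t *\<^sub>R F (X i))" for t
  proof (cases "t \<in> {0..<1}")
    case True
    then obtain j where j: "j < k" "t \<in> ?I j" using step_fun_covers[of k lam t, OF nn] 1 by auto
    have 1: "step_fun lam X k t = X j" by (rule step_fun_value[OF nn j(2,1)])
    have "(\<Sum>i<k. indicator (?I i) t *\<^sub>R F (X i)) = step_fun lam (\<lambda>i. F (X i)) k t" by (simp only: step_fun_def)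
    also have "\<dots> = F (X j)" by (rule step_fun_value[OF nn j(2,1)])
    also have "\<dots> = indicator {0..<1} t *\<^sub>R F (step_fun lam X k t)" using True by (simp add: 1)
    finally show ?thesis by simp
  next
    case False
    have "t \<notin> ?I i" if "i < k" for i
      using False mono[of 0 i] mono[of "Suc i" k] that 1 by auto
    then show ?thesis using False by simp
  qed
  have "(LINT t|lborel. indicator {0..<1} t *\<^sub>R F (step_fun lam X k t)) = (\<Sum>i<k. LINT t|lborel. indicator (?I i) t *\<^sub>R F (X i))"
    unfolding eq using nn
    by (intro Bochner_Integration.integral_sum integrable_scaleR_left integrable_real_indicator) auto
  also have "\<dots> = (\<Sum>i<k. lam i *\<^sub>R F (X i))"
  proof (rule sum.cong[OF refl])
    fix i assume "i \<in> {..<k}"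
    then have "0 \<le> lam i" using nn by simp
    then show "(LINT t|lborel. indicator (?I i) t *\<^sub>R F (X i)) = lam i *\<^sub>R F (X i)" by simp
  qed
  finally show ?thesis .
qed

lemma step_fun_measurable:
  fixes X :: "nat \<Rightarrow> 'b::euclidean_space"
  shows "step_fun lam X k \<in> borel_measurable borel"
  unfolding step_fun_def[abs_def]
  by (intro borel_measurable_sum borel_measurable_scaleR borel_measurable_indicator) auto

text \<open>Let h be the lower boundary of the convex hull of all pairs (\<xi> $ 3, r) with r at
  least f b \<xi>. It is convex and lies below \<open>f0\<close>, hence below the envelope, and
  points of the hull are finite convex combinations. Taking the pairs over all matrices, and not
  over values of \<open>f0\<close>, resolves the infimum over the first two columns and the
  convexification in a single combination.\<close>

lemma convex_envelope_f0_approx: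
  fixes f :: "real \<Rightarrow> real^3^3 \<Rightarrow> real"
  assumes lb: "\<And>\<xi>. m \<le> f b \<xi>" and e: "0 < e"
  obtains \<psi> :: "real \<Rightarrow> real^3^3" where "\<psi> \<in> borel_measurable borel" "finite (range \<psi>)"
    "(LINT t|lborel. indicator {0..<1} t *\<^sub>R \<psi> t $ 3) = \<eta>"
    "(LINT t|lborel. indicator {0..<1} t * f b (\<psi> t)) < convex_envelope (f0 f b) \<eta> + e"
proof -
  let ?S = "{(\<xi> $ 3, r) | \<xi> r. f b \<xi> \<le> r}"
  let ?H = "convex hull ?S"
  define h where "h \<eta> = Inf {r. (\<eta>, r) \<in> ?H}" for \<eta>
  have lbH: "m \<le> r" if "(\<eta>, r) \<in> ?H" for \<eta> r
  proof -
    have "?S \<subseteq> {p. m \<le> snd p}" using lb order_trans by fastforce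
    moreover have "convex {p :: (real^3) \<times> real. m \<le> snd p}"
    proof -
      have "{p :: (real^3) \<times> real. m \<le> snd p} = UNIV \<times> {m..}" by auto
      then show ?thesis by (simp add: convex_Times)
    qed
    ultimately have "?H \<subseteq> {p. m \<le> snd p}" by (rule hull_minimal)
    then show ?thesis using that by auto
  qed
  have bd: "bdd_below {r. (\<eta>, r) \<in> ?H}" for \<eta> using lbH by (auto intro!: bdd_belowI[of _ m])
  have ne: "{r. (\<eta>, r) \<in> ?H} \<noteq> {}" for \<eta>
  proof -
    have "(\<eta>, f b (vector [0, 0, \<eta>])) \<in> ?S"
      by (simp, rule exI[of _ "vector [0, 0, \<eta>]"]) (simp add: vector_3_nth)
    then show ?thesis using hull_subset[of ?S convex] by blast
  qed
  have "convex_on UNIV h"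
  proof (rule convex_onI)
    fix t :: real and x y :: "real^3" assume t: "0 < t" "t < 1"
    show "h ((1 - t) *\<^sub>R x + t *\<^sub>R y) \<le> (1 - t) * h x + t * h y"
    proof (rule field_le_epsilon)
      fix d :: real assume d: "0 < d"
      obtain r where r: "(x, r) \<in> ?H" "r < h x + d"
        using cInf_lessD[OF ne[of x], of "h x + d"] d unfolding h_def by auto
      obtain r' where r': "(y, r') \<in> ?H" "r' < h y + d"
        using cInf_lessD[OF ne[of y], of "h y + d"] d unfolding h_def by auto
      have "(1 - t) *\<^sub>R (x, r) + t *\<^sub>R (y, r') \<in> ?H"
        using r(1) r'(1) t by (intro convexD[OF convex_convex_hull]) auto
      then have "h ((1 - t) *\<^sub>R x + t *\<^sub>R y) \<le> (1 - t) * r + t * r'"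
        unfolding h_def by (intro cInf_lower bd) auto
      also have "\<dots> \<le> (1 - t) * (h x + d) + t * (h y + d)"
        using r(2) r'(2) t by (intro add_mono mult_left_mono) auto
      finally show "h ((1 - t) *\<^sub>R x + t *\<^sub>R y) \<le> (1 - t) * h x + t * h y + d" by (simp add: algebra_simps)
    qed
  qed simp
  moreover have "h \<eta> \<le> f0 f b \<eta>" for \<eta>
  proof (rule f0_ge)
    fix \<xi> :: "real^3^3" assume "\<xi> $ 3 = \<eta>"
    then have "(\<eta>, f b \<xi>) \<in> ?S" by auto
    then have "(\<eta>, f b \<xi>) \<in> ?H" using hull_subset[of ?S convex] by blast
    then show "h \<eta> \<le> f b \<xi>" unfolding h_def by (intro cInf_lower bd) simp
  qed
  ultimately have "h \<eta> \<le> convex_envelope (f0 f b) \<eta>" by (rule convex_envelope_ge)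
  then have "h \<eta> < convex_envelope (f0 f b) \<eta> + e" using e by linarith
  then obtain r where r: "(\<eta>, r) \<in> ?H" "r < convex_envelope (f0 f b) \<eta> + e"
    using cInf_lessD[OF ne[of \<eta>]] unfolding h_def by blast
  then obtain k :: nat and u x where kux: "\<forall>i\<in>{1..k}. 0 \<le> u i \<and> x i \<in> ?S" "sum u {1..k} = 1"
    "(\<Sum>i = 1..k. u i *\<^sub>R x i) = (\<eta>, r)"
    unfolding convex_hull_indexed by blast
  have "\<forall>i. \<exists>\<xi>. i \<in> {1..k} \<longrightarrow> fst (x i) = \<xi> $ 3 \<and> f b \<xi> \<le> snd (x i)"
  proof
    fix i
    show "\<exists>\<xi>. i \<in> {1..k} \<longrightarrow> fst (x i) = \<xi> $ 3 \<and> f b \<xi> \<le> snd (x i)"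
    proof (cases "i \<in> {1..k}")
      case True
      then have "x i \<in> ?S" using kux(1) by blast
      then obtain \<xi> r where "x i = (\<xi> $ 3, r)" "f b \<xi> \<le> r" by auto
      then show ?thesis by auto
    qed blast
  qed
  from choice[OF this] obtain X where X: "\<forall>i. i \<in> {1..k} \<longrightarrow> fst (x i) = X i $ 3 \<and> f b (X i) \<le> snd (x i)" by (rule exE)
  define lam where "lam i = u (Suc i)" for i
  define Y where "Y i = X (Suc i)" for i
  have sh: "(\<Sum>i = 1..k. g i) = (\<Sum>i<k. g (Suc i))" for g :: "nat \<Rightarrow> 'z::comm_monoid_add"
    by (simp add: sum.atLeast1_atMost_eq)
  have nn: "\<And>i. i < k \<Longrightarrow> 0 \<le> lam i" using kux(1) by (simp add: lam_def)
  have 1: "sum lam {..<k} = 1" using kux(2) unfolding sh lam_def by simp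
  have Xi: "fst (x (Suc i)) = Y i $ 3" "f b (Y i) \<le> snd (x (Suc i))" if "i < k" for i
    using X that by (auto simp: Y_def)
  have eta: "(\<Sum>i<k. lam i *\<^sub>R (Y i $ 3)) = \<eta>"
  proof -
    have "\<eta> = fst (\<Sum>i = 1..k. u i *\<^sub>R x i)" using kux(3) by simp
    also have "\<dots> = (\<Sum>i<k. lam i *\<^sub>R (Y i $ 3))"
      unfolding fst_sum sh using Xi by (intro sum.cong) (auto simp: lam_def)
    finally show ?thesis by simp
  qed
  have le: "(\<Sum>i<k. lam i * f b (Y i)) \<le> r"
  proof -
    have "(\<Sum>i<k. lam i * f b (Y i)) \<le> (\<Sum>i<k. lam i * snd (x (Suc i)))"
      using Xi nn by (intro sum_mono mult_left_mono) auto
    also have "\<dots> = snd (\<Sum>i = 1..k. u i *\<^sub>R x i)" unfolding snd_sum sh by (simp add: lam_def)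
    also have "\<dots> = r" using kux(3) by simp
    finally show ?thesis .
  qed
  show ?thesis
  proof (rule that[of "step_fun lam Y k"])
    show "step_fun lam Y k \<in> borel_measurable borel" by (rule step_fun_measurable)
    have "range (step_fun lam Y k) \<subseteq> insert 0 (Y ` {..<k})" using step_fun_range[of k lam Y, OF nn] by blast
    then show "finite (range (step_fun lam Y k))" by (rule finite_subset) auto
    show "(LINT t|lborel. indicator {0..<1} t *\<^sub>R step_fun lam Y k t $ 3) = \<eta>"
      using step_fun_integral[OF nn 1, of "\<lambda>\<xi>. \<xi> $ 3" Y] eta by simp
    show "(LINT t|lborel. indicator {0..<1} t * f b (step_fun lam Y k t)) < convex_envelope (f0 f b) \<eta> + e"
      using step_fun_integral[OF nn 1, of "f b" Y] le r(2) by simp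
  qed
qed

section \<open>Oscillating sequences\<close>

lemma integrable_bounded_interval:
  fixes q :: "real \<Rightarrow> 'b::euclidean_space"
  assumes "q \<in> borel_measurable borel" "\<And>t. norm (q t) \<le> M" "A \<in> sets borel" "emeasure lborel A < \<infinity>"
  shows "integrable lborel (\<lambda>s. indicator A s *\<^sub>R q s)"
proof (rule Bochner_Integration.integrable_bound)
  show "integrable lborel (\<lambda>s. M * indicator A s :: real)"
    using assms(3,4) by (intro integrable_mult_right integrable_real_indicator) auto
  show "(\<lambda>s. indicator A s *\<^sub>R q s) \<in> borel_measurable lborel"
    using assms(1,3) by (intro borel_measurable_scaleR borel_measurable_indicator) auto
  have "0 \<le> M" using assms(2)[of undefined] norm_ge_zero order_trans by blast
  then show "AE s in lborel. norm (indicator A s *\<^sub>R q s) \<le> norm (M * indicator A s)"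
    using assms(2) by (intro AE_I2) (auto split: split_indicator)
qed

text \<open>Full periods contribute 0, so only the fractional part of y is left, an interval of
  length at most 1.\<close>

lemma periodic_integral_bound:
  fixes q :: "real \<Rightarrow> 'b::euclidean_space"
  assumes q: "q \<in> borel_measurable borel" and M: "\<And>t. norm (q t) \<le> M" and per: "\<And>t. q (t + 1) = q t"
    and 0: "(LINT s|lborel. indicator {0..<1} s *\<^sub>R q s) = 0" and y: "0 \<le> y"
  shows "norm (LINT s|lborel. indicator {0..<y} s *\<^sub>R q s) \<le> M"
proof -
  define R where "R y = (LINT s|lborel. indicator {0..<y} s *\<^sub>R q s)" for y
  have int: "integrable lborel (\<lambda>s. indicator {a..<b} s *\<^sub>R q s)" for a b
    by (rule integrable_bounded_interval[OF q M])
      (cases "a \<le> b"; simp)+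
  have step: "R (y + 1) = R y" if "0 \<le> y" for y
  proof -
    have "R (y + 1) = (LINT s|lborel. indicator {0..<1} s *\<^sub>R q s + indicator {1..<y + 1} s *\<^sub>R q s)"
      unfolding R_def using that by (intro Bochner_Integration.integral_cong) (auto split: split_indicator)
    also have "\<dots> = (LINT s|lborel. indicator {1..<y + 1} s *\<^sub>R q s)"
      by (simp add: Bochner_Integration.integral_add[OF int int] 0)
    also have "\<dots> = \<bar>1\<bar> *\<^sub>R (LINT s|lborel. indicator {1..<y + 1} (1 + 1 * s) *\<^sub>R q (1 + 1 * s))"
      by (rule lborel_integral_real_affine) simp
    also have "\<dots> = R y"
      unfolding R_def using per by (simp add: add.commute) (intro Bochner_Integration.integral_cong, auto split: split_indicator)
    finally show ?thesis .
  qed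
  have steps: "R (y + real n) = R y" if "0 \<le> y" for y n
  proof (induction n)
    case (Suc n)
    have "R (y + real (Suc n)) = R ((y + real n) + 1)" by (simp add: algebra_simps)
    also have "\<dots> = R (y + real n)" using that by (intro step) simp
    finally show ?case using Suc by simp
  qed simp
  define n where "n = nat \<lfloor>y\<rfloor>"
  define z where "z = y - real n"
  have z: "0 \<le> z" "z \<le> 1" using y unfolding z_def n_def by linarith+
  have "R y = R z" using steps[OF z(1), of n] by (simp add: z_def)
  moreover have "norm (R z) \<le> M"
  proof -
    have M0: "0 \<le> M" using M[of 0] norm_ge_zero order_trans by blast
    have "norm (R z) \<le> (LINT s|lborel. norm (indicator {0..<z} s *\<^sub>R q s))" unfolding R_def by (rule integral_norm_bound)
    also have "\<dots> \<le> (LINT s|lborel. M * indicator {0..<z} s)"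
      using z M by (intro integral_mono integrable_norm int) (auto split: split_indicator)
    also have "\<dots> = M * z" using z by simp
    also have "\<dots> \<le> M" using z M0 by (simp add: mult_left_le)
    finally show ?thesis .
  qed
  ultimately show ?thesis by (simp add: R_def)
qed

text \<open>The substitution of k * t for the variable turns the primitive into 1 / k times an
  integral of q that is bounded independently of its length.\<close>

lemma prim_periodic_bound:
  fixes q :: "real \<Rightarrow> 'b::euclidean_space"
  assumes q: "q \<in> borel_measurable borel" and M: "\<And>t. norm (q t) \<le> M" and per: "\<And>t. q (t + 1) = q t"
    and 0: "(LINT s|lborel. indicator {0..<1} s *\<^sub>R q s) = 0" and k: "0 < k" and l: "0 < l"
  shows "norm (prim l (\<lambda>t. q (k * t)) t) \<le> M / k"
proof -
  \<comment> \<open>The primitive is constant to the left of 0 and to the right of l, so t is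
    clamped to that interval.\<close>
  define \<tau> where "\<tau> = max 0 (min t l)"
  have qk: "(\<lambda>s. q (k * s)) \<in> borel_measurable borel" by (rule measurable_compose[OF _ q]) simp
  have "prim l (\<lambda>t. q (k * t)) t = (LINT s|lebesgue. indicator {0<..<l} s *\<^sub>R indicator {..t} s *\<^sub>R q (k * s))"
    unfolding prim_def by (subst integral_lebesgue_on) auto
  also have "\<dots> = (LINT s|lborel. indicator {0<..<l} s *\<^sub>R indicator {..t} s *\<^sub>R q (k * s))"
    using qk by (intro integral_completion borel_measurable_scaleR borel_measurable_indicator) auto
  also have "\<dots> = (LINT s|lborel. indicator {0..<\<tau>} s *\<^sub>R q (k * s))"
  proof (rule integral_cong_AE)
    show "AE s in lborel. indicator {0<..<l} s *\<^sub>R indicator {..t} s *\<^sub>R q (k * s) = indicator {0..<\<tau>} s *\<^sub>R q (k * s)"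
      using AE_lborel_singleton[of 0] AE_lborel_singleton[of t]
      by eventually_elim (auto simp: \<tau>_def split: split_indicator)
  qed (use qk in \<open>auto intro!: borel_measurable_scaleR borel_measurable_indicator\<close>)
  finally have e1: "prim l (\<lambda>t. q (k * t)) t = (LINT s|lborel. indicator {0..<\<tau>} s *\<^sub>R q (k * s))" .
  have "(LINT s|lborel. indicator {0..<k * \<tau>} s *\<^sub>R q s) = \<bar>k\<bar> *\<^sub>R (LINT s|lborel. indicator {0..<k * \<tau>} (0 + k * s) *\<^sub>R q (0 + k * s))"
    using k by (intro lborel_integral_real_affine) simp
  also have "(\<lambda>s. indicator {0..<k * \<tau>} (0 + k * s) *\<^sub>R q (0 + k * s)) = (\<lambda>s. indicator {0..<\<tau>} s *\<^sub>R q (k * s))"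
    using k by (intro ext) (auto simp: zero_le_mult_iff split: split_indicator)
  finally have "k * norm (LINT s|lborel. indicator {0..<\<tau>} s *\<^sub>R q (k * s)) = norm (LINT s|lborel. indicator {0..<k * \<tau>} s *\<^sub>R q s)"
    using k by simp
  also have "\<dots> \<le> M" by (rule periodic_integral_bound[OF q M per 0]) (use k in \<open>simp add: \<tau>_def\<close>)
  finally show ?thesis unfolding e1 using k by (simp add: pos_le_divide_eq mult.commute)
qed

text \<open>Once the mean is subtracted, the primitive of the oscillating function is of order 1 /
  k, so integration by parts settles weights in \<open>C1c\<close>. Boundedness of p and density in
  L1 give all integrable weights.\<close>

lemma Riemann_Lebesgue:
  fixes p :: "real \<Rightarrow> 'b::euclidean_space"
  assumes p: "p \<in> borel_measurable borel" and M: "\<And>t. norm (p t) \<le> M" and per: "\<And>t. p (t + 1) = p t"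
    and l: "0 < l" and h: "integrable (lebesgue_on {0<..<l}) h"
  shows "(\<lambda>k. LINT t|lebesgue_on {0<..<l}. h t *\<^sub>R p (real k * t)) \<longlonglongrightarrow>
    (LINT t|lebesgue_on {0<..<l}. h t :: real) *\<^sub>R (LINT s|lborel. indicator {0..<1} s *\<^sub>R p s)"
proof -
  let ?L = "lebesgue_on {0<..<l}"
  interpret L: finite_measure ?L by (rule finite_measure_lebesgue_on[OF interval_lmeasurable])
  define m where "m = (LINT s|lborel. indicator {0..<1} s *\<^sub>R p s)"
  define q where "q t = p t - m" for t
  define N where "N = M + norm m"
  have q: "q \<in> borel_measurable borel" unfolding q_def[abs_def] using p by (intro borel_measurable_diff) auto
  have qN: "norm (q t) \<le> N" for t
    using norm_triangle_ineq4[of "p t" m] M[of t] unfolding q_def N_def by linarith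
  have qper: "q (t + 1) = q t" for t by (simp add: q_def per)
  have q0: "(LINT s|lborel. indicator {0..<1} s *\<^sub>R q s) = 0"
  proof -
    have "(LINT s|lborel. indicator {0..<1} s *\<^sub>R q s) =
        (LINT s|lborel. indicator {0..<1} s *\<^sub>R p s - indicator {0..<1} s *\<^sub>R m)"
      by (simp add: q_def scaleR_diff_right)
    also have "\<dots> = m - (LINT s|lborel. indicator {0..<1::real} s *\<^sub>R m)"
      unfolding m_def[symmetric]
      by (subst Bochner_Integration.integral_diff)
        (auto intro!: integrable_bounded_interval[OF p M] integrable_scaleR_left integrable_real_indicator simp: m_def)
    also have "\<dots> = 0" by simp
    finally show ?thesis .
  qed
  have N0: "0 \<le> N" using qN[of 0] norm_ge_zero order_trans by blast
  have km: "(\<lambda>t. g (real k * t)) \<in> borel_measurable ?L" if "g \<in> borel_measurable borel" for g :: "real \<Rightarrow> 'b" and k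
  proof -
    have "(\<lambda>t. g (real k * t)) \<in> borel_measurable lborel"
      using measurable_compose[OF _ that, of "\<lambda>t. real k * t"] by simp
    then show ?thesis by (intro measurable_restrict_space1) (rule measurable_completion)
  qed
  have bi: "integrable ?L (\<lambda>t. g t *\<^sub>R q (real k * t))" if "integrable ?L g" for g :: "real \<Rightarrow> real" and k
  proof (rule Bochner_Integration.integrable_bound)
    show "integrable ?L (\<lambda>t. N * norm (g t))" using that by (intro integrable_mult_right integrable_norm)
    show "(\<lambda>t. g t *\<^sub>R q (real k * t)) \<in> borel_measurable ?L"
      using km[OF q] borel_measurable_integrable[OF that] by (intro borel_measurable_scaleR)
    show "AE t in ?L. norm (g t *\<^sub>R q (real k * t)) \<le> norm (N * norm (g t))"
      using qN N0 by (intro AE_I2) (simp add: abs_mult mult.commute[of N] mult_left_mono)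
  qed
  have test: "(\<lambda>k. LINT t|?L. \<phi> t *\<^sub>R q (real k * t)) \<longlonglongrightarrow> 0" if \<phi>: "\<phi> \<in> C1c {0<..<l}" for \<phi> :: "real \<Rightarrow> real"
  proof -
    let ?d = "\<lambda>t. frechet_derivative \<phi> (at t) 1"
    obtain M' where M': "M' > 0" "\<And>x. norm (?d x) \<le> M'" by (rule C1c_bounded_deriv[OF \<phi>, of 1]) (rule that)
    show ?thesis
    proof (rule Lim_null_comparison)
      show "(\<lambda>k. (M' * N * measure ?L (space ?L)) / real k) \<longlonglongrightarrow> 0" by real_asymp
      show "\<forall>\<^sub>F k in sequentially. norm (LINT t|?L. \<phi> t *\<^sub>R q (real k * t)) \<le> (M' * N * measure ?L (space ?L)) / real k"
        using eventually_gt_at_top[of 0]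
      proof eventually_elim
        fix k :: nat assume k: "0 < k"
        have qi: "integrable ?L (\<lambda>t. q (real k * t))"
          by (rule L.integrable_const_bound[of _ N]) (use qN km[OF q] in auto)
        note P = prim_has_weak_partial[OF qi]
        have b: "norm (prim l (\<lambda>t. q (real k * t)) t) \<le> N / real k" for t
          by (rule prim_periodic_bound[OF q qN qper q0 _ l]) (use k in simp)
        have "(LINT t|?L. \<phi> t *\<^sub>R q (real k * t)) = - (LINT t|?L. ?d t *\<^sub>R prim l (\<lambda>t. q (real k * t)) t)"
          using P(1) \<phi> unfolding has_weak_partial_def by simp
        then have "norm (LINT t|?L. \<phi> t *\<^sub>R q (real k * t)) \<le> (LINT t|?L. norm (?d t *\<^sub>R prim l (\<lambda>t. q (real k * t)) t))"
          using integral_norm_bound[of ?L "\<lambda>t. ?d t *\<^sub>R prim l (\<lambda>t. q (real k * t)) t"] by simp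
        also have "\<dots> \<le> (LINT t|?L. M' * (N / real k))"
        proof (rule integral_mono)
          have lp: "locally_integrable {0<..<l} (prim l (\<lambda>t. q (real k * t)))"
            by (rule locally_integrable_if_integrable[OF _ P(2)]) simp
          show "integrable ?L (\<lambda>t. norm (?d t *\<^sub>R prim l (\<lambda>t. q (real k * t)) t))"
            by (rule integrable_norm, rule integrable_C1c_scaleR(2)[OF _ lp \<phi>]) simp
          show "norm (?d t *\<^sub>R prim l (\<lambda>t. q (real k * t)) t) \<le> M' * (N / real k)" for t
            unfolding norm_scaleR using M'(1) M'(2)[of t] b[of t] by (intro mult_mono) auto
        qed simp
        also have "\<dots> = (M' * N * measure ?L (space ?L)) / real k" by simp
        finally show "norm (LINT t|?L. \<phi> t *\<^sub>R q (real k * t)) \<le> (M' * N * measure ?L (space ?L)) / real k" .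
      qed
    qed
  qed
  have q_lim: "(\<lambda>k. LINT t|?L. h t *\<^sub>R q (real k * t)) \<longlonglongrightarrow> 0"
  proof (rule LIMSEQ_I)
    fix e :: real assume e: "0 < e"
    have "0 < e / (2 * (N + 1))" using e N0 by simp
    obtain \<phi> where \<phi>: "\<phi> \<in> C1c {0<..<l}" "integrable ?L \<phi>" "(LINT t|?L. norm (h t - \<phi> t)) < e / (2 * (N + 1))"
      by (rule L1_density[OF _ interval_lmeasurable h \<open>0 < e / (2 * (N + 1))\<close>]) (simp, rule that)
    have hp: "integrable ?L (\<lambda>t. h t - \<phi> t)" using h \<phi>(2) by simp
    have close: "norm (LINT t|?L. (h t - \<phi> t) *\<^sub>R q (real k * t)) \<le> e / 2" for k
    proof -
      have "norm (LINT t|?L. (h t - \<phi> t) *\<^sub>R q (real k * t)) \<le> (LINT t|?L. norm ((h t - \<phi> t) *\<^sub>R q (real k * t)))"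
        by (rule integral_norm_bound)
      also have "\<dots> \<le> (LINT t|?L. (N + 1) * norm (h t - \<phi> t))"
      proof (rule integral_mono)
        show "integrable ?L (\<lambda>t. norm ((h t - \<phi> t) *\<^sub>R q (real k * t)))" by (rule integrable_norm[OF bi[OF hp]])
        show "integrable ?L (\<lambda>t. (N + 1) * norm (h t - \<phi> t))" by (intro integrable_mult_right integrable_norm hp)
        show "norm ((h t - \<phi> t) *\<^sub>R q (real k * t)) \<le> (N + 1) * norm (h t - \<phi> t)" for t
        proof -
          have N1: "norm (q (real k * t)) \<le> N + 1" using qN[of "real k * t"] by linarith
          show ?thesis
            using mult_left_mono[OF N1 norm_ge_zero[of "h t - \<phi> t"]] by (simp add: mult.commute)
        qed
      qed
      also have "\<dots> \<le> (N + 1) * (e / (2 * (N + 1)))"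
        using \<phi>(3) N0 by (simp only: integral_mult_right_zero) (intro mult_left_mono, auto)
      also have "\<dots> = e / 2" using N0 by (simp add: divide_eq_eq)
      finally show ?thesis .
    qed
    obtain k0 where k0: "\<And>k. k \<ge> k0 \<Longrightarrow> norm (LINT t|?L. \<phi> t *\<^sub>R q (real k * t)) < e / 2"
      using LIMSEQ_D[OF test[OF \<phi>(1)], of "e / 2"] e by auto
    show "\<exists>no. \<forall>n\<ge>no. norm ((LINT t|?L. h t *\<^sub>R q (real n * t)) - 0) < e"
    proof (intro exI[of _ k0] allI impI)
      fix n assume "n \<ge> k0"
      have "(LINT t|?L. h t *\<^sub>R q (real n * t)) = (LINT t|?L. (h t - \<phi> t) *\<^sub>R q (real n * t)) + (LINT t|?L. \<phi> t *\<^sub>R q (real n * t))"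
        by (subst Bochner_Integration.integral_add[symmetric, OF bi[OF hp] bi[OF \<phi>(2)]])
          (simp add: scaleR_left_diff_distrib)
      then have "norm (LINT t|?L. h t *\<^sub>R q (real n * t)) \<le> norm (LINT t|?L. (h t - \<phi> t) *\<^sub>R q (real n * t)) + norm (LINT t|?L. \<phi> t *\<^sub>R q (real n * t))"
        by (simp add: norm_triangle_ineq)
      then show "norm ((LINT t|?L. h t *\<^sub>R q (real n * t)) - 0) < e"
        using close[of n] k0[OF \<open>n \<ge> k0\<close>] by simp
    qed
  qed
  have "(LINT t|?L. h t *\<^sub>R p (real k * t)) = (LINT t|?L. h t *\<^sub>R q (real k * t)) + (LINT t|?L. h t) *\<^sub>R m" for k
  proof -
    have "(LINT t|?L. h t *\<^sub>R p (real k * t)) = (LINT t|?L. h t *\<^sub>R q (real k * t) + h t *\<^sub>R m)"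
      by (simp add: q_def scaleR_diff_right)
    also have "\<dots> = (LINT t|?L. h t *\<^sub>R q (real k * t)) + (LINT t|?L. h t *\<^sub>R m)"
      using h by (intro Bochner_Integration.integral_add bi integrable_scaleR_left) auto
    also have "(LINT t|?L. h t *\<^sub>R m) = (LINT t|?L. h t) *\<^sub>R m" using h by simp
    finally show ?thesis .
  qed
  then show ?thesis
    using tendsto_add[OF q_lim tendsto_const[of "(LINT t|?L. h t) *\<^sub>R m"]] by (simp add: m_def)
qed

section \<open>Recovery of the relaxed energy in one dimension\<close>

lemma vec_norm_nth_le: "norm (x $ i) \<le> norm (x :: 'a::real_normed_vector^'n)"
  unfolding norm_vec_def by (rule member_le_L2_set) auto

text \<open>\<open>W\<close> is the set on which \<open>w = 1\<close>, so that \<open>f (w t)\<close> is \<open>fb (t \<in> W)\<close>.\<close>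

locale wire =
  fixes l :: real and f :: "real \<Rightarrow> real^3^3 \<Rightarrow> real" and m :: real and W :: "real set"
  assumes l: "0 < l"
    and cont: "\<And>b :: bool. continuous_on UNIV (f (of_bool b))"
    and lower: "\<And>(b :: bool) \<xi>. m \<le> f (of_bool b) \<xi>"
    and W: "W \<in> sets (lebesgue_on {0<..<l})"
begin

abbreviation "L \<equiv> lebesgue_on {0<..<l}"

definition fb :: "bool \<Rightarrow> real^3^3 \<Rightarrow> real" where "fb b = f (of_bool b)"
definition gb :: "bool \<Rightarrow> real^3 \<Rightarrow> real" where "gb b = convex_envelope (f0 f (of_bool b))"

lemma m_le_f0: "m \<le> f0 f (of_bool b) \<eta>"
  by (rule f0_ge) (rule lower)

lemma gb_ge: "m \<le> gb b \<eta>"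
  unfolding gb_def by (rule convex_envelope_ge[of "\<lambda>_. m"]) (auto simp: convex_on_const m_le_f0)

lemma gb_le: "gb b (\<xi> $ 3) \<le> fb b \<xi>"
proof -
  have "gb b (\<xi> $ 3) \<le> f0 f (of_bool b) (\<xi> $ 3)"
    unfolding gb_def by (rule convex_envelope_le[of "\<lambda>_. m"]) (auto simp: convex_on_const m_le_f0)
  also have "\<dots> \<le> fb b \<xi>" unfolding fb_def by (rule f0_le[of m]) (rule lower)
  finally show ?thesis .
qed

lemma gb_convex: "convex_on UNIV (gb b)"
  unfolding gb_def by (rule convex_on_convex_envelope[of "\<lambda>_. m"]) (auto simp: convex_on_const m_le_f0)

lemma gb_cont: "continuous_on UNIV (gb b)"
  by (rule convex_on_continuous[OF open_UNIV gb_convex])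

lemma fb_cont: "continuous_on UNIV (fb b)"
  unfolding fb_def by (rule cont)

sublocale L: finite_measure L
  by (rule finite_measure_lebesgue_on[OF interval_lmeasurable])

text \<open>The switch has only two positions, so measurability in t reduces to that of each
  \<open>H b\<close> and of W. This treats f and its envelope as pairs of continuous functions
  selected by the phase.\<close>

lemma measurable_switch:
  fixes H :: "bool \<Rightarrow> 'a::euclidean_space \<Rightarrow> 'b::euclidean_space"
  assumes H: "\<And>b. H b \<in> borel_measurable borel" and X: "X \<in> borel_measurable L"
  shows "(\<lambda>t. H (t \<in> W) (X t)) \<in> borel_measurable L"
proof -
  have "(\<lambda>t. H True (X t)) \<in> borel_measurable L" "(\<lambda>t. H False (X t)) \<in> borel_measurable L"
    by (rule measurable_compose[OF X H])+
  then have "(\<lambda>t. if t \<in> W then H True (X t) else H False (X t)) \<in> borel_measurable L"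
    using W by (intro measurable_If_set) (auto dest: sets.sets_into_space simp: Int_absorb2)
  moreover have "(\<lambda>t. if t \<in> W then H True (X t) else H False (X t)) = (\<lambda>t. H (t \<in> W) (X t))" by auto
  ultimately show ?thesis by simp
qed

lemma switch_bounded:
  fixes H :: "bool \<Rightarrow> 'a::euclidean_space \<Rightarrow> 'b::euclidean_space"
  assumes H: "\<And>b. continuous_on UNIV (H b)"
  obtains K where "\<And>b \<xi>. norm \<xi> \<le> B \<Longrightarrow> norm (H b \<xi>) \<le> K"
proof -
  have "bounded (H b ` cball 0 B)" for b
    by (rule compact_imp_bounded[OF compact_continuous_image[OF continuous_on_subset[OF H]]]) auto
  then have "bounded (H True ` cball 0 B \<union> H False ` cball 0 B)" by simp
  then obtain K where K: "\<forall>y \<in> H True ` cball 0 B \<union> H False ` cball 0 B. norm y \<le> K"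
    unfolding bounded_iff by (rule exE)
  show ?thesis
  proof (rule that[of K])
    show "norm (H b \<xi>) \<le> K" if "norm \<xi> \<le> B" for b \<xi>
      using K that by (cases b) auto
  qed
qed

lemma integrable_switch_bounded:
  fixes H :: "bool \<Rightarrow> 'a::euclidean_space \<Rightarrow> 'b::euclidean_space"
  assumes H: "\<And>b. continuous_on UNIV (H b)" and X: "X \<in> borel_measurable L" and B: "AE t in L. norm (X t) \<le> B"
  shows "integrable L (\<lambda>t. H (t \<in> W) (X t))"
proof -
  obtain K where K: "\<And>b \<xi>. norm \<xi> \<le> B \<Longrightarrow> norm (H b \<xi>) \<le> K"
    by (rule switch_bounded[OF H]) (rule that)
  show ?thesis
  proof (rule L.integrable_const_bound[of _ K])
    show "AE t in L. norm (H (t \<in> W) (X t)) \<le> K" using B by eventually_elim (rule K)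
    show "(\<lambda>t. H (t \<in> W) (X t)) \<in> borel_measurable L"
      by (rule measurable_switch[OF borel_measurable_continuous_onI[OF H] X])
  qed
qed

lemma switch_tendsto:
  fixes H :: "bool \<Rightarrow> 'a::euclidean_space \<Rightarrow> 'b::euclidean_space"
  assumes H: "\<And>b. continuous_on UNIV (H b)" and X: "X \<in> borel_measurable L"
    and Y: "\<And>n::nat. Y n \<in> borel_measurable L" "\<And>n. AE t in L. norm (Y n t) \<le> B"
    and lim: "AE t in L. (\<lambda>n. Y n t) \<longlonglongrightarrow> X t"
  shows "(\<lambda>n. LINT t|L. H (t \<in> W) (Y n t)) \<longlonglongrightarrow> (LINT t|L. H (t \<in> W) (X t))"
proof -
  obtain K where K: "\<And>b \<xi>. norm \<xi> \<le> B \<Longrightarrow> norm (H b \<xi>) \<le> K"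
    by (rule switch_bounded[OF H]) (rule that)
  show ?thesis
  proof (rule integral_dominated_convergence[where w = "\<lambda>_. K"])
    show "AE t in L. (\<lambda>n. H (t \<in> W) (Y n t)) \<longlonglongrightarrow> H (t \<in> W) (X t)"
      using lim
    proof eventually_elim
      fix t assume l: "(\<lambda>n. Y n t) \<longlonglongrightarrow> X t"
      show "(\<lambda>n. H (t \<in> W) (Y n t)) \<longlonglongrightarrow> H (t \<in> W) (X t)"
        by (rule continuous_on_tendsto_compose[OF H l]) auto
    qed
    show "AE t in L. norm (H (t \<in> W) (Y n t)) \<le> K" for n using Y(2)[of n] by eventually_elim (rule K)
    show "(\<lambda>t. H (t \<in> W) (X t)) \<in> borel_measurable L"
      by (rule measurable_switch[OF borel_measurable_continuous_onI[OF H] X])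
    show "(\<lambda>t. H (t \<in> W) (Y n t)) \<in> borel_measurable L" for n
      by (rule measurable_switch[OF borel_measurable_continuous_onI[OF H] Y(1)])
  qed simp
qed

text \<open>V has finitely many values, so finitely many profiles \<psi> are involved: at height t
  the profile belonging to (t \<in> W, V t) is run through with frequency k. By
  \<open>Riemann_Lebesgue\<close> the energies tend to cell averages, which nearly equal
  \<open>gb\<close>. The cell average of the third column is V, which makes its primitives converge
  pointwise and, being bounded, in L1.\<close>

lemma oscillating_simple:
  fixes V :: "real \<Rightarrow> real^3"
  assumes V: "V \<in> borel_measurable L" "finite (V ` {0<..<l})" and e: "0 < e"
  obtains X :: "real \<Rightarrow> real^3^3" where "X \<in> borel_measurable L" "finite (X ` {0<..<l})"
    "(LINT t|L. fb (t \<in> W) (X t)) < (LINT t|L. gb (t \<in> W) (V t)) + e"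
    "(LINT t|L. norm (prim l (\<lambda>s. X s $ 3) t - prim l V t)) < e"
proof -
  \<comment> \<open>The excess e' per unit length adds up to l * e' = e / 2 over the interval,
    strictly below e.\<close>
  define e' where "e' = e / (2 * l)"
  have e': "0 < e'" using e l by (simp add: e'_def)
  have "\<forall>y. \<exists>\<psi> :: real \<Rightarrow> real^3^3. \<psi> \<in> borel_measurable borel \<and> finite (range \<psi>) \<and>
    (LINT t|lborel. indicator {0..<1} t *\<^sub>R \<psi> t $ 3) = snd y \<and>
    (LINT t|lborel. indicator {0..<1} t * fb (fst y) (\<psi> t)) < gb (fst y) (snd y) + e'"
  proof
    fix y :: "bool \<times> (real^3)"
    show "\<exists>\<psi> :: real \<Rightarrow> real^3^3. \<psi> \<in> borel_measurable borel \<and> finite (range \<psi>) \<and>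
      (LINT t|lborel. indicator {0..<1} t *\<^sub>R \<psi> t $ 3) = snd y \<and>
      (LINT t|lborel. indicator {0..<1} t * fb (fst y) (\<psi> t)) < gb (fst y) (snd y) + e'"
      by (rule convex_envelope_f0_approx[of m f "of_bool (fst y)" e' "snd y", OF lower e'])
        (unfold fb_def gb_def, blast)
  qed
  from choice[OF this] obtain \<psi> :: "bool \<times> (real^3) \<Rightarrow> real \<Rightarrow> real^3^3" where \<psi>0: "\<forall>y. \<psi> y \<in> borel_measurable borel \<and> finite (range (\<psi> y)) \<and>
    (LINT t|lborel. indicator {0..<1} t *\<^sub>R (\<psi> y t :: real^3^3) $ 3) = snd y \<and>
    (LINT t|lborel. indicator {0..<1} t * fb (fst y) (\<psi> y t)) < gb (fst y) (snd y) + e'" by (rule exE)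
  note \<psi>1 = spec[OF \<psi>0]
  note \<psi> = \<psi>1[THEN conjunct1] \<psi>1[THEN conjunct2, THEN conjunct1]
    \<psi>1[THEN conjunct2, THEN conjunct2, THEN conjunct1] \<psi>1[THEN conjunct2, THEN conjunct2, THEN conjunct2]
  define Y where "Y = (UNIV :: bool set) \<times> V ` {0<..<l}"
  have finY: "finite Y" using V(2) by (simp add: Y_def)
  define R where "R = (\<Union>y\<in>Y. range (\<psi> y))"
  have finR: "finite R" unfolding R_def using finY \<psi>(2) by auto
  define A where "A y = {t \<in> {0<..<l}. (t \<in> W, V t) = y}" for y
  have spL: "space L = {0<..<l}" by simp
  have A: "A y \<in> sets L" for y
  proof -
    have "V -` {snd y} \<inter> space L \<in> sets L" using V(1) by (rule measurable_sets) simp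
    moreover have "A y = (V -` {snd y} \<inter> space L) \<inter> (if fst y then W else space L - W)"
      using sets.sets_into_space[OF W] by (cases y) (auto simp: A_def)
    ultimately show ?thesis using W by auto
  qed
  define X where "X k t = \<psi> (t \<in> W, V t) (frac (real k * t))" for k :: nat and t
  have XR: "X k t \<in> R" if "t \<in> {0<..<l}" for k t
    using that unfolding X_def R_def Y_def by (intro UN_I[of "(t \<in> W, V t)"]) auto
  have frac_m: "frac \<in> borel_measurable (borel :: real measure)"
    unfolding frac_def[abs_def] by measurable
  have \<psi>km: "(\<lambda>t. \<psi> y (frac (real k * t))) \<in> borel_measurable L" for y k
  proof -
    have "(\<lambda>t. real k * t) \<in> borel_measurable borel" by simp
    from measurable_compose[OF measurable_compose[OF this frac_m] \<psi>(1)]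
    have "(\<lambda>t. \<psi> y (frac (real k * t))) \<in> borel_measurable lborel" by simp
    then show ?thesis by (intro measurable_restrict_space1) (rule measurable_completion)
  qed
  have decomp: "G (t \<in> W, V t) = (\<Sum>y\<in>Y. indicator (A y) t *\<^sub>R G y)" if "t \<in> {0<..<l}" for t and G :: "_ \<Rightarrow> 'z::real_vector"
  proof -
    have "(\<Sum>y\<in>Y. indicator (A y) t *\<^sub>R G y) = (\<Sum>y\<in>Y. if y = (t \<in> W, V t) then G y else 0)"
      using that by (intro sum.cong) (auto simp: A_def indicator_def)
    also have "\<dots> = G (t \<in> W, V t)" using finY that by (simp add: Y_def)
    finally show ?thesis by simp
  qed
  have Xm: "X k \<in> borel_measurable L" for k
  proof -
    have "(\<lambda>t. \<Sum>y\<in>Y. indicator (A y) t *\<^sub>R \<psi> y (frac (real k * t))) \<in> borel_measurable L"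
      using A \<psi>km by (intro borel_measurable_sum borel_measurable_scaleR borel_measurable_indicator)
    then show ?thesis
    proof (rule measurable_cong[THEN iffD1, rotated])
      fix t assume "t \<in> space L"
      then have t: "t \<in> {0<..<l}" by simp
      show "(\<Sum>y\<in>Y. indicator (A y) t *\<^sub>R \<psi> y (frac (real k * t))) = X k t"
        unfolding X_def using decomp[OF t, of "\<lambda>y. \<psi> y (frac (real k * t))"] by simp
    qed
  qed
  obtain C where C: "\<And>\<xi>. \<xi> \<in> R \<Longrightarrow> norm \<xi> \<le> C" using finite_imp_bounded[OF finR] by (auto simp: bounded_iff)
  \<comment> \<open>Used with B the whole line for the energy, and with B = {..t} for the primitive
    at t.\<close>
  have star: "(\<lambda>k. LINT t|L. indicator B t *\<^sub>R H (t \<in> W) (X k t)) \<longlonglongrightarrow>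
      (LINT t|L. indicator B t *\<^sub>R (LINT s|lborel. indicator {0..<1} s *\<^sub>R H (t \<in> W) (\<psi> (t \<in> W, V t) s)))"
    if H: "\<And>b. continuous_on UNIV (H b)" and B: "B \<in> sets lebesgue"
    for H :: "bool \<Rightarrow> real^3^3 \<Rightarrow> 'z::euclidean_space" and B
  proof -
    define p where "p y t = H (fst y) (\<psi> y (frac t))" for y t
    define mean where "mean y = (LINT s|lborel. indicator {0..<1} s *\<^sub>R H (fst y) (\<psi> y s))" for y
    have indB: "(\<lambda>t. indicator B t :: real) \<in> borel_measurable L"
      using B by (intro measurable_restrict_space1) simp
    have hi: "integrable L (\<lambda>t. indicator B t * indicator (A y) t :: real)" for y
      by (rule L.integrable_const_bound[of _ 1]) (use indB A in \<open>auto intro!: AE_I2 borel_measurable_times split: split_indicator\<close>)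
    have pm: "p y \<in> borel_measurable borel" for y
      unfolding p_def[abs_def]
      by (rule measurable_compose[OF measurable_compose[OF frac_m \<psi>(1)] borel_measurable_continuous_onI[OF H]])
    have "finite (range (p y))" for y
    proof (rule finite_subset)
      show "range (p y) \<subseteq> H (fst y) ` range (\<psi> y)" by (auto simp: p_def)
    qed (use \<psi>(2) in simp)
    then have "bounded (range (p y))" for y by (rule finite_imp_bounded)
    then have "\<exists>M. \<forall>t. norm (p y t) \<le> M" for y by (auto simp: bounded_iff)
    then obtain M where M: "\<And>y t. norm (p y t) \<le> M y" by metis
    have mean_p: "(LINT s|lborel. indicator {0..<1} s *\<^sub>R p y s) = mean y" for y
      unfolding mean_def p_def
      by (intro Bochner_Integration.integral_cong) (auto simp: frac_eq split: split_indicator)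
    have "(\<lambda>k. LINT t|L. (indicator B t * indicator (A y) t) *\<^sub>R p y (real k * t)) \<longlonglongrightarrow>
        (LINT t|L. indicator B t * indicator (A y) t) *\<^sub>R mean y" for y
      unfolding mean_p[symmetric]
      by (rule Riemann_Lebesgue[OF pm M _ l hi]) (simp add: p_def frac_1_eq)
    then have lim: "(\<lambda>k. \<Sum>y\<in>Y. (LINT t|L. (indicator B t * indicator (A y) t) *\<^sub>R p y (real k * t))) \<longlonglongrightarrow>
        (\<Sum>y\<in>Y. (LINT t|L. indicator B t * indicator (A y) t) *\<^sub>R mean y)"
      by (rule tendsto_sum)
    have pkm: "(\<lambda>t. p y (real k * t)) \<in> borel_measurable L" for y k
      unfolding p_def by (rule measurable_compose[OF \<psi>km borel_measurable_continuous_onI[OF H]])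
    have pki: "integrable L (\<lambda>t. (indicator B t * indicator (A y) t) *\<^sub>R p y (real k * t))" for y k
    proof (rule L.integrable_const_bound[of _ "M y"])
      have "0 \<le> M y" using M[of y 0] norm_ge_zero order_trans by blast
      then show "AE t in L. norm ((indicator B t * indicator (A y) t) *\<^sub>R p y (real k * t)) \<le> M y"
        using M[of y] by (intro AE_I2) (auto split: split_indicator)
      show "(\<lambda>t. (indicator B t * indicator (A y) t) *\<^sub>R p y (real k * t)) \<in> borel_measurable L"
        using pkm borel_measurable_integrable[OF hi] by (intro borel_measurable_scaleR)
    qed
    have e1: "(LINT t|L. indicator B t *\<^sub>R H (t \<in> W) (X k t)) = (\<Sum>y\<in>Y. (LINT t|L. (indicator B t * indicator (A y) t) *\<^sub>R p y (real k * t)))" for k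
    proof -
      have "(LINT t|L. indicator B t *\<^sub>R H (t \<in> W) (X k t)) = (LINT t|L. (\<Sum>y\<in>Y. (indicator B t * indicator (A y) t) *\<^sub>R p y (real k * t)))"
      proof (intro Bochner_Integration.integral_cong refl)
        fix t assume "t \<in> space L"
        then have t: "t \<in> {0<..<l}" by simp
        have "H (t \<in> W) (X k t) = (\<Sum>y\<in>Y. indicator (A y) t *\<^sub>R p y (real k * t))"
          using decomp[OF t, of "\<lambda>y. p y (real k * t)"] by (simp add: p_def X_def)
        then show "indicator B t *\<^sub>R H (t \<in> W) (X k t) = (\<Sum>y\<in>Y. (indicator B t * indicator (A y) t) *\<^sub>R p y (real k * t))"
          by (simp add: scaleR_sum_right)
      qed
      then show ?thesis by (simp add: Bochner_Integration.integral_sum[OF pki])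
    qed
    have e2: "(LINT t|L. indicator B t *\<^sub>R mean (t \<in> W, V t)) = (\<Sum>y\<in>Y. (LINT t|L. indicator B t * indicator (A y) t) *\<^sub>R mean y)"
    proof -
      have "(LINT t|L. indicator B t *\<^sub>R mean (t \<in> W, V t)) = (LINT t|L. (\<Sum>y\<in>Y. (indicator B t * indicator (A y) t) *\<^sub>R mean y))"
      proof (intro Bochner_Integration.integral_cong refl)
        fix t assume "t \<in> space L"
        then have t: "t \<in> {0<..<l}" by simp
        show "indicator B t *\<^sub>R mean (t \<in> W, V t) = (\<Sum>y\<in>Y. (indicator B t * indicator (A y) t) *\<^sub>R mean y)"
          using decomp[OF t, of mean] by (simp add: scaleR_sum_right)
      qed
      also have "\<dots> = (\<Sum>y\<in>Y. (LINT t|L. (indicator B t * indicator (A y) t) *\<^sub>R mean y))"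
        by (rule Bochner_Integration.integral_sum) (rule integrable_scaleR_left[OF hi])
      finally show ?thesis using hi by simp
    qed
    show ?thesis using lim unfolding e1[symmetric] e2[symmetric] by (simp add: mean_def)
  qed
  have L1: "measure L (space L) = l" using l by (simp add: measure_restrict_space)
  have energy: "\<forall>\<^sub>F k in sequentially. (LINT t|L. fb (t \<in> W) (X k t)) < (LINT t|L. gb (t \<in> W) (V t)) + e"
  proof -
    let ?mean = "\<lambda>t. LINT s|lborel. indicator {0..<1} s *\<^sub>R fb (t \<in> W) (\<psi> (t \<in> W, V t) s)"
    have lim: "(\<lambda>k. LINT t|L. fb (t \<in> W) (X k t)) \<longlonglongrightarrow> (LINT t|L. ?mean t)"
      using star[of fb UNIV, OF fb_cont] by simp
    have intf: "integrable L (\<lambda>t. G (t \<in> W, V t))" for G :: "_ \<Rightarrow> real"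
    proof -
      have i: "integrable L (\<lambda>t. (\<Sum>y\<in>Y. indicator (A y) t *\<^sub>R G y))"
        using A by (intro Bochner_Integration.integrable_sum integrable_scaleR_left integrable_real_indicator)
          (auto simp: less_top[symmetric] L.emeasure_finite)
      show ?thesis
        by (rule Bochner_Integration.integrable_cong[OF refl, THEN iffD1, OF _ i])
          (simp only: spL decomp[of _ G])
    qed
    have "(LINT t|L. ?mean t) \<le> (LINT t|L. gb (t \<in> W) (V t) + e')"
    proof (rule integral_mono)
      show "integrable L ?mean" using intf[of "\<lambda>y. LINT s|lborel. indicator {0..<1} s *\<^sub>R fb (fst y) (\<psi> y s)"] by simp
      show "integrable L (\<lambda>t. gb (t \<in> W) (V t) + e')" using intf[of "\<lambda>y. gb (fst y) (snd y)"] by simp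
      show "?mean t \<le> gb (t \<in> W) (V t) + e'" for t using \<psi>(4)[of "(t \<in> W, V t)"] by simp
    qed
    also have "\<dots> = (LINT t|L. gb (t \<in> W) (V t)) + l * e'"
      using intf[of "\<lambda>y. gb (fst y) (snd y)"] L1 by simp
    also have "\<dots> < (LINT t|L. gb (t \<in> W) (V t)) + e" using e l by (simp add: e'_def)
    finally show ?thesis by (rule order_tendstoD(2)[OF lim])
  qed
  have Xi: "integrable L (\<lambda>s. X k s $ 3)" for k
  proof (rule L.integrable_const_bound[of _ C])
    show "AE s in L. norm (X k s $ 3) \<le> C"
      using XR C vec_norm_nth_le order_trans by (intro AE_I2) (fastforce)
    show "(\<lambda>s. X k s $ 3) \<in> borel_measurable L"
      by (rule measurable_compose[OF Xm borel_measurable_continuous_onI[OF continuous_on_component[OF continuous_on_id]]])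
  qed
  have Vi: "integrable L V"
  proof -
    obtain C' where "\<And>v. v \<in> V ` {0<..<l} \<Longrightarrow> norm v \<le> C'" using finite_imp_bounded[OF V(2)] by (auto simp: bounded_iff)
    then show ?thesis by (intro L.integrable_const_bound[of _ C'] AE_I2 V(1)) auto
  qed
  have "(\<lambda>k. LINT t|L. norm (prim l (\<lambda>s. X k s $ 3) t - prim l V t)) \<longlonglongrightarrow> (LINT t|L. 0)"
  proof (rule integral_dominated_convergence[where w = "\<lambda>_. C * l + (LINT t|L. norm (V t))"])
    have pc: "(\<lambda>t. norm (prim l (\<lambda>s. X k s $ 3) t - prim l V t)) \<in> borel_measurable L" for k
      by (rule measurable_compose[OF borel_measurable_diff[OF borel_measurable_integrable[OF prim_has_weak_partial(2)[OF Xi]] borel_measurable_integrable[OF prim_has_weak_partial(2)[OF Vi]]] borel_measurable_norm])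
    then show "\<And>k. (\<lambda>t. norm (prim l (\<lambda>s. X k s $ 3) t - prim l V t)) \<in> borel_measurable L" .
    show "AE t in L. (\<lambda>k. norm (prim l (\<lambda>s. X k s $ 3) t - prim l V t)) \<longlonglongrightarrow> 0"
    proof (rule AE_I2)
      fix t
      have "(\<lambda>k. prim l (\<lambda>s. X k s $ 3) t) \<longlonglongrightarrow> prim l V t"
        unfolding prim_def
        using star[of "\<lambda>_ \<xi>. \<xi> $ 3" "{..t}", OF continuous_on_component[OF continuous_on_id]] by (simp add: \<psi>(3))
      then show "(\<lambda>k. norm (prim l (\<lambda>s. X k s $ 3) t - prim l V t)) \<longlonglongrightarrow> 0"
        by (intro tendsto_norm_zero) (simp add: LIM_zero_iff)
    qed
    show "AE t in L. norm (norm (prim l (\<lambda>s. X k s $ 3) t - prim l V t)) \<le> C * l + (LINT t|L. norm (V t))" for k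
    proof (rule AE_I2)
      fix t
      have "norm (prim l (\<lambda>s. X k s $ 3) t) \<le> (LINT t|L. norm (X k t $ 3))" by (rule prim_has_weak_partial(3)[OF Xi])
      also have "\<dots> \<le> (LINT t|L. C)"
        using Xi XR C vec_norm_nth_le order_trans by (intro integral_mono integrable_norm) fastforce+
      also have "\<dots> = C * l" using L1 by simp
      finally show "norm (norm (prim l (\<lambda>s. X k s $ 3) t - prim l V t)) \<le> C * l + (LINT t|L. norm (V t))"
        using prim_has_weak_partial(3)[OF Vi, of t] norm_triangle_ineq4[of "prim l (\<lambda>s. X k s $ 3) t" "prim l V t"] by simp
    qed
  qed auto
  then have "\<forall>\<^sub>F k in sequentially. (LINT t|L. norm (prim l (\<lambda>s. X k s $ 3) t - prim l V t)) < e"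
    using e by (intro order_tendstoD) auto
  with energy have "\<forall>\<^sub>F k in sequentially. (LINT t|L. fb (t \<in> W) (X k t)) < (LINT t|L. gb (t \<in> W) (V t)) + e \<and>
    (LINT t|L. norm (prim l (\<lambda>s. X k s $ 3) t - prim l V t)) < e" by eventually_elim simp
  then obtain k where "(LINT t|L. fb (t \<in> W) (X k t)) < (LINT t|L. gb (t \<in> W) (V t)) + e"
    "(LINT t|L. norm (prim l (\<lambda>s. X k s $ 3) t - prim l V t)) < e"
    using eventually_happens trivial_limit_sequentially by blast
  moreover have "finite (X k ` {0<..<l})" by (rule finite_subset[OF _ finR]) (use XR in blast)
  ultimately show ?thesis using that Xm by blast
qed

text \<open>Large values of V are replaced by 0 and not by shorter vectors: then \<open>gb\<close>
  of the truncation is either \<open>gb\<close> of V or \<open>gb\<close> of 0, and the assumed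
  integrability of \<open>gb\<close> along V provides the dominating function. The truncated
  function is bounded, so simple functions converge to it boundedly.\<close>

lemma truncated_simple:
  fixes V :: "real \<Rightarrow> real^3"
  assumes V: "integrable L V" and g: "integrable L (\<lambda>t. gb (t \<in> W) (V t))" and e: "0 < e"
  obtains V' where "V' \<in> borel_measurable L" "finite (V' ` {0<..<l})"
    "(LINT t|L. gb (t \<in> W) (V' t)) < (LINT t|L. gb (t \<in> W) (V t)) + e"
    "(LINT t|L. norm (V' t - V t)) < e"
proof -
  have Vm: "V \<in> borel_measurable L" using V by simp
  define T where "T k t = (if norm (V t) \<le> real k then V t else 0)" for k :: nat and t
  have Tm: "T k \<in> borel_measurable L" for k
    unfolding T_def[abs_def] using Vm by measurable
  have Tev: "\<forall>\<^sub>F k in sequentially. T k t = V t" for t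
    using eventually_ge_at_top[of "nat \<lceil>norm (V t)\<rceil>"]
  proof eventually_elim
    fix k assume "nat \<lceil>norm (V t)\<rceil> \<le> k"
    then have "norm (V t) \<le> real k" by linarith
    then show "T k t = V t" by (simp add: T_def)
  qed
  have Tlim: "(\<lambda>k. H (T k t)) \<longlonglongrightarrow> H (V t)" for t and H :: "real^3 \<Rightarrow> 'z::topological_space"
    by (rule tendsto_eventually) (use Tev[of t] in \<open>eventually_elim, simp\<close>)
  have g0: "integrable L (\<lambda>t. gb (t \<in> W) 0)"
    using integrable_switch_bounded[OF gb_cont, of "\<lambda>_. 0" 0] by simp
  have "(\<lambda>k. LINT t|L. gb (t \<in> W) (T k t)) \<longlonglongrightarrow> (LINT t|L. gb (t \<in> W) (V t))"
  proof (rule integral_dominated_convergence[where w = "\<lambda>t. \<bar>gb (t \<in> W) (V t)\<bar> + \<bar>gb (t \<in> W) 0\<bar>"])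
    show "(\<lambda>t. gb (t \<in> W) (T k t)) \<in> borel_measurable L" for k
      by (rule measurable_switch[OF borel_measurable_continuous_onI[OF gb_cont] Tm])
    show "AE t in L. (\<lambda>k. gb (t \<in> W) (T k t)) \<longlonglongrightarrow> gb (t \<in> W) (V t)" by (intro AE_I2 Tlim)
    show "AE t in L. norm (gb (t \<in> W) (T k t)) \<le> \<bar>gb (t \<in> W) (V t)\<bar> + \<bar>gb (t \<in> W) 0\<bar>" for k
      by (intro AE_I2) (simp add: T_def)
  qed (use g g0 in auto)
  then have 1: "\<forall>\<^sub>F k in sequentially. (LINT t|L. gb (t \<in> W) (T k t)) < (LINT t|L. gb (t \<in> W) (V t)) + e"
    by (rule order_tendstoD) (use e in simp)
  have "(\<lambda>k. LINT t|L. norm (T k t - V t)) \<longlonglongrightarrow> (LINT t|L. 0)"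
  proof (rule integral_dominated_convergence[where w = "\<lambda>t. norm (V t)"])
    show "(\<lambda>t. norm (T k t - V t)) \<in> borel_measurable L" for k using Tm Vm by measurable
    show "AE t in L. (\<lambda>k. norm (T k t - V t)) \<longlonglongrightarrow> 0"
    proof (rule AE_I2)
      fix t
      show "(\<lambda>k. norm (T k t - V t)) \<longlonglongrightarrow> 0" using Tlim[of "\<lambda>v. norm (v - V t)" t] by simp
    qed
    show "AE t in L. norm (norm (T k t - V t)) \<le> norm (V t)" for k by (intro AE_I2) (simp add: T_def)
  qed (use V in auto)
  then have 2: "\<forall>\<^sub>F k in sequentially. (LINT t|L. norm (T k t - V t)) < e"
    using e by (intro order_tendstoD) auto
  from 1 2 have "\<forall>\<^sub>F k in sequentially. (LINT t|L. gb (t \<in> W) (T k t)) < (LINT t|L. gb (t \<in> W) (V t)) + e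
    \<and> (LINT t|L. norm (T k t - V t)) < e" by eventually_elim simp
  then obtain k where k: "(LINT t|L. gb (t \<in> W) (T k t)) < (LINT t|L. gb (t \<in> W) (V t)) + e"
    "(LINT t|L. norm (T k t - V t)) < e"
    using eventually_happens trivial_limit_sequentially by blast
  have Tb: "norm (T k t) \<le> real k" for t by (simp add: T_def)
  obtain s where s0: "(\<forall>i. simple_function L (s i)) \<and> (\<forall>x\<in>space L. (\<lambda>i. s i x) \<longlonglongrightarrow> T k x) \<and>
      (\<forall>i. \<forall>x\<in>space L. dist (s i x) 0 \<le> 2 * dist (T k x) 0)"
    using borel_measurable_implies_sequence_metric[OF Tm, of k 0] by (rule exE)
  then have s: "\<And>i. simple_function L (s i)" "AE x in L. (\<lambda>i. s i x) \<longlonglongrightarrow> T k x"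
    "\<And>i x. x \<in> space L \<Longrightarrow> norm (s i x) \<le> 2 * norm (T k x)" by (auto intro!: AE_I2)
  have sb: "AE x in L. norm (s i x) \<le> 2 * real k" for i
    using s(3) Tb by (intro AE_I2) (meson mult_left_mono order_trans zero_le_numeral)
  have sm: "s i \<in> borel_measurable L" for i using s(1) by (rule borel_measurable_simple_function)
  have "(\<lambda>i. LINT t|L. gb (t \<in> W) (s i t)) \<longlonglongrightarrow> (LINT t|L. gb (t \<in> W) (T k t))"
    by (rule switch_tendsto[OF gb_cont Tm sm sb s(2)])
  then have 3: "\<forall>\<^sub>F i in sequentially. (LINT t|L. gb (t \<in> W) (s i t)) < (LINT t|L. gb (t \<in> W) (V t)) + e"
    by (rule order_tendstoD) (use k in simp)
  have "(\<lambda>i. LINT t|L. norm (s i t - V t)) \<longlonglongrightarrow> (LINT t|L. norm (T k t - V t))"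
  proof (rule integral_dominated_convergence[where w = "\<lambda>t. 2 * real k + norm (V t)"])
    show "(\<lambda>t. norm (s i t - V t)) \<in> borel_measurable L" for i using sm Vm by measurable
    show "(\<lambda>t. norm (T k t - V t)) \<in> borel_measurable L" using Tm Vm by measurable
    show "AE t in L. (\<lambda>i. norm (s i t - V t)) \<longlonglongrightarrow> norm (T k t - V t)"
      using s(2) by eventually_elim (intro tendsto_intros)
    show "AE t in L. norm (norm (s i t - V t)) \<le> 2 * real k + norm (V t)" for i
      using sb[of i]
    proof eventually_elim
      fix t assume "norm (s i t) \<le> 2 * real k"
      then show "norm (norm (s i t - V t)) \<le> 2 * real k + norm (V t)"
        using norm_triangle_ineq4[of "s i t" "V t"] by simp
    qed
  qed (use V in auto)
  then have 4: "\<forall>\<^sub>F i in sequentially. (LINT t|L. norm (s i t - V t)) < e"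
    by (rule order_tendstoD) (use k in simp)
  from 3 4 have "\<forall>\<^sub>F i in sequentially. (LINT t|L. gb (t \<in> W) (s i t)) < (LINT t|L. gb (t \<in> W) (V t)) + e
    \<and> (LINT t|L. norm (s i t - V t)) < e" by eventually_elim simp
  then obtain i where i: "(LINT t|L. gb (t \<in> W) (s i t)) < (LINT t|L. gb (t \<in> W) (V t)) + e"
    "(LINT t|L. norm (s i t - V t)) < e"
    using eventually_happens trivial_limit_sequentially by blast
  have "finite (s i ` {0<..<l})" using simple_functionD(1)[OF s(1)[of i]] by simp
  with i sm show ?thesis by (intro that[of "s i"])
qed

lemma nth3_integrable:
  fixes X :: "real \<Rightarrow> real^3^3"
  assumes "integrable L X"
  shows "integrable L (\<lambda>t. X t $ 3)"
  by (rule Bochner_Integration.integrable_bound[OF assms])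
    (auto intro!: AE_I2 vec_norm_nth_le[of _ 3] measurable_compose[OF borel_measurable_integrable[OF assms]
        borel_measurable_continuous_onI[OF continuous_on_component[OF continuous_on_id]]])

lemma recovery_1D:
  fixes V :: "real \<Rightarrow> real^3"
  assumes V: "integrable L V" and g: "integrable L (\<lambda>t. gb (t \<in> W) (V t))" and e: "0 < e"
  obtains Y :: "real \<Rightarrow> real^3^3" where "Y \<in> C1c {0<..<l}"
    "(LINT t|L. fb (t \<in> W) (Y t)) < (LINT t|L. gb (t \<in> W) (V t)) + e"
    "(LINT t|L. norm (prim l (\<lambda>s. Y s $ 3) t - prim l V t)) < e"
proof -
  \<comment> \<open>Two of the three distances between primitives are estimated through their
    integrands, which costs the factor l. Dividing by l + 1 keeps both d and l * d within e / 3; the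
    energy excess is below 2 * d.\<close>
  define d where "d = e / (3 * (l + 1))"
  have d: "0 < d" "d \<le> e / 3" "l * d \<le> e / 3"
    using e l by (auto simp: d_def field_simps)
  obtain V' where V': "V' \<in> borel_measurable L" "finite (V' ` {0<..<l})"
    "(LINT t|L. gb (t \<in> W) (V' t)) < (LINT t|L. gb (t \<in> W) (V t)) + d"
    "(LINT t|L. norm (V' t - V t)) < d"
    by (rule truncated_simple[OF V g d(1)]) (rule that)
  obtain X :: "real \<Rightarrow> real^3^3" where X: "X \<in> borel_measurable L" "finite (X ` {0<..<l})"
    "(LINT t|L. fb (t \<in> W) (X t)) < (LINT t|L. gb (t \<in> W) (V' t)) + d"
    "(LINT t|L. norm (prim l (\<lambda>s. X s $ 3) t - prim l V' t)) < d"
    by (rule oscillating_simple[OF V'(1,2) d(1)]) (rule that)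
  obtain Y B where Y: "\<And>n::nat. Y n \<in> C1c {0<..<l}" "\<And>n x. norm (Y n x) \<le> B"
    "AE x in L. (\<lambda>n. Y n x) \<longlonglongrightarrow> X x"
    by (rule simple_approx_C1c[OF _ interval_lmeasurable X(1,2)]) (simp, rule that)
  have Ym: "Y n \<in> borel_measurable L" for n by (rule continuous_measurable_lebesgue_on[OF C1c_continuous[OF Y(1)]])
  have bi: "integrable L Z" if Z: "Z \<in> borel_measurable L" "finite (Z ` {0<..<l})" for Z :: "real \<Rightarrow> 'z::euclidean_space"
  proof -
    obtain C' where "\<And>v. v \<in> Z ` {0<..<l} \<Longrightarrow> norm v \<le> C'" using finite_imp_bounded[OF Z(2)] by (auto simp: bounded_iff)
    then show ?thesis by (intro L.integrable_const_bound[of _ C'] AE_I2 Z(1)) auto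
  qed
  have Xi: "integrable L X" by (rule bi[OF X(1,2)])
  have V'i: "integrable L V'" by (rule bi[OF V'(1,2)])
  have Yi: "integrable L (Y n)" for n by (rule L.integrable_const_bound[of _ B]) (use Y(2) Ym in auto)
  have "(\<lambda>n. LINT t|L. fb (t \<in> W) (Y n t)) \<longlonglongrightarrow> (LINT t|L. fb (t \<in> W) (X t))"
    by (rule switch_tendsto[OF fb_cont X(1) Ym _ Y(3)]) (use Y(2) in auto)
  then have 1: "\<forall>\<^sub>F n in sequentially. (LINT t|L. fb (t \<in> W) (Y n t)) < (LINT t|L. gb (t \<in> W) (V' t)) + d"
    by (rule order_tendstoD) (use X(3) in simp)
  have "(\<lambda>n. LINT t|L. norm (Y n t - X t)) \<longlonglongrightarrow> (LINT t|L. 0)"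
  proof (rule integral_dominated_convergence[where w = "\<lambda>t. B + norm (X t)"])
    show "(\<lambda>t. norm (Y n t - X t)) \<in> borel_measurable L" for n using Ym X(1) by measurable
    show "AE t in L. (\<lambda>n. norm (Y n t - X t)) \<longlonglongrightarrow> 0"
      using Y(3) by eventually_elim (intro tendsto_norm_zero, simp add: LIM_zero_iff)
    show "AE t in L. norm (norm (Y n t - X t)) \<le> B + norm (X t)" for n
    proof (rule AE_I2)
      fix t
      show "norm (norm (Y n t - X t)) \<le> B + norm (X t)"
        using norm_triangle_ineq4[of "Y n t" "X t"] Y(2)[of n t] by simp
    qed
  qed (use Xi in auto)
  then have 2: "\<forall>\<^sub>F n in sequentially. (LINT t|L. norm (Y n t - X t)) < d"
    using d by (intro order_tendstoD) auto
  from 1 2 have "\<forall>\<^sub>F n in sequentially. (LINT t|L. fb (t \<in> W) (Y n t)) < (LINT t|L. gb (t \<in> W) (V' t)) + d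
    \<and> (LINT t|L. norm (Y n t - X t)) < d" by eventually_elim simp
  then obtain n where n: "(LINT t|L. fb (t \<in> W) (Y n t)) < (LINT t|L. gb (t \<in> W) (V' t)) + d"
    "(LINT t|L. norm (Y n t - X t)) < d"
    using eventually_happens trivial_limit_sequentially by blast
  note i3 = nth3_integrable[OF Xi] nth3_integrable[OF Yi]
  have pi: "integrable L (prim l Z)" if "integrable L Z" for Z :: "real \<Rightarrow> real^3" by (rule prim_has_weak_partial(2)[OF that])
  have pd: "(LINT t|L. norm (prim l Z t - prim l Z' t)) \<le> l * (LINT t|L. norm (Z t - Z' t))"
    if "integrable L Z" "integrable L Z'" for Z Z' :: "real \<Rightarrow> real^3"
  proof -
    have "(LINT t|L. norm (prim l Z t - prim l Z' t)) \<le> (LINT t|L. (LINT t|L. norm (Z t - Z' t)))"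
      by (rule integral_mono) (use pi that prim_dist_le[OF that] in auto)
    also have "\<dots> = l * (LINT t|L. norm (Z t - Z' t))" using l by (simp add: measure_restrict_space)
    finally show ?thesis .
  qed
  have "(LINT t|L. norm (Y n t $ 3 - X t $ 3)) \<le> (LINT t|L. norm (Y n t - X t))"
  proof (rule integral_mono)
    show "integrable L (\<lambda>t. norm (Y n t $ 3 - X t $ 3))" using i3 by (intro integrable_norm Bochner_Integration.integrable_diff)
    show "integrable L (\<lambda>t. norm (Y n t - X t))" using Xi Yi by (intro integrable_norm Bochner_Integration.integrable_diff)
    show "norm (Y n t $ 3 - X t $ 3) \<le> norm (Y n t - X t)" for t
      using vec_norm_nth_le[of "Y n t - X t" 3] by simp
  qed
  then have "(LINT t|L. norm (Y n t $ 3 - X t $ 3)) \<le> d" using n(2) by simp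
  then have "l * (LINT t|L. norm (Y n t $ 3 - X t $ 3)) \<le> l * d" using l by (intro mult_left_mono) auto
  then have b1: "(LINT t|L. norm (prim l (\<lambda>s. Y n s $ 3) t - prim l (\<lambda>s. X s $ 3) t)) \<le> l * d"
    using pd[OF i3(2)[of n] i3(1)] by linarith
  have "l * (LINT t|L. norm (V' t - V t)) \<le> l * d" using l V'(4) by (intro mult_left_mono) auto
  then have b2: "(LINT t|L. norm (prim l V' t - prim l V t)) \<le> l * d" using pd[OF V'i V] by linarith
  have "(LINT t|L. norm (prim l (\<lambda>s. Y n s $ 3) t - prim l V t)) \<le>
    (LINT t|L. norm (prim l (\<lambda>s. Y n s $ 3) t - prim l (\<lambda>s. X s $ 3) t) +
      (norm (prim l (\<lambda>s. X s $ 3) t - prim l V' t) + norm (prim l V' t - prim l V t)))"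
  proof (rule integral_mono)
    show "norm (prim l (\<lambda>s. Y n s $ 3) t - prim l V t) \<le> norm (prim l (\<lambda>s. Y n s $ 3) t - prim l (\<lambda>s. X s $ 3) t) +
      (norm (prim l (\<lambda>s. X s $ 3) t - prim l V' t) + norm (prim l V' t - prim l V t))" for t
      by (rule order_trans[OF _ add_left_mono[OF norm_triangle_ineq]]) (rule order_trans[OF _ norm_triangle_ineq], simp)
  qed (intro Bochner_Integration.integrable_add integrable_norm Bochner_Integration.integrable_diff pi i3 V V'i)+
  also have "\<dots> = (LINT t|L. norm (prim l (\<lambda>s. Y n s $ 3) t - prim l (\<lambda>s. X s $ 3) t)) +
      ((LINT t|L. norm (prim l (\<lambda>s. X s $ 3) t - prim l V' t)) + (LINT t|L. norm (prim l V' t - prim l V t)))"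
    using pi[OF i3(1)] pi[OF i3(2)] pi[OF V] pi[OF V'i] by simp
  also have "\<dots> < e" using b1 b2 X(4) d by linarith
  finally have "(LINT t|L. norm (prim l (\<lambda>s. Y n s $ 3) t - prim l V t)) < e" .
  moreover have "(LINT t|L. fb (t \<in> W) (Y n t)) < (LINT t|L. gb (t \<in> W) (V t)) + e"
    using n(1) V'(3) d by linarith
  ultimately show ?thesis by (intro that[of "Y n"] Y(1))
qed

end

section \<open>The upper bound\<close>

lemma bounded_on_in_Lp:
  fixes f :: "'a::euclidean_space \<Rightarrow> 'b::euclidean_space"
  assumes U: "U \<in> lmeasurable" and f: "f \<in> borel_measurable (lebesgue_on U)"
    and M: "AE x in lebesgue_on U. norm (f x) \<le> M" and p: "0 \<le> p"
  shows "f \<in> Lp p U" "(LINT x|lebesgue_on U. norm (f x) powr p) \<le> M powr p * measure lebesgue U"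
proof -
  interpret L: finite_measure "lebesgue_on U" by (rule finite_measure_lebesgue_on[OF U])
  have b: "AE x in lebesgue_on U. norm (norm (f x) powr p) \<le> M powr p"
    using M by eventually_elim (simp add: powr_mono2 p)
  have i: "integrable (lebesgue_on U) (\<lambda>x. norm (f x) powr p)"
    by (rule L.integrable_const_bound[OF b]) (use f in measurable)
  then show "f \<in> Lp p U" using f by (simp add: Lp_def)
  have "(LINT x|lebesgue_on U. norm (f x) powr p) \<le> (LINT x|lebesgue_on U. M powr p)"
    by (rule integral_mono_AE) (use i b in auto)
  also have "\<dots> = M powr p * measure lebesgue U"
    using U by (simp add: measure_restrict_space fmeasurableD)
  finally show "(LINT x|lebesgue_on U. norm (f x) powr p) \<le> M powr p * measure lebesgue U" .
qed

lemma C1_in_sobolev: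
  fixes v :: "'a::euclidean_space \<Rightarrow> 'b::euclidean_space"
  assumes U: "open U" "U \<in> lmeasurable" "bounded U" and v: "C1_deriv v D" and r: "0 \<le> r"
  shows "v \<in> sobolev (Lp r) U"
proof -
  obtain R where R: "\<And>x. x \<in> U \<Longrightarrow> norm x \<le> R" using U(3) by (auto simp: bounded_iff)
  have Lp: "g \<in> Lp r U" if g: "continuous_on UNIV g" for g :: "'a \<Rightarrow> 'b"
  proof -
    have "bounded (g ` cball 0 R)"
      by (rule compact_imp_bounded[OF compact_continuous_image[OF continuous_on_subset[OF g]]]) auto
    then obtain B where "\<forall>y\<in>g ` cball 0 R. norm y \<le> B" unfolding bounded_iff by (rule exE)
    then have "AE x in lebesgue_on U. norm (g x) \<le> B" using R by (intro AE_I2) auto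
    then show ?thesis by (rule bounded_on_in_Lp(1)[OF U(2) continuous_measurable_lebesgue_on[OF g] _ r])
  qed
  show ?thesis
    unfolding sobolev_def
    using Lp[OF C1_deriv_continuous[OF v]] Lp[OF C1_deriv_continuous_deriv[OF v]] has_weak_partial_C1[OF U(1) v] by blast
qed

text \<open>N \<epsilon> is the largest index n at most 1 / \<epsilon> for which \<epsilon> is below
  the threshold b n. The cap 1 / \<epsilon> makes this set of indices finite, and it recedes to
  infinity as \<epsilon> tends to 0.\<close>

lemma diagonal_at_right:
  assumes Q: "\<And>n :: nat. \<forall>\<^sub>F \<epsilon> in at_right (0::real). Q n \<epsilon>"
  obtains N where "\<forall>\<^sub>F \<epsilon> in at_right 0. Q (N \<epsilon>) \<epsilon>" "filterlim N at_top (at_right (0::real))"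
proof -
  have "\<forall>n. \<exists>b>0. \<forall>\<epsilon>>0. \<epsilon> < b \<longrightarrow> Q n \<epsilon>" using Q by (simp add: eventually_at_right_field)
  from choice[OF this] obtain b where b: "\<forall>n. b n > 0 \<and> (\<forall>\<epsilon>>0. \<epsilon> < b n \<longrightarrow> Q n \<epsilon>)" by (rule exE)
  define S where "S \<epsilon> = {n. real n \<le> 1 / \<epsilon> \<and> \<epsilon> < b n}" for \<epsilon>
  define N where "N \<epsilon> = (if S \<epsilon> = {} then 0 else Max (S \<epsilon>))" for \<epsilon>
  have fin: "finite (S \<epsilon>)" for \<epsilon>
  proof (rule finite_subset)
    show "S \<epsilon> \<subseteq> {..nat \<lceil>1 / \<epsilon>\<rceil>}"
    proof
      fix n assume "n \<in> S \<epsilon>"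
      then have "real n \<le> 1 / \<epsilon>" by (simp add: S_def)
      then show "n \<in> {..nat \<lceil>1 / \<epsilon>\<rceil>}" by (simp, linarith)
    qed
  qed simp
  have mem: "\<forall>\<^sub>F \<epsilon> in at_right 0. m \<in> S \<epsilon>" for m
  proof -
    have "\<forall>\<^sub>F \<epsilon> in at_right 0. \<epsilon> < min (b m) (1 / (real m + 1))"
      by (rule eventually_at_right_field[THEN iffD2]) (use b in \<open>auto intro!: exI[of _ "min (b m) (1 / (real m + 1))"]\<close>)
    with eventually_at_right_less[of 0] show ?thesis
    proof eventually_elim
      fix \<epsilon> :: real assume e: "0 < \<epsilon>" "\<epsilon> < min (b m) (1 / (real m + 1))"
      then have "(real m + 1) * \<epsilon> < 1" by (simp add: pos_less_divide_eq mult.commute)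
      then have "real m * \<epsilon> \<le> 1" using e(1) by (simp add: distrib_right)
      then show "m \<in> S \<epsilon>" using e by (simp add: S_def pos_le_divide_eq)
    qed
  qed
  show ?thesis
  proof (rule that[of N])
    show "\<forall>\<^sub>F \<epsilon> in at_right 0. Q (N \<epsilon>) \<epsilon>"
      using mem[of 0] eventually_at_right_less[of 0]
    proof eventually_elim
      fix \<epsilon> :: real assume "0 \<in> S \<epsilon>" "0 < \<epsilon>"
      then have "N \<epsilon> \<in> S \<epsilon>" unfolding N_def using Max_in[OF fin, of \<epsilon>] by auto
      then show "Q (N \<epsilon>) \<epsilon>" using b \<open>0 < \<epsilon>\<close> by (simp add: S_def)
    qed
    show "filterlim N at_top (at_right 0)"
      unfolding filterlim_at_top
    proof
      fix m
      show "\<forall>\<^sub>F \<epsilon> in at_right 0. m \<le> N \<epsilon>"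
        using mem[of m] by eventually_elim (auto simp: N_def intro!: Max_ge fin)
    qed
  qed
qed

lemma ext_integral_integrable:
  assumes "integrable M g"
  shows "ext_integral M g = ereal (integral\<^sup>L M g)"
proof -
  have p: "integrable M (\<lambda>x. max 0 (g x))" "integrable M (\<lambda>x. max 0 (- g x))" using assms by auto
  have "(\<integral>\<^sup>+x. ennreal (g x) \<partial>M) = (\<integral>\<^sup>+x. ennreal (max 0 (g x)) \<partial>M)"
    by (intro nn_integral_cong) (auto simp: max_def ennreal_neg)
  also have "\<dots> = ennreal (LINT x|M. max 0 (g x))" by (rule nn_integral_eq_integral[OF p(1)]) simp
  finally have 1: "(\<integral>\<^sup>+x. ennreal (g x) \<partial>M) = ennreal (LINT x|M. max 0 (g x))" .
  have "(\<integral>\<^sup>+x. ennreal (- g x) \<partial>M) = (\<integral>\<^sup>+x. ennreal (max 0 (- g x)) \<partial>M)"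
    by (intro nn_integral_cong) (auto simp: max_def ennreal_neg)
  also have "\<dots> = ennreal (LINT x|M. max 0 (- g x))" by (rule nn_integral_eq_integral[OF p(2)]) simp
  finally have 2: "(\<integral>\<^sup>+x. ennreal (- g x) \<partial>M) = ennreal (LINT x|M. max 0 (- g x))" .
  have "integral\<^sup>L M g = (LINT x|M. max 0 (g x) - max 0 (- g x))"
    by (intro Bochner_Integration.integral_cong) (auto simp: max_def)
  also have "\<dots> = (LINT x|M. max 0 (g x)) - (LINT x|M. max 0 (- g x))" using p by simp
  finally show ?thesis unfolding ext_integral_def 1 2 by (simp add: enn2ereal_ennreal)
qed

lemma ext_integral_cong_AE:
  assumes "AE x in M. g x = h x"
  shows "ext_integral M g = ext_integral M h"
proof -
  have "(\<integral>\<^sup>+x. ennreal (g x) \<partial>M) = (\<integral>\<^sup>+x. ennreal (h x) \<partial>M)"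
    by (rule nn_integral_cong_AE) (use assms in \<open>auto elim!: eventually_mono\<close>)
  moreover have "(\<integral>\<^sup>+x. ennreal (- g x) \<partial>M) = (\<integral>\<^sup>+x. ennreal (- h x) \<partial>M)"
    by (rule nn_integral_cong_AE) (use assms in \<open>auto elim!: eventually_mono\<close>)
  ultimately show ?thesis by (simp add: ext_integral_def)
qed

lemma norm_axis: "norm (axis i a :: 'a::real_normed_vector^'n) = norm a"
proof -
  have "(norm ((axis i a :: 'a^'n) $ j))\<^sup>2 = (if j = i then (norm a)\<^sup>2 else 0)" for j by (simp add: axis_def)
  then show ?thesis by (simp add: norm_vec_def[of "axis i a"] L2_set_def)
qed

locale rod = jumps l w J s c + wire l f "- c0" W
  for l :: real and w :: "real \<Rightarrow> real" and J s c and f :: "real \<Rightarrow> real^3^3 \<Rightarrow> real" and c0 W +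
  fixes p q cg :: real and u :: "real \<Rightarrow> real^3"
  assumes p: "1 < p" and q: "0 < q" and cg: "0 < cg"
    and growth: "\<And>(b :: bool) \<xi>. cg * norm \<xi> powr p - c0 \<le> f (of_bool b) \<xi>"
    and wW: "AE t in lebesgue_on {0<..<l}. w t = of_bool (t \<in> W)"
    and u: "u \<in> sobolev (Lp p) {0<..<l}"
begin

abbreviation "Om \<equiv> cylinder l"
abbreviation "LO \<equiv> lebesgue_on (cylinder l)"
abbreviation "V \<equiv> weak_partial {0<..<l} 1 u"

sublocale O: finite_measure LO by (rule finite_measure_lebesgue_on[OF cylinder_lmeasurable])

lemma V_props: "V \<in> Lp p {0<..<l}" "integrable L V" "has_weak_partial {0<..<l} 1 u V"
proof -
  show 1: "V \<in> Lp p {0<..<l}" by (rule sobolev_weak_partial(2)[OF _ u]) auto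
  show "integrable L V" by (rule Lp_integrable[OF interval_lmeasurable 1]) (use p in simp)
  show "has_weak_partial {0<..<l} 1 u V" by (rule sobolev_weak_partial(1)[OF _ u]) auto
qed

lemma u_Lp: "u \<in> Lp p {0<..<l}" and ui: "integrable L u"
proof -
  show 1: "u \<in> Lp p {0<..<l}" using u by (simp add: sobolev_def)
  show "integrable L u" by (rule Lp_integrable[OF interval_lmeasurable 1]) (use p in simp)
qed

lemma u_eq_prim: obtains cu where "AE t in L. u t = cu + prim l V t"
  by (rule sobolev_1D_eq_prim[OF l _ u]) (use p in simp, rule that)

lemma u3_partial: "has_weak_partial Om (axis i 1) (\<lambda>x. u (x $ 3)) (\<lambda>x. if i = 3 then V (x $ 3) else 0)"
proof (cases "i = 3")
  case True
  obtain cu where "AE t in L. u t = cu + prim l V t" by (rule u_eq_prim)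
  from axial_weak_partial[OF V_props(2) this ui] True show ?thesis by simp
next
  case False
  with axial_radial_partial_zero[OF ui False] show ?thesis by simp
qed

lemma u3_sobolev: "(\<lambda>x. u (x $ 3)) \<in> sobolev (Lp p) Om"
  unfolding sobolev_def
proof (intro CollectI conjI ballI)
  show "(\<lambda>x. u (x $ 3)) \<in> Lp p Om" by (rule axial_in_Lp[OF u_Lp])
  fix i :: "real^3" assume "i \<in> Basis"
  then obtain k where k: "i = axis k 1" by (auto simp: Basis_vec_def)
  have "(\<lambda>x. if k = 3 then V (x $ 3) else 0) \<in> Lp p Om"
    using axial_in_Lp[OF V_props(1)] p by (cases "k = 3") (simp_all add: Lp_def)
  then show "\<exists>g\<in>Lp p Om. has_weak_partial Om i (\<lambda>x. u (x $ 3)) g" using u3_partial[of k] k by blast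
qed

lemma u3_weak_partial: "AE x in LO. weak_partial Om (axis 3 1) (\<lambda>x. u (x $ 3)) x = V (x $ 3)"
  using weak_partial_AE[OF cylinder_open u3_partial[of 3]] by simp

lemma w3_BV01: "(\<lambda>x. w (x $ 3)) \<in> BV01 Om"
proof -
  have "AE t in L. w t \<in> {0, 1}" using wW by eventually_elim auto
  from AE_axial[OF this] w_BV show ?thesis by (simp add: BV01_def)
qed

lemma weak_star: "weakly_star_in_BV Om F (\<lambda>_. (\<lambda>x. w (x $ 3))) (\<lambda>x. w (x $ 3))"
  unfolding weakly_star_in_BV_def
proof (intro conjI exI)
  show "\<forall>\<^sub>F \<epsilon> in F. ennreal (LINT x|LO. \<bar>w (x $ 3)\<bar>) + total_variation Om (derivative_measure Om (\<lambda>x. w (x $ 3)))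
    \<le> ennreal ((LINT x|LO. \<bar>w (x $ 3)\<bar>) + card J * pi)"
    by (intro always_eventually allI) (simp add: ennreal_plus total_variation_3D(2) add_left_mono integral_nonneg_AE)
qed (use w_BV in auto)

lemma cylinder_abs_le_1:
  assumes "x \<in> cylinder l"
  shows "\<bar>x $ 1\<bar> \<le> 1" "\<bar>x $ 2\<bar> \<le> 1"
proof -
  have "(x $ 1)\<^sup>2 + (x $ 2)\<^sup>2 < 1" using assms by (simp add: cylinder_def)
  then have "(x $ 1)\<^sup>2 \<le> 1" "(x $ 2)\<^sup>2 \<le> 1" using zero_le_power2[of "x $ 1"] zero_le_power2[of "x $ 2"] by linarith+
  then show "\<bar>x $ 1\<bar> \<le> 1" "\<bar>x $ 2\<bar> \<le> 1" by (simp_all add: abs_square_le_1)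
qed

text \<open>
  The recovery deformation: an axial curve with derivative \<open>Y $ 3\<close>, together with cross sections
  that shear by \<open>\<epsilon> Y $ 1\<close> and \<open>\<epsilon> Y $ 2\<close>.
\<close>

definition defo :: "real^3 \<Rightarrow> (real \<Rightarrow> real^3^3) \<Rightarrow> real \<Rightarrow> real^3 \<Rightarrow> real^3" where
  "defo a Y \<epsilon> x = (a + prim l (\<lambda>s. Y s $ 3) (x $ 3)) + \<epsilon> *\<^sub>R ((x $ 1) *\<^sub>R Y (x $ 3) $ 1 + (x $ 2) *\<^sub>R Y (x $ 3) $ 2)"

text \<open>The axial derivative of the cross-section term of \<open>defo\<close>, without its
  factor \<epsilon>: the sole error in the rescaled gradient.\<close>

definition corr :: "(real \<Rightarrow> real^3^3) \<Rightarrow> real^3 \<Rightarrow> real^3" where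
  "corr Y x = (x $ 1) *\<^sub>R frechet_derivative Y (at (x $ 3)) 1 $ 1 + (x $ 2) *\<^sub>R frechet_derivative Y (at (x $ 3)) 1 $ 2"

text \<open>In the first two columns the factor 1 / \<epsilon> of the scaling cancels the \<epsilon>
  of the cross-section term and leaves exactly Y. The third column, which is not scaled, picks up
  \<epsilon> times \<open>corr\<close>.\<close>

definition scaled_grad :: "(real \<Rightarrow> real^3^3) \<Rightarrow> real \<Rightarrow> real^3 \<Rightarrow> real^3^3" where
  "scaled_grad Y \<epsilon> x = Y (x $ 3) + \<epsilon> *\<^sub>R axis 3 (corr Y x)"

lemma defo_C1:
  assumes Y: "Y \<in> C1c {0<..<l}"
  obtains D where "C1_deriv (defo a Y \<epsilon>) D"
    "\<And>x i. D x (axis i 1) = (if i = 3 then 1 else \<epsilon>) *\<^sub>R scaled_grad Y \<epsilon> x $ i"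
proof -
  let ?Y' = "\<lambda>t. frechet_derivative Y (at t) 1"
  have vd: "((\<lambda>t. Y t $ i) has_vector_derivative ?Y' t $ i) (at t)" for i t
    using bounded_linear.has_vector_derivative[OF bounded_linear_vec_nth C1c_has_vector_derivative[OF Y]] .
  have c': "continuous_on UNIV (\<lambda>t. ?Y' t $ i)" for i
    by (intro continuous_on_component C1c_continuous_deriv[OF Y])
  note A = C1_deriv_axial[OF vd c']
  have nth: "C1_deriv (\<lambda>x::real^3. x $ i) (\<lambda>_ v. v $ i)" for i
    using C1_deriv_inner[of "axis i 1 :: real^3"] by (simp add: inner_axis)
  have Y3: "(\<lambda>s. Y s $ 3) \<in> C1c {0<..<l}"
  proof -
    obtain K where K: "compact K" "K \<subseteq> {0<..<l}" "\<And>x. x \<notin> K \<Longrightarrow> Y x = 0"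
      "\<And>x v. x \<notin> K \<Longrightarrow> frechet_derivative Y (at x) v = 0"
      by (rule C1c_support[OF Y]) (rule that)
    show ?thesis by (rule C1cI[OF C1_deriv_real[OF vd c'] K(1,2)]) (simp add: K(3))
  qed
  have P: "((\<lambda>t. a + prim l (\<lambda>s. Y s $ 3) t) has_vector_derivative Y t $ 3) (at t)" for t
    using has_vector_derivative_add[OF has_vector_derivative_const prim_has_vector_derivative[OF Y3]] by simp
  note D = C1_deriv_add[OF C1_deriv_axial[OF P C1c_continuous[OF Y3]]
      C1_deriv_scaleR[OF C1_deriv_const[of \<epsilon>] C1_deriv_add[OF C1_deriv_scaleR[OF nth[of 1] A[of 1]] C1_deriv_scaleR[OF nth[of 2] A[of 2]]]]]
  show ?thesis
  proof (rule that)
    show "C1_deriv (defo a Y \<epsilon>) (\<lambda>x v. (v $ 3) *\<^sub>R Y (x $ 3) $ 3 +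
      (\<epsilon> *\<^sub>R (((x $ 1) *\<^sub>R (v $ 3) *\<^sub>R ?Y' (x $ 3) $ 1 + (v $ 1) *\<^sub>R Y (x $ 3) $ 1) +
        ((x $ 2) *\<^sub>R (v $ 3) *\<^sub>R ?Y' (x $ 3) $ 2 + (v $ 2) *\<^sub>R Y (x $ 3) $ 2)) +
       0 *\<^sub>R ((x $ 1) *\<^sub>R Y (x $ 3) $ 1 + (x $ 2) *\<^sub>R Y (x $ 3) $ 2)))"
      using D unfolding defo_def[abs_def] .
    fix x i
    consider "i = 1" | "i = 2" | "i = (3::3)" using exhaust_3[of i] by blast
    then show "(axis i 1 $ 3) *\<^sub>R Y (x $ 3) $ 3 +
      (\<epsilon> *\<^sub>R (((x $ 1) *\<^sub>R (axis i 1 $ 3) *\<^sub>R ?Y' (x $ 3) $ 1 + (axis i 1 $ 1) *\<^sub>R Y (x $ 3) $ 1) +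
        ((x $ 2) *\<^sub>R (axis i 1 $ 3) *\<^sub>R ?Y' (x $ 3) $ 2 + (axis i 1 $ 2) *\<^sub>R Y (x $ 3) $ 2)) +
       0 *\<^sub>R ((x $ 1) *\<^sub>R Y (x $ 3) $ 1 + (x $ 2) *\<^sub>R Y (x $ 3) $ 2))
      = (if i = 3 then 1 else \<epsilon>) *\<^sub>R scaled_grad Y \<epsilon> x $ i"
      by cases (simp_all add: scaled_grad_def corr_def axis_def)
  qed
qed

lemma defo_weak_partial:
  assumes Y: "Y \<in> C1c {0<..<l}"
  shows "AE x in LO. weak_partial Om (axis i 1) (defo a Y \<epsilon>) x = (if i = 3 then 1 else \<epsilon>) *\<^sub>R scaled_grad Y \<epsilon> x $ i"
    and "has_weak_partial Om (axis i 1) (defo a Y \<epsilon>) (weak_partial Om (axis i 1) (defo a Y \<epsilon>))"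
proof -
  obtain D where D: "C1_deriv (defo a Y \<epsilon>) D"
    "\<And>x i. D x (axis i 1) = (if i = 3 then 1 else \<epsilon>) *\<^sub>R scaled_grad Y \<epsilon> x $ i"
    by (rule defo_C1[OF Y, of a \<epsilon>]) (rule that)
  note h = has_weak_partial_C1[OF cylinder_open D(1), of l "axis i 1"]
  show "AE x in LO. weak_partial Om (axis i 1) (defo a Y \<epsilon>) x = (if i = 3 then 1 else \<epsilon>) *\<^sub>R scaled_grad Y \<epsilon> x $ i"
    using weak_partial_AE[OF cylinder_open h] by (simp only: D(2))
  show "has_weak_partial Om (axis i 1) (defo a Y \<epsilon>) (weak_partial Om (axis i 1) (defo a Y \<epsilon>))"
    by (rule has_weak_partial_weak_partial[OF h])
qed

lemma defo_sobolev: "Y \<in> C1c {0<..<l} \<Longrightarrow> 0 \<le> r \<Longrightarrow> defo a Y \<epsilon> \<in> sobolev (Lp r) Om"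
  by (rule defo_C1[of Y a \<epsilon>], assumption)
    (rule C1_in_sobolev[OF cylinder_open cylinder_lmeasurable cylinder_bounded])

lemma rescaled_gradient:
  assumes "Y \<in> C1c {0<..<l}" "\<epsilon> \<noteq> 0"
  shows "AE x in LO. rescale \<epsilon> (weak_grad Om (defo a Y \<epsilon>) x) = scaled_grad Y \<epsilon> x"
  using defo_weak_partial(1)[OF assms(1), of 1 a \<epsilon>] defo_weak_partial(1)[OF assms(1), of 2 a \<epsilon>]
    defo_weak_partial(1)[OF assms(1), of 3 a \<epsilon>]
proof eventually_elim
  fix x
  assume a: "weak_partial Om (axis 1 1) (defo a Y \<epsilon>) x = (if (1::3) = 3 then 1 else \<epsilon>) *\<^sub>R scaled_grad Y \<epsilon> x $ 1"
    "weak_partial Om (axis 2 1) (defo a Y \<epsilon>) x = (if (2::3) = 3 then 1 else \<epsilon>) *\<^sub>R scaled_grad Y \<epsilon> x $ 2"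
    "weak_partial Om (axis 3 1) (defo a Y \<epsilon>) x = (if (3::3) = 3 then 1 else \<epsilon>) *\<^sub>R scaled_grad Y \<epsilon> x $ 3"
  have "rescale \<epsilon> (weak_grad Om (defo a Y \<epsilon>) x) $ i = scaled_grad Y \<epsilon> x $ i" for i
  proof -
    consider "i = 1" | "i = 2" | "i = (3::3)" using exhaust_3[of i] by blast
    then show ?thesis by cases (simp_all add: rescale_def weak_grad_def a assms(2))
  qed
  then show "rescale \<epsilon> (weak_grad Om (defo a Y \<epsilon>) x) = scaled_grad Y \<epsilon> x" by (simp add: vec_eq_iff)
qed

lemma corr_bounded:
  assumes Y: "Y \<in> C1c {0<..<l}"
  obtains B where "0 < B" "\<And>t. norm (Y t) \<le> B" "\<And>x. x \<in> Om \<Longrightarrow> norm (corr Y x) \<le> B"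
    "continuous_on UNIV (corr Y)"
proof -
  obtain B where B: "B > 0" "\<And>t. norm (Y t) \<le> B" by (rule C1c_bounded[OF Y]) (rule that)
  obtain B' where B': "B' > 0" "\<And>t. norm (frechet_derivative Y (at t) 1) \<le> B'"
    by (rule C1c_bounded_deriv[OF Y, of 1]) (rule that)
  show ?thesis
  proof (rule that[of "B + 2 * B'"])
    show "norm (Y t) \<le> B + 2 * B'" for t using B(2)[of t] B'(1) by linarith
    show "norm (corr Y x) \<le> B + 2 * B'" if "x \<in> Om" for x
    proof -
      note a = cylinder_abs_le_1[OF that]
      have n: "norm (frechet_derivative Y (at (x $ 3)) 1 $ i) \<le> B'" for i
        using order_trans[OF vec_norm_nth_le B'(2)] .
      have "norm (corr Y x) \<le> \<bar>x $ 1\<bar> * norm (frechet_derivative Y (at (x $ 3)) 1 $ 1) + \<bar>x $ 2\<bar> * norm (frechet_derivative Y (at (x $ 3)) 1 $ 2)"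
        unfolding corr_def by (rule order_trans[OF norm_triangle_ineq]) simp
      also have "\<dots> \<le> 1 * B' + 1 * B'" using a n B'(1) by (intro add_mono mult_mono) auto
      finally show ?thesis using B(1) by simp
    qed
    have "continuous_on UNIV (\<lambda>x::real^3. frechet_derivative Y (at (x $ 3)) 1 $ i)" for i
      by (intro continuous_on_component continuous_on_compose2[OF C1c_continuous_deriv[OF Y, of UNIV 1] continuous_on_nth]) auto
    then show "continuous_on UNIV (corr Y)"
      unfolding corr_def[abs_def] by (intro continuous_on_add continuous_on_scaleR continuous_on_nth)
  qed (use B B' in simp)
qed

text \<open>As \<epsilon> tends to 0 the rescaled gradient tends to Y pointwise, and for \<epsilon>
  at most 1 it stays in the ball of radius 2 * B, where \<open>fb\<close> is bounded by continuity.
  Dominated convergence and projection to the axis give the limit.\<close>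

lemma defo_energy:
  assumes Y: "Y \<in> C1c {0<..<l}"
  shows "((\<lambda>\<epsilon>. LINT x|LO. fb (x $ 3 \<in> W) (scaled_grad Y \<epsilon> x)) \<longlongrightarrow> pi * (LINT t|L. fb (t \<in> W) (Y t))) (at_right 0)"
    and "0 < \<epsilon> \<Longrightarrow> \<epsilon> \<le> 1 \<Longrightarrow> integrable LO (\<lambda>x. fb (x $ 3 \<in> W) (scaled_grad Y \<epsilon> x))"
proof -
  obtain B where B: "0 < B" "\<And>t. norm (Y t) \<le> B" "\<And>x. x \<in> Om \<Longrightarrow> norm (corr Y x) \<le> B"
    "continuous_on UNIV (corr Y)" by (rule corr_bounded[OF Y]) (rule that)
  obtain K where K: "\<And>b \<xi>. norm \<xi> \<le> 2 * B \<Longrightarrow> norm (fb b \<xi>) \<le> K"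
    by (rule switch_bounded[OF fb_cont]) (rule that)
  have sc: "continuous_on UNIV (scaled_grad Y \<epsilon>)" for \<epsilon>
  proof -
    have "continuous_on UNIV (\<lambda>x. axis 3 (corr Y x) :: real^3^3)"
      unfolding axis_def
    proof (rule continuous_on_vec_lambda)
      fix i :: 3
      show "continuous_on UNIV (\<lambda>x. if i = 3 then corr Y x else 0)" by (cases "i = 3") (simp_all add: B(4))
    qed
    moreover have "continuous_on UNIV (\<lambda>x::real^3. Y (x $ 3))"
      by (rule continuous_on_compose2[OF C1c_continuous[OF Y, of UNIV] continuous_on_nth]) auto
    ultimately show ?thesis unfolding scaled_grad_def[abs_def] by (intro continuous_on_add continuous_on_scaleR continuous_on_const)
  qed
  have sm: "(\<lambda>x. fb (x $ 3 \<in> W) (scaled_grad Y \<epsilon> x)) \<in> borel_measurable LO" for \<epsilon>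
  proof -
    have ind: "(\<lambda>x. indicator W (x $ 3) :: real) \<in> borel_measurable LO"
      by (rule measurable_axial) (use W in simp)
    have fm: "(\<lambda>x. fb b (scaled_grad Y \<epsilon> x)) \<in> borel_measurable LO" for b
      by (rule continuous_measurable_lebesgue_on, rule continuous_on_compose2[OF fb_cont sc]) auto
    have "(\<lambda>x. indicator W (x $ 3) * fb True (scaled_grad Y \<epsilon> x) + (1 - indicator W (x $ 3)) * fb False (scaled_grad Y \<epsilon> x)) \<in> borel_measurable LO"
      by (intro borel_measurable_add borel_measurable_times borel_measurable_diff ind fm borel_measurable_const)
    moreover have "(\<lambda>x. indicator W (x $ 3) * fb True (scaled_grad Y \<epsilon> x) + (1 - indicator W (x $ 3)) * fb False (scaled_grad Y \<epsilon> x))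
      = (\<lambda>x. fb (x $ 3 \<in> W) (scaled_grad Y \<epsilon> x))" by (auto split: split_indicator)
    ultimately show ?thesis by simp
  qed
  have sb: "AE x in LO. norm (fb (x $ 3 \<in> W) (scaled_grad Y \<epsilon> x)) \<le> K" if "0 < \<epsilon>" "\<epsilon> \<le> 1" for \<epsilon>
  proof (rule AE_I2, rule K)
    fix x assume "x \<in> space LO"
    then have "norm (corr Y x) \<le> B" using B(3) by simp
    have "norm (scaled_grad Y \<epsilon> x) \<le> norm (Y (x $ 3)) + norm (\<epsilon> *\<^sub>R axis 3 (corr Y x) :: real^3^3)"
      unfolding scaled_grad_def by (rule norm_triangle_ineq)
    also have "\<dots> \<le> B + 1 * B"
    proof (intro add_mono B(2))
      have "norm (axis 3 (corr Y x) :: real^3^3) = norm (corr Y x)" by (rule norm_axis)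
      then show "norm (\<epsilon> *\<^sub>R axis 3 (corr Y x) :: real^3^3) \<le> 1 * B"
        unfolding norm_scaleR using that \<open>norm (corr Y x) \<le> B\<close> by (intro mult_mono) auto
    qed
    finally show "norm (scaled_grad Y \<epsilon> x) \<le> 2 * B" by simp
  qed
  show int: "integrable LO (\<lambda>x. fb (x $ 3 \<in> W) (scaled_grad Y \<epsilon> x))" if "0 < \<epsilon>" "\<epsilon> \<le> 1" for \<epsilon>
    by (rule O.integrable_const_bound[OF sb[OF that] sm])
  have Yi: "integrable L (\<lambda>t. fb (t \<in> W) (Y t))"
    by (rule integrable_switch_bounded[OF fb_cont continuous_measurable_lebesgue_on[OF C1c_continuous[OF Y]], of B]) (use B(2) in simp)
  show "((\<lambda>\<epsilon>. LINT x|LO. fb (x $ 3 \<in> W) (scaled_grad Y \<epsilon> x)) \<longlongrightarrow> pi * (LINT t|L. fb (t \<in> W) (Y t))) (at_right 0)"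
  proof (rule tendsto_at_right_sequentially[of 0 1])
    fix S :: "nat \<Rightarrow> real" assume S: "\<And>n. 0 < S n" "\<And>n. S n < 1" "decseq S" "S \<longlonglongrightarrow> 0"
    have "(\<lambda>n. LINT x|LO. fb (x $ 3 \<in> W) (scaled_grad Y (S n) x)) \<longlonglongrightarrow> (LINT x|LO. fb (x $ 3 \<in> W) (Y (x $ 3)))"
    proof (rule integral_dominated_convergence[where w = "\<lambda>_. K"])
      show "(\<lambda>x. fb (x $ 3 \<in> W) (Y (x $ 3))) \<in> borel_measurable LO"
        using integral_axial(1)[OF Yi] by (rule borel_measurable_integrable)
      show "AE x in LO. (\<lambda>n. fb (x $ 3 \<in> W) (scaled_grad Y (S n) x)) \<longlonglongrightarrow> fb (x $ 3 \<in> W) (Y (x $ 3))"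
      proof (rule AE_I2)
        fix x
        have "(\<lambda>n. scaled_grad Y (S n) x) \<longlonglongrightarrow> Y (x $ 3) + 0 *\<^sub>R axis 3 (corr Y x)"
          unfolding scaled_grad_def by (intro tendsto_intros S(4))
        then have "(\<lambda>n. scaled_grad Y (S n) x) \<longlonglongrightarrow> Y (x $ 3)" by simp
        then show "(\<lambda>n. fb (x $ 3 \<in> W) (scaled_grad Y (S n) x)) \<longlonglongrightarrow> fb (x $ 3 \<in> W) (Y (x $ 3))"
          by (rule continuous_on_tendsto_compose[OF fb_cont]) auto
      qed
      show "AE x in LO. norm (fb (x $ 3 \<in> W) (scaled_grad Y (S n) x)) \<le> K" for n
        by (rule sb) (use S(1,2)[of n] in auto)
    qed (use sm in auto)
    then show "(\<lambda>n. LINT x|LO. fb (x $ 3 \<in> W) (scaled_grad Y (S n) x)) \<longlonglongrightarrow> pi * (LINT t|L. fb (t \<in> W) (Y t))"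
      using integral_axial(2)[OF Yi] by simp
  qed simp
qed

end

section \<open>Compactness and energy of the recovery sequence\<close>

context rod
begin

lemma fb_growth: "cg * norm \<xi> powr p - c0 \<le> fb b \<xi>"
  unfolding fb_def by (rule growth)

lemma le_1_plus_powr: "a \<le> 1 + a powr p" if "0 \<le> a"
proof (cases "a \<le> 1")
  case True
  then show ?thesis by (simp add: add_increasing2)
next
  case False
  then have "a powr 1 \<le> a powr p" using p by (intro powr_mono) auto
  then show ?thesis using False by simp
qed

text \<open>Coercivity bounds Y in L^p by its energy alone. The sup bounds of the smoothed fields
  may deteriorate along the approximation; this bound does not.\<close>

lemma Lp_norm_from_energy:
  assumes Y: "Y \<in> C1c {0<..<l}" and T: "(LINT t|L. fb (t \<in> W) (Y t)) \<le> T"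
  shows "(LINT t|L. norm (Y t) powr p) \<le> (T + c0 * l) / cg"
    and "integrable L (\<lambda>t. norm (Y t) powr p)"
proof -
  obtain B where B: "0 < B" "\<And>t. norm (Y t) \<le> B" by (rule C1c_bounded[OF Y]) (rule that)
  have Ym: "Y \<in> borel_measurable L" by (rule continuous_measurable_lebesgue_on[OF C1c_continuous[OF Y]])
  have "Y \<in> Lp p {0<..<l}" by (rule bounded_in_Lp[OF interval_lmeasurable Ym B(2)]) (use p in simp)
  then show i: "integrable L (\<lambda>t. norm (Y t) powr p)" by (simp add: Lp_def)
  have f: "integrable L (\<lambda>t. fb (t \<in> W) (Y t))"
    by (rule integrable_switch_bounded[OF fb_cont Ym, of B]) (use B(2) in simp)
  have "(LINT t|L. cg * norm (Y t) powr p - c0) \<le> (LINT t|L. fb (t \<in> W) (Y t))"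
    by (rule integral_mono) (use i f fb_growth in auto)
  moreover have "(LINT t|L. cg * norm (Y t) powr p - c0) = cg * (LINT t|L. norm (Y t) powr p) - c0 * l"
    using i l by (simp add: measure_restrict_space)
  ultimately have "cg * (LINT t|L. norm (Y t) powr p) \<le> T + c0 * l" using T by linarith
  then show "(LINT t|L. norm (Y t) powr p) \<le> (T + c0 * l) / cg" using cg by (simp add: field_simps)
qed

text \<open>In the cylinder |x_1| and |x_2| are at most 1, so the cross-section term is at most
  \<epsilon> * (2 * B), and the error in the gradient is at most \<epsilon> * B. Requiring
  \<epsilon> to be small relative to B, as measured by d, makes the estimates uniform over a family
  of fields Y.\<close>

lemma defo_bounds:
  assumes Y: "Y \<in> C1c {0<..<l}" and B: "\<And>t. norm (Y t) \<le> B" "\<forall>x\<in>Om. norm (corr Y x) \<le> B"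
    and \<epsilon>: "0 < \<epsilon>" "\<epsilon> \<le> 1" "\<epsilon> * (2 * B) \<le> d"
  shows "x \<in> Om \<Longrightarrow> norm (defo a Y \<epsilon> x - (a + prim l (\<lambda>s. Y s $ 3) (x $ 3))) \<le> d"
    and "x \<in> Om \<Longrightarrow> norm (scaled_grad Y \<epsilon> x) \<le> norm (Y (x $ 3)) + d"
    and "AE x in LO. norm (weak_partial Om (axis i 1) (defo a Y \<epsilon>) x) \<le> norm (Y (x $ 3)) + d"
proof -
  have B0: "0 \<le> B" using B(1)[of 0] norm_ge_zero order_trans by blast
  have n: "norm (Y t $ i) \<le> B" for t i using order_trans[OF vec_norm_nth_le B(1)] .
  show "norm (defo a Y \<epsilon> x - (a + prim l (\<lambda>s. Y s $ 3) (x $ 3))) \<le> d" if "x \<in> Om" for x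
  proof -
    have "norm ((x $ 1) *\<^sub>R Y (x $ 3) $ 1 + (x $ 2) *\<^sub>R Y (x $ 3) $ 2) \<le>
      \<bar>x $ 1\<bar> * norm (Y (x $ 3) $ 1) + \<bar>x $ 2\<bar> * norm (Y (x $ 3) $ 2)"
      by (rule order_trans[OF norm_triangle_ineq]) simp
    also have "\<dots> \<le> 1 * B + 1 * B"
      using cylinder_abs_le_1[OF that] n B0 by (intro add_mono mult_mono) auto
    finally have m: "\<epsilon> * norm ((x $ 1) *\<^sub>R Y (x $ 3) $ 1 + (x $ 2) *\<^sub>R Y (x $ 3) $ 2) \<le> \<epsilon> * (2 * B)"
      using \<epsilon>(1) by (intro mult_left_mono) auto
    have "norm (defo a Y \<epsilon> x - (a + prim l (\<lambda>s. Y s $ 3) (x $ 3))) = \<epsilon> * norm ((x $ 1) *\<^sub>R Y (x $ 3) $ 1 + (x $ 2) *\<^sub>R Y (x $ 3) $ 2)"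
      using \<epsilon>(1) by (simp add: defo_def)
    with m \<epsilon>(3) show ?thesis by linarith
  qed
  show s: "norm (scaled_grad Y \<epsilon> x) \<le> norm (Y (x $ 3)) + d" if "x \<in> Om" for x
  proof -
    have "\<epsilon> * norm (corr Y x) \<le> \<epsilon> * (2 * B)" using \<epsilon>(1) bspec[OF B(2) that] B0 by (intro mult_left_mono) auto
    moreover have "norm (scaled_grad Y \<epsilon> x) \<le> norm (Y (x $ 3)) + norm (\<epsilon> *\<^sub>R axis 3 (corr Y x) :: real^3^3)"
      unfolding scaled_grad_def by (rule norm_triangle_ineq)
    moreover have "norm (\<epsilon> *\<^sub>R axis 3 (corr Y x) :: real^3^3) = \<epsilon> * norm (corr Y x)"
      using \<epsilon>(1) by (simp only: norm_scaleR norm_axis abs_of_pos)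
    ultimately show ?thesis using \<epsilon>(3) by linarith
  qed
  show "AE x in LO. norm (weak_partial Om (axis i 1) (defo a Y \<epsilon>) x) \<le> norm (Y (x $ 3)) + d"
    using defo_weak_partial(1)[OF Y, of i a \<epsilon>] AE_space[of LO]
  proof eventually_elim
    fix x assume h: "weak_partial Om (axis i 1) (defo a Y \<epsilon>) x = (if i = 3 then 1 else \<epsilon>) *\<^sub>R scaled_grad Y \<epsilon> x $ i"
      and "x \<in> space LO"
    then have x: "x \<in> Om" by simp
    have "norm (weak_partial Om (axis i 1) (defo a Y \<epsilon>) x) = \<bar>if i = 3 then 1 else \<epsilon>\<bar> * norm (scaled_grad Y \<epsilon> x $ i)"
      by (simp only: h norm_scaleR)
    also have "\<dots> \<le> 1 * norm (scaled_grad Y \<epsilon> x)"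
      using \<epsilon>(1,2) vec_norm_nth_le by (intro mult_mono) auto
    finally show "norm (weak_partial Om (axis i 1) (defo a Y \<epsilon>) x) \<le> norm (Y (x $ 3)) + d" using s[OF x] by linarith
  qed
qed

lemma recovery_energy:
  assumes Y: "Y \<in> C1c {0<..<l}" and \<epsilon>: "0 < \<epsilon>" "\<epsilon> \<le> 1"
  shows "rescaled_energy f l \<epsilon> (\<lambda>x. w (x $ 3)) (defo a Y \<epsilon>) \<le>
    ereal ((LINT x|LO. fb (x $ 3 \<in> W) (scaled_grad Y \<epsilon> x)) + card J * pi)"
proof -
  have "AE x in LO. f (w (x $ 3)) (rescale \<epsilon> (weak_grad Om (defo a Y \<epsilon>) x)) = fb (x $ 3 \<in> W) (scaled_grad Y \<epsilon> x)"
    using AE_axial[OF wW] rescaled_gradient[OF Y, of \<epsilon> a, OF less_imp_neq[OF \<epsilon>(1), symmetric]]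
    by eventually_elim (simp add: fb_def)
  then have "ext_integral LO (\<lambda>x. f (w (x $ 3)) (rescale \<epsilon> (weak_grad Om (defo a Y \<epsilon>) x)))
    = ereal (LINT x|LO. fb (x $ 3 \<in> W) (scaled_grad Y \<epsilon> x))"
    by (simp add: ext_integral_cong_AE ext_integral_integrable[OF defo_energy(2)[OF Y \<epsilon>]])
  moreover have "enn2ereal (total_variation Om (\<lambda>E. rescale \<epsilon> (derivative_measure Om (\<lambda>x. w (x $ 3)) E))) \<le> ereal (card J * pi)"
    using total_variation_3D(1)[of \<epsilon>] by (simp add: less_eq_ennreal.rep_eq enn2ereal_ennreal)
  ultimately show ?thesis
    unfolding rescaled_energy_def plus_ereal.simps(1)[symmetric] by (intro add_mono) auto
qed

text \<open>The L^p bounds reduce weak convergence to test functions. For the functions themselves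
  L1 convergence is then enough; for a partial derivative the derivative is first moved to the test
  function, so L1 convergence of the functions is enough again.\<close>

lemma weakly_in_W1p_if_L1:
  assumes s: "\<And>\<epsilon>. us \<epsilon> \<in> sobolev (Lp p) Om"
    and b: "\<forall>\<^sub>F \<epsilon> in F. (LINT x|LO. norm (us \<epsilon> x) powr p) \<le> M"
    and pb: "\<And>i. \<forall>\<^sub>F \<epsilon> in F. (LINT x|LO. norm (weak_partial Om (axis i 1) (us \<epsilon>) x) powr p) \<le> M"
    and lim: "((\<lambda>\<epsilon>. LINT x|LO. norm (us \<epsilon> x - u (x $ 3))) \<longlongrightarrow> 0) F"
  shows "weakly_in_W1p p Om F us (\<lambda>x. u (x $ 3))"
proof -
  let ?u = "\<lambda>x::real^3. u (x $ 3)"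
  have sLp: "us \<epsilon> \<in> Lp p Om" for \<epsilon> using s[of \<epsilon>] by (simp add: sobolev_def)
  have uLp: "?u \<in> Lp p Om" by (rule axial_in_Lp[OF u_Lp])
  have int: "integrable LO (us \<epsilon>)" "integrable LO ?u" for \<epsilon>
    by (rule Lp_integrable[OF cylinder_lmeasurable sLp], use p in simp) (rule Lp_integrable[OF cylinder_lmeasurable uLp], use p in simp)
  note conv = integral_bounded_tendsto[OF _ _ always_eventually[OF allI[OF int(1)]] int(2) lim]
  have "weakly_in_Lp p Om F us ?u"
  proof (rule weakly_in_Lp_if_C1c[OF cylinder_open cylinder_lmeasurable p uLp, where M = M])
    show "\<forall>\<^sub>F \<epsilon> in F. us \<epsilon> \<in> Lp p Om \<and> (LINT x|LO. norm (us \<epsilon> x) powr p) \<le> M"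
      using b by eventually_elim (simp add: sLp)
    fix \<phi> :: "real^3 \<Rightarrow> real" assume "\<phi> \<in> C1c Om"
    then obtain M' where M': "\<And>x. \<bar>\<phi> x\<bar> \<le> M'" "\<phi> \<in> borel_measurable LO"
      by (rule C1c_bounded_measurable[of _ _ 0]) (rule that)
    show "((\<lambda>\<epsilon>. LINT x|LO. \<phi> x *\<^sub>R us \<epsilon> x) \<longlongrightarrow> (LINT x|LO. \<phi> x *\<^sub>R u (x $ 3))) F"
      by (rule conv[OF M'(2,1)])
  qed
  moreover have "weakly_in_Lp p Om F (\<lambda>\<epsilon>. weak_partial Om (axis i 1) (us \<epsilon>)) (weak_partial Om (axis i 1) ?u)" for i
  proof (rule weakly_in_Lp_if_C1c[OF cylinder_open cylinder_lmeasurable p, where M = M])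
    have ib: "(axis i 1 :: real^3) \<in> Basis" by (simp add: axis_in_Basis3)
    note P = sobolev_weak_partial[OF cylinder_open _ ib]
    show "weak_partial Om (axis i 1) ?u \<in> Lp p Om" by (rule P(2)[OF u3_sobolev])
    show "\<forall>\<^sub>F \<epsilon> in F. weak_partial Om (axis i 1) (us \<epsilon>) \<in> Lp p Om \<and>
      (LINT x|LO. norm (weak_partial Om (axis i 1) (us \<epsilon>) x) powr p) \<le> M"
      using pb[of i] by eventually_elim (simp add: P(2)[OF s])
    fix \<phi> :: "real^3 \<Rightarrow> real" assume \<phi>: "\<phi> \<in> C1c Om"
    then obtain M' where M': "\<And>x. \<bar>frechet_derivative \<phi> (at x) (axis i 1)\<bar> \<le> M'"
      "(\<lambda>x. frechet_derivative \<phi> (at x) (axis i 1)) \<in> borel_measurable LO"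
      by (rule C1c_bounded_measurable[of _ _ "axis i 1"]) (rule that)
    have "((\<lambda>\<epsilon>. - (LINT x|LO. frechet_derivative \<phi> (at x) (axis i 1) *\<^sub>R us \<epsilon> x)) \<longlongrightarrow>
      - (LINT x|LO. frechet_derivative \<phi> (at x) (axis i 1) *\<^sub>R u (x $ 3))) F"
      by (rule tendsto_minus[OF conv[OF M'(2,1)]])
    moreover have "- (LINT x|LO. frechet_derivative \<phi> (at x) (axis i 1) *\<^sub>R v x) = (LINT x|LO. \<phi> x *\<^sub>R weak_partial Om (axis i 1) v x)"
      if "v \<in> sobolev (Lp p) Om" for v :: "real^3 \<Rightarrow> real^3"
      using P(1)[OF that] \<phi> unfolding has_weak_partial_def by simp
    ultimately show "((\<lambda>\<epsilon>. LINT x|LO. \<phi> x *\<^sub>R weak_partial Om (axis i 1) (us \<epsilon>) x) \<longlongrightarrow>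
      (LINT x|LO. \<phi> x *\<^sub>R weak_partial Om (axis i 1) ?u x)) F"
      using s u3_sobolev by simp
  qed
  moreover have "\<exists>k. i = axis k 1" if "i \<in> Basis" for i :: "real^3" using that by (auto simp: Basis_vec_def)
  ultimately show ?thesis
    unfolding weakly_in_W1p_def using s u3_sobolev by (auto intro!: always_eventually)
qed

text \<open>For fixed n the energy of \<open>defo\<close> built from \<open>Y n\<close> converges as
  \<epsilon> tends to 0, but the admissible \<epsilon> depends on the sup bound \<open>B n\<close>.
  The diagonal index \<open>N \<epsilon>\<close> grows slowly enough to respect this, and the L^p
  bounds needed for weak convergence are independent of n by coercivity.\<close>

lemma upper_bound:
  assumes g: "integrable L (\<lambda>t. gb (t \<in> W) (V t))"
  shows "F_DR f l p q (\<lambda>x. w (x $ 3)) (\<lambda>x. u (x $ 3)) \<le>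
    ereal (pi * (LINT t|L. gb (t \<in> W) (V t)) + card J * pi)"
proof -
  define T where "T = (LINT t|L. gb (t \<in> W) (V t))"
  obtain cu where cu: "AE t in L. u t = cu + prim l V t" by (rule u_eq_prim)
  have "\<forall>n::nat. \<exists>Y. Y \<in> C1c {0<..<l} \<and> (LINT t|L. fb (t \<in> W) (Y t)) < T + 1 / (real n + 1) \<and>
    (LINT t|L. norm (prim l (\<lambda>s. Y s $ 3) t - prim l V t)) < 1 / (real n + 1)"
  proof
    fix n :: nat
    have "0 < 1 / (real n + 1)" by simp
    then obtain Y :: "real \<Rightarrow> real^3^3" where "Y \<in> C1c {0<..<l}" "(LINT t|L. fb (t \<in> W) (Y t)) < (LINT t|L. gb (t \<in> W) (V t)) + 1 / (real n + 1)"
      "(LINT t|L. norm (prim l (\<lambda>s. Y s $ 3) t - prim l V t)) < 1 / (real n + 1)"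
      by (rule recovery_1D[OF V_props(2) g]) (rule that)
    then show "\<exists>Y. Y \<in> C1c {0<..<l} \<and> (LINT t|L. fb (t \<in> W) (Y t)) < T + 1 / (real n + 1) \<and>
      (LINT t|L. norm (prim l (\<lambda>s. Y s $ 3) t - prim l V t)) < 1 / (real n + 1)" unfolding T_def by blast
  qed
  from choice[OF this] obtain Y where "\<forall>n::nat. Y n \<in> C1c {0<..<l} \<and> (LINT t|L. fb (t \<in> W) (Y n t)) < T + 1 / (real n + 1) \<and>
    (LINT t|L. norm (prim l (\<lambda>s. Y n s $ 3) t - prim l V t)) < 1 / (real n + 1)" by (rule exE)
  then have Y: "\<And>n. Y n \<in> C1c {0<..<l}" "\<And>n. (LINT t|L. fb (t \<in> W) (Y n t)) < T + 1 / (real n + 1)"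
    "\<And>n. (LINT t|L. norm (prim l (\<lambda>s. Y n s $ 3) t - prim l V t)) < 1 / (real n + 1)" by auto
  have "\<forall>n. \<exists>B. 0 < B \<and> (\<forall>t. norm (Y n t) \<le> B) \<and> (\<forall>x\<in>Om. norm (corr (Y n) x) \<le> B)"
  proof
    fix n
    obtain B where "0 < B" "\<And>t. norm (Y n t) \<le> B" "\<And>x. x \<in> Om \<Longrightarrow> norm (corr (Y n) x) \<le> B"
      by (rule corr_bounded[OF Y(1)[of n]]) (rule that)
    then show "\<exists>B. 0 < B \<and> (\<forall>t. norm (Y n t) \<le> B) \<and> (\<forall>x\<in>Om. norm (corr (Y n) x) \<le> B)" by blast
  qed
  from choice[OF this] obtain B where "\<forall>n. 0 < B n \<and> (\<forall>t. norm (Y n t) \<le> B n) \<and> (\<forall>x\<in>Om. norm (corr (Y n) x) \<le> B n)" by (rule exE)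
  then have B: "\<And>n. 0 < B n" "\<And>n t. norm (Y n t) \<le> B n" "\<And>n. \<forall>x\<in>Om. norm (corr (Y n) x) \<le> B n" by auto
  \<comment> \<open>Everything the diagonal sequence has to satisfy at the pair (n, \<epsilon>); the
    last clause compensates a growing \<open>B n\<close>.\<close>
  define Q where "Q n \<epsilon> \<longleftrightarrow> 0 < \<epsilon> \<and> \<epsilon> \<le> 1 \<and>
    (LINT x|LO. fb (x $ 3 \<in> W) (scaled_grad (Y n) \<epsilon> x)) < pi * (T + 1 / (real n + 1)) \<and> \<epsilon> * (2 * B n) \<le> 1 / (real n + 1)" for n :: nat and \<epsilon> :: real
  have "\<forall>\<^sub>F \<epsilon> in at_right 0. Q n \<epsilon>" for n
  proof -
    have 1: "\<forall>\<^sub>F \<epsilon> in at_right 0. \<epsilon> \<le> (1::real)"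
      unfolding eventually_at_right_field by (rule exI[of _ 1]) auto
    have 2: "\<forall>\<^sub>F \<epsilon> in at_right 0. (LINT x|LO. fb (x $ 3 \<in> W) (scaled_grad (Y n) \<epsilon> x)) < pi * (T + 1 / (real n + 1))"
      by (rule order_tendstoD(2)[OF defo_energy(1)[OF Y(1)]]) (use Y(2) in simp)
    have "((\<lambda>\<epsilon>. \<epsilon> * (2 * B n)) \<longlongrightarrow> 0 * (2 * B n)) (at_right 0)" by (intro tendsto_intros)
    then have 3: "\<forall>\<^sub>F \<epsilon> in at_right 0. \<epsilon> * (2 * B n) < 1 / (real n + 1)"
      by (rule order_tendstoD(2)) simp
    from eventually_at_right_less[of 0] 1 2 3 show ?thesis by eventually_elim (simp add: Q_def)
  qed
  then obtain N where N: "\<forall>\<^sub>F \<epsilon> in at_right 0. Q (N \<epsilon>) \<epsilon>" "filterlim N at_top (at_right (0::real))"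
    by (rule diagonal_at_right) (rule that)
  define e where "e \<epsilon> = 1 / (real (N \<epsilon>) + 1)" for \<epsilon>
  have e0: "(e \<longlongrightarrow> 0) (at_right 0)"
  proof -
    have "((\<lambda>n. 1 / (real n + 1)) \<longlongrightarrow> 0) at_top" by real_asymp
    from filterlim_compose[OF this N(2)] show ?thesis by (simp add: e_def[abs_def])
  qed
  have e1: "0 < e \<epsilon>" "e \<epsilon> \<le> 1" for \<epsilon> by (auto simp: e_def)
  define us where "us \<epsilon> = defo cu (Y (N \<epsilon>)) \<epsilon>" for \<epsilon>
  \<comment> \<open>By coercivity this bounds the integral of the p-th power of every
    \<open>Y n\<close>, whose energies are at most T + 1.\<close>
  define K where "K = (T + 1 + c0 * l) / cg"
  have YT: "(LINT t|L. fb (t \<in> W) (Y n t)) \<le> T + 1" for n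
    using Y(2)[of n] by (smt (verit) divide_le_eq_1 of_nat_0_le_iff)
  note YK = Lp_norm_from_energy[OF Y(1) YT, folded K_def]
  have s: "us \<epsilon> \<in> sobolev (Lp r) Om" if "0 \<le> r" for r \<epsilon> unfolding us_def by (rule defo_sobolev[OF Y(1) that])
  note D = defo_bounds[OF Y(1) B(2,3)]
  have prim_int: "integrable L (\<lambda>t. norm (prim l (\<lambda>s. Y n s $ 3) t - prim l V t))"
    and Y3n: "(LINT t|L. norm (Y n t $ 3)) \<le> l + K" and Y3i: "integrable L (\<lambda>t. Y n t $ 3)" for n
  proof -
    have Yi: "integrable L (Y n)"
      by (rule L.integrable_const_bound[of _ "B n"]) (use B(2) continuous_measurable_lebesgue_on[OF C1c_continuous[OF Y(1)]] in auto)
    show Y3: "integrable L (\<lambda>t. Y n t $ 3)" by (rule nth3_integrable[OF Yi])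
    show "integrable L (\<lambda>t. norm (prim l (\<lambda>s. Y n s $ 3) t - prim l V t))"
      by (intro integrable_norm Bochner_Integration.integrable_diff prim_has_weak_partial(2) Y3 V_props(2))
    have "(LINT t|L. norm (Y n t $ 3)) \<le> (LINT t|L. 1 + norm (Y n t) powr p)"
    proof (rule integral_mono)
      show "norm (Y n t $ 3) \<le> 1 + norm (Y n t) powr p" for t
        by (rule order_trans[OF vec_norm_nth_le le_1_plus_powr]) simp
    qed (use Y3 YK(2)[of n] in auto)
    also have "\<dots> = l + (LINT t|L. norm (Y n t) powr p)" using YK(2)[of n] l by (simp add: measure_restrict_space)
    finally show "(LINT t|L. norm (Y n t $ 3)) \<le> l + K" using YK(1)[of n] by linarith
  qed
  \<comment> \<open>A sup bound for \<open>us\<close>: the constant cu, the primitive of the third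
    column, estimated through |y| \<le> 1 + |y|^p by l + K, and the cross-section term, at most 1.
    The constant M below then serves the functions and their partial derivatives alike.\<close>
  define R where "R = norm cu + (l + K) + 1"
  define M where "M = max (R powr p * measure lebesgue Om) (2 powr p * (pi * K + measure lebesgue Om))"
  have mO: "measure LO (space LO) = measure lebesgue Om"
    using cylinder_lmeasurable by (simp add: measure_restrict_space fmeasurableD)
  have Lp_b: "(LINT x|LO. norm (us \<epsilon> x) powr p) \<le> M" if "Q (N \<epsilon>) \<epsilon>" for \<epsilon>
  proof -
    have q: "0 < \<epsilon>" "\<epsilon> \<le> 1" "\<epsilon> * (2 * B (N \<epsilon>)) \<le> e \<epsilon>" using that by (auto simp: Q_def e_def)
    have "AE x in LO. norm (us \<epsilon> x) \<le> R"
    proof (rule AE_I2)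
      fix x assume "x \<in> space LO"
      then have "norm (us \<epsilon> x - (cu + prim l (\<lambda>s. Y (N \<epsilon>) s $ 3) (x $ 3))) \<le> 1"
        using D(1)[OF q, of x cu] e1(2)[of \<epsilon>] by (simp add: us_def)
      moreover have "norm (cu + prim l (\<lambda>s. Y (N \<epsilon>) s $ 3) (x $ 3)) \<le> norm cu + (l + K)"
        using prim_has_weak_partial(3)[OF Y3i, of "N \<epsilon>" "x $ 3"] Y3n[of "N \<epsilon>"] by (intro order_trans[OF norm_triangle_ineq]) simp
      ultimately show "norm (us \<epsilon> x) \<le> R"
        using norm_triangle_sub[of "us \<epsilon> x" "cu + prim l (\<lambda>s. Y (N \<epsilon>) s $ 3) (x $ 3)"] unfolding R_def by linarith
    qed
    moreover have "us \<epsilon> \<in> borel_measurable LO" using s[of 1 \<epsilon>] by (simp add: sobolev_def Lp_def)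
    ultimately have "(LINT x|LO. norm (us \<epsilon> x) powr p) \<le> R powr p * measure lebesgue Om"
      using p by (intro bounded_on_in_Lp(2)[OF cylinder_lmeasurable]) auto
    then show ?thesis by (simp add: M_def)
  qed
  have part_b: "(LINT x|LO. norm (weak_partial Om (axis i 1) (us \<epsilon>) x) powr p) \<le> M" if "Q (N \<epsilon>) \<epsilon>" for \<epsilon> i
  proof -
    have "0 < \<epsilon>" "\<epsilon> \<le> 1" "\<epsilon> * (2 * B (N \<epsilon>)) \<le> e \<epsilon>" using that by (auto simp: Q_def e_def)
    then have q: "0 < \<epsilon>" "\<epsilon> \<le> 1" "\<epsilon> * (2 * B (N \<epsilon>)) \<le> 1" using e1(2)[of \<epsilon>] by linarith+
    note YO = integral_axial[OF YK(2)[of "N \<epsilon>"]]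
    have ib: "(axis i 1 :: real^3) \<in> Basis" by (simp add: axis_in_Basis3)
    have "weak_partial Om (axis i 1) (us \<epsilon>) \<in> Lp p Om"
      by (rule sobolev_weak_partial(2)[OF cylinder_open s ib]) (use p in simp)
    then have pi': "integrable LO (\<lambda>x. norm (weak_partial Om (axis i 1) (us \<epsilon>) x) powr p)" by (simp add: Lp_def)
    have "(LINT x|LO. norm (weak_partial Om (axis i 1) (us \<epsilon>) x) powr p)
      \<le> (LINT x|LO. 2 powr p * (norm (Y (N \<epsilon>) (x $ 3)) powr p + 1))"
    proof (rule integral_mono_AE[OF pi'])
      show "AE x in LO. norm (weak_partial Om (axis i 1) (us \<epsilon>) x) powr p \<le> 2 powr p * (norm (Y (N \<epsilon>) (x $ 3)) powr p + 1)"
        using D(3)[OF q, of i cu]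
      proof eventually_elim
        fix x assume "norm (weak_partial Om (axis i 1) (defo cu (Y (N \<epsilon>)) \<epsilon>) x) \<le> norm (Y (N \<epsilon>) (x $ 3)) + 1"
        then have "norm (weak_partial Om (axis i 1) (us \<epsilon>) x) powr p \<le> (norm (Y (N \<epsilon>) (x $ 3)) + 1) powr p"
          unfolding us_def using p by (intro powr_mono2) auto
        also have "\<dots> \<le> 2 powr p * (norm (Y (N \<epsilon>) (x $ 3)) powr p + 1)"
          using add_powr_le[of "norm (Y (N \<epsilon>) (x $ 3))" 1 p] p by simp
        finally show "norm (weak_partial Om (axis i 1) (us \<epsilon>) x) powr p \<le> 2 powr p * (norm (Y (N \<epsilon>) (x $ 3)) powr p + 1)" .
      qed
    qed (use YO(1) in simp)
    also have "\<dots> = 2 powr p * (pi * (LINT t|L. norm (Y (N \<epsilon>) t) powr p) + measure lebesgue Om)"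
      using YO mO by simp
    also have "\<dots> \<le> 2 powr p * (pi * K + measure lebesgue Om)" using YK(1)[of "N \<epsilon>"] by (intro mult_left_mono add_mono) auto
    finally show ?thesis by (simp add: M_def)
  qed
  have L1: "(LINT x|LO. norm (us \<epsilon> x - u (x $ 3))) \<le> e \<epsilon> * (pi + measure lebesgue Om)" if "Q (N \<epsilon>) \<epsilon>" for \<epsilon>
  proof -
    have q: "0 < \<epsilon>" "\<epsilon> \<le> 1" "\<epsilon> * (2 * B (N \<epsilon>)) \<le> e \<epsilon>" using that by (auto simp: Q_def e_def)
    note PO = integral_axial[OF prim_int[of "N \<epsilon>"]]
    have i: "integrable LO (us \<epsilon>)"
      by (rule Lp_integrable[OF cylinder_lmeasurable, of _ 1]) (use s[of 1 \<epsilon>] in \<open>simp_all add: sobolev_def\<close>)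
    have "(LINT x|LO. norm (us \<epsilon> x - u (x $ 3))) \<le>
      (LINT x|LO. norm (prim l (\<lambda>s. Y (N \<epsilon>) s $ 3) (x $ 3) - prim l V (x $ 3)) + e \<epsilon>)"
    proof (rule integral_mono_AE)
      show "integrable LO (\<lambda>x. norm (us \<epsilon> x - u (x $ 3)))"
        using i integral_axial(1)[OF ui] by (intro integrable_norm Bochner_Integration.integrable_diff)
      show "AE x in LO. norm (us \<epsilon> x - u (x $ 3)) \<le> norm (prim l (\<lambda>s. Y (N \<epsilon>) s $ 3) (x $ 3) - prim l V (x $ 3)) + e \<epsilon>"
        using AE_axial[OF cu] AE_space[of LO]
      proof eventually_elim
        fix x assume h: "u (x $ 3) = cu + prim l V (x $ 3)" and "x \<in> space LO"
        then have "norm (us \<epsilon> x - (cu + prim l (\<lambda>s. Y (N \<epsilon>) s $ 3) (x $ 3))) \<le> e \<epsilon>"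
          using D(1)[OF q, of x cu] by (simp add: us_def)
        moreover have eq: "us \<epsilon> x - u (x $ 3) = (prim l (\<lambda>s. Y (N \<epsilon>) s $ 3) (x $ 3) - prim l V (x $ 3))
          + (us \<epsilon> x - (cu + prim l (\<lambda>s. Y (N \<epsilon>) s $ 3) (x $ 3)))" by (simp add: h)
        have "norm (us \<epsilon> x - u (x $ 3)) \<le> norm (prim l (\<lambda>s. Y (N \<epsilon>) s $ 3) (x $ 3) - prim l V (x $ 3))
          + norm (us \<epsilon> x - (cu + prim l (\<lambda>s. Y (N \<epsilon>) s $ 3) (x $ 3)))"
          unfolding eq by (rule norm_triangle_ineq)
        ultimately show "norm (us \<epsilon> x - u (x $ 3)) \<le> norm (prim l (\<lambda>s. Y (N \<epsilon>) s $ 3) (x $ 3) - prim l V (x $ 3)) + e \<epsilon>"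
          by linarith
      qed
    qed (use PO(1) in simp)
    also have "\<dots> = pi * (LINT t|L. norm (prim l (\<lambda>s. Y (N \<epsilon>) s $ 3) t - prim l V t)) + e \<epsilon> * measure lebesgue Om"
      using PO mO by simp
    also have "\<dots> \<le> pi * e \<epsilon> + e \<epsilon> * measure lebesgue Om"
      using Y(3)[of "N \<epsilon>"] by (intro add_right_mono mult_left_mono) (auto simp: e_def)
    finally show ?thesis by (simp add: algebra_simps)
  qed
  have "((\<lambda>\<epsilon>. LINT x|LO. norm (us \<epsilon> x - u (x $ 3))) \<longlongrightarrow> 0) (at_right 0)"
  proof (rule tendsto_sandwich[OF _ _ tendsto_const])
    show "\<forall>\<^sub>F \<epsilon> in at_right 0. (LINT x|LO. norm (us \<epsilon> x - u (x $ 3))) \<le> e \<epsilon> * (pi + measure lebesgue Om)"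
      using N(1) by eventually_elim (rule L1)
    show "((\<lambda>\<epsilon>. e \<epsilon> * (pi + measure lebesgue Om)) \<longlongrightarrow> 0) (at_right 0)"
      by (rule tendsto_mult_left_zero[OF e0])
  qed (simp add: integral_nonneg_AE)
  then have W: "weakly_in_W1p p Om (at_right 0) us (\<lambda>x. u (x $ 3))"
  proof (rule weakly_in_W1p_if_L1[rotated 3])
    show "us \<epsilon> \<in> sobolev (Lp p) Om" for \<epsilon> by (rule s) (use p in simp)
    show "\<forall>\<^sub>F \<epsilon> in at_right 0. (LINT x|LO. norm (us \<epsilon> x) powr p) \<le> M"
      using N(1) by eventually_elim (rule Lp_b)
    show "\<forall>\<^sub>F \<epsilon> in at_right 0. (LINT x|LO. norm (weak_partial Om (axis i 1) (us \<epsilon>) x) powr p) \<le> M" for i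
      using N(1) by eventually_elim (rule part_b)
  qed
  have "F_DR f l p q (\<lambda>x. w (x $ 3)) (\<lambda>x. u (x $ 3)) \<le>
    Liminf (at_right 0) (\<lambda>\<epsilon>. rescaled_energy f l \<epsilon> (\<lambda>x. w (x $ 3)) (us \<epsilon>))"
    unfolding F_DR_def
  proof (rule Inf_lower, rule CollectI, rule exI[of _ "\<lambda>_ x. w (x $ 3)"], rule exI[of _ us], intro conjI refl)
    show "\<forall>\<epsilon>>0. us \<epsilon> \<in> sobolev (Lp q) Om \<and> (\<lambda>x. w (x $ 3)) \<in> BV01 Om"
      using s q w3_BV01 by auto
  qed (rule W weak_star)+
  also have "\<dots> \<le> Liminf (at_right 0) (\<lambda>\<epsilon>. ereal (pi * (T + e \<epsilon>) + card J * pi))"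
  proof (rule Liminf_mono)
    show "\<forall>\<^sub>F \<epsilon> in at_right 0. rescaled_energy f l \<epsilon> (\<lambda>x. w (x $ 3)) (us \<epsilon>) \<le> ereal (pi * (T + e \<epsilon>) + card J * pi)"
      using N(1)
    proof eventually_elim
      fix \<epsilon> assume "Q (N \<epsilon>) \<epsilon>"
      then have q: "0 < \<epsilon>" "\<epsilon> \<le> 1" "(LINT x|LO. fb (x $ 3 \<in> W) (scaled_grad (Y (N \<epsilon>)) \<epsilon> x)) < pi * (T + e \<epsilon>)"
        by (auto simp: Q_def e_def)
      show "rescaled_energy f l \<epsilon> (\<lambda>x. w (x $ 3)) (us \<epsilon>) \<le> ereal (pi * (T + e \<epsilon>) + card J * pi)"
        unfolding us_def by (rule order_trans[OF recovery_energy[OF Y(1) q(1,2)]]) (use q(3) in simp)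
    qed
  qed
  also have "\<dots> = ereal (pi * T + card J * pi)"
  proof (rule lim_imp_Liminf)
    have "((\<lambda>\<epsilon>. pi * (T + e \<epsilon>) + card J * pi) \<longlongrightarrow> pi * (T + 0) + card J * pi) (at_right 0)"
      by (intro tendsto_intros e0)
    then show "((\<lambda>\<epsilon>. ereal (pi * (T + e \<epsilon>) + card J * pi)) \<longlongrightarrow> ereal (pi * T + card J * pi)) (at_right 0)" by simp
  qed simp
  finally show ?thesis by (simp add: T_def)
qed

end

section \<open>The lower bound\<close>

lemma ext_integral_ge:
  assumes h: "integrable M h" and le: "AE x in M. h x \<le> g x"
  shows "ereal (integral\<^sup>L M h) \<le> ext_integral M g"
proof -
  have "(\<integral>\<^sup>+x. ennreal (h x) \<partial>M) \<le> (\<integral>\<^sup>+x. ennreal (g x) \<partial>M)"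
    by (rule nn_integral_mono_AE) (use le in \<open>auto elim!: eventually_mono intro: ennreal_leI\<close>)
  moreover have "(\<integral>\<^sup>+x. ennreal (- g x) \<partial>M) \<le> (\<integral>\<^sup>+x. ennreal (- h x) \<partial>M)"
    by (rule nn_integral_mono_AE) (use le in \<open>auto elim!: eventually_mono intro: ennreal_leI\<close>)
  ultimately have "ext_integral M h \<le> ext_integral M g"
    unfolding ext_integral_def by (intro ereal_minus_mono) (simp_all add: less_eq_ennreal.rep_eq)
  then show ?thesis by (simp add: ext_integral_integrable[OF h])
qed

text \<open>The point s0 satisfies R = k * s0^(p - 1). Up to s0 the constant R * s0 suffices, and
  beyond it the power dominates the linear term; here p > 1 is essential.\<close>

lemma linear_le_powr:
  fixes R k p :: real
  assumes "0 \<le> R" "0 < k" "1 < p"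
  obtains K where "0 \<le> K" "\<And>s. 0 \<le> s \<Longrightarrow> R * s \<le> k * s powr p + K"
proof -
  define s0 where "s0 = (R / k) powr (1 / (p - 1))"
  show ?thesis
  proof (rule that[of "R * s0"])
    show "0 \<le> R * s0" using assms by (simp add: s0_def)
    fix s :: real assume s: "0 \<le> s"
    show "R * s \<le> k * s powr p + R * s0"
    proof (cases "s \<le> s0")
      case True
      then have "R * s \<le> R * s0" using assms by (intro mult_left_mono)
      then show ?thesis using assms by (simp add: add_increasing)
    next
      case False
      moreover have "0 \<le> s0" by (simp add: s0_def)
      ultimately have "s0 < s" "0 < s" by linarith+
      have "s0 powr (p - 1) \<le> s powr (p - 1)" using \<open>s0 < s\<close> assms by (intro powr_mono2) (auto simp: s0_def)
      moreover have "s0 powr (p - 1) = R / k" using assms by (simp add: s0_def powr_powr)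
      ultimately have "R \<le> k * s powr (p - 1)" using assms by (simp add: field_simps)
      then have "R * s \<le> k * s powr (p - 1) * s" using s by (intro mult_right_mono)
      also have "\<dots> = k * s powr p" using \<open>0 < s\<close> by (simp add: powr_diff)
      finally show ?thesis using assms by (simp add: s0_def add_increasing2)
    qed
  qed
qed

text \<open>Chosen recursively, so that the maximising affine function depends measurably on \<open>y\<close>.\<close>

primrec best_affine :: "(nat \<Rightarrow> real) \<Rightarrow> (nat \<Rightarrow> 'a) \<Rightarrow> real \<Rightarrow> nat \<Rightarrow> 'a::euclidean_space \<Rightarrow> real \<times> 'a" where
  "best_affine a \<beta> m 0 y = (m, 0)"
| "best_affine a \<beta> m (Suc k) y =
    (if fst (best_affine a \<beta> m k y) + snd (best_affine a \<beta> m k y) \<bullet> y < a k + \<beta> k \<bullet> y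
     then (a k, \<beta> k) else best_affine a \<beta> m k y)"

abbreviation "best_value a \<beta> m k y \<equiv> fst (best_affine a \<beta> m k y) + snd (best_affine a \<beta> m k y) \<bullet> y"

lemma best_affine_measurable:
  fixes \<beta> :: "nat \<Rightarrow> 'a::euclidean_space"
  shows "(\<lambda>y. fst (best_affine a \<beta> m k y)) \<in> borel_measurable borel"
    and "(\<lambda>y. snd (best_affine a \<beta> m k y)) \<in> borel_measurable borel"
proof (induction k)
  case (Suc k)
  have [measurable]: "(\<lambda>y. fst (best_affine a \<beta> m k y)) \<in> borel_measurable borel"
    "(\<lambda>y. snd (best_affine a \<beta> m k y)) \<in> borel_measurable borel" by fact+
  case 1
  show ?case by (simp add: if_distrib[of fst])
  case 2
  show ?case by (simp add: if_distrib[of snd])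
qed simp_all

lemma best_affine_range: "best_affine a \<beta> m k y \<in> insert (m, 0) ((\<lambda>j. (a j, \<beta> j)) ` {..<k})"
  by (induction k) (auto simp: less_Suc_eq)

lemma best_value_mono: "k \<le> k' \<Longrightarrow> best_value a \<beta> m k y \<le> best_value a \<beta> m k' y"
  by (rule lift_Suc_mono_le[of "\<lambda>k. best_value a \<beta> m k y"]) auto

lemma best_value_ge: "j < k \<Longrightarrow> a j + \<beta> j \<bullet> y \<le> best_value a \<beta> m k y"
  by (rule order_trans[OF _ best_value_mono[of "Suc j"]]) auto

context rod
begin

text \<open>The coefficients are bounded and measurable functions of the height, hence admissible
  weights in the dual of L^p, and the affine integral passes to the weak limit. Bulk and surface
  estimates each hold eventually up to a margin, and they are added before the limit inferior is
  taken.\<close>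

lemma lower_bound_affine:
  fixes \<alpha> :: "real \<Rightarrow> real" and \<beta> :: "real \<Rightarrow> real^3"
  assumes us: "\<forall>\<epsilon>>0. us \<epsilon> \<in> sobolev (Lp q) Om \<and> ws \<epsilon> \<in> BV01 Om"
    and cu: "weakly_in_W1p p Om (at_right 0) us (\<lambda>x. u (x $ 3))"
    and cw: "weakly_star_in_BV Om (at_right 0) ws (\<lambda>x. w (x $ 3))"
    and m: "\<alpha> \<in> borel_measurable L" "\<beta> \<in> borel_measurable L"
    and R: "\<And>t. \<bar>\<alpha> t\<bar> \<le> R" "\<And>t. norm (\<beta> t) \<le> R"
    and minorant: "\<And>t y. \<alpha> t + \<beta> t \<bullet> y \<le> gb (t \<in> W) y"
  shows "ereal (pi * (LINT t|L. \<alpha> t + \<beta> t \<bullet> V t) + card J * pi)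
    \<le> Liminf (at_right 0) (\<lambda>\<epsilon>. rescaled_energy f l \<epsilon> (ws \<epsilon>) (us \<epsilon>))"
proof -
  have R0: "0 \<le> R" using R(2)[of 0] norm_ge_zero order_trans by blast
  obtain K0 where K0: "0 \<le> K0" "\<And>s. 0 \<le> s \<Longrightarrow> R * s \<le> cg * s powr p + K0"
    by (rule linear_le_powr[OF R0 cg p]) (rule that)
  \<comment> \<open>Where the phases of \<open>ws \<epsilon>\<close> and w differ, the minorant
    belongs to the wrong density. There it is at most R + R * |\<xi>|, and R * |\<xi>| exceeds f by
    at most K0 + c0, by coercivity; so subtracting K repairs the inequality.\<close>
  define K where "K = R + K0 + c0"
  let ?P = "\<lambda>\<epsilon>. weak_partial Om (axis 3 1) (us \<epsilon>)"
  define h where "h \<epsilon> x = \<alpha> (x $ 3) + ?P \<epsilon> x \<bullet> \<beta> (x $ 3) - K * \<bar>ws \<epsilon> x - w (x $ 3)\<bar>" for \<epsilon> x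
  have switch: "\<alpha> t + \<eta> \<bullet> \<beta> t - K * \<bar>of_bool b - of_bool (t \<in> W)\<bar> \<le> fb b \<xi>"
    if "\<eta> = \<xi> $ 3" for t b \<eta> \<xi>
  proof (cases "b = (t \<in> W)")
    case True
    have "\<alpha> t + \<beta> t \<bullet> \<eta> \<le> gb b \<eta>" using minorant[of t \<eta>] True by simp
    also have "\<dots> \<le> fb b \<xi>" unfolding that by (rule gb_le)
    finally show ?thesis using True by (simp add: inner_commute)
  next
    case False
    have "\<eta> \<bullet> \<beta> t \<le> norm \<eta> * norm (\<beta> t)" by (rule norm_cauchy_schwarz)
    also have "\<dots> \<le> norm \<xi> * R" using that R(2) vec_norm_nth_le by (intro mult_mono) auto
    also have "\<dots> \<le> cg * norm \<xi> powr p + K0" using K0(2)[of "norm \<xi>"] by (simp add: mult.commute)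
    also have "\<dots> \<le> fb b \<xi> + c0 + K0" using fb_growth[of \<xi> b] by simp
    finally have "\<alpha> t + \<eta> \<bullet> \<beta> t - K \<le> fb b \<xi>" using R(1)[of t] unfolding K_def by linarith
    moreover have "\<bar>of_bool b - of_bool (t \<in> W)\<bar> = (1::real)" using False by auto
    ultimately show ?thesis by simp
  qed
  have ib: "(axis 3 1 :: real^3) \<in> Basis" by (simp add: axis_in_Basis3)
  have "\<beta> \<in> Lp (p / (p - 1)) {0<..<l}"
    by (rule bounded_in_Lp[OF interval_lmeasurable m(2) R(2)]) (use p in simp)
  then have \<beta>3: "(\<lambda>x. \<beta> (x $ 3)) \<in> Lp (p / (p - 1)) Om" by (rule axial_in_Lp)
  have Pv: "\<forall>v \<in> Lp (p / (p - 1)) Om. ((\<lambda>\<epsilon>. LINT x|LO. ?P \<epsilon> x \<bullet> v x) \<longlongrightarrow>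
      (LINT x|LO. weak_partial Om (axis 3 1) (\<lambda>x. u (x $ 3)) x \<bullet> v x)) (at_right 0)"
    and PLp: "\<forall>\<^sub>F \<epsilon> in at_right 0. ?P \<epsilon> \<in> Lp p Om"
    using cu ib unfolding weakly_in_W1p_def weakly_in_Lp_def by auto
  have P: "((\<lambda>\<epsilon>. LINT x|LO. ?P \<epsilon> x \<bullet> \<beta> (x $ 3)) \<longlongrightarrow>
      (LINT x|LO. weak_partial Om (axis 3 1) (\<lambda>x. u (x $ 3)) x \<bullet> \<beta> (x $ 3))) (at_right 0)"
    by (rule bspec[OF Pv \<beta>3])
  have Pint: "\<forall>\<^sub>F \<epsilon> in at_right 0. integrable LO (\<lambda>x. ?P \<epsilon> x \<bullet> \<beta> (x $ 3))"
    using PLp by eventually_elim (rule Lp_inner_integrable(1)[OF _ \<beta>3 p zero_less_one])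
  have wint: "\<forall>\<^sub>F \<epsilon> in at_right 0. integrable LO (ws \<epsilon>)"
    using cw unfolding weakly_star_in_BV_def by (auto simp: BV_def elim!: eventually_mono)
  have w3: "integrable LO (\<lambda>x. w (x $ 3))" using w_BV by (simp add: BV_def)
  have wlim: "((\<lambda>\<epsilon>. LINT x|LO. \<bar>ws \<epsilon> x - w (x $ 3)\<bar>) \<longlongrightarrow> 0) (at_right 0)"
    using cw by (simp add: weakly_star_in_BV_def)
  have \<alpha>i: "integrable L \<alpha>" by (rule L.integrable_const_bound[of _ R]) (use R m in auto)
  have \<beta>V: "integrable L (\<lambda>t. \<beta> t \<bullet> V t)"
  proof (rule Bochner_Integration.integrable_bound[OF integrable_scaleR_right[OF V_props(2), of R]])
    show "(\<lambda>t. \<beta> t \<bullet> V t) \<in> borel_measurable L"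
      using m(2) borel_measurable_integrable[OF V_props(2)] by (rule borel_measurable_inner)
    show "AE t in L. norm (\<beta> t \<bullet> V t) \<le> norm (R *\<^sub>R V t)"
    proof (rule AE_I2)
      fix t
      have "\<bar>\<beta> t \<bullet> V t\<bar> \<le> norm (\<beta> t) * norm (V t)" by (rule Cauchy_Schwarz_ineq2)
      also have "\<dots> \<le> R * norm (V t)" using R(2) by (intro mult_right_mono) auto
      finally show "norm (\<beta> t \<bullet> V t) \<le> norm (R *\<^sub>R V t)" using R0 by simp
    qed
  qed
  have "(LINT x|LO. weak_partial Om (axis 3 1) (\<lambda>x. u (x $ 3)) x \<bullet> \<beta> (x $ 3)) = (LINT x|LO. \<beta> (x $ 3) \<bullet> V (x $ 3))"
  proof (rule integral_cong_AE)
    show "AE x in LO. weak_partial Om (axis 3 1) (\<lambda>x. u (x $ 3)) x \<bullet> \<beta> (x $ 3) = \<beta> (x $ 3) \<bullet> V (x $ 3)"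
      using u3_weak_partial by eventually_elim (simp add: inner_commute)
    have "weak_partial Om (axis 3 1) (\<lambda>x. u (x $ 3)) \<in> Lp p Om"
      by (rule sobolev_weak_partial(2)[OF cylinder_open u3_sobolev ib])
    from Lp_inner_integrable(1)[OF this \<beta>3 p zero_less_one]
    show "(\<lambda>x. weak_partial Om (axis 3 1) (\<lambda>x. u (x $ 3)) x \<bullet> \<beta> (x $ 3)) \<in> borel_measurable LO" by simp
    show "(\<lambda>x. \<beta> (x $ 3) \<bullet> V (x $ 3)) \<in> borel_measurable LO"
      using integral_axial(1)[OF \<beta>V] by simp
  qed
  also have "\<dots> = pi * (LINT t|L. \<beta> t \<bullet> V t)" using integral_axial(2)[OF \<beta>V] by simp
  finally have lim: "((\<lambda>\<epsilon>. (LINT x|LO. \<alpha> (x $ 3)) + (LINT x|LO. ?P \<epsilon> x \<bullet> \<beta> (x $ 3)) - K * (LINT x|LO. \<bar>ws \<epsilon> x - w (x $ 3)\<bar>)) \<longlongrightarrow>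
      pi * (LINT t|L. \<alpha> t) + pi * (LINT t|L. \<beta> t \<bullet> V t) - K * 0) (at_right 0)"
    using P integral_axial(2)[OF \<alpha>i] by (intro tendsto_intros wlim) simp_all
  have hint: "\<forall>\<^sub>F \<epsilon> in at_right 0. integrable LO (h \<epsilon>) \<and>
    (LINT x|LO. h \<epsilon> x) = (LINT x|LO. \<alpha> (x $ 3)) + (LINT x|LO. ?P \<epsilon> x \<bullet> \<beta> (x $ 3)) - K * (LINT x|LO. \<bar>ws \<epsilon> x - w (x $ 3)\<bar>)"
    using Pint wint
  proof eventually_elim
    fix \<epsilon> assume i: "integrable LO (\<lambda>x. ?P \<epsilon> x \<bullet> \<beta> (x $ 3))" "integrable LO (ws \<epsilon>)"
    note i3 = integral_axial(1)[OF \<alpha>i]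
    have iw: "integrable LO (\<lambda>x. \<bar>ws \<epsilon> x - w (x $ 3)\<bar>)" using i(2) w3 by (intro integrable_abs Bochner_Integration.integrable_diff)
    show "integrable LO (h \<epsilon>) \<and>
    (LINT x|LO. h \<epsilon> x) = (LINT x|LO. \<alpha> (x $ 3)) + (LINT x|LO. ?P \<epsilon> x \<bullet> \<beta> (x $ 3)) - K * (LINT x|LO. \<bar>ws \<epsilon> x - w (x $ 3)\<bar>)"
      unfolding h_def[abs_def] using i(1) i3 iw by simp
  qed
  have hlim: "((\<lambda>\<epsilon>. LINT x|LO. h \<epsilon> x) \<longlongrightarrow> pi * (LINT t|L. \<alpha> t + \<beta> t \<bullet> V t)) (at_right 0)"
  proof (rule Lim_transform_eventually)
    show "((\<lambda>\<epsilon>. (LINT x|LO. \<alpha> (x $ 3)) + (LINT x|LO. ?P \<epsilon> x \<bullet> \<beta> (x $ 3)) - K * (LINT x|LO. \<bar>ws \<epsilon> x - w (x $ 3)\<bar>)) \<longlongrightarrow>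
      pi * (LINT t|L. \<alpha> t + \<beta> t \<bullet> V t)) (at_right 0)"
      using lim \<alpha>i \<beta>V by (simp add: distrib_left)
  qed (use hint in \<open>eventually_elim, simp\<close>)
  have energy: "\<forall>\<^sub>F \<epsilon> in at_right 0. ereal (LINT x|LO. h \<epsilon> x) \<le>
    ext_integral LO (\<lambda>x. f (ws \<epsilon> x) (rescale \<epsilon> (weak_grad Om (us \<epsilon>) x)))"
    using hint eventually_at_right_less[of 0]
  proof eventually_elim
    fix \<epsilon> :: real assume i: "integrable LO (h \<epsilon>) \<and>
      (LINT x|LO. h \<epsilon> x) = (LINT x|LO. \<alpha> (x $ 3)) + (LINT x|LO. ?P \<epsilon> x \<bullet> \<beta> (x $ 3)) - K * (LINT x|LO. \<bar>ws \<epsilon> x - w (x $ 3)\<bar>)"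
      and "0 < \<epsilon>"
    then have w01: "AE x in LO. ws \<epsilon> x \<in> {0, 1}" using us by (simp add: BV01_def)
    show "ereal (LINT x|LO. h \<epsilon> x) \<le> ext_integral LO (\<lambda>x. f (ws \<epsilon> x) (rescale \<epsilon> (weak_grad Om (us \<epsilon>) x)))"
    proof (rule ext_integral_ge)
      show "integrable LO (h \<epsilon>)" using i by simp
      show "AE x in LO. h \<epsilon> x \<le> f (ws \<epsilon> x) (rescale \<epsilon> (weak_grad Om (us \<epsilon>) x))"
        using w01 AE_axial[OF wW]
      proof eventually_elim
        fix x assume a: "ws \<epsilon> x \<in> {0, 1}" and b: "w (x $ 3) = of_bool (x $ 3 \<in> W)"
        have e: "ws \<epsilon> x = of_bool (ws \<epsilon> x = 1)" using a by auto
        have "?P \<epsilon> x = rescale \<epsilon> (weak_grad Om (us \<epsilon>) x) $ 3" by (simp add: rescale_def weak_grad_def)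
        from switch[OF this, of "x $ 3" "ws \<epsilon> x = 1"]
        show "h \<epsilon> x \<le> f (ws \<epsilon> x) (rescale \<epsilon> (weak_grad Om (us \<epsilon>) x))"
          unfolding h_def fb_def b e[symmetric] .
      qed
    qed
  qed
  let ?x = "pi * (LINT t|L. \<alpha> t + \<beta> t \<bullet> V t) + card J * pi"
  show ?thesis
  proof (rule dense_le)
    fix z assume z: "z < ereal ?x"
    show "z \<le> Liminf (at_right 0) (\<lambda>\<epsilon>. rescaled_energy f l \<epsilon> (ws \<epsilon>) (us \<epsilon>))"
    proof (cases z)
      case (real r)
      \<comment> \<open>Half of the gap between r and the claimed bound is spent on the bulk term
        and half on the surface term.\<close>
      define d where "d = (?x - r) / 2"
      have d: "0 < d" using z real by (simp add: d_def)
      have "\<forall>\<^sub>F \<epsilon> in at_right 0. pi * (LINT t|L. \<alpha> t + \<beta> t \<bullet> V t) - d < (LINT x|LO. h \<epsilon> x)"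
        by (rule order_tendstoD(1)[OF hlim]) (use d in simp)
      with energy total_variation_lower_semicontinuous[OF cw d, of "\<lambda>\<epsilon>. \<epsilon>"]
      have "\<forall>\<^sub>F \<epsilon> in at_right 0. z \<le> rescaled_energy f l \<epsilon> (ws \<epsilon>) (us \<epsilon>)"
      proof eventually_elim
        fix \<epsilon>
        assume 1: "ereal (LINT x|LO. h \<epsilon> x) \<le> ext_integral LO (\<lambda>x. f (ws \<epsilon> x) (rescale \<epsilon> (weak_grad Om (us \<epsilon>) x)))"
          and 2: "ennreal (card J * pi - d) \<le> total_variation Om (\<lambda>E. rescale \<epsilon> (derivative_measure Om (ws \<epsilon>) E))"
          and 3: "pi * (LINT t|L. \<alpha> t + \<beta> t \<bullet> V t) - d < (LINT x|LO. h \<epsilon> x)"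
        \<comment> \<open>True also for a negative left side, since \<open>ennreal\<close> truncates
          at 0.\<close>
        have "ereal (card J * pi - d) \<le> enn2ereal (ennreal (card J * pi - d))"
          by (simp add: ennreal.rep_eq)
        also have "\<dots> \<le> enn2ereal (total_variation Om (\<lambda>E. rescale \<epsilon> (derivative_measure Om (ws \<epsilon>) E)))"
          using 2 by (simp add: less_eq_ennreal.rep_eq)
        finally have "ereal (LINT x|LO. h \<epsilon> x) + ereal (card J * pi - d) \<le> rescaled_energy f l \<epsilon> (ws \<epsilon>) (us \<epsilon>)"
          unfolding rescaled_energy_def by (rule add_mono[OF 1])
        moreover have "r \<le> (LINT x|LO. h \<epsilon> x) + (card J * pi - d)" using 3 unfolding d_def by argo
        then have "z \<le> ereal (LINT x|LO. h \<epsilon> x) + ereal (card J * pi - d)" by (simp add: real)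
        ultimately show "z \<le> rescaled_energy f l \<epsilon> (ws \<epsilon>) (us \<epsilon>)" by (rule order_trans[rotated])
      qed
      then show ?thesis by (rule Liminf_bounded)
    qed (use z in auto)
  qed
qed

text \<open>The best of the first k affine minorants increases to \<open>gb\<close>, and each stage
  has its integral below the relaxed functional. Finiteness of the functional therefore bounds the
  increasing integrals, and monotone convergence yields the integrability of \<open>gb\<close> along
  V together with the inequality.\<close>

lemma lower_bound:
  assumes fin: "F_DR f l p q (\<lambda>x. w (x $ 3)) (\<lambda>x. u (x $ 3)) \<noteq> \<infinity>"
  shows "integrable L (\<lambda>t. gb (t \<in> W) (V t))"
    and "ereal (pi * (LINT t|L. gb (t \<in> W) (V t)) + card J * pi) \<le> F_DR f l p q (\<lambda>x. w (x $ 3)) (\<lambda>x. u (x $ 3))"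
proof -
  let ?F = "F_DR f l p q (\<lambda>x. w (x $ 3)) (\<lambda>x. u (x $ 3))"
  have "\<forall>b. \<exists>A. (\<forall>n y. fst A n + snd A n \<bullet> y \<le> gb b y) \<and> (\<forall>x r. r < gb b x \<longrightarrow> (\<exists>n::nat. r < fst A n + snd A n \<bullet> x))"
  proof
    fix b
    obtain a \<beta> where "\<And>(n::nat) y. a n + \<beta> n \<bullet> y \<le> gb b y" "\<And>x r. r < gb b x \<Longrightarrow> \<exists>n. r < a n + \<beta> n \<bullet> x"
      by (rule convex_countable_affine_minorants[OF gb_convex]) (rule that)
    then show "\<exists>A. (\<forall>n y. fst A n + snd A n \<bullet> y \<le> gb b y) \<and> (\<forall>x r. r < gb b x \<longrightarrow> (\<exists>n::nat. r < fst A n + snd A n \<bullet> x))"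
      by (intro exI[of _ "(a, \<beta>)"]) simp
  qed
  from choice[OF this] obtain A :: "bool \<Rightarrow> (nat \<Rightarrow> real) \<times> (nat \<Rightarrow> real^3)" where
    "\<forall>b. (\<forall>n y. fst (A b) n + snd (A b) n \<bullet> y \<le> gb b y) \<and> (\<forall>x r. r < gb b x \<longrightarrow> (\<exists>n::nat. r < fst (A b) n + snd (A b) n \<bullet> x))"
    by (rule exE)
  then have A: "\<And>b n y. fst (A b) n + snd (A b) n \<bullet> y \<le> gb b y"
    "\<And>b x r. r < gb b x \<Longrightarrow> \<exists>n. r < fst (A b) n + snd (A b) n \<bullet> x" by auto
  \<comment> \<open>The starting value is the constant minorant -c0, so that stage 0 is a minorant
    as well.\<close>
  define S where "S b = best_affine (fst (A b)) (snd (A b)) (- c0)" for b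
  define \<alpha> where "\<alpha> k t = fst (S (t \<in> W) k (V t))" for k t
  define \<beta> where "\<beta> k t = snd (S (t \<in> W) k (V t))" for k t
  define G where "G k t = \<alpha> k t + \<beta> k t \<bullet> V t" for k t
  have Vm: "V \<in> borel_measurable L" using V_props(2) by simp
  have m: "\<alpha> k \<in> borel_measurable L" "\<beta> k \<in> borel_measurable L" for k
    unfolding \<alpha>_def[abs_def] \<beta>_def[abs_def] S_def
    by (rule measurable_switch[OF best_affine_measurable(1) Vm], rule measurable_switch[OF best_affine_measurable(2) Vm])
  have rng: "S b k y \<in> insert (- c0, 0) ((\<lambda>j. (fst (A b) j, snd (A b) j)) ` {..<k})" for b k y
    unfolding S_def by (rule best_affine_range)
  have minor: "fst (S b k y) + snd (S b k y) \<bullet> z \<le> gb b z" for b k y z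
    using rng[of b k y] A(1)[of b _ z] gb_ge[of b z] by auto
  \<comment> \<open>At stage k the coefficients are taken from a finite list, whatever the value of
    V; this is the boundedness that \<open>lower_bound_affine\<close> asks for.\<close>
  have "\<exists>R. (\<forall>t. \<bar>\<alpha> k t\<bar> \<le> R) \<and> (\<forall>t. norm (\<beta> k t) \<le> R)" for k
  proof -
    let ?D = "insert (- c0, 0) ((\<lambda>j. (fst (A True) j, snd (A True) j)) ` {..<k})
      \<union> insert (- c0, 0) ((\<lambda>j. (fst (A False) j, snd (A False) j)) ` {..<k})"
    have "finite ?D" by simp
    then obtain R where R: "\<forall>z\<in>?D. norm z \<le> R" using finite_imp_bounded bounded_iff by blast
    have n: "norm (S (t \<in> W) k (V t)) \<le> R" for t
      using R rng[of "t \<in> W" k "V t"] by (cases "t \<in> W") auto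
    have "\<bar>\<alpha> k t\<bar> \<le> R" "norm (\<beta> k t) \<le> R" for t
      using norm_fst_le[of "fst (S (t \<in> W) k (V t))" "snd (S (t \<in> W) k (V t))"]
        norm_snd_le[of "snd (S (t \<in> W) k (V t))" "fst (S (t \<in> W) k (V t))"] n[of t] by (simp_all add: \<alpha>_def \<beta>_def)
    then show ?thesis by blast
  qed
  from choice[OF allI[OF this]] obtain R where "\<forall>k. (\<forall>t. \<bar>\<alpha> k t\<bar> \<le> R k) \<and> (\<forall>t. norm (\<beta> k t) \<le> R k)" by (rule exE)
  then have R: "\<And>k t. \<bar>\<alpha> k t\<bar> \<le> R k" "\<And>k t. norm (\<beta> k t) \<le> R k" by auto
  have low: "ereal (pi * (LINT t|L. G k t) + card J * pi) \<le> ?F" for k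
    unfolding F_DR_def G_def
  proof (rule Inf_greatest)
    fix z assume "z \<in> {Liminf (at_right 0) (\<lambda>\<epsilon>. rescaled_energy f l \<epsilon> (ws \<epsilon>) (us \<epsilon>)) |ws us.
      (\<forall>\<epsilon>>0. us \<epsilon> \<in> sobolev (Lp q) Om \<and> ws \<epsilon> \<in> BV01 Om) \<and>
      weakly_in_W1p p Om (at_right 0) us (\<lambda>x. u (x $ 3)) \<and> weakly_star_in_BV Om (at_right 0) ws (\<lambda>x. w (x $ 3))}"
    then obtain ws us where z: "z = Liminf (at_right 0) (\<lambda>\<epsilon>. rescaled_energy f l \<epsilon> (ws \<epsilon>) (us \<epsilon>))"
      and a: "\<forall>\<epsilon>>0. us \<epsilon> \<in> sobolev (Lp q) Om \<and> ws \<epsilon> \<in> BV01 Om"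
      "weakly_in_W1p p Om (at_right 0) us (\<lambda>x. u (x $ 3))" "weakly_star_in_BV Om (at_right 0) ws (\<lambda>x. w (x $ 3))" by auto
    show "ereal (pi * (LINT t|L. \<alpha> k t + \<beta> k t \<bullet> V t) + card J * pi) \<le> z"
      unfolding z by (rule lower_bound_affine[OF a m R]) (simp add: \<alpha>_def \<beta>_def minor)
  qed
  \<comment> \<open>Stage 0 already bounds the functional from below by a real number.\<close>
  have "?F \<noteq> - \<infinity>" using low[of 0] by auto
  then obtain r where r: "?F = ereal r" using fin by (cases ?F) auto
  have mono: "G k t \<le> G k' t" if "k \<le> k'" for k k' t
    unfolding G_def \<alpha>_def \<beta>_def S_def using that by (rule best_value_mono)
  have Gi: "integrable L (G k)" for k
  proof -
    have "integrable L (\<alpha> k)" by (rule L.integrable_const_bound[of _ "R k"]) (use R m in auto)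
    moreover have "integrable L (\<lambda>t. \<beta> k t \<bullet> V t)"
    proof (rule Bochner_Integration.integrable_bound[OF integrable_scaleR_right[OF V_props(2), of "R k"]])
      show "(\<lambda>t. \<beta> k t \<bullet> V t) \<in> borel_measurable L" using m(2) Vm by (rule borel_measurable_inner)
      show "AE t in L. norm (\<beta> k t \<bullet> V t) \<le> norm (R k *\<^sub>R V t)"
      proof (rule AE_I2)
        fix t
        have "\<bar>\<beta> k t \<bullet> V t\<bar> \<le> norm (\<beta> k t) * norm (V t)" by (rule Cauchy_Schwarz_ineq2)
        also have "\<dots> \<le> \<bar>R k\<bar> * norm (V t)" using R(2)[of k t] by (intro mult_right_mono) auto
        finally show "norm (\<beta> k t \<bullet> V t) \<le> norm (R k *\<^sub>R V t)" by simp
      qed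
    qed
    ultimately show ?thesis unfolding G_def[abs_def] by simp
  qed
  have Gb: "(LINT t|L. G k t) \<le> (r - card J * pi) / pi" for k
    using low[of k] by (simp add: r field_simps)
  have Glim: "(\<lambda>k. G k t) \<longlonglongrightarrow> gb (t \<in> W) (V t)" for t
  proof (rule order_tendstoI)
    fix y assume "y < gb (t \<in> W) (V t)"
    from A(2)[OF this] obtain n where n: "y < fst (A (t \<in> W)) n + snd (A (t \<in> W)) n \<bullet> V t" by (rule exE)
    show "\<forall>\<^sub>F k in sequentially. y < G k t"
      using eventually_gt_at_top[of n]
    proof eventually_elim
      fix k assume "n < k"
      from best_value_ge[OF this, of "fst (A (t \<in> W))" "snd (A (t \<in> W))" "V t" "- c0"] n
      show "y < G k t" unfolding G_def \<alpha>_def \<beta>_def S_def by (rule less_le_trans[rotated])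
    qed
  next
    fix y assume y: "gb (t \<in> W) (V t) < y"
    have "G k t \<le> gb (t \<in> W) (V t)" for k unfolding G_def \<alpha>_def \<beta>_def by (rule minor)
    then show "\<forall>\<^sub>F k in sequentially. G k t < y" by (intro always_eventually allI) (rule le_less_trans[OF _ y])
  qed
  have "incseq (\<lambda>k. LINT t|L. G k t)"
    by (rule incseq_SucI, rule integral_mono[OF Gi Gi]) (rule mono, simp)
  then obtain y where y: "(\<lambda>k. LINT t|L. G k t) \<longlonglongrightarrow> y"
    using Gb by (rule incseq_convergent[OF _ allI]) (rule that)
  have gm: "(\<lambda>t. gb (t \<in> W) (V t)) \<in> borel_measurable L"
    by (rule measurable_switch[OF borel_measurable_continuous_onI[OF gb_cont] Vm])
  have inc: "AE t in L. mono (\<lambda>k. G k t)" by (intro AE_I2 monoI mono)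
  show g: "integrable L (\<lambda>t. gb (t \<in> W) (V t))"
    by (rule integrable_monotone_convergence[OF Gi inc AE_I2[OF Glim] y gm])
  have "(LINT t|L. gb (t \<in> W) (V t)) = y"
    by (rule integral_monotone_convergence[OF Gi inc AE_I2[OF Glim] y gm])
  moreover have "y \<le> (r - card J * pi) / pi" by (rule LIMSEQ_le_const2[OF y]) (use Gb in blast)
  ultimately show "ereal (pi * (LINT t|L. gb (t \<in> W) (V t)) + card J * pi) \<le> ?F"
    by (simp add: r field_simps)
qed

end

theorem proposition5p1:
  fixes l p q c c0 C :: real
    and f :: "real \<Rightarrow> real^3^3 \<Rightarrow> real"
    and W1 W2 :: "real^3^3 \<Rightarrow> real"
    and w :: "real \<Rightarrow> real"
    and u :: "real \<Rightarrow> real^3"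
  assumes "0 < l" and "1 < p" and "p \<le> q"
    and "continuous_on ({0, 1} \<times> UNIV) (\<lambda>(b, \<xi>). f b \<xi>)"
    and "\<And>b \<xi>. b \<in> {0, 1} \<Longrightarrow> f b \<xi> = b * W1 \<xi> + (1 - b) * W2 \<xi>"
    and "\<And>b. b \<in> {0, 1} \<Longrightarrow> quasiconvex_envelope (f b) = convex_envelope (f b)"
    and "0 < c" and "0 < c0" and "0 < C"
    and "\<And>b \<xi>. b \<in> {0, 1} \<Longrightarrow>
           c * norm \<xi> powr p - c0 \<le> f b \<xi> \<and> f b \<xi> \<le> C * (1 + norm \<xi> powr q)"
    and "w \<in> BV01 {0<..<l}"
    and "u \<in> sobolev (Lp p) {0<..<l}"
    and "\<bar>F_DR f l p q (\<lambda>x. w (x $ 3)) (\<lambda>x. u (x $ 3))\<bar> \<noteq> \<infinity>"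
  shows "F_DR f l p q (\<lambda>x. w (x $ 3)) (\<lambda>x. u (x $ 3)) =
    ereal pi *
      (ext_integral (lebesgue_on {0<..<l})
         (\<lambda>t. convex_envelope (f0 f (w t)) (weak_partial {0<..<l} 1 u t))
       + enn2ereal (total_variation {0<..<l} (derivative_measure {0<..<l} w)))"
proof -
  obtain J s a where J: "finite J" "J \<subseteq> {0<..<l}" "\<And>t. t \<in> J \<Longrightarrow> \<bar>s t\<bar> = 1"
    "AE t in lebesgue_on {0<..<l}. w t = a + (\<Sum>r\<in>J. s r * indicator {r..} t)"
    by (rule BV01_interval_jumps[OF assms(1) assms(11)]) (rule that)
  have wi: "integrable (lebesgue_on {0<..<l}) w" and w01: "AE t in lebesgue_on {0<..<l}. w t \<in> {0, 1}"
    using assms(11) by (auto simp: BV01_def BV_def)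
  \<comment> \<open>w is binary only almost everywhere; \<open>of_bool (t \<in> W)\<close> is a
    representative with values exactly 0 and 1, which are the phases at which f is
    controlled.\<close>
  define W where "W = {t \<in> space (lebesgue_on {0<..<l}). w t = 1}"
  have W: "W \<in> sets (lebesgue_on {0<..<l})"
    unfolding W_def using borel_measurable_integrable[OF wi] by measurable
  have wW: "AE t in lebesgue_on {0<..<l}. w t = of_bool (t \<in> W)"
    using w01 AE_space by eventually_elim (auto simp: W_def)
  have cont: "continuous_on UNIV (f (of_bool b))" for b
    by (rule continuous_on_compose2[OF assms(4), of UNIV "\<lambda>\<xi>. (of_bool b, \<xi>)", simplified])
      (auto intro!: continuous_intros)
  have growth: "c * norm \<xi> powr p - c0 \<le> f (of_bool b) \<xi>" for b \<xi>
    using assms(10)[of "of_bool b" \<xi>] by auto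
  have lower: "- c0 \<le> f (of_bool b) \<xi>" for b \<xi>
    by (rule order_trans[OF _ growth]) (use assms(7) in simp)
  interpret rod l w J s a f c0 W p q c u
    using assms J wi W wW cont growth lower by unfold_locales auto
  have "F_DR f l p q (\<lambda>x. w (x $ 3)) (\<lambda>x. u (x $ 3)) \<noteq> \<infinity>" using assms(13) by auto
  \<comment> \<open>The lower bound is applied first: it supplies the integrability that the upper
    bound assumes.\<close>
  note low = lower_bound[OF this]
  have "F_DR f l p q (\<lambda>x. w (x $ 3)) (\<lambda>x. u (x $ 3)) = ereal (pi * (LINT t|L. gb (t \<in> W) (V t)) + card J * pi)"
    by (rule antisym[OF upper_bound[OF low(1)] low(2)])
  moreover have "ext_integral L (\<lambda>t. convex_envelope (f0 f (w t)) (V t)) = ereal (LINT t|L. gb (t \<in> W) (V t))"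
  proof -
    have "AE t in L. convex_envelope (f0 f (w t)) (V t) = gb (t \<in> W) (V t)"
      using wW by eventually_elim (simp add: gb_def)
    then show ?thesis by (simp add: ext_integral_cong_AE ext_integral_integrable[OF low(1)])
  qed
  ultimately show ?thesis by (simp add: total_variation_1D enn2ereal_ennreal algebra_simps)
qed

end
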